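(* Let $k$ be a finitely generated field and let $G$ be an abelian group of finite total rank such that $\operatorname{char} k\notin Sp(G)$. Then any faithful irreducible representation $\varphi$ of $G$ over $k$ is induced from a representation of some finitely generated subgroup of $G$.
   Context: For an abelian group $A$ with torsion subgroup $t(A)$, the total rank is $r_t(A)=r(A/t(A))+\sum_{p} r(A_p)$, where $p$ runs over the primes dividing orders of elements of $t(A)$, $A_p$ is the $p$-component of $t(A)$, and $r$ denotes the (Prüfer) rank (the least $m$ such that every finitely generated subgroup can be generated by $m$ elements). $Sp(G)$ denotes the set of primes $p$ such that $G$ has an infinite $p$-section (a section is a quotient of a subgroup). A field is finitely generated if it is finitely generated as a field (over its prime subfield). Modules are right modules and representations may be infinite-dimensional: a representation $\varphi$ of $G$ over $k$ is given by a $kG$-module $M$, irreducible if $M$ is simple, and faithful if $C_G(M)=1$. If $H\le G$ and $\phi$ is a representation of $H$ over $k$ with module $U$, then $\varphi$ is induced from $\phi$ if $M=U\otimes_{kH}kG$; for $U\le M$ this means $M=\bigoplus_{t\in T}Ut$, with $T$ a right transversal to $H$ in $G$. *)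

theory Defs
  imports "HOL-Algebra.Algebra" "HOL-Library.Extended_Nat"
begin

section \<open>Fields\<close>

text \<open>Since \<^const>\<open>generate_field\<close> always contains the prime subfield, this is finite generation
  as a field over the prime subfield.\<close>

definition fin_gen_field :: "('k, 'r) ring_scheme \<Rightarrow> bool" where
  "fin_gen_field K \<longleftrightarrow>
     field K \<and> (\<exists>S. finite S \<and> S \<subseteq> carrier K \<and> generate_field K S = carrier K)"

definition ring_char :: "('k, 'r) ring_scheme \<Rightarrow> nat" where
  "ring_char R =
     (if \<exists>n::nat. n > 0 \<and> add_pow R n \<one>\<^bsub>R\<^esub> = \<zero>\<^bsub>R\<^esub>
      then (LEAST n::nat. n > 0 \<and> add_pow R n \<one>\<^bsub>R\<^esub> = \<zero>\<^bsub>R\<^esub>) else 0)"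

section \<open>Ranks and sections of groups\<close>

definition fin_gen_subgroup :: "('g, 'a) monoid_scheme \<Rightarrow> 'g set \<Rightarrow> bool" where
  "fin_gen_subgroup G H \<longleftrightarrow>
     subgroup H G \<and> (\<exists>S. finite S \<and> S \<subseteq> carrier G \<and> generate G S = H)"

text \<open>The infimum of the empty set in \<^typ>\<open>enat\<close> is \<open>\<infinity>\<close>.\<close>

definition prufer_rank :: "('g, 'a) monoid_scheme \<Rightarrow> enat" where
  "prufer_rank G = Inf {enat m | m. \<forall>H. fin_gen_subgroup G H \<longrightarrow>
     (\<exists>S. finite S \<and> card S \<le> m \<and> S \<subseteq> carrier G \<and> generate G S = H)}"

definition torsion_part :: "('g, 'a) monoid_scheme \<Rightarrow> 'g set" where
  "torsion_part G = {x \<in> carrier G. \<exists>n::nat. n > 0 \<and> x [^]\<^bsub>G\<^esub> n = \<one>\<^bsub>G\<^esub>}"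

definition p_component :: "('g, 'a) monoid_scheme \<Rightarrow> nat \<Rightarrow> 'g set" where
  "p_component G p = {x \<in> torsion_part G. \<exists>n::nat. x [^]\<^bsub>G\<^esub> (p ^ n) = \<one>\<^bsub>G\<^esub>}"

definition torsion_primes :: "('g, 'a) monoid_scheme \<Rightarrow> nat set" where
  "torsion_primes G = {p. Factorial_Ring.prime p \<and> (\<exists>x\<in>torsion_part G. p dvd group.ord G x)}"

text \<open>The set of relevant primes may be infinite, so the sum over it is the supremum of its finite
  partial sums (a plain \<^const>\<open>sum\<close> over an infinite set would be \<open>0\<close>).\<close>

definition total_rank :: "('g, 'a) monoid_scheme \<Rightarrow> enat" where
  "total_rank G = prufer_rank (G Mod torsion_part G) +
     (SUP F\<in>{F. finite F \<and> F \<subseteq> torsion_primes G}.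
        \<Sum>p\<in>F. prufer_rank (G\<lparr>carrier := p_component G p\<rparr>))"

definition p_group :: "nat \<Rightarrow> ('g, 'a) monoid_scheme \<Rightarrow> bool" where
  "p_group p Q \<longleftrightarrow> group Q \<and> (\<forall>x\<in>carrier Q. \<exists>n::nat. x [^]\<^bsub>Q\<^esub> (p ^ n) = \<one>\<^bsub>Q\<^esub>)"

definition Sp :: "('g, 'a) monoid_scheme \<Rightarrow> nat set" where
  "Sp G = {p. Factorial_Ring.prime p \<and>
     (\<exists>H N. subgroup H G \<and> N \<lhd> G\<lparr>carrier := H\<rparr> \<and>
        p_group p (G\<lparr>carrier := H\<rparr> Mod N) \<and> infinite (carrier (G\<lparr>carrier := H\<rparr> Mod N)))}"

text \<open>\<^term>\<open>rcosets\<^bsub>G\<^esub> H\<close> consists of the cosets \<open>Hx\<close>.\<close>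

definition right_transversal :: "('g, 'a) monoid_scheme \<Rightarrow> 'g set \<Rightarrow> 'g set \<Rightarrow> bool" where
  "right_transversal G H T \<longleftrightarrow> T \<subseteq> carrier G \<and> (\<forall>C\<in>rcosets\<^bsub>G\<^esub> H. \<exists>!t. t \<in> T \<inter> C)"

section \<open>Group rings\<close>

text \<open>Elements of \<open>KG\<close> are the finitely supported functions on the carrier of \<open>G\<close> (with value
  \<^const>\<open>undefined\<close> outside of it); multiplication is convolution,
  \<open>(a b)(g) = \<Sum>\<^sub>x a(x) b(x\<inverse> g)\<close>.\<close>

definition group_ring_supp ::
  "('k, 'r) ring_scheme \<Rightarrow> ('g, 'a) monoid_scheme \<Rightarrow> ('g \<Rightarrow> 'k) \<Rightarrow> 'g set" where
  "group_ring_supp K G a = {g \<in> carrier G. a g \<noteq> \<zero>\<^bsub>K\<^esub>}"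

definition group_ring_elem ::
  "('k, 'r) ring_scheme \<Rightarrow> ('g, 'a) monoid_scheme \<Rightarrow> 'g \<Rightarrow> 'g \<Rightarrow> 'k" where
  "group_ring_elem K G g = (\<lambda>x\<in>carrier G. if x = g then \<one>\<^bsub>K\<^esub> else \<zero>\<^bsub>K\<^esub>)"

definition group_ring ::
  "('k, 'r) ring_scheme \<Rightarrow> ('g, 'a) monoid_scheme \<Rightarrow> ('g \<Rightarrow> 'k) ring" where
  "group_ring K G =
     \<lparr>carrier = {a \<in> carrier G \<rightarrow>\<^sub>E carrier K. finite (group_ring_supp K G a)},
      monoid.mult = (\<lambda>a b. \<lambda>g\<in>carrier G.
        \<Oplus>\<^bsub>K\<^esub>x\<in>group_ring_supp K G a. a x \<otimes>\<^bsub>K\<^esub> b (inv\<^bsub>G\<^esub> x \<otimes>\<^bsub>G\<^esub> g)),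
      one = group_ring_elem K G \<one>\<^bsub>G\<^esub>,
      ring.zero = (\<lambda>g\<in>carrier G. \<zero>\<^bsub>K\<^esub>),
      add = (\<lambda>a b. \<lambda>g\<in>carrier G. a g \<oplus>\<^bsub>K\<^esub> b g)\<rparr>"

text \<open>Over a commutative group and a commutative ring this is a commutative ring, as required by the
  locale \<^locale>\<open>module\<close>.\<close>

lemma group_ring_mult_superset:
  assumes "group G" "cring K" "a \<in> carrier (group_ring K G)" "b \<in> carrier (group_ring K G)"
    and "finite F" "group_ring_supp K G a \<subseteq> F" "F \<subseteq> carrier G" "g \<in> carrier G"
  shows "(a \<otimes>\<^bsub>group_ring K G\<^esub> b) g = (\<Oplus>\<^bsub>K\<^esub>x\<in>F. a x \<otimes>\<^bsub>K\<^esub> b (inv\<^bsub>G\<^esub> x \<otimes>\<^bsub>G\<^esub> g))"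
proof -
  interpret G: group G by fact
  interpret K: cring K by fact
  have "(\<Oplus>\<^bsub>K\<^esub>x\<in>group_ring_supp K G a. a x \<otimes>\<^bsub>K\<^esub> b (inv\<^bsub>G\<^esub> x \<otimes>\<^bsub>G\<^esub> g)) = 
    (\<Oplus>\<^bsub>K\<^esub>x\<in>F. a x \<otimes>\<^bsub>K\<^esub> b (inv\<^bsub>G\<^esub> x \<otimes>\<^bsub>G\<^esub> g))"
    by (rule K.add.finprod_mono_neutral_cong_left)
      (use assms in \<open>auto simp: group_ring_def group_ring_supp_def PiE_iff\<close>)
  then show ?thesis using assms by (simp add: group_ring_def)
qed

lemma group_ring_mult_supp:
  assumes "group G" "cring K" "a \<in> carrier (group_ring K G)" "b \<in> carrier (group_ring K G)"
  shows "group_ring_supp K G (a \<otimes>\<^bsub>group_ring K G\<^esub> b) \<subseteq>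
    (\<lambda>(x,y). x \<otimes>\<^bsub>G\<^esub> y) ` (group_ring_supp K G a \<times> group_ring_supp K G b)"
proof
  interpret G: group G by fact
  interpret K: cring K by fact
  fix g assume g: "g \<in> group_ring_supp K G (a \<otimes>\<^bsub>group_ring K G\<^esub> b)"
  then have gG: "g \<in> carrier G" by (simp add: group_ring_supp_def)
  show "g \<in> (\<lambda>(x,y). x \<otimes>\<^bsub>G\<^esub> y) ` (group_ring_supp K G a \<times> group_ring_supp K G b)"
  proof (rule ccontr)
    assume n: "\<not> ?thesis"
    have "a x \<otimes>\<^bsub>K\<^esub> b (inv\<^bsub>G\<^esub> x \<otimes>\<^bsub>G\<^esub> g) = \<zero>\<^bsub>K\<^esub>" if x: "x \<in> group_ring_supp K G a" for x
    proof -
      have xG: "x \<in> carrier G" using x by (simp add: group_ring_supp_def)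
      have "g = x \<otimes>\<^bsub>G\<^esub> (inv\<^bsub>G\<^esub> x \<otimes>\<^bsub>G\<^esub> g)" using xG gG by (simp add: G.m_assoc[symmetric])
      then have "inv\<^bsub>G\<^esub> x \<otimes>\<^bsub>G\<^esub> g \<notin> group_ring_supp K G b" using n x by force
      then have "b (inv\<^bsub>G\<^esub> x \<otimes>\<^bsub>G\<^esub> g) = \<zero>\<^bsub>K\<^esub>" using xG gG by (simp add: group_ring_supp_def)
      then show ?thesis using xG assms by (auto simp: group_ring_def PiE_iff)
    qed
    then have "(a \<otimes>\<^bsub>group_ring K G\<^esub> b) g = \<zero>\<^bsub>K\<^esub>"
      using gG by (simp add: group_ring_def K.add.finprod_one_eqI)
    then show False using g by (simp add: group_ring_supp_def)
  qed
qed

lemma group_ring_mult_closed: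
  assumes "group G" "cring K" "a \<in> carrier (group_ring K G)" "b \<in> carrier (group_ring K G)"
  shows "a \<otimes>\<^bsub>group_ring K G\<^esub> b \<in> carrier (group_ring K G)"
proof -
  interpret G: group G by fact
  interpret K: cring K by fact
  have "finite (group_ring_supp K G (a \<otimes>\<^bsub>group_ring K G\<^esub> b))"
    by (rule finite_subset[OF group_ring_mult_supp[OF assms]])
      (use assms in \<open>auto simp: group_ring_def\<close>)
  moreover have "a \<otimes>\<^bsub>group_ring K G\<^esub> b \<in> carrier G \<rightarrow>\<^sub>E carrier K"
    using assms by (auto simp: group_ring_def group_ring_supp_def PiE_iff intro!: K.finsum_closed)
  ultimately show ?thesis by (simp add: group_ring_def)
qed

lemma group_ring_mult_comm:
  assumes "comm_group G" "cring K" "a \<in> carrier (group_ring K G)" "b \<in> carrier (group_ring K G)"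
  shows "a \<otimes>\<^bsub>group_ring K G\<^esub> b = b \<otimes>\<^bsub>group_ring K G\<^esub> a"
proof -
  interpret G: comm_group G by fact
  interpret K: cring K by fact
  have G: "group G" by unfold_locales
  show ?thesis
  proof (rule extensionalityI[of _ "carrier G"])
    fix g assume g: "g \<in> carrier G"
    let ?A = "group_ring_supp K G a" and ?B = "group_ring_supp K G b"
    let ?h = "\<lambda>x. inv\<^bsub>G\<^esub> x \<otimes>\<^bsub>G\<^esub> g"
    define F where "F = ?A \<union> ?h ` ?B"
    have fin: "finite F" "F \<subseteq> carrier G" "?A \<subseteq> F" "finite (?h ` F)" "?h ` F \<subseteq> carrier G"
      using assms g by (auto simp: F_def group_ring_def group_ring_supp_def)
    have hh: "?h (?h x) = x" if "x \<in> carrier G" for x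
      using that g by (simp add: G.inv_mult G.m_assoc)
    have inj: "inj_on ?h F"
      by (rule inj_on_inverseI[of _ ?h]) (use fin hh in auto)
    have sub: "?B \<subseteq> ?h ` F"
    proof
      fix y assume "y \<in> ?B"
      then have "y = ?h (?h y)" "?h y \<in> F" using hh by (auto simp: F_def group_ring_supp_def)
      then show "y \<in> ?h ` F" by blast
    qed
    have ab: "a x \<in> carrier K" "b x \<in> carrier K" if "x \<in> carrier G" for x
      using assms that by (auto simp: group_ring_def PiE_iff)
    have "(b \<otimes>\<^bsub>group_ring K G\<^esub> a) g = (\<Oplus>\<^bsub>K\<^esub>x\<in>?h ` F. b x \<otimes>\<^bsub>K\<^esub> a (?h x))"
      by (rule group_ring_mult_superset) (use assms G fin sub g in auto)
    also have "\<dots> = (\<Oplus>\<^bsub>K\<^esub>x\<in>F. b (?h x) \<otimes>\<^bsub>K\<^esub> a (?h (?h x)))"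
      by (rule K.add.finprod_reindex) (use fin g ab inj in auto)
    also have "\<dots> = (\<Oplus>\<^bsub>K\<^esub>x\<in>F. a x \<otimes>\<^bsub>K\<^esub> b (?h x))"
      by (rule K.add.finprod_cong') (use fin g ab hh in \<open>auto simp: K.m_comm subset_iff\<close>)
    also have "\<dots> = (a \<otimes>\<^bsub>group_ring K G\<^esub> b) g"
      by (rule group_ring_mult_superset[symmetric]) (use assms G fin g in auto)
    finally show "(a \<otimes>\<^bsub>group_ring K G\<^esub> b) g = (b \<otimes>\<^bsub>group_ring K G\<^esub> a) g" by simp
  qed (auto simp: group_ring_def)
qed

lemma group_ring_mult_assoc:
  assumes "group G" "cring K" "a \<in> carrier (group_ring K G)" "b \<in> carrier (group_ring K G)"
    "c \<in> carrier (group_ring K G)"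
  shows "(a \<otimes>\<^bsub>group_ring K G\<^esub> b) \<otimes>\<^bsub>group_ring K G\<^esub> c = a \<otimes>\<^bsub>group_ring K G\<^esub> (b \<otimes>\<^bsub>group_ring K G\<^esub> c)"
proof -
  interpret G: group G by fact
  interpret K: cring K by fact
  have coeff: "a x \<in> carrier K" "b x \<in> carrier K" "c x \<in> carrier K" if "x \<in> carrier G" for x
    using assms that by (auto simp: group_ring_def PiE_iff)
  note cl = group_ring_mult_closed[OF assms(1,2)]
  show ?thesis
  proof (rule extensionalityI[of _ "carrier G"])
    fix g assume g: "g \<in> carrier G"
    let ?A = "group_ring_supp K G a" and ?B = "group_ring_supp K G b"
    let ?P = "(\<lambda>(x,y). x \<otimes>\<^bsub>G\<^esub> y) ` (?A \<times> ?B)"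
    have fin: "finite ?A" "finite ?B" "?A \<subseteq> carrier G" "?B \<subseteq> carrier G" "finite ?P" "?P \<subseteq> carrier G"
      using assms by (auto simp: group_ring_def group_ring_supp_def)
    have "((a \<otimes>\<^bsub>group_ring K G\<^esub> b) \<otimes>\<^bsub>group_ring K G\<^esub> c) g
        = (\<Oplus>\<^bsub>K\<^esub>z\<in>?P. (a \<otimes>\<^bsub>group_ring K G\<^esub> b) z \<otimes>\<^bsub>K\<^esub> c (inv\<^bsub>G\<^esub> z \<otimes>\<^bsub>G\<^esub> g))"
      by (rule group_ring_mult_superset) (use assms fin(5,6) g cl group_ring_mult_supp[OF assms(1-4)] in \<open>simp_all add: assms(1)\<close>)
    also have "\<dots> = (\<Oplus>\<^bsub>K\<^esub>z\<in>?P. \<Oplus>\<^bsub>K\<^esub>x\<in>?A. a x \<otimes>\<^bsub>K\<^esub> b (inv\<^bsub>G\<^esub> x \<otimes>\<^bsub>G\<^esub> z) \<otimes>\<^bsub>K\<^esub> c (inv\<^bsub>G\<^esub> z \<otimes>\<^bsub>G\<^esub> g))"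
    proof (rule K.add.finprod_cong')
      fix z assume "z \<in> ?P"
      then have z: "z \<in> carrier G" using fin by blast
      then show "(a \<otimes>\<^bsub>group_ring K G\<^esub> b) z \<otimes>\<^bsub>K\<^esub> c (inv\<^bsub>G\<^esub> z \<otimes>\<^bsub>G\<^esub> g) =
        (\<Oplus>\<^bsub>K\<^esub>x\<in>?A. a x \<otimes>\<^bsub>K\<^esub> b (inv\<^bsub>G\<^esub> x \<otimes>\<^bsub>G\<^esub> z) \<otimes>\<^bsub>K\<^esub> c (inv\<^bsub>G\<^esub> z \<otimes>\<^bsub>G\<^esub> g))"
        by (subst group_ring_mult_superset[where F = ?A])
          (use assms fin g coeff in \<open>auto intro!: K.finsum_ldistr simp: subset_iff\<close>)
    qed (use fin g coeff in \<open>auto intro!: K.finsum_closed K.m_closed simp: subset_iff\<close>)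
    also have "\<dots> = (\<Oplus>\<^bsub>K\<^esub>x\<in>?A. \<Oplus>\<^bsub>K\<^esub>z\<in>?P. a x \<otimes>\<^bsub>K\<^esub> b (inv\<^bsub>G\<^esub> x \<otimes>\<^bsub>G\<^esub> z) \<otimes>\<^bsub>K\<^esub> c (inv\<^bsub>G\<^esub> z \<otimes>\<^bsub>G\<^esub> g))"
    proof -
      have "(\<Oplus>\<^bsub>K\<^esub>z\<in>P. \<Oplus>\<^bsub>K\<^esub>x\<in>?A. f x z) = (\<Oplus>\<^bsub>K\<^esub>x\<in>?A. \<Oplus>\<^bsub>K\<^esub>z\<in>P. f x z)"
        if "finite P" "P \<subseteq> carrier G" "\<And>x z. x \<in> ?A \<Longrightarrow> z \<in> carrier G \<Longrightarrow> f x z \<in> carrier K" for P f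
        using that(1,2)
      proof (induction P rule: finite_induct)
        case (insert p P)
        have "(\<Oplus>\<^bsub>K\<^esub>z\<in>insert p P. \<Oplus>\<^bsub>K\<^esub>x\<in>?A. f x z) =
          (\<Oplus>\<^bsub>K\<^esub>x\<in>?A. f x p) \<oplus>\<^bsub>K\<^esub> (\<Oplus>\<^bsub>K\<^esub>x\<in>?A. \<Oplus>\<^bsub>K\<^esub>z\<in>P. f x z)"
          using insert that(3) by (subst K.finsum_insert) (auto intro!: K.finsum_closed simp: subset_iff)
        also have "\<dots> = (\<Oplus>\<^bsub>K\<^esub>x\<in>?A. f x p \<oplus>\<^bsub>K\<^esub> (\<Oplus>\<^bsub>K\<^esub>z\<in>P. f x z))"
          using insert that(3) by (intro K.finsum_addf[symmetric]) (auto intro!: K.finsum_closed simp: subset_iff)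
        also have "\<dots> = (\<Oplus>\<^bsub>K\<^esub>x\<in>?A. \<Oplus>\<^bsub>K\<^esub>z\<in>insert p P. f x z)"
          using insert that(3)
          by (intro K.add.finprod_cong') (auto intro!: K.finsum_closed K.finsum_insert[symmetric] simp: subset_iff)
        finally show ?case .
      qed (simp add: K.add.finprod_one_eqI)
      then show ?thesis using fin g coeff by (auto simp: subset_iff)
    qed
    also have "\<dots> = (\<Oplus>\<^bsub>K\<^esub>x\<in>?A. a x \<otimes>\<^bsub>K\<^esub> (b \<otimes>\<^bsub>group_ring K G\<^esub> c) (inv\<^bsub>G\<^esub> x \<otimes>\<^bsub>G\<^esub> g))"
    proof (rule K.add.finprod_cong')
      fix x assume x: "x \<in> ?A"
      then have xG: "x \<in> carrier G" using fin by blast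
      let ?h = "\<lambda>z. inv\<^bsub>G\<^esub> x \<otimes>\<^bsub>G\<^esub> z"
      have inj: "inj_on ?h ?P" using fin(6) xG by (intro inj_onI) (simp add: subset_iff)
      have sub: "?B \<subseteq> ?h ` ?P"
      proof
        fix y assume y: "y \<in> ?B"
        then have "y = ?h (x \<otimes>\<^bsub>G\<^esub> y)" using xG fin by (simp add: G.m_assoc[symmetric] subset_iff)
        moreover have "x \<otimes>\<^bsub>G\<^esub> y \<in> ?P" using x y by force
        ultimately show "y \<in> ?h ` ?P" by blast
      qed
      have "(b \<otimes>\<^bsub>group_ring K G\<^esub> c) (?h g) = (\<Oplus>\<^bsub>K\<^esub>y\<in>?h ` ?P. b y \<otimes>\<^bsub>K\<^esub> c (inv\<^bsub>G\<^esub> y \<otimes>\<^bsub>G\<^esub> ?h g))"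
        by (rule group_ring_mult_superset) (use assms fin sub g xG in auto)
      also have "\<dots> = (\<Oplus>\<^bsub>K\<^esub>z\<in>?P. b (?h z) \<otimes>\<^bsub>K\<^esub> c (inv\<^bsub>G\<^esub> (?h z) \<otimes>\<^bsub>G\<^esub> ?h g))"
        by (rule K.add.finprod_reindex) (use fin(6) g xG coeff inj in \<open>auto simp: subset_iff\<close>)
      also have "\<dots> = (\<Oplus>\<^bsub>K\<^esub>z\<in>?P. b (?h z) \<otimes>\<^bsub>K\<^esub> c (inv\<^bsub>G\<^esub> z \<otimes>\<^bsub>G\<^esub> g))"
      proof (rule K.add.finprod_cong')
        fix z assume "z \<in> ?P"
        then have z: "z \<in> carrier G" using fin by blast
        have "inv\<^bsub>G\<^esub> (?h z) \<otimes>\<^bsub>G\<^esub> ?h g = inv\<^bsub>G\<^esub> z \<otimes>\<^bsub>G\<^esub> (x \<otimes>\<^bsub>G\<^esub> (inv\<^bsub>G\<^esub> x \<otimes>\<^bsub>G\<^esub> g))"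
          using xG z g by (simp add: G.inv_mult_group G.m_assoc)
        also have "\<dots> = inv\<^bsub>G\<^esub> z \<otimes>\<^bsub>G\<^esub> g" using xG z g by (simp add: G.m_assoc[symmetric])
        finally show "b (?h z) \<otimes>\<^bsub>K\<^esub> c (inv\<^bsub>G\<^esub> (?h z) \<otimes>\<^bsub>G\<^esub> ?h g) = b (?h z) \<otimes>\<^bsub>K\<^esub> c (inv\<^bsub>G\<^esub> z \<otimes>\<^bsub>G\<^esub> g)"
          by simp
      qed (use fin(6) g xG coeff in \<open>auto simp: subset_iff\<close>)
      finally have "a x \<otimes>\<^bsub>K\<^esub> (b \<otimes>\<^bsub>group_ring K G\<^esub> c) (?h g) =
        (\<Oplus>\<^bsub>K\<^esub>z\<in>?P. a x \<otimes>\<^bsub>K\<^esub> (b (?h z) \<otimes>\<^bsub>K\<^esub> c (inv\<^bsub>G\<^esub> z \<otimes>\<^bsub>G\<^esub> g)))"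
        using fin g xG coeff by (simp only:) (auto intro!: K.finsum_rdistr simp: subset_iff)
      also have "\<dots> = (\<Oplus>\<^bsub>K\<^esub>z\<in>?P. a x \<otimes>\<^bsub>K\<^esub> b (?h z) \<otimes>\<^bsub>K\<^esub> c (inv\<^bsub>G\<^esub> z \<otimes>\<^bsub>G\<^esub> g))"
        by (rule K.add.finprod_cong') (use fin(6) g xG coeff in \<open>auto simp: K.m_assoc subset_iff\<close>)
      finally show "(\<Oplus>\<^bsub>K\<^esub>z\<in>?P. a x \<otimes>\<^bsub>K\<^esub> b (?h z) \<otimes>\<^bsub>K\<^esub> c (inv\<^bsub>G\<^esub> z \<otimes>\<^bsub>G\<^esub> g)) =
        a x \<otimes>\<^bsub>K\<^esub> (b \<otimes>\<^bsub>group_ring K G\<^esub> c) (?h g)" by simp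
    qed (use cl[OF assms(4,5)] fin g coeff in \<open>auto simp: subset_iff group_ring_def PiE_iff\<close>)
    also have "\<dots> = (a \<otimes>\<^bsub>group_ring K G\<^esub> (b \<otimes>\<^bsub>group_ring K G\<^esub> c)) g"
      by (rule group_ring_mult_superset[symmetric]) (use assms fin g cl in auto)
    finally show "((a \<otimes>\<^bsub>group_ring K G\<^esub> b) \<otimes>\<^bsub>group_ring K G\<^esub> c) g =
      (a \<otimes>\<^bsub>group_ring K G\<^esub> (b \<otimes>\<^bsub>group_ring K G\<^esub> c)) g" .
  qed (auto simp: group_ring_def)
qed

lemma group_ring_elem_closed:
  assumes "cring K"
  shows "group_ring_elem K G g \<in> carrier (group_ring K G)"
proof -
  interpret K: cring K by fact
  have "group_ring_supp K G (group_ring_elem K G g) \<subseteq> {g}"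
    by (auto simp: group_ring_supp_def group_ring_elem_def split: if_splits)
  then have "finite (group_ring_supp K G (group_ring_elem K G g))"
    by (rule finite_subset) simp
  then show ?thesis by (auto simp: group_ring_def group_ring_elem_def)
qed

lemma group_ring_elem_mult:
  assumes "group G" "cring K" "g \<in> carrier G" "b \<in> carrier (group_ring K G)" "h \<in> carrier G"
  shows "(group_ring_elem K G g \<otimes>\<^bsub>group_ring K G\<^esub> b) h = b (inv\<^bsub>G\<^esub> g \<otimes>\<^bsub>G\<^esub> h)"
proof -
  interpret G: group G by fact
  interpret K: cring K by fact
  have "b (inv\<^bsub>G\<^esub> g \<otimes>\<^bsub>G\<^esub> h) \<in> carrier K" using assms by (auto simp: group_ring_def PiE_iff)
  then show ?thesis
    by (subst group_ring_mult_superset[where F = "{g}"])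
      (use assms group_ring_elem_closed in
        \<open>auto simp: group_ring_supp_def group_ring_elem_def split: if_splits\<close>)
qed

lemma group_ring_cring:
  assumes "comm_group G" "cring K"
  shows "cring (group_ring K G)"
proof -
  interpret G: comm_group G by fact
  interpret K: cring K by fact
  have G: "group G" by unfold_locales
  let ?R = "group_ring K G"
  have coeff: "a x \<in> carrier K" if "a \<in> carrier ?R" "x \<in> carrier G" for a x
    using that by (auto simp: group_ring_def PiE_iff)
  have addc: "a \<oplus>\<^bsub>?R\<^esub> b \<in> carrier ?R" if ab: "a \<in> carrier ?R" "b \<in> carrier ?R" for a b
  proof -
    have "group_ring_supp K G (a \<oplus>\<^bsub>?R\<^esub> b) \<subseteq> group_ring_supp K G a \<union> group_ring_supp K G b"
      by (auto simp: group_ring_supp_def group_ring_def)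
    then have "finite (group_ring_supp K G (a \<oplus>\<^bsub>?R\<^esub> b))"
      by (rule finite_subset) (use ab in \<open>auto simp: group_ring_def\<close>)
    then show ?thesis using coeff ab by (auto simp: group_ring_def)
  qed
  have ext: "a = b" if "a \<in> extensional (carrier G)" "b \<in> extensional (carrier G)"
    "\<And>g. g \<in> carrier G \<Longrightarrow> a g = b g" for a b :: "'a \<Rightarrow> 'c"
    using that by (rule extensionalityI)
  have exR: "a \<in> extensional (carrier G)" if "a \<in> carrier ?R" for a
    using that by (auto simp: group_ring_def PiE_def)
  show ?thesis
  proof (rule cringI)
    show "abelian_group ?R"
    proof (rule abelian_groupI)
      fix a assume a: "a \<in> carrier ?R"
      let ?n = "\<lambda>g\<in>carrier G. \<ominus>\<^bsub>K\<^esub> a g"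
      have "group_ring_supp K G ?n \<subseteq> group_ring_supp K G a"
        by (auto simp: group_ring_supp_def)
      then have "?n \<in> carrier ?R"
        using a coeff by (auto simp: group_ring_def dest: finite_subset)
      moreover have "?n \<oplus>\<^bsub>?R\<^esub> a = \<zero>\<^bsub>?R\<^esub>"
        using a coeff by (auto simp: group_ring_def K.l_neg intro!: restrict_ext)
      ultimately show "\<exists>y\<in>carrier ?R. y \<oplus>\<^bsub>?R\<^esub> a = \<zero>\<^bsub>?R\<^esub>" by blast
      show "\<zero>\<^bsub>?R\<^esub> \<oplus>\<^bsub>?R\<^esub> a = a"
        by (rule extensionalityI[of _ "carrier G"])
          (use exR[OF a] coeff[OF a] in \<open>auto simp: group_ring_def\<close>)
    next
      show "\<zero>\<^bsub>?R\<^esub> \<in> carrier ?R" by (auto simp: group_ring_def group_ring_supp_def)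
    next
      fix a b assume "a \<in> carrier ?R" "b \<in> carrier ?R"
      then show "a \<oplus>\<^bsub>?R\<^esub> b \<in> carrier ?R" by (rule addc)
      show "a \<oplus>\<^bsub>?R\<^esub> b = b \<oplus>\<^bsub>?R\<^esub> a"
        using coeff[OF \<open>a \<in> carrier ?R\<close>] coeff[OF \<open>b \<in> carrier ?R\<close>]
        by (simp add: group_ring_def K.a_comm cong: restrict_cong)
    next
      fix a b c assume abc: "a \<in> carrier ?R" "b \<in> carrier ?R" "c \<in> carrier ?R"
      show "a \<oplus>\<^bsub>?R\<^esub> b \<oplus>\<^bsub>?R\<^esub> c = a \<oplus>\<^bsub>?R\<^esub> (b \<oplus>\<^bsub>?R\<^esub> c)"
        using coeff[OF abc(1)] coeff[OF abc(2)] coeff[OF abc(3)]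
        by (simp add: group_ring_def K.a_assoc cong: restrict_cong)
    qed
    show "comm_monoid ?R"
    proof (rule comm_monoidI)
      fix a assume a: "a \<in> carrier ?R"
      show "\<one>\<^bsub>?R\<^esub> \<otimes>\<^bsub>?R\<^esub> a = a"
      proof (rule extensionalityI[of _ "carrier G"])
        fix h assume h: "h \<in> carrier G"
        show "(\<one>\<^bsub>?R\<^esub> \<otimes>\<^bsub>?R\<^esub> a) h = a h"
          using group_ring_elem_mult[OF G \<open>cring K\<close> G.one_closed a h] h
          by (simp add: group_ring_def)
      qed (use exR[OF a] in \<open>auto simp: group_ring_def\<close>)
    next
      show "\<one>\<^bsub>?R\<^esub> \<in> carrier ?R"
        using group_ring_elem_closed[OF assms(2), of G "\<one>\<^bsub>G\<^esub>"] by (simp add: group_ring_def)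
    qed (use assms G group_ring_mult_assoc group_ring_mult_comm group_ring_mult_closed in blast)+
    fix a b c assume abc: "a \<in> carrier ?R" "b \<in> carrier ?R" "c \<in> carrier ?R"
    show "(a \<oplus>\<^bsub>?R\<^esub> b) \<otimes>\<^bsub>?R\<^esub> c = a \<otimes>\<^bsub>?R\<^esub> c \<oplus>\<^bsub>?R\<^esub> b \<otimes>\<^bsub>?R\<^esub> c"
    proof (rule extensionalityI[of _ "carrier G"])
      fix g assume g: "g \<in> carrier G"
      let ?F = "group_ring_supp K G a \<union> group_ring_supp K G b"
      have F: "finite ?F" "?F \<subseteq> carrier G" "group_ring_supp K G (a \<oplus>\<^bsub>?R\<^esub> b) \<subseteq> ?F"
        using abc by (auto simp: group_ring_def group_ring_supp_def)
      have "((a \<oplus>\<^bsub>?R\<^esub> b) \<otimes>\<^bsub>?R\<^esub> c) g = (\<Oplus>\<^bsub>K\<^esub>x\<in>?F. (a \<oplus>\<^bsub>?R\<^esub> b) x \<otimes>\<^bsub>K\<^esub> c (inv\<^bsub>G\<^esub> x \<otimes>\<^bsub>G\<^esub> g))"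
        by (rule group_ring_mult_superset) (use assms G F g abc addc in auto)
      also have "\<dots> = (\<Oplus>\<^bsub>K\<^esub>x\<in>?F. a x \<otimes>\<^bsub>K\<^esub> c (inv\<^bsub>G\<^esub> x \<otimes>\<^bsub>G\<^esub> g) \<oplus>\<^bsub>K\<^esub> b x \<otimes>\<^bsub>K\<^esub> c (inv\<^bsub>G\<^esub> x \<otimes>\<^bsub>G\<^esub> g))"
      proof (rule K.add.finprod_cong')
        fix x assume "x \<in> ?F"
        then have "x \<in> carrier G" using F by blast
        then show "(a \<oplus>\<^bsub>?R\<^esub> b) x \<otimes>\<^bsub>K\<^esub> c (inv\<^bsub>G\<^esub> x \<otimes>\<^bsub>G\<^esub> g) =
          a x \<otimes>\<^bsub>K\<^esub> c (inv\<^bsub>G\<^esub> x \<otimes>\<^bsub>G\<^esub> g) \<oplus>\<^bsub>K\<^esub> b x \<otimes>\<^bsub>K\<^esub> c (inv\<^bsub>G\<^esub> x \<otimes>\<^bsub>G\<^esub> g)"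
          using abc g coeff[OF abc(1)] coeff[OF abc(2)] coeff[OF abc(3)]
          by (simp add: group_ring_def K.l_distr)
      qed (use F abc g coeff in \<open>auto simp: subset_iff\<close>)
      also have "\<dots> = (\<Oplus>\<^bsub>K\<^esub>x\<in>?F. a x \<otimes>\<^bsub>K\<^esub> c (inv\<^bsub>G\<^esub> x \<otimes>\<^bsub>G\<^esub> g)) \<oplus>\<^bsub>K\<^esub> (\<Oplus>\<^bsub>K\<^esub>x\<in>?F. b x \<otimes>\<^bsub>K\<^esub> c (inv\<^bsub>G\<^esub> x \<otimes>\<^bsub>G\<^esub> g))"
        by (rule K.finsum_addf) (use F abc g coeff in \<open>auto simp: subset_iff\<close>)
      also have "\<dots> = (a \<otimes>\<^bsub>?R\<^esub> c) g \<oplus>\<^bsub>K\<^esub> (b \<otimes>\<^bsub>?R\<^esub> c) g"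
        using group_ring_mult_superset[OF G assms(2) abc(1,3) F(1) _ F(2) g]
          group_ring_mult_superset[OF G assms(2) abc(2,3) F(1) _ F(2) g] by simp
      also have "\<dots> = (a \<otimes>\<^bsub>?R\<^esub> c \<oplus>\<^bsub>?R\<^esub> b \<otimes>\<^bsub>?R\<^esub> c) g" using g by (simp add: group_ring_def)
      finally show "((a \<oplus>\<^bsub>?R\<^esub> b) \<otimes>\<^bsub>?R\<^esub> c) g = (a \<otimes>\<^bsub>?R\<^esub> c \<oplus>\<^bsub>?R\<^esub> b \<otimes>\<^bsub>?R\<^esub> c) g" .
    qed (auto simp: group_ring_def)
  qed
qed

section \<open>Representations\<close>

text \<open>A representation of an abelian group \<open>G\<close> over \<open>K\<close> is a \<open>KG\<close>-module \<open>M\<close>, that is,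
  \<^prop>\<open>module (group_ring K G) M\<close>. As \<open>KG\<close> is commutative, right modules are the same as left
  modules, and \<open>v g\<close> is written \<^term>\<open>group_ring_elem K G g \<odot>\<^bsub>M\<^esub> v\<close>.\<close>

definition simple_module ::
  "('c, 'r) ring_scheme \<Rightarrow> ('c, 'm, 'x) module_scheme \<Rightarrow> bool" where
  "simple_module R M \<longleftrightarrow>
     module R M \<and> carrier M \<noteq> {\<zero>\<^bsub>M\<^esub>} \<and>
     (\<forall>N. submodule N R M \<longrightarrow> N = {\<zero>\<^bsub>M\<^esub>} \<or> N = carrier M)"

definition rep_centralizer ::
  "('k, 'r) ring_scheme \<Rightarrow> ('g, 'a) monoid_scheme \<Rightarrow> ('g \<Rightarrow> 'k, 'm, 'x) module_scheme \<Rightarrow> 'g set" where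
  "rep_centralizer K G M =
     {g \<in> carrier G. \<forall>v\<in>carrier M. group_ring_elem K G g \<odot>\<^bsub>M\<^esub> v = v}"

text \<open>For a subgroup \<open>H\<close> the inclusion of \<open>KH\<close> into \<open>KG\<close> is extension by zero; restriction along it
  makes a \<open>KG\<close>-module a \<open>KH\<close>-module.\<close>

definition group_ring_incl ::
  "('k, 'r) ring_scheme \<Rightarrow> ('g, 'a) monoid_scheme \<Rightarrow> 'g set \<Rightarrow> ('g \<Rightarrow> 'k) \<Rightarrow> 'g \<Rightarrow> 'k" where
  "group_ring_incl K G H a = (\<lambda>g\<in>carrier G. if g \<in> H then a g else \<zero>\<^bsub>K\<^esub>)"

definition restrict_rep ::
  "('k, 'r) ring_scheme \<Rightarrow> ('g, 'a) monoid_scheme \<Rightarrow> 'g set \<Rightarrow>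
     ('g \<Rightarrow> 'k, 'm, 'x) module_scheme \<Rightarrow> ('g \<Rightarrow> 'k, 'm, 'x) module_scheme" where
  "restrict_rep K G H M = M\<lparr>smult := (\<lambda>a v. group_ring_incl K G H a \<odot>\<^bsub>M\<^esub> v)\<rparr>"

definition internal_direct_sum ::
  "('m, 'x) ring_scheme \<Rightarrow> 'i set \<Rightarrow> ('i \<Rightarrow> 'm set) \<Rightarrow> bool" where
  "internal_direct_sum M I V \<longleftrightarrow>
     (\<forall>i\<in>I. subgroup (V i) (add_monoid M)) \<and>
     (\<forall>v\<in>carrier M. \<exists>!w. w \<in> (\<Pi>\<^sub>E i\<in>I. V i) \<and> finite {i\<in>I. w i \<noteq> \<zero>\<^bsub>M\<^esub>} \<and>
        v = (\<Oplus>\<^bsub>M\<^esub>i\<in>{i\<in>I. w i \<noteq> \<zero>\<^bsub>M\<^esub>}. w i))"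

text \<open>\<open>M\<close> is induced from its \<open>KH\<close>-submodule \<open>U\<close>: \<open>M = \<Oplus>\<^sub>t U t\<close>. The coset \<open>Ht\<close> determines \<open>U t\<close>,
  so the choice of the transversal is immaterial.\<close>

definition induced_from ::
  "('k, 'r) ring_scheme \<Rightarrow> ('g, 'a) monoid_scheme \<Rightarrow> ('g \<Rightarrow> 'k, 'm, 'x) module_scheme \<Rightarrow>
     'g set \<Rightarrow> 'm set \<Rightarrow> bool" where
  "induced_from K G M H U \<longleftrightarrow>
     subgroup H G \<and>
     submodule U (group_ring K (G\<lparr>carrier := H\<rparr>)) (restrict_rep K G H M) \<and>
     (\<exists>T. right_transversal G H T \<and>
        internal_direct_sum M T (\<lambda>t. (\<lambda>u. group_ring_elem K G t \<odot>\<^bsub>M\<^esub> u) ` U))"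

end

theory Submission
  imports Defs
begin

text \<open>As \<open>KG\<close> is commutative, a simple module \<open>M = KG m\<close> is
  \<open>KG/I\<close> for a maximal ideal \<open>I\<close>, hence a field; embed it in an
  algebraically closed field \<open>L\<close>. Then \<open>K\<close> becomes a finitely generated
  subfield of \<open>L\<close>, and \<open>G\<close> acts by multiplication through a homomorphism
  \<open>\<gamma>\<close> into the nonzero elements of \<open>L\<close>, injective because the
  representation is faithful.

  Suppose that \<open>E\<close> is a subfield of \<open>L\<close> containing the image of
  \<open>K\<close>, and let \<open>H\<close> be the set of all \<open>g\<close> with
  \<open>\<gamma> g \<in> E\<close>. The \<open>KH\<close>-submodule \<open>U\<close> generated by
  \<open>m\<close> lies inside \<open>E\<close>, so a relation between the translates \<open>U
  t\<close> for \<open>t\<close> in a transversal of \<open>H\<close> is an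
  \<open>E\<close>-linear relation between the elements \<open>\<gamma> t\<close>. These are
  pairwise incongruent modulo the multiplicative group of \<open>E\<close>. So the theorem follows
  (\<open>induced_from_orbit\<close>) once \<open>E\<close> is found such that \<open>H\<close> is
  finitely generated and elements of \<open>\<gamma> G\<close> that are pairwise incongruent
  modulo \<open>E\<close> are linearly independent over \<open>E\<close>
  (\<open>independence_field\<close>).

  The hypotheses on \<open>G\<close> enter as follows. Finite torsion-free rank gives a finitely
  generated subgroup with torsion quotient; the condition on \<open>Sp(G)\<close> allows it to be
  enlarged so that the quotient has no elements of order divisible by the characteristic
  (\<open>torsion_quotient_coprime_to_char\<close>). Finite total rank leaves only finitely many
  primes as orders of elements of \<open>G\<close> (\<open>finite_torsion_primes\<close>). Thus
  \<open>\<gamma> G\<close> consists of radicals, of exponent prime to the characteristic, over a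
  finitely generated field \<open>F\<close>.

  Finite generation of \<open>H\<close> rests on a finiteness property of finitely generated
  fields that replaces a theory of heights (\<open>exists_northcott_subfield\<close>): given a
  finite set \<open>D\<close> and bounds \<open>e\<close>, \<open>r\<close>, there are only
  finitely many \<open>a\<close> for which every power \<open>a^m\<close> is a sum of
  \<open>O(r^m)\<close> products of \<open>e m\<close> elements of \<open>D\<close> and one factor
  from a finite set. Over the integers this bounds the absolute value of \<open>a\<close>, over a
  polynomial ring it bounds the degree. If a power of \<open>a\<close> lies in the group generated
  by \<open>D\<close>, then \<open>a\<close> times a suitable element of that group is of this
  kind; so the roots in the field of elements of a finitely generated group form a finitely
  generated group.

  Independence is Kummer theory. Over a field \<open>V\<close> containing the \<open>p\<close>-th
  roots of unity (the fourth ones if \<open>p = 2\<close>), incongruent radicals of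
  \<open>p\<close>-power exponent are independent (\<open>prime_power_roots_independent\<close>).
  For arbitrary exponents the primes are treated in increasing order
  (\<open>roots_independent\<close>): all radicals whose exponents involve only primes below
  \<open>p\<close>, together with a \<open>p\<close>-th root of unity, generate an extension whose
  degree has only prime factors below \<open>p\<close>, and such an extension cannot make
  incongruent \<open>p\<close>-power radicals congruent, unless roots of unity interfere: the one
  thing to exclude is that \<open>\<gamma> g\<close> is outside \<open>E\<close> while
  \<open>\<eta> \<gamma> g\<close> is in \<open>E\<close> for some \<open>\<eta>\<close> with
  \<open>\<eta>^p = 1\<close>. For large \<open>p\<close> this never happens over
  \<open>F\<close>, again by the finiteness property (\<open>large_primes_good\<close>); for the
  finitely many small \<open>p\<close> it is prevented by adjoining the roots of unity to
  \<open>F\<close>, which gives \<open>E\<close>.\<close>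

section \<open>Powers that are short sums of products\<close>

text \<open>\<open>sumprod D F m N x\<close>: the element \<open>x\<close> is a sum of at most
  \<open>N\<close> terms, each a product of \<open>m\<close> elements of \<open>D\<close> and one
  element of \<open>F\<close>. Sizes of elements are measured by the numbers \<open>m\<close> and
  \<open>N\<close>.\<close>

inductive (in ring) sumprod :: "'a set \<Rightarrow> 'a set \<Rightarrow> nat \<Rightarrow> nat \<Rightarrow> 'a \<Rightarrow> bool" for D F where
  base: "x \<in> F \<Longrightarrow> sumprod D F 0 1 x"
| zero: "sumprod D F m N \<zero>"
| mult: "c \<in> D \<Longrightarrow> sumprod D F m N x \<Longrightarrow> sumprod D F (Suc m) N (c \<otimes> x)"
| add: "sumprod D F m N x \<Longrightarrow> sumprod D F m N' y \<Longrightarrow> sumprod D F m (N + N') (x \<oplus> y)"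

context cring
begin

lemma sumprod_closed:
  assumes "sumprod D F m N x" "subring S R" "D \<subseteq> S" "F \<subseteq> S"
  shows "x \<in> S"
  using assms(1) by induction (use assms subringE(2,6,7)[OF assms(2)] in auto)

lemma sumprod_carrier:
  "sumprod D F m N x \<Longrightarrow> D \<subseteq> carrier R \<Longrightarrow> F \<subseteq> carrier R \<Longrightarrow> x \<in> carrier R"
  using sumprod_closed[OF _ carrier_is_subring] by blast

lemma sumprod_mono_count:
  assumes "sumprod D F m N x" "N \<le> N'" "D \<subseteq> carrier R" "F \<subseteq> carrier R"
  shows "sumprod D F m N' x"
proof -
  have "sumprod D F m (N + (N' - N)) (x \<oplus> \<zero>)"
    by (intro sumprod.add sumprod.zero assms)
  with sumprod_carrier[OF assms(1,3,4)] assms(2) show ?thesis by simp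
qed

lemma sumprod_mono:
  assumes "sumprod D F m N x" "D \<subseteq> D'" "F \<subseteq> F'"
  shows "sumprod D' F' m N x"
  using assms(1) by induction (use assms in \<open>auto intro: sumprod.intros simp del: One_nat_def\<close>)

lemma sumprod_pad:
  assumes "sumprod D F m N x" "\<one> \<in> D" "D \<subseteq> carrier R" "F \<subseteq> carrier R"
  shows "m \<le> m' \<Longrightarrow> sumprod D F m' N x"
proof (induction m' rule: dec_induct)
  case (step k)
  then show ?case
    using sumprod.mult[OF assms(2) step(3)] sumprod_carrier[OF assms(1,3,4)] by simp
qed (rule assms(1))

lemma sumprod_mult:
  assumes "sumprod D F m N x" "sumprod D F' m' N' y" "D \<subseteq> carrier R" "F \<subseteq> carrier R" "F' \<subseteq> carrier R"
  shows "sumprod D ((\<lambda>(u,v). u \<otimes> v) ` (F \<times> F')) (m + m') (N * N') (x \<otimes> y)"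
  using assms(1)
proof induction
  case (base u)
  let ?P = "(\<lambda>(u,v). u \<otimes> v) ` (F \<times> F')"
  have u: "u \<in> carrier R" using base assms by auto
  from assms(2) show ?case
  proof induction
    case (base v)
    then have "sumprod D ?P 0 1 (u \<otimes> v)" using \<open>u \<in> F\<close> by (intro sumprod.base) auto
    then show ?case by simp
  next
    case zero show ?case using u by (simp add: sumprod.zero)
  next
    case (mult c k N v)
    have v: "v \<in> carrier R" "c \<in> carrier R" using mult sumprod_carrier assms by blast+
    have "sumprod D ?P (Suc (0 + k)) (1 * N) (c \<otimes> (u \<otimes> v))"
      using mult by (intro sumprod.mult) auto
    then show ?case using u v by (simp add: m_lcomm)
  next
    case (add k N v N' w)
    have v: "v \<in> carrier R" "w \<in> carrier R" using add sumprod_carrier assms by blast+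
    show ?case using sumprod.add[OF add(3,4)] u v by (simp add: r_distr)
  qed
next
  case (zero m N)
  show ?case using sumprod_carrier[OF assms(2,3,5)] by (simp add: sumprod.zero)
next
  case (mult c k N v)
  have v: "v \<in> carrier R" "c \<in> carrier R" "y \<in> carrier R" using mult sumprod_carrier assms by blast+
  show ?case using sumprod.mult[OF mult(1,3)] v by (simp add: m_assoc)
next
  case (add k N v N' w)
  have v: "v \<in> carrier R" "w \<in> carrier R" "y \<in> carrier R" using add sumprod_carrier assms by blast+
  show ?case using sumprod.add[OF add(3,4)] v by (simp add: l_distr distrib_right)
qed

lemma sumprod_finsum:
  assumes "finite A" "\<And>i. i \<in> A \<Longrightarrow> sumprod D F m N (f i)" "D \<subseteq> carrier R" "F \<subseteq> carrier R"
  shows "sumprod D F m (card A * N) (\<Oplus>i\<in>A. f i)"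
  using assms(1,2)
proof (induction A rule: finite_induct)
  case empty then show ?case by (simp add: sumprod.zero)
next
  case (insert a A)
  have "f \<in> A \<rightarrow> carrier R" "f a \<in> carrier R" using insert sumprod_carrier[OF _ assms(3,4)] by blast+
  then show ?case using insert sumprod.add[of D F m N "f a" "card A * N"] by simp
qed

text \<open>A purely algebraic growth condition on the powers of \<open>a\<close>. The finite set
  \<open>F\<close> and the constant \<open>c\<close> depend on \<open>a\<close>, but
  \<open>D\<close>, \<open>e\<close> and \<open>r\<close> do not, so that only the exponential
  growth rate is controlled, as it would be by the height of \<open>a\<close>.\<close>

definition power_bounded :: "'a set \<Rightarrow> 'a set \<Rightarrow> nat \<Rightarrow> nat \<Rightarrow> 'a \<Rightarrow> bool" where
  "power_bounded V D e r a \<longleftrightarrow>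
     (\<exists>F c. finite F \<and> F \<subseteq> V \<and> (\<forall>m. sumprod D F (e * m) (c * r ^ m) (a [^] m)))"

text \<open>The analogue of the finiteness of sets of bounded height and degree.\<close>

definition northcott :: "'a set \<Rightarrow> bool" where
  "northcott K \<longleftrightarrow>
     (\<forall>D e r. finite D \<and> D \<subseteq> K \<longrightarrow> finite {a \<in> K. power_bounded K D e r a})"

lemma northcott_finite: "finite K \<Longrightarrow> northcott K"
  by (simp add: northcott_def)

text \<open>Expanding \<open>(a + b)^m\<close> by the binomial formula has \<open>2^m\<close> terms, and
  already the terms \<open>a^j\<close> cost \<open>c r^j\<close> summands each; the induction
  keeps track of \<open>a^j (a + b)^m\<close>, whose count is \<open>c r^j (r + 1)^m\<close>.\<close>

lemma power_bounded_add:
  assumes "power_bounded V D e r a" "b \<in> V" "a \<in> V" "V \<subseteq> carrier R" "D \<subseteq> V"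
  shows "power_bounded V (insert b (insert \<one> D)) (Suc e) (Suc r) (a \<oplus> b)"
proof -
  obtain F c where F: "finite F" "F \<subseteq> V" and bd: "\<And>m. sumprod D F (e * m) (c * r ^ m) (a [^] m)"
    using assms(1) by (auto simp: power_bounded_def)
  let ?D = "insert b (insert \<one> D)"
  have carr: "?D \<subseteq> carrier R" "F \<subseteq> carrier R" "a \<in> carrier R" "b \<in> carrier R" using assms F by auto
  have "sumprod ?D F (Suc e * (j + m)) (c * r ^ j * Suc r ^ m) (a [^] j \<otimes> (a \<oplus> b) [^] m)" for j m
  proof (induction m arbitrary: j)
    case 0
    have "sumprod ?D F (e * j) (c * r ^ j) (a [^] j)"
      by (rule sumprod_mono[OF bd]) auto
    then have "sumprod ?D F (Suc e * j) (c * r ^ j) (a [^] j)"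
      by (rule sumprod_pad) (use carr in auto)
    then show ?case using carr by simp
  next
    case (Suc m)
    have 1: "sumprod ?D F (Suc e * (j + Suc m)) (c * r ^ Suc j * Suc r ^ m) (a [^] Suc j \<otimes> (a \<oplus> b) [^] m)"
      using Suc[of "Suc j"] by simp
    have "sumprod ?D F (Suc (Suc e * (j + m))) (c * r ^ j * Suc r ^ m) (b \<otimes> (a [^] j \<otimes> (a \<oplus> b) [^] m))"
      by (intro sumprod.mult Suc) simp
    then have 2: "sumprod ?D F (Suc e * (j + Suc m)) (c * r ^ j * Suc r ^ m) (b \<otimes> (a [^] j \<otimes> (a \<oplus> b) [^] m))"
      by (rule sumprod_pad) (use carr in auto)
    have N: "c * r ^ Suc j * Suc r ^ m + c * r ^ j * Suc r ^ m = c * r ^ j * Suc r ^ Suc m"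
      by (simp add: algebra_simps)
    have "a [^] Suc j \<otimes> (a \<oplus> b) [^] m \<oplus> b \<otimes> (a [^] j \<otimes> (a \<oplus> b) [^] m) = a [^] j \<otimes> (a \<oplus> b) [^] Suc m"
      using carr by (simp add: l_distr r_distr m_ac)
    then show ?case using sumprod.add[OF 1 2] unfolding N by simp
  qed
  from this[of 0] have "\<And>m. sumprod ?D F (Suc e * m) (c * Suc r ^ m) ((a \<oplus> b) [^] m)" using carr by simp
  then show ?thesis using F unfolding power_bounded_def by blast
qed

lemma power_bounded_mult:
  assumes "power_bounded V D e r a" "power_bounded V D e' r' b" "a \<in> carrier R" "b \<in> carrier R"
    "subring V R" "D \<subseteq> V"
  shows "power_bounded V D (e + e') (r * r') (a \<otimes> b)"
proof -
  obtain F c where F: "finite F" "F \<subseteq> V" and bd: "\<And>m. sumprod D F (e * m) (c * r ^ m) (a [^] m)"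
    using assms(1) by (auto simp: power_bounded_def)
  obtain F' c' where F': "finite F'" "F' \<subseteq> V" and bd': "\<And>m. sumprod D F' (e' * m) (c' * r' ^ m) (b [^] m)"
    using assms(2) by (auto simp: power_bounded_def)
  let ?P = "(\<lambda>(u,v). u \<otimes> v) ` (F \<times> F')"
  have V: "V \<subseteq> carrier R" using subringE(1)[OF assms(5)] .
  have "sumprod D ?P ((e + e') * m) (c * c' * (r * r') ^ m) ((a \<otimes> b) [^] m)" for m
  proof -
    have "sumprod D ?P (e * m + e' * m) (c * r ^ m * (c' * r' ^ m)) (a [^] m \<otimes> b [^] m)"
      by (rule sumprod_mult[OF bd[of m] bd'[of m]]) (use F F' V assms in auto)
    moreover have "e * m + e' * m = (e + e') * m" "c * r ^ m * (c' * r' ^ m) = c * c' * (r * r') ^ m"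
      by (simp_all add: distrib_right power_mult_distrib)
    ultimately show ?thesis using assms(3,4) by (simp add: nat_pow_distrib)
  qed
  moreover have "?P \<subseteq> V" using F F' subringE(6)[OF assms(5)] by auto
  ultimately show ?thesis using F F' unfolding power_bounded_def
    by (intro exI[of _ ?P] exI[of _ "c * c'"]) simp
qed

lemma power_bounded_one:
  assumes "subring V R"
  shows "power_bounded V D 0 1 \<one>"
proof -
  have "sumprod D {\<one>} (0 * m) (1 * 1 ^ m) (\<one> [^] m)" for m :: nat
    using sumprod.base[of \<one> "{\<one>}" D] by simp
  then show ?thesis using subringE(3)[OF assms]
    unfolding power_bounded_def by (intro exI[of _ "{\<one>}"] exI[of _ 1] conjI allI) auto
qed

lemma power_bounded_mono:
  assumes "power_bounded V D e r a" "D \<subseteq> D'" "V \<subseteq> V'"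
  shows "power_bounded V' D' e r a"
proof -
  obtain F c where F: "finite F" "F \<subseteq> V" and bd: "\<And>m. sumprod D F (e * m) (c * r ^ m) (a [^] m)"
    using assms(1) by (auto simp: power_bounded_def)
  have "sumprod D' F (e * m) (c * r ^ m) (a [^] m)" for m
    by (rule sumprod_mono[OF bd assms(2) order_refl])
  then show ?thesis using F assms(3) unfolding power_bounded_def by blast
qed

lemma power_bounded_map:
  assumes "power_bounded V D e r a" "subring V R" "D \<subseteq> V" "a \<in> V"
    and h: "h \<in> ring_hom (R\<lparr>carrier := V\<rparr>) R"
  shows "power_bounded (h ` V) (h ` D) e r (h a)"
proof -
  obtain F c where F: "finite F" "F \<subseteq> V" and bd: "\<And>m. sumprod D F (e * m) (c * r ^ m) (a [^] m)"
    using assms(1) by (auto simp: power_bounded_def)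
  interpret V: ring "R\<lparr>carrier := V\<rparr>" by (rule subring_is_ring[OF assms(2)])
  interpret h: ring_hom_ring "R\<lparr>carrier := V\<rparr>" R h
    by (rule ring_hom_ringI2[OF V.ring_axioms ring_axioms h])
  have *: "sumprod (h ` D) (h ` F) m N (h x)" if "sumprod D F m N x" for m N x
    using that
  proof induction
    case (mult c m N x)
    have "x \<in> V" using sumprod_closed[OF mult(2) assms(2,3) F(2)] .
    with mult assms(3) show ?case using h.hom_mult[of c x] sumprod.mult[of "h c"] by auto
  next
    case (add m N x N' y)
    have "x \<in> V" "y \<in> V" using sumprod_closed[OF _ assms(2,3) F(2)] add by blast+
    then show ?case using h.hom_add[of x y] sumprod.add[OF add(3,4)] by simp
  next
    case (zero m N)
    show ?case using h.hom_zero by (simp add: sumprod.zero)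
  next
    case (base x) then show ?case using sumprod.base[of "h x" "h ` F"] by simp
  qed
  have "h (a [^] m) = h a [^] m" for m :: nat
    using h.hom_nat_pow[of a m] assms(4) by (simp add: nat_pow_consistent[symmetric])
  then have "sumprod (h ` D) (h ` F) (e * m) (c * r ^ m) (h a [^] m)" for m
    using *[OF bd[of m]] by simp
  moreover have "finite (h ` F)" "h ` F \<subseteq> h ` V" using F by auto
  ultimately show ?thesis unfolding power_bounded_def by blast
qed

end

section \<open>Linear independence of families\<close>

text \<open>Families indexed by sets, rather than the lists of \<open>independent\<close>, since the index
  sets below are sets of group elements that get partitioned and reindexed.\<close>

definition (in ring) lin_independent :: "'a set \<Rightarrow> 'i set \<Rightarrow> ('i \<Rightarrow> 'a) \<Rightarrow> bool" where
  "lin_independent K I w \<longleftrightarrow>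
     (\<forall>f\<in>I \<rightarrow> K. (\<Oplus>i\<in>I. f i \<otimes> w i) = \<zero> \<longrightarrow> (\<forall>i\<in>I. f i = \<zero>))"

context ring
begin

lemma finsum_swap:
  assumes "finite A" "finite B" "\<And>i j. i \<in> A \<Longrightarrow> j \<in> B \<Longrightarrow> f i j \<in> carrier R"
  shows "(\<Oplus>i\<in>A. \<Oplus>j\<in>B. f i j) = (\<Oplus>j\<in>B. \<Oplus>i\<in>A. f i j)"
  using assms(1,3)
proof (induction A rule: finite_induct)
  case empty then show ?case by (simp add: add.finprod_one_eqI)
next
  case (insert a A)
  have "(\<Oplus>j\<in>B. \<Oplus>i\<in>insert a A. f i j) = (\<Oplus>j\<in>B. f a j \<oplus> (\<Oplus>i\<in>A. f i j))"
    by (rule finsum_cong') (use insert in \<open>auto intro!: finsum_closed\<close>)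
  also have "\<dots> = (\<Oplus>j\<in>B. f a j) \<oplus> (\<Oplus>j\<in>B. \<Oplus>i\<in>A. f i j)"
    by (rule finsum_addf) (use insert in \<open>auto intro!: finsum_closed\<close>)
  finally show ?case using insert by (simp add: finsum_closed Pi_iff)
qed

lemma finsum_in_subring:
  assumes "subring S R" "\<And>i. i \<in> I \<Longrightarrow> f i \<in> S"
  shows "(\<Oplus>i\<in>I. f i) \<in> S"
proof (cases "finite I")
  case True
  then show ?thesis using assms(2)
  proof (induction I rule: finite_induct)
    case empty then show ?case using subringE(2)[OF assms(1)] by simp
  next
    case (insert i I)
    have "f \<in> insert i I \<rightarrow> carrier R" using insert subringE(1)[OF assms(1)] by blast
    then show ?case using insert subringE(7)[OF assms(1)] by (simp add: Pi_iff)
  qed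
qed (use subringE(2)[OF assms(1)] in \<open>simp add: finsum_infinite\<close>)

lemma finsum_fibres:
  assumes "finite I" "\<And>i. i \<in> I \<Longrightarrow> f i \<in> carrier R"
  shows "(\<Oplus>i\<in>I. f i) = (\<Oplus>j\<in>r ` I. \<Oplus>i\<in>{i\<in>I. r i = j}. f i)"
proof -
  have U: "I = \<Union> ((\<lambda>j. {i\<in>I. r i = j}) ` (r ` I))" by auto
  have "(\<Oplus>i\<in>\<Union> ((\<lambda>j. {i\<in>I. r i = j}) ` (r ` I)). f i) = (\<Oplus>j\<in>r ` I. \<Oplus>i\<in>{i\<in>I. r i = j}. f i)"
    by (rule add.finprod_UN_disjoint) (use assms in \<open>auto simp: pairwise_def disjnt_def\<close>)
  then show ?thesis using U by simp
qed

text \<open>Independence is transitive in towers: a basis of the upper field whose elements are multiplied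
  by families independent over the lower field. The lower family may depend on the fibre.\<close>

lemma lin_independent_fibres:
  assumes E: "subring E R" and V: "subring V R" "E \<subseteq> V" and I: "finite I"
    and b: "\<And>i. i \<in> I \<Longrightarrow> b (r i) \<in> carrier R"
    and c: "\<And>i. i \<in> I \<Longrightarrow> c i \<in> V"
    and ind: "lin_independent V (r ` I) b"
    and fib: "\<And>i. i \<in> I \<Longrightarrow> lin_independent E {i'\<in>I. r i' = r i} c"
  shows "lin_independent E I (\<lambda>i. c i \<otimes> b (r i))"
  unfolding lin_independent_def
proof (intro ballI impI)
  fix f i assume f: "f \<in> I \<rightarrow> E" and eq: "(\<Oplus>i\<in>I. f i \<otimes> (c i \<otimes> b (r i))) = \<zero>" and i: "i \<in> I"
  have Vc: "V \<subseteq> carrier R" using subringE(1)[OF V(1)] .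
  have fc: "f i \<otimes> c i \<in> V" if "i \<in> I" for i
    using f c[OF that] that V subringE(6)[OF V(1)] by (auto simp: Pi_iff)
  define s where "s j = (\<Oplus>i\<in>{i\<in>I. r i = j}. f i \<otimes> c i)" for j
  have sV: "s j \<in> V" for j
    unfolding s_def by (rule finsum_in_subring[OF V(1)]) (use fc in auto)
  have "(\<Oplus>i\<in>I. f i \<otimes> (c i \<otimes> b (r i))) = (\<Oplus>j\<in>r ` I. \<Oplus>i\<in>{i\<in>I. r i = j}. f i \<otimes> (c i \<otimes> b (r i)))"
    by (rule finsum_fibres[OF I]) (use f c b V Vc in \<open>auto simp: Pi_iff subset_iff\<close>)
  also have "\<dots> = (\<Oplus>j\<in>r ` I. s j \<otimes> b j)"
  proof (rule finsum_cong')
    fix j assume j: "j \<in> r ` I"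
    have "(\<Oplus>i\<in>{i\<in>I. r i = j}. f i \<otimes> (c i \<otimes> b (r i))) = (\<Oplus>i\<in>{i\<in>I. r i = j}. (f i \<otimes> c i) \<otimes> b j)"
    proof (rule finsum_cong')
      fix i assume i: "i \<in> {i\<in>I. r i = j}"
      have "f i \<in> carrier R" "c i \<in> carrier R" "b (r i) \<in> carrier R"
        using f c b V Vc i by (auto simp: Pi_iff subset_iff)
      then show "f i \<otimes> (c i \<otimes> b (r i)) = (f i \<otimes> c i) \<otimes> b j" using i by (simp add: m_assoc)
    qed (use fc Vc b j in \<open>auto simp: Pi_iff subset_iff\<close>)
    also have "\<dots> = s j \<otimes> b j"
      unfolding s_def by (rule finsum_ldistr[symmetric]) (use I fc Vc b j in \<open>auto simp: Pi_iff subset_iff\<close>)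
    finally show "(\<Oplus>i\<in>{i\<in>I. r i = j}. f i \<otimes> (c i \<otimes> b (r i))) = s j \<otimes> b j" .
  qed (use sV Vc b in auto)
  finally have "(\<Oplus>j\<in>r ` I. s j \<otimes> b j) = \<zero>" using eq by simp
  moreover have "s \<in> r ` I \<rightarrow> V" using sV by auto
  ultimately have "s (r i) = \<zero>" using ind i unfolding lin_independent_def by blast
  then have "(\<Oplus>i'\<in>{i'\<in>I. r i' = r i}. f i' \<otimes> c i') = \<zero>" by (simp add: s_def)
  moreover have "f \<in> {i'\<in>I. r i' = r i} \<rightarrow> E" using f by auto
  ultimately show "f i = \<zero>" using fib[OF i] i unfolding lin_independent_def by blast
qed

lemma combine_eq_finsum:
  assumes "length Ks = length Us" "set Ks \<subseteq> carrier R" "set Us \<subseteq> carrier R"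
  shows "combine Ks Us = (\<Oplus>i\<in>{..<length Us}. Ks ! i \<otimes> Us ! i)"
  using assms
proof (induction Ks Us rule: list_induct2)
  case (Cons k Ks u Us)
  have S: "{..<length (u # Us)} = insert 0 (Suc ` {..<length Us})"
    by (auto simp: image_iff less_Suc_eq_0_disj)
  have nth: "Ks ! i \<in> carrier R" "Us ! i \<in> carrier R" if "i < length Us" for i
    using Cons that by (auto simp: subset_iff)
  have "(\<Oplus>i\<in>Suc ` {..<length Us}. (k # Ks) ! i \<otimes> (u # Us) ! i) = (\<Oplus>i\<in>{..<length Us}. Ks ! i \<otimes> Us ! i)"
    by (subst finsum_reindex) (use nth in \<open>auto intro!: m_closed\<close>)
  then show ?case using Cons nth unfolding S
    by (subst finsum_insert) (auto intro!: m_closed)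
qed simp

lemma independent_imp_lin_independent:
  assumes "subfield K R" "independent K Us"
  shows "lin_independent K {..<length Us} (\<lambda>i. Us ! i)"
  unfolding lin_independent_def
proof (intro ballI impI)
  fix f i assume f: "f \<in> {..<length Us} \<rightarrow> K" and eq: "(\<Oplus>i\<in>{..<length Us}. f i \<otimes> Us ! i) = \<zero>"
    and i: "i \<in> {..<length Us}"
  have Kc: "K \<subseteq> carrier R" and Uc: "set Us \<subseteq> carrier R"
    using subfieldE(3)[OF assms(1)] independent_in_carrier[OF assms(2)] by auto
  let ?Ks = "map f [0..<length Us]"
  have "combine ?Ks Us = (\<Oplus>i\<in>{..<length Us}. ?Ks ! i \<otimes> Us ! i)"
    by (rule combine_eq_finsum) (use f Kc Uc in auto)
  also have "\<dots> = (\<Oplus>i\<in>{..<length Us}. f i \<otimes> Us ! i)"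
    by (rule finsum_cong') (use f Kc Uc in \<open>auto intro!: m_closed\<close>)
  finally have "combine ?Ks Us = \<zero>" using eq by simp
  then have "set (take (length Us) ?Ks) \<subseteq> {\<zero>}"
    by (intro independent_imp_trivial_combine[OF assms]) (use f in auto)
  then show "f i = \<zero>" using i by (simp add: image_subset_iff)
qed

text \<open>In \<open>power_bounded_descend\<close> the basis has to contain \<open>1\<close>.\<close>

lemma finite_dimension_basis:
  assumes K: "subfield K R" and L: "finite_dimension K L" and x: "x \<in> L" "x \<in> carrier R" "x \<noteq> \<zero>"
  obtains n u j where "u \<in> {..<n::nat} \<rightarrow> L" "lin_independent K {..<n} u"
    "\<And>y. y \<in> L \<Longrightarrow> \<exists>k\<in>{..<n} \<rightarrow> K. y = (\<Oplus>i\<in>{..<n}. k i \<otimes> u i)" "j < n" "u j = x"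
proof -
  obtain n where n: "dimension n K L" using L by auto
  have "independent K [x]"
    using x by (intro li_Cons) auto
  then obtain Vs where Vs: "independent K (Vs @ [x])" "Span K (Vs @ [x]) = L"
    using complete_base[OF K n, of "[x]"] x by auto
  let ?U = "Vs @ [x]"
  have Kc: "K \<subseteq> carrier R" and Uc: "set ?U \<subseteq> carrier R"
    using subfieldE(3)[OF K] independent_in_carrier[OF Vs(1)] by blast+
  show thesis
  proof (rule that[of "\<lambda>i. ?U ! i" "length ?U" "length Vs"])
    show "(\<lambda>i. ?U ! i) \<in> {..<length ?U} \<rightarrow> L"
      using Span_base_incl[OF K Uc] Vs(2) nth_mem by blast
    show "lin_independent K {..<length ?U} (\<lambda>i. ?U ! i)"
      by (rule independent_imp_lin_independent[OF K Vs(1)])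
    show "\<exists>k\<in>{..<length ?U} \<rightarrow> K. y = (\<Oplus>i\<in>{..<length ?U}. k i \<otimes> ?U ! i)" if y: "y \<in> L" for y
    proof -
      obtain Ks where Ks: "set Ks \<subseteq> K" "length Ks = length ?U" "y = combine Ks ?U"
        using Span_mem_iff_length_version[OF K Uc, of y] Vs(2) y by auto
      then show ?thesis using combine_eq_finsum[OF Ks(2) _ Uc] Kc
        by (intro bexI[of _ "\<lambda>i. Ks ! i"]) (auto simp: subset_iff)
    qed
  qed auto
qed

lemma lin_independent_unique:
  assumes K: "subring K R" and ind: "lin_independent K I w" and I: "finite I" and w: "w \<in> I \<rightarrow> carrier R"
    and f: "f \<in> I \<rightarrow> K" and g: "g \<in> I \<rightarrow> K" and eq: "(\<Oplus>i\<in>I. f i \<otimes> w i) = (\<Oplus>i\<in>I. g i \<otimes> w i)"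
    and i: "i \<in> I"
  shows "f i = g i"
proof -
  have Kc: "K \<subseteq> carrier R" using subringE(1)[OF K] .
  have fc: "f \<in> I \<rightarrow> carrier R" "g \<in> I \<rightarrow> carrier R" using f g Kc by auto
  let ?h = "\<lambda>i. f i \<oplus> \<ominus> g i"
  have h: "?h \<in> I \<rightarrow> K" using f g subringE(5,7)[OF K] by (auto simp: Pi_iff)
  have "(\<Oplus>i\<in>I. ?h i \<otimes> w i) \<oplus> (\<Oplus>i\<in>I. g i \<otimes> w i) = (\<Oplus>i\<in>I. ?h i \<otimes> w i \<oplus> g i \<otimes> w i)"
    by (rule finsum_addf[symmetric]) (use fc w in \<open>auto simp: Pi_iff\<close>)
  also have "\<dots> = (\<Oplus>i\<in>I. f i \<otimes> w i)"
  proof (rule finsum_cong')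
    fix i assume "i \<in> I"
    then have "f i \<in> carrier R" "g i \<in> carrier R" "w i \<in> carrier R" using fc w by auto
    then show "?h i \<otimes> w i \<oplus> g i \<otimes> w i = f i \<otimes> w i"
      by (simp add: l_distr[symmetric] a_assoc l_neg)
  qed (use fc w in \<open>auto simp: Pi_iff\<close>)
  finally have "(\<Oplus>i\<in>I. ?h i \<otimes> w i) \<oplus> (\<Oplus>i\<in>I. g i \<otimes> w i) = \<zero> \<oplus> (\<Oplus>i\<in>I. g i \<otimes> w i)"
    using eq fc w by (simp add: finsum_closed Pi_iff)
  then have "(\<Oplus>i\<in>I. ?h i \<otimes> w i) = \<zero>"
    by (subst (asm) add.r_cancel) (use fc w in \<open>auto intro!: finsum_closed simp: Pi_iff\<close>)
  then have "?h i = \<zero>" using bspec[OF ind[unfolded lin_independent_def] h] i by simp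
  then show ?thesis using fc i r_right_minus_eq[of "f i" "g i"] by (auto simp: a_minus_def)
qed

end

context cring
begin

text \<open>Multiplication by an element of \<open>D\<close> is, in a basis of \<open>L\<close> over
  \<open>K\<close> with \<open>n\<close> elements, an \<open>n\<close> by \<open>n\<close> matrix;
  taking for \<open>D'\<close> the matrix entries, every factor from \<open>D\<close> multiplies
  the number of summands of each coordinate by at most \<open>n\<close>. For \<open>y\<close> in
  \<open>K\<close> the powers are read off from the coordinate of the basis vector
  \<open>1\<close>.\<close>

lemma power_bounded_descend:
  assumes K: "subfield K R" and L: "subring L R" and KL: "K \<subseteq> L" and fin: "finite_dimension K L"
    and nz: "\<one> \<noteq> \<zero>" and D: "finite D" "D \<subseteq> L"
  obtains D' s where "finite D'" "D' \<subseteq> K"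
    "\<And>e r y. y \<in> K \<Longrightarrow> power_bounded L D e r y \<Longrightarrow> power_bounded K D' e (r * s ^ e) y"
proof -
  have Lc: "L \<subseteq> carrier R" and Kc: "K \<subseteq> carrier R" and Ks: "subring K R"
    using subringE(1)[OF L] subfieldE[OF K] by auto
  obtain n u j where u: "u \<in> {..<n::nat} \<rightarrow> L" and ind: "lin_independent K {..<n} u"
    and span: "\<And>y. y \<in> L \<Longrightarrow> \<exists>k\<in>{..<n} \<rightarrow> K. y = (\<Oplus>i\<in>{..<n}. k i \<otimes> u i)"
    and j: "j < n" "u j = \<one>"
    by (rule finite_dimension_basis[OF K fin subringE(3)[OF L] one_closed nz]) (rule that)
  have uc: "u \<in> {..<n} \<rightarrow> carrier R" using u Lc by auto
  obtain B where B: "\<And>y. y \<in> L \<Longrightarrow> B y \<in> {..<n} \<rightarrow> K \<and> y = (\<Oplus>i\<in>{..<n}. B y i \<otimes> u i)"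
    using span by metis
  define A where "A c i = B (c \<otimes> u i)" for c i
  have A: "A c i \<in> {..<n} \<rightarrow> K" "c \<otimes> u i = (\<Oplus>l\<in>{..<n}. A c i l \<otimes> u l)" if "c \<in> L" "i < n" for c i
    using B[of "c \<otimes> u i"] that u subringE(6)[OF L] unfolding A_def by auto
  define D' where "D' = (\<Union>c\<in>D. \<Union>i\<in>{..<n}. A c i ` {..<n})"
  have D'K: "D' \<subseteq> K" using A(1) D unfolding D'_def by blast
  have main: "power_bounded K D' e (r * n ^ e) y" if y: "y \<in> K" and pb: "power_bounded L D e r y" for e r y
  proof -
    obtain F c where F: "finite F" "F \<subseteq> L" and bd: "\<And>m. sumprod D F (e * m) (c * r ^ m) (y [^] m)"
      using pb by (auto simp: power_bounded_def)
    define F' where "F' = (\<Union>x\<in>F. B x ` {..<n})"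
    have F': "finite F'" "F' \<subseteq> K" using F B unfolding F'_def by auto
    have carr: "D' \<subseteq> carrier R" "F' \<subseteq> carrier R" using D'K F'(2) Kc by auto
    have coord: "\<exists>k\<in>{..<n} \<rightarrow> K. x = (\<Oplus>i\<in>{..<n}. k i \<otimes> u i) \<and>
        (\<forall>i<n. sumprod D' F' m (N * n ^ m) (k i))" if "sumprod D F m N x" for m N x
      using that
    proof induction
      case (base x)
      then have x: "x \<in> L" using F by auto
      have "\<forall>i<n. sumprod D' F' 0 1 (B x i)"
        using base unfolding F'_def by (auto simp del: One_nat_def intro!: sumprod.base)
      with B[OF x] show ?case by (intro bexI[of _ "B x"]) auto
    next
      case (zero m N)
      have "\<zero> = (\<Oplus>i\<in>{..<n}. \<zero> \<otimes> u i)"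
        using uc by (intro add.finprod_one_eqI[symmetric]) (auto simp: Pi_iff)
      then show ?case
        by (intro bexI[of _ "\<lambda>_. \<zero>"]) (auto simp: sumprod.zero subringE(2)[OF Ks])
    next
      case (mult c m N x)
      then obtain k where k: "k \<in> {..<n} \<rightarrow> K" "x = (\<Oplus>i\<in>{..<n}. k i \<otimes> u i)"
        and bk: "\<And>i. i < n \<Longrightarrow> sumprod D' F' m (N * n ^ m) (k i)" by auto
      have c: "c \<in> L" "c \<in> carrier R" using mult(1) D Lc by auto
      have kc: "k i \<in> carrier R" "u i \<in> carrier R" if "i < n" for i using k uc Kc that by (auto simp: Pi_iff subset_iff)
      have Ac: "A c i l \<in> K" "A c i l \<in> carrier R" if "i < n" "l < n" for i l
        using A(1)[OF c(1) that(1)] that Kc by auto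
      define k' where "k' l = (\<Oplus>i\<in>{..<n}. A c i l \<otimes> k i)" for l
      have k'K: "k' \<in> {..<n} \<rightarrow> K"
        unfolding k'_def using Ac k subringE(6)[OF Ks]
        by (auto intro!: finsum_in_subring[OF Ks] simp: Pi_iff)
      have "c \<otimes> x = (\<Oplus>i\<in>{..<n}. c \<otimes> (k i \<otimes> u i))"
        unfolding k(2) by (rule finsum_rdistr) (use c kc in auto)
      also have "\<dots> = (\<Oplus>i\<in>{..<n}. \<Oplus>l\<in>{..<n}. (A c i l \<otimes> k i) \<otimes> u l)"
      proof (rule finsum_cong')
        fix i assume i: "i \<in> {..<n}"
        have "c \<otimes> (k i \<otimes> u i) = k i \<otimes> (c \<otimes> u i)" using c kc i by (simp add: m_lcomm)
        also have "\<dots> = (\<Oplus>l\<in>{..<n}. k i \<otimes> (A c i l \<otimes> u l))"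
          using A(2)[OF c(1)] i Ac kc by (simp add: finsum_rdistr Pi_iff)
        also have "\<dots> = (\<Oplus>l\<in>{..<n}. (A c i l \<otimes> k i) \<otimes> u l)"
          by (rule finsum_cong') (use Ac kc i in \<open>auto simp: m_ac\<close>)
        finally show "c \<otimes> (k i \<otimes> u i) = (\<Oplus>l\<in>{..<n}. (A c i l \<otimes> k i) \<otimes> u l)" .
      qed (use Ac kc in \<open>auto intro!: finsum_closed simp: Pi_iff\<close>)
      also have "\<dots> = (\<Oplus>l\<in>{..<n}. \<Oplus>i\<in>{..<n}. (A c i l \<otimes> k i) \<otimes> u l)"
        by (rule finsum_swap) (use Ac kc in \<open>auto simp: Pi_iff\<close>)
      also have "\<dots> = (\<Oplus>l\<in>{..<n}. k' l \<otimes> u l)"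
        unfolding k'_def
        by (rule finsum_cong') (use Ac kc in \<open>auto intro!: finsum_closed finsum_ldistr[symmetric] simp: Pi_iff\<close>)
      finally have eq: "c \<otimes> x = (\<Oplus>l\<in>{..<n}. k' l \<otimes> u l)" .
      have "sumprod D' F' (Suc m) (N * n ^ Suc m) (k' l)" if l: "l < n" for l
      proof -
        have "sumprod D' F' (Suc m) (card {..<n} * (N * n ^ m)) (k' l)"
          unfolding k'_def
        proof (rule sumprod_finsum)
          fix i assume "i \<in> {..<n}"
          then show "sumprod D' F' (Suc m) (N * n ^ m) (A c i l \<otimes> k i)"
            using mult(1) l bk unfolding D'_def by (auto intro!: sumprod.mult)
        qed (use carr in auto)
        then show ?thesis by (simp add: algebra_simps)
      qed
      with eq k'K show ?case by blast
    next
      case (add m N x N' z)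
      then obtain k k' where k: "k \<in> {..<n} \<rightarrow> K" "x = (\<Oplus>i\<in>{..<n}. k i \<otimes> u i)"
        and bk: "\<And>i. i < n \<Longrightarrow> sumprod D' F' m (N * n ^ m) (k i)"
        and k': "k' \<in> {..<n} \<rightarrow> K" "z = (\<Oplus>i\<in>{..<n}. k' i \<otimes> u i)"
        and bk': "\<And>i. i < n \<Longrightarrow> sumprod D' F' m (N' * n ^ m) (k' i)" by auto
      have kc: "k i \<in> carrier R" "k' i \<in> carrier R" "u i \<in> carrier R" if "i < n" for i
        using k k' uc Kc that by (auto simp: Pi_iff subset_iff)
      have "x \<oplus> z = (\<Oplus>i\<in>{..<n}. k i \<otimes> u i \<oplus> k' i \<otimes> u i)"
        unfolding k(2) k'(2) by (rule finsum_addf[symmetric]) (use kc in auto)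
      also have "\<dots> = (\<Oplus>i\<in>{..<n}. (k i \<oplus> k' i) \<otimes> u i)"
        by (rule finsum_cong') (use kc in \<open>auto simp: l_distr\<close>)
      finally have eq: "x \<oplus> z = (\<Oplus>i\<in>{..<n}. (k i \<oplus> k' i) \<otimes> u i)" .
      have "\<forall>i<n. sumprod D' F' m ((N + N') * n ^ m) (k i \<oplus> k' i)"
        using sumprod.add[OF bk bk'] by (simp add: distrib_right)
      moreover have "(\<lambda>i. k i \<oplus> k' i) \<in> {..<n} \<rightarrow> K" using k k' subringE(7)[OF Ks] by (auto simp: Pi_iff)
      ultimately show ?case using eq by (intro bexI[of _ "\<lambda>i. k i \<oplus> k' i"]) auto
    qed
    have "sumprod D' F' (e * m) (c * (r * n ^ e) ^ m) (y [^] m)" for m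
    proof -
      have yK: "y [^] m \<in> K"
        by (induction m) (use y subringE(3,6)[OF Ks] in auto)
      obtain k where k: "k \<in> {..<n} \<rightarrow> K" "y [^] m = (\<Oplus>i\<in>{..<n}. k i \<otimes> u i)"
        and bk: "\<And>i. i < n \<Longrightarrow> sumprod D' F' (e * m) (c * r ^ m * n ^ (e * m)) (k i)"
        using coord[OF bd[of m]] by auto
      let ?d = "\<lambda>i. if i = j then y [^] m else \<zero>"
      have "(\<Oplus>i\<in>{..<n}. ?d i \<otimes> u i) = (\<Oplus>i\<in>{..<n}. if j = i then y [^] m else \<zero>)"
        by (rule finsum_cong') (use uc j yK Kc in \<open>auto simp: Pi_iff split: if_splits\<close>)
      also have "\<dots> = y [^] m"
        using j yK Kc by (intro finsum_singleton) auto
      finally have "(\<Oplus>i\<in>{..<n}. k i \<otimes> u i) = (\<Oplus>i\<in>{..<n}. ?d i \<otimes> u i)" using k(2) by simp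
      then have "k j = ?d j"
        using lin_independent_unique[OF Ks ind _ uc k(1), of ?d j] j yK subringE(2)[OF Ks] by auto
      with bk[OF j(1)] show ?thesis by (simp add: power_mult_distrib power_mult mult.assoc)
    qed
    then show ?thesis unfolding power_bounded_def using F'
      by (intro exI[of _ F'] exI[of _ c]) auto
  qed
  show thesis
    by (rule that[of D' n]) (use D D'K main in \<open>auto simp: D'_def\<close>)
qed

end

section \<open>Products over roots and conjugation\<close>

definition (in monoid) prodl :: "('x \<Rightarrow> 'a) \<Rightarrow> 'x list \<Rightarrow> 'a" where
  "prodl f xs = foldr (\<lambda>x a. f x \<otimes> a) xs \<one>"

lemma (in monoid) prodl_simps [simp]:
  "prodl f [] = \<one>" "prodl f (x # xs) = f x \<otimes> prodl f xs"
  by (simp_all add: prodl_def)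

context cring
begin

lemma prodl_closed [simp]: "(\<And>x. x \<in> set xs \<Longrightarrow> f x \<in> carrier R) \<Longrightarrow> prodl f xs \<in> carrier R"
  by (induction xs) auto

lemma prodl_in_subring:
  assumes "subring S R"
  shows "(\<And>x. x \<in> set xs \<Longrightarrow> f x \<in> S) \<Longrightarrow> prodl f xs \<in> S"
  by (induction xs) (auto intro: subringE(3,6)[OF assms])

lemma prodl_cong: "(\<And>x. x \<in> set xs \<Longrightarrow> f x = g x) \<Longrightarrow> prodl f xs = prodl g xs"
  by (induction xs) auto

lemma prodl_mult:
  "(\<And>x. x \<in> set xs \<Longrightarrow> f x \<in> carrier R) \<Longrightarrow> (\<And>x. x \<in> set xs \<Longrightarrow> g x \<in> carrier R) \<Longrightarrow>
     prodl (\<lambda>x. f x \<otimes> g x) xs = prodl f xs \<otimes> prodl g xs"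
  by (induction xs) (auto simp: m_ac)

lemma prodl_const: "c \<in> carrier R \<Longrightarrow> prodl (\<lambda>_. c) xs = c [^] length xs"
  by (induction xs) (auto simp: m_comm)

lemma prodl_swap:
  assumes "\<And>x y. x \<in> set xs \<Longrightarrow> y \<in> set ys \<Longrightarrow> f x y \<in> carrier R"
  shows "prodl (\<lambda>x. prodl (f x) ys) xs = prodl (\<lambda>y. prodl (\<lambda>x. f x y) xs) ys"
  using assms
proof (induction xs)
  case Nil then show ?case by (simp add: prodl_const)
next
  case (Cons x xs) then show ?case by (simp add: prodl_mult)
qed

lemma prodl_zero:
  assumes "x \<in> set xs" "f x = \<zero>" "\<And>x. x \<in> set xs \<Longrightarrow> f x \<in> carrier R"
  shows "prodl f xs = \<zero>"
  using assms by (induction xs) auto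

end

lemma (in domain) prodl_eq_zero:
  assumes "prodl f xs = \<zero>" "\<And>x. x \<in> set xs \<Longrightarrow> f x \<in> carrier R"
  shows "\<exists>x\<in>set xs. f x = \<zero>"
  using assms by (induction xs) (auto simp: integral_iff)

context field
begin

lemma subfield_inv: "subfield K R \<Longrightarrow> x \<in> K \<Longrightarrow> x \<noteq> \<zero> \<Longrightarrow> inv x \<in> K"
  using subfield_m_inv(1)[of K x] by auto

lemma poly_diff:
  assumes "subring K R" "p \<in> carrier (K[X])" "q \<in> carrier (K[X])"
  shows "\<exists>h\<in>carrier (K[X]). (\<forall>x\<in>carrier R. eval h x = eval p x \<ominus> eval q x) \<and> (h = [] \<longleftrightarrow> p = q) \<and>
    degree h \<le> max (degree p) (degree q)"
proof -
  interpret UP: domain "K[X]" by (rule univ_poly_is_domain[OF assms(1)])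
  let ?h = "p \<ominus>\<^bsub>K[X]\<^esub> q"
  have h: "?h \<in> carrier (K[X])" using assms by simp
  have "eval ?h x = eval p x \<ominus> eval q x" if x: "x \<in> carrier R" for x
  proof -
    interpret ev: ring_hom_cring "K[X]" R "\<lambda>p. eval p x" by (rule eval_cring_hom[OF assms(1) x])
    show ?thesis using assms by (simp add: a_minus_def ev.hom_a_inv)
  qed
  moreover have "?h = [] \<longleftrightarrow> p = q"
    using UP.r_right_minus_eq[OF assms(2,3)] by (simp add: univ_poly_zero)
  moreover have "degree ?h \<le> max (degree p) (degree q)"
    using poly_add_degree[of p "\<ominus>\<^bsub>K[X]\<^esub> q"] univ_poly_a_inv_degree[OF assms(1,3)]
    by (simp add: a_minus_def univ_poly_add)
  ultimately show ?thesis using h by blast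
qed

text \<open>A polynomial with more zeros than its degree vanishes.\<close>

lemma poly_agree:
  assumes "p \<in> carrier (poly_ring R)" "q \<in> carrier (poly_ring R)" "finite Z" "Z \<subseteq> carrier R"
    "max (degree p) (degree q) < card Z" "\<And>x. x \<in> Z \<Longrightarrow> eval p x = eval q x"
  shows "p = q"
proof (rule ccontr)
  assume "p \<noteq> q"
  then obtain h where h: "h \<in> carrier (poly_ring R)" "\<And>x. x \<in> carrier R \<Longrightarrow> eval h x = eval p x \<ominus> eval q x"
    "h \<noteq> []" "degree h \<le> max (degree p) (degree q)"
    using poly_diff[OF carrier_is_subring assms(1,2)] by auto
  have pc: "eval p x \<in> carrier R" if "x \<in> carrier R" for x
    using eval_in_carrier[OF polynomial_in_carrier[OF carrier_is_subring]] assms(1) that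
    by (simp add: univ_poly_carrier)
  have "Z \<subseteq> set_mset (roots h)"
  proof
    fix x assume x: "x \<in> Z"
    then have "is_root h x"
      using h assms pc[of x] by (auto simp: is_root_def r_right_minus_eq subset_iff)
    then show "x \<in> set_mset (roots h)" using roots_mem_iff_is_root[OF h(1)] by simp
  qed
  then have "card Z \<le> card (set_mset (roots h))" by (intro card_mono) auto
  also have "\<dots> \<le> size (roots h)"
    using sum_mono[of "set_mset (roots h)" "\<lambda>_. 1" "count (roots h)"]
    by (simp add: size_multiset_overloaded_eq Suc_le_eq)
  also have "\<dots> \<le> degree h" by (rule size_roots_le_degree[OF h(1)])
  finally show False using h(4) assms(5) by linarith
qed

lemma monic_with_roots:
  assumes "set cs \<subseteq> carrier R"
  shows "\<exists>p\<in>carrier (poly_ring R). degree p = length cs \<and> p \<noteq> [] \<and>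
    (\<forall>x\<in>carrier R. eval p x = prodl (\<lambda>c. x \<ominus> c) cs)"
  using assms
proof (induction cs)
  case Nil
  have "[\<one>] \<in> carrier (poly_ring R)" by (simp add: univ_poly_carrier[symmetric] polynomial_def)
  then show ?case by (intro bexI[of _ "[\<one>]"]) auto
next
  case (Cons c cs)
  then obtain p where p: "p \<in> carrier (poly_ring R)" "degree p = length cs" "p \<noteq> []"
    "\<And>x. x \<in> carrier R \<Longrightarrow> eval p x = prodl (\<lambda>c. x \<ominus> c) cs" by auto
  let ?l = "[\<one>, \<ominus> c]"
  have c: "c \<in> carrier R" using Cons by simp
  have l: "?l \<in> carrier (poly_ring R)" using c by (simp add: univ_poly_carrier[symmetric] polynomial_def)
  interpret UP: domain "poly_ring R" by (rule univ_poly_is_domain[OF carrier_is_subring])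
  let ?p = "?l \<otimes>\<^bsub>poly_ring R\<^esub> p"
  have "eval ?p x = prodl (\<lambda>c. x \<ominus> c) (c # cs)" if x: "x \<in> carrier R" for x
  proof -
    interpret ev: ring_hom_cring "poly_ring R" R "\<lambda>p. eval p x"
      by (rule eval_cring_hom[OF carrier_is_subring x])
    show ?thesis using l p x c by (simp add: a_minus_def)
  qed
  moreover have "?p \<noteq> []" using UP.integral[OF _ l p(1)] p(3) by (auto simp: univ_poly_zero)
  moreover have "degree ?p = length (c # cs)"
    using poly_mult_degree_eq[OF carrier_is_subring, of ?l p] l p
    by (cases p) (simp_all add: univ_poly_mult univ_poly_carrier del: poly_mult.simps poly_add.simps)
  ultimately show ?case using l p by (intro bexI[of _ ?p]) auto
qed

text \<open>A polynomial that vanishes at \<open>\<theta>\<close> is a multiple of the minimal polynomial,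
  so evaluation at \<open>\<theta>'\<close> factors through evaluation at \<open>\<theta>\<close>.\<close>

lemma conjugation:
  assumes K: "subfield K R" and th: "\<theta> \<in> carrier R" "(algebraic over K) \<theta>"
    and th': "\<theta>' \<in> carrier R" "eval (Irr K \<theta>) \<theta>' = \<zero>"
  obtains \<phi> where "\<phi> \<in> ring_hom (R\<lparr>carrier := simple_extension K \<theta>\<rparr>) R"
    "\<And>p. p \<in> carrier (K[X]) \<Longrightarrow> \<phi> (eval p \<theta>) = eval p \<theta>'"
proof -
  have Ks: "subring K R" using subfieldE(1)[OF K] .
  interpret UP: domain "K[X]" by (rule univ_poly_is_domain[OF Ks])
  interpret ev: ring_hom_cring "K[X]" R "\<lambda>p. eval p \<theta>" by (rule eval_cring_hom[OF Ks th(1)])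
  interpret ev': ring_hom_cring "K[X]" R "\<lambda>p. eval p \<theta>'" by (rule eval_cring_hom[OF Ks th'(1)])
  have L: "simple_extension K \<theta> = (\<lambda>p. eval p \<theta>) ` carrier (K[X])"
    by (rule simple_extension_as_eval_img[OF subringE(1)[OF Ks] th(1)])
  have eq: "eval p \<theta>' = eval q \<theta>'" if pq: "p \<in> carrier (K[X])" "q \<in> carrier (K[X])" "eval p \<theta> = eval q \<theta>" for p q
  proof -
    let ?h = "p \<ominus>\<^bsub>K[X]\<^esub> q"
    have "eval ?h \<theta> = \<zero>"
      using pq ev.hom_closed[OF pq(2)] by (simp add: a_minus_def ev.hom_a_inv r_neg)
    then have "Irr K \<theta> pdivides ?h"
      using Irr_minimal[OF K th, of ?h] pq by simp
    then obtain w where w: "w \<in> carrier (K[X])" "?h = Irr K \<theta> \<otimes>\<^bsub>K[X]\<^esub> w"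
      using pdivides_iff_shell[OF K IrrE(1)[OF K th], of ?h] pq unfolding factor_def by auto
    have "eval ?h \<theta>' = eval (Irr K \<theta>) \<theta>' \<otimes> eval w \<theta>'"
      using w IrrE(1)[OF K th] by simp
    then have "eval p \<theta>' \<ominus> eval q \<theta>' = \<zero>"
      using pq w th'(2) by (simp add: a_minus_def ev'.hom_a_inv)
    then show ?thesis using pq by (simp add: r_right_minus_eq)
  qed
  define \<phi> where "\<phi> y = eval (SOME p. p \<in> carrier (K[X]) \<and> eval p \<theta> = y) \<theta>'" for y
  have phi: "\<phi> (eval p \<theta>) = eval p \<theta>'" if p: "p \<in> carrier (K[X])" for p
  proof -
    have "(SOME p'. p' \<in> carrier (K[X]) \<and> eval p' \<theta> = eval p \<theta>) \<in> carrier (K[X]) \<and>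
      eval (SOME p'. p' \<in> carrier (K[X]) \<and> eval p' \<theta> = eval p \<theta>) \<theta> = eval p \<theta>"
      by (rule someI[of _ p]) (use p in simp)
    then show ?thesis unfolding \<phi>_def using eq[OF _ p] by blast
  qed
  have "\<phi> \<in> ring_hom (R\<lparr>carrier := simple_extension K \<theta>\<rparr>) R"
  proof (rule ring_hom_memI)
    fix x y assume "x \<in> carrier (R\<lparr>carrier := simple_extension K \<theta>\<rparr>)" "y \<in> carrier (R\<lparr>carrier := simple_extension K \<theta>\<rparr>)"
    then obtain p q where p: "p \<in> carrier (K[X])" "x = eval p \<theta>" and q: "q \<in> carrier (K[X])" "y = eval q \<theta>"
      unfolding L by auto
    show "\<phi> (x \<otimes>\<^bsub>R\<lparr>carrier := simple_extension K \<theta>\<rparr>\<^esub> y) = \<phi> x \<otimes> \<phi> y"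
      using phi[of "p \<otimes>\<^bsub>K[X]\<^esub> q"] p q by (simp add: phi)
    show "\<phi> (x \<oplus>\<^bsub>R\<lparr>carrier := simple_extension K \<theta>\<rparr>\<^esub> y) = \<phi> x \<oplus> \<phi> y"
      using phi[of "p \<oplus>\<^bsub>K[X]\<^esub> q"] p q by (simp add: phi)
  next
    fix x assume "x \<in> carrier (R\<lparr>carrier := simple_extension K \<theta>\<rparr>)"
    then show "\<phi> x \<in> carrier R" unfolding L using phi by auto
  next
    show "\<phi> \<one>\<^bsub>R\<lparr>carrier := simple_extension K \<theta>\<rparr>\<^esub> = \<one>" using phi[of "\<one>\<^bsub>K[X]\<^esub>"] by simp
  qed
  with phi show thesis using that by blast
qed

end

context algebraically_closed
begin

lemma poly_factors:
  assumes "p \<in> carrier (poly_ring L)" "p \<noteq> []"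
  obtains rs where "set rs \<subseteq> carrier L" "length rs = degree p"
    "\<And>x. x \<in> carrier L \<Longrightarrow> eval p x = lead_coeff p \<otimes> prodl (\<lambda>y. x \<ominus> y) rs"
proof -
  have "\<exists>rs. set rs \<subseteq> carrier L \<and> length rs = degree p \<and>
    (\<forall>x\<in>carrier L. eval p x = lead_coeff p \<otimes> prodl (\<lambda>y. x \<ominus> y) rs)"
    using assms
  proof (induction "degree p" arbitrary: p)
    case 0
    then obtain c where "p = [c]" by (cases p) auto
    with 0 show ?case by (intro exI[of _ "[]"]) (auto simp: univ_poly_carrier[symmetric] polynomial_def)
  next
    case (Suc n)
    interpret UP: domain "poly_ring L" by (rule univ_poly_is_domain[OF carrier_is_subring])
    have "size (roots p) = Suc n" using roots_over_carrier[OF Suc(3)] Suc(2) by (simp add: splitted_def)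
    then obtain a where "a \<in># roots p" by fastforce
    then have "is_root p a" using roots_mem_iff_is_root[OF Suc(3)] by simp
    then have a: "a \<in> carrier L" and "[\<one>, \<ominus> a] pdivides p"
      using is_root_imp_pdivides[OF Suc(3)] by (auto simp: is_root_def)
    then obtain q where q: "q \<in> carrier (poly_ring L)" "p = [\<one>, \<ominus> a] \<otimes>\<^bsub>poly_ring L\<^esub> q"
      unfolding pdivides_def factor_def by auto
    have la: "[\<one>, \<ominus> a] \<in> carrier (poly_ring L)"
      using a by (simp add: univ_poly_carrier[symmetric] polynomial_def)
    have qn: "q \<noteq> []" using q(2) Suc(4) UP.r_null[OF la] by (auto simp: univ_poly_zero)
    have deg: "degree p = Suc (degree q)"
      using poly_mult_degree_eq[OF carrier_is_subring, of "[\<one>, \<ominus> a]" q] la q qn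
      by (cases q) (simp_all add: univ_poly_mult univ_poly_carrier del: poly_mult.simps poly_add.simps)
    have lc: "lead_coeff p = lead_coeff q"
      using poly_mult_lead_coeff[OF carrier_is_subring, of "[\<one>, \<ominus> a]" q] la q qn
        lead_coeff_in_carrier[OF carrier_is_subring, of "hd q" "tl q"]
      by (simp add: univ_poly_mult univ_poly_carrier del: poly_mult.simps poly_add.simps)
    have qc: "lead_coeff q \<in> carrier L"
      using q qn by (auto simp: univ_poly_carrier[symmetric] polynomial_def)
    obtain rs where rs: "set rs \<subseteq> carrier L" "length rs = degree q"
      "\<And>x. x \<in> carrier L \<Longrightarrow> eval q x = lead_coeff q \<otimes> prodl (\<lambda>y. x \<ominus> y) rs"
      using Suc(1)[OF _ q(1) qn] Suc(2) deg by (metis Suc_inject)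
    have "eval p x = lead_coeff p \<otimes> prodl (\<lambda>y. x \<ominus> y) (a # rs)" if x: "x \<in> carrier L" for x
    proof -
      interpret ev: ring_hom_cring "poly_ring L" L "\<lambda>p. eval p x"
        by (rule eval_cring_hom[OF carrier_is_subring x])
      have "prodl (\<lambda>y. x \<ominus> y) rs \<in> carrier L" by (rule prodl_closed) (use rs x in auto)
      then show ?thesis using ev.hom_mult[OF la q(1)] q(2) x a rs(3)[OF x] qc unfolding lc
        by (simp add: a_minus_def m_ac)
    qed
    then show ?case using rs a deg by (intro exI[of _ "a # rs"]) auto
  qed
  then show thesis using that by blast
qed

text \<open>The product of \<open>p(y)\<close> over the zeros \<open>y\<close> of \<open>P\<close> is, up to
  powers of leading coefficients, the resultant of \<open>p\<close> and \<open>P\<close>. It lies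
  in \<open>K\<close> by the Euclidean algorithm: replace \<open>p\<close> by its remainder modulo
  \<open>P\<close>, then exchange the two polynomials up to a factor from \<open>K\<close>, which
  lowers the degree.\<close>

lemma prodl_roots_in_subfield:
  assumes K: "subfield K L"
  shows "P \<in> carrier (K[X]) \<Longrightarrow> P \<noteq> [] \<Longrightarrow> p \<in> carrier (K[X]) \<Longrightarrow> set rs \<subseteq> carrier L \<Longrightarrow>
    length rs = degree P \<Longrightarrow>
    (\<And>x. x \<in> carrier L \<Longrightarrow> eval P x = lead_coeff P \<otimes> prodl (\<lambda>y. x \<ominus> y) rs) \<Longrightarrow>
    prodl (eval p) rs \<in> K"
proof (induction "degree P" arbitrary: P p rs rule: less_induct)
  case (less P)
  have Ks: "subring K L" using subfieldE(1)[OF K] .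
  have Kc: "K \<subseteq> carrier L" using subringE(1)[OF Ks] .
  interpret UP: domain "K[X]" by (rule univ_poly_is_domain[OF Ks])
  have PL: "q \<in> carrier (poly_ring L)" if "q \<in> carrier (K[X])" for q
    using carrier_polynomial_shell[OF Ks that] .
  have evc: "eval q x \<in> carrier L" "x \<in> K \<Longrightarrow> eval q x \<in> K" if "q \<in> carrier (K[X])" "x \<in> carrier L" for q x
  proof -
    interpret ev: ring_hom_cring "K[X]" L "\<lambda>p. eval p x" by (rule eval_cring_hom[OF Ks that(2)])
    show "eval q x \<in> carrier L" using that by simp
    assume xK: "x \<in> K"
    have "set q \<subseteq> K" using that(1) by (auto simp: univ_poly_carrier[symmetric] polynomial_def)
    then show "eval q x \<in> K"
    proof (induction q)
      case (Cons a q)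
      have "x [^] n \<in> K" for n :: nat
        by (induction n) (use xK subringE(3,6)[OF Ks] in auto)
      then show ?case using Cons subringE(6,7)[OF Ks] by simp
    qed (use subringE(2)[OF Ks] in simp)
  qed
  have lcP: "lead_coeff P \<in> K" "lead_coeff P \<noteq> \<zero>"
    using less(2,3) by (auto simp: univ_poly_carrier[symmetric] polynomial_def)
  let ?r = "pmod p P"
  have r: "?r \<in> carrier (K[X])" "pdiv p P \<in> carrier (K[X])"
    using long_division_closed[OF K less(4,2)] by auto
  have root: "eval P y = \<zero>" if "y \<in> set rs" for y
  proof -
    have "y \<in> carrier L" using that less(5) by auto
    then have "prodl (\<lambda>z. y \<ominus> z) rs = \<zero>"
      using that less(5) by (intro prodl_zero[of y]) (auto simp: r_right_minus_eq)
    with less(7)[OF \<open>y \<in> carrier L\<close>] lcP Kc show ?thesis by auto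
  qed
  have pr: "eval p y = eval ?r y" if y: "y \<in> set rs" for y
  proof -
    have yc: "y \<in> carrier L" using y less(5) by auto
    interpret ev: ring_hom_cring "K[X]" L "\<lambda>p. eval p y" by (rule eval_cring_hom[OF Ks yc])
    have "eval p y = eval (P \<otimes>\<^bsub>K[X]\<^esub> (pdiv p P) \<oplus>\<^bsub>K[X]\<^esub> ?r) y"
      using pdiv_pmod[OF K less(4,2)] by simp
    then show ?thesis using r less(2) root[OF y] by simp
  qed
  have eq1: "prodl (eval p) rs = prodl (eval ?r) rs" by (rule prodl_cong) (rule pr)
  show ?case
  proof (cases "degree P = 0 \<or> ?r = []")
    case True
    then show ?thesis
    proof
      assume "degree P = 0" then show ?thesis using less(6) subringE(3)[OF Ks] by simp
    next
      assume "?r = []"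
      then have "prodl (eval ?r) rs \<in> {\<zero>,\<one>}"
        by (cases rs) (auto intro!: l_null)
      then show ?thesis unfolding eq1 using subringE(2,3)[OF Ks] by auto
    qed
  next
    case False
    then have degr: "degree ?r < degree P" and rn: "?r \<noteq> []"
      using pmod_degree[OF K less(4,2,3)] by auto
    obtain ss where ss: "set ss \<subseteq> carrier L" "length ss = degree ?r"
      "\<And>x. x \<in> carrier L \<Longrightarrow> eval ?r x = lead_coeff ?r \<otimes> prodl (\<lambda>y. x \<ominus> y) ss"
      by (rule poly_factors[OF PL[OF r(1)] rn]) (rule that)
    have IH: "prodl (eval P) ss \<in> K"
      by (rule less(1)[OF degr r(1) rn less(2) ss])
    have lcr: "lead_coeff ?r \<in> K"
      using r(1) rn by (auto simp: univ_poly_carrier[symmetric] polynomial_def)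
    let ?c = "(\<ominus> \<one>) [^] length rs \<otimes> inv (lead_coeff P)"
    have ilc: "inv (lead_coeff P) \<in> K" using subfield_inv[OF K lcP] .
    have m1: "\<ominus> \<one> \<in> K" using subringE(3,5)[OF Ks] by auto
    have powK: "x [^] n \<in> K" if "x \<in> K" for x and n :: nat
      by (induction n) (use that subringE(3,6)[OF Ks] in auto)
    have cK: "?c \<in> K" using powK[OF m1] ilc subringE(6)[OF Ks] by auto
    have diff: "prodl (\<lambda>y. y \<ominus> s) rs = ?c \<otimes> eval P s" if s: "s \<in> set ss" for s
    proof -
      have sc: "s \<in> carrier L" using s ss by auto
      have "prodl (\<lambda>y. y \<ominus> s) rs = prodl (\<lambda>y. \<ominus> \<one> \<otimes> (s \<ominus> y)) rs"
        by (rule prodl_cong) (use less(5) sc in \<open>auto simp: a_minus_def l_minus minus_add a_comm subset_iff\<close>)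
      also have "\<dots> = (\<ominus> \<one>) [^] length rs \<otimes> prodl (\<lambda>y. s \<ominus> y) rs"
        using less(5) sc by (subst prodl_mult) (auto simp: prodl_const)
      finally have 1: "prodl (\<lambda>y. y \<ominus> s) rs = (\<ominus> \<one>) [^] length rs \<otimes> prodl (\<lambda>y. s \<ominus> y) rs" .
      have pc: "prodl (\<lambda>y. s \<ominus> y) rs \<in> carrier L"
        by (rule prodl_closed) (use less(5) sc in auto)
      have "inv (lead_coeff P) \<otimes> eval P s = (inv (lead_coeff P) \<otimes> lead_coeff P) \<otimes> prodl (\<lambda>y. s \<ominus> y) rs"
        using less(7)[OF sc] pc lcP ilc Kc by (simp add: m_assoc subset_iff)
      then have "inv (lead_coeff P) \<otimes> eval P s = prodl (\<lambda>y. s \<ominus> y) rs"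
        using lcP Kc pc field_Units by (auto simp: subset_iff)
      with 1 show ?thesis using evc[OF less(2) sc] ilc Kc by (simp add: m_assoc subset_iff)
    qed
    have "prodl (eval ?r) rs = prodl (\<lambda>y. lead_coeff ?r \<otimes> prodl (\<lambda>s. y \<ominus> s) ss) rs"
      by (rule prodl_cong) (use ss less(5) in auto)
    also have "\<dots> = lead_coeff ?r [^] length rs \<otimes> prodl (\<lambda>y. prodl (\<lambda>s. y \<ominus> s) ss) rs"
      using lcr Kc ss less(5) by (subst prodl_mult) (auto simp: prodl_const subset_iff intro!: prodl_closed)
    also have "prodl (\<lambda>y. prodl (\<lambda>s. y \<ominus> s) ss) rs = prodl (\<lambda>s. prodl (\<lambda>y. y \<ominus> s) rs) ss"
      by (rule prodl_swap) (use ss less(5) in auto)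
    also have "\<dots> = prodl (\<lambda>s. ?c \<otimes> eval P s) ss"
      by (rule prodl_cong) (rule diff)
    also have "\<dots> = ?c [^] length ss \<otimes> prodl (eval P) ss"
    proof (subst prodl_mult)
      show "prodl (\<lambda>x. ?c) ss \<otimes> prodl (eval P) ss = ?c [^] length ss \<otimes> prodl (eval P) ss"
        using cK Kc by (subst prodl_const) auto
    qed (use evc[OF less(2)] ss cK Kc in auto)
    finally show ?thesis unfolding eq1
      using subringE(6)[OF Ks] powK[OF lcr] powK[OF cK] IH by simp
  qed
qed

end

section \<open>Finiteness passes to algebraic extensions\<close>

lemma finite_of_finite_fibres:
  assumes "finite (f ` A)" "\<And>a. a \<in> A \<Longrightarrow> finite {b \<in> A. f b = f a}"
  shows "finite A"
proof -
  have "A = (\<Union>y\<in>f ` A. {b \<in> A. f b = y})" by auto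
  moreover have "finite (\<Union>y\<in>f ` A. {b \<in> A. f b = y})" using assms by (intro finite_UN_I) auto
  ultimately show ?thesis by simp
qed

context cring
begin

lemma power_bounded_elem:
  assumes "subring V R" "c \<in> D" "D \<subseteq> V"
  shows "power_bounded V D 1 1 c"
proof -
  have c: "c \<in> carrier R" using assms subringE(1)[OF assms(1)] by auto
  have "sumprod D {\<one>} m 1 (c [^] m)" for m
  proof (induction m)
    case 0 then show ?case using sumprod.base[of \<one> "{\<one>}" D] by simp
  next
    case (Suc m) then show ?case using sumprod.mult[OF assms(2) Suc] c by (simp add: nat_pow_comm m_comm)
  qed
  then show ?thesis unfolding power_bounded_def using subringE(3)[OF assms(1)]
    by (intro exI[of _ "{\<one>}"] exI[of _ 1]) auto
qed

lemma power_bounded_prodl: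
  assumes "subring V R" "D \<subseteq> V" "\<And>y. y \<in> set ys \<Longrightarrow> f y \<in> carrier R"
    "\<And>y. y \<in> set ys \<Longrightarrow> power_bounded V D e r (f y)"
  shows "power_bounded V D (e * length ys) (r ^ length ys) (prodl f ys)"
  using assms(3,4)
proof (induction ys)
  case Nil then show ?case using power_bounded_one[OF assms(1)] by simp
next
  case (Cons y ys)
  have "power_bounded V D (e + e * length ys) (r * r ^ length ys) (f y \<otimes> prodl f ys)"
    by (rule power_bounded_mult) (use Cons assms in \<open>auto intro!: prodl_closed\<close>)
  then show ?case by simp
qed

lemma power_bounded_minus:
  assumes V: "subring V R" and D: "D \<subseteq> V" and a: "a \<in> V" "power_bounded V D e r a" and x: "x \<in> V"
  shows "power_bounded V (insert x (insert (\<ominus> \<one>) (insert \<one> D))) (Suc (Suc e)) (Suc r) (x \<ominus> a)"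
proof -
  let ?D = "insert (\<ominus> \<one>) D"
  have Vc: "V \<subseteq> carrier R" using subringE(1)[OF V] .
  have m1: "\<ominus> \<one> \<in> V" using subringE(3,5)[OF V] by auto
  have "power_bounded V ?D (1 + e) (1 * r) (\<ominus> \<one> \<otimes> a)"
    by (rule power_bounded_mult)
      (use assms m1 Vc power_bounded_elem[OF V, of "\<ominus> \<one>" ?D] power_bounded_mono[OF a(2), of ?D V] in auto)
  then have "power_bounded V (insert x (insert \<one> ?D)) (Suc (Suc e)) (Suc r) (\<ominus> \<one> \<otimes> a \<oplus> x)"
    using power_bounded_add[of V ?D "Suc e" r "\<ominus> \<one> \<otimes> a" x] x m1 a Vc subringE(6)[OF V m1 a(1)] D by auto
  moreover have "\<ominus> \<one> \<otimes> a \<oplus> x = x \<ominus> a"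
    using a x Vc by (auto simp: a_minus_def l_minus a_comm subset_iff)
  ultimately show ?thesis by (simp add: insert_commute)
qed

lemma finite_space_over_finite_field:
  assumes "subfield K R" "finite K" "finite_dimension K V" "\<one> \<in> V" "\<one> \<noteq> \<zero>"
  shows "finite V"
proof -
  obtain n u j where u: "u \<in> {..<n::nat} \<rightarrow> V" and ind: "lin_independent K {..<n} u"
    and span: "\<And>y. y \<in> V \<Longrightarrow> \<exists>k\<in>{..<n} \<rightarrow> K. y = (\<Oplus>i\<in>{..<n}. k i \<otimes> u i)"
    and j: "j < n" "u j = \<one>"
    by (rule finite_dimension_basis[OF assms(1,3,4) one_closed assms(5)]) (rule that)
  obtain Us where Us: "set Us \<subseteq> carrier R" "Span K Us = V"
    using exists_base[OF assms(1)] assms(3) by (metis finite_dimensionE')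
  have Vc: "V \<subseteq> carrier R" using Us Span_subgroup_props(1)[OF assms(1) Us(1)] by simp
  have Kc: "K \<subseteq> carrier R" using subfieldE(3)[OF assms(1)] .
  have "V \<subseteq> (\<lambda>k. \<Oplus>i\<in>{..<n}. k i \<otimes> u i) ` ({..<n} \<rightarrow>\<^sub>E K)"
  proof
    fix y assume "y \<in> V"
    then obtain k where k: "k \<in> {..<n} \<rightarrow> K" "y = (\<Oplus>i\<in>{..<n}. k i \<otimes> u i)" using span by auto
    have "y = (\<Oplus>i\<in>{..<n}. restrict k {..<n} i \<otimes> u i)" unfolding k(2)
      by (rule finsum_cong') (use k u Kc Vc in \<open>auto simp: Pi_iff subset_iff\<close>)
    then show "y \<in> (\<lambda>k. \<Oplus>i\<in>{..<n}. k i \<otimes> u i) ` ({..<n} \<rightarrow>\<^sub>E K)"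
      using k(1) by (intro image_eqI[of _ _ "restrict k {..<n}"]) auto
  qed
  moreover have "finite ({..<n} \<rightarrow>\<^sub>E K)" using assms(2) by (intro finite_PiE) auto
  ultimately show ?thesis using finite_subset by blast
qed

end

context algebraically_closed
begin

text \<open>The norm of \<open>x - a\<close> from \<open>K(\<theta>)\<close> to \<open>K\<close> is power
  bounded with constants that do not depend on \<open>a\<close>, so it takes finitely many values
  for each \<open>x\<close>. As a polynomial in \<open>x\<close> the norm is determined by its
  values at more points than its degree, and its zeros are the conjugates of \<open>a\<close>;
  hence only finitely many \<open>a\<close> share the same values.\<close>

lemma northcott_simple_extension:
  assumes K: "subfield K L" and NK: "northcott K" and th: "\<theta> \<in> carrier L" "(algebraic over K) \<theta>"
  shows "northcott (simple_extension K \<theta>)"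
proof (cases "finite K")
  case True
  have "finite (simple_extension K \<theta>)"
    by (rule finite_space_over_finite_field[OF K True])
      (use finite_dimension_simple_extension[OF K th(1)] th(2) one_not_zero
        subringE(3)[OF simple_extension_is_subring[OF subfieldE(1)[OF K] th(1)]] in auto)
  then show ?thesis by (rule northcott_finite)
next
  case False
  have Ks: "subring K L" and Kc: "K \<subseteq> carrier L" using subfieldE[OF K] by auto
  let ?E = "simple_extension K \<theta>"
  have E: "?E = (\<lambda>p. eval p \<theta>) ` carrier (K[X])"
    by (rule simple_extension_as_eval_img[OF Kc th(1)])
  have Es: "subring ?E L" by (rule simple_extension_is_subring[OF Ks th(1)])
  have Ec: "?E \<subseteq> carrier L" using subringE(1)[OF Es] .
  let ?P = "Irr K \<theta>"
  note P = IrrE[OF K th]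
  have Pn: "?P \<noteq> []" using pirreducible_degree[OF K P(1,2)] by auto
  obtain rs where rs: "set rs \<subseteq> carrier L" "length rs = degree ?P"
    "\<And>x. x \<in> carrier L \<Longrightarrow> eval ?P x = lead_coeff ?P \<otimes> prodl (\<lambda>y. x \<ominus> y) rs"
    by (rule poly_factors[OF carrier_polynomial_shell[OF Ks P(1)] Pn]) (rule that)
  have prc: "prodl (\<lambda>y. x \<ominus> y) rs \<in> carrier L" if "x \<in> carrier L" for x
    by (rule prodl_closed) (use rs that in auto)
  have root: "eval ?P y = \<zero>" if "y \<in> set rs" for y
  proof -
    have "y \<in> carrier L" using that rs by auto
    then have "prodl (\<lambda>z. y \<ominus> z) rs = \<zero>"
      using that rs(1) by (intro prodl_zero[of y]) (auto simp: r_right_minus_eq)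
    with rs(3)[OF \<open>y \<in> carrier L\<close>] P(3) show ?thesis by simp
  qed
  have th_rs: "\<theta> \<in> set rs"
  proof -
    have "prodl (\<lambda>y. \<theta> \<ominus> y) rs = \<zero>" using rs(3)[OF th(1)] P(3,4) prc[OF th(1)] by simp
    then obtain y where "y \<in> set rs" "\<theta> \<ominus> y = \<zero>"
      using prodl_eq_zero[of "\<lambda>y. \<theta> \<ominus> y" rs] rs(1) th(1) by auto
    then show ?thesis using rs(1) th(1) by (auto simp: r_right_minus_eq)
  qed
  have "\<exists>\<phi>. \<phi> \<in> ring_hom (L\<lparr>carrier := ?E\<rparr>) L \<and> (\<forall>p\<in>carrier (K[X]). \<phi> (eval p \<theta>) = eval p y)"
    if "y \<in> set rs" for y
    by (rule conjugation[OF K th, of y]) (use root[OF that] rs that in auto)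
  then obtain \<phi> where hom: "\<And>y. y \<in> set rs \<Longrightarrow> \<phi> y \<in> ring_hom (L\<lparr>carrier := ?E\<rparr>) L"
    and phi: "\<And>y p. y \<in> set rs \<Longrightarrow> p \<in> carrier (K[X]) \<Longrightarrow> \<phi> y (eval p \<theta>) = eval p y"
    by metis
  let ?M = "finite_extension K rs"
  have alg: "(algebraic over K) y" if "y \<in> set rs" for y
    using algebraicI[OF P(1) Pn root[OF that]] by (simp add: over_def)
  have Ms: "subring ?M L" by (rule finite_extension_is_subring[OF Ks rs(1)])
  have Mc: "?M \<subseteq> carrier L" using subringE(1)[OF Ms] .
  have KM: "K \<subseteq> ?M" by (rule finite_extension_incl[OF Kc rs(1)])
  have Mfin: "finite_dimension K ?M" by (rule finite_extension_finite_dimension(1)[OF K rs(1) alg])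
  have rsM: "set rs \<subseteq> ?M" by (rule finite_extension_mem[OF Ks rs(1)])
  have phiM: "\<phi> y ` ?E \<subseteq> ?M" if y: "y \<in> set rs" for y
  proof -
    have "\<phi> y ` ?E = simple_extension K y"
      unfolding E simple_extension_as_eval_img[OF Kc subsetD[OF rs(1) y]]
      using phi[OF y] by (auto simp: image_iff)
    also have "\<dots> \<subseteq> ?M"
      using rsM y by (intro simple_extension_subring_incl[OF Ms KM]) auto
    finally show ?thesis .
  qed
  define N where "N x a = prodl (\<lambda>y. x \<ominus> \<phi> y a) rs" for x a
  have phic: "\<phi> y a \<in> carrier L" if "y \<in> set rs" "a \<in> ?E" for y a
    using phiM[OF that(1)] that(2) Mc by auto
  have NK_mem: "N x a \<in> K" if x: "x \<in> K" and a: "a \<in> ?E" for x a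
  proof -
    obtain p where p: "p \<in> carrier (K[X])" "a = eval p \<theta>" using a unfolding E by auto
    interpret UP: domain "K[X]" by (rule univ_poly_is_domain[OF Ks])
    have cx: "poly_of_const x \<in> carrier (K[X])"
      using x by (auto simp: poly_of_const_def univ_poly_carrier[symmetric] polynomial_def)
    obtain q where q: "q \<in> carrier (K[X])"
      "\<And>z. z \<in> carrier L \<Longrightarrow> eval q z = eval (poly_of_const x) z \<ominus> eval p z"
      using poly_diff[OF Ks cx p(1)] by auto
    have "prodl (eval q) rs \<in> K"
      by (rule prodl_roots_in_subfield[OF K P(1) Pn q(1) rs])
    moreover have "prodl (eval q) rs = N x a"
      unfolding N_def
    proof (rule prodl_cong)
      fix y assume y: "y \<in> set rs"
      have "eval (poly_of_const x) y = x" using x Kc y rs(1) by (auto simp: poly_of_const_def)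
      then show "eval q y = x \<ominus> \<phi> y a" using q(2)[of y] y rs(1) phi[OF y p(1)] p(2) by auto
    qed
    ultimately show ?thesis by simp
  qed
  show ?thesis unfolding northcott_def
  proof (intro allI impI)
    fix D e r assume D: "finite D \<and> D \<subseteq> ?E"
    define A where "A = {a \<in> ?E. power_bounded ?E D e r a}"
    define D1 where "D1 = (\<Union>y\<in>set rs. \<phi> y ` D)"
    have D1: "finite D1" "D1 \<subseteq> ?M" using D phiM unfolding D1_def by auto
    have finN: "finite (N x ` A)" if x: "x \<in> K" for x
    proof -
      let ?D2 = "insert x (insert (\<ominus> \<one>) (insert \<one> D1))"
      have xM: "x \<in> ?M" using x KM by auto
      have D2: "finite ?D2" "?D2 \<subseteq> ?M" using D1 xM subringE(3,5)[OF Ms] by auto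
      obtain D' s where D': "finite D'" "D' \<subseteq> K"
        "\<And>e r y. y \<in> K \<Longrightarrow> power_bounded ?M ?D2 e r y \<Longrightarrow> power_bounded K D' e (r * s ^ e) y"
        by (rule power_bounded_descend[OF K Ms KM Mfin one_not_zero D2]) (rule that)
      (* The constants come from power_bounded_minus, once for each of the conjugates. *)
      let ?e = "Suc (Suc e) * length rs" and ?r = "Suc r ^ length rs"
      have "power_bounded K D' ?e (?r * s ^ ?e) (N x a)" if a: "a \<in> A" for a
      proof (rule D'(3))
        have aE: "a \<in> ?E" and pb: "power_bounded ?E D e r a" using a by (auto simp: A_def)
        show "N x a \<in> K" using NK_mem[OF x aE] .
        show "power_bounded ?M ?D2 ?e ?r (N x a)"
          unfolding N_def
        proof (rule power_bounded_prodl[OF Ms D2(2)])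
          fix y assume y: "y \<in> set rs"
          show "x \<ominus> \<phi> y a \<in> carrier L" using phic[OF y aE] x Kc by auto
          have "power_bounded (\<phi> y ` ?E) (\<phi> y ` D) e r (\<phi> y a)"
            by (rule power_bounded_map[OF pb Es _ aE hom[OF y]]) (use D in auto)
          then have "power_bounded ?M D1 e r (\<phi> y a)"
            by (rule power_bounded_mono) (use y phiM in \<open>auto simp: D1_def\<close>)
          then show "power_bounded ?M ?D2 (Suc (Suc e)) (Suc r) (x \<ominus> \<phi> y a)"
            by (intro power_bounded_minus[OF Ms D1(2) _ _ xM]) (use phiM[OF y] aE in auto)
        qed
      qed
      then have "N x ` A \<subseteq> {b \<in> K. power_bounded K D' ?e (?r * s ^ ?e) b}"
        using NK_mem[OF x] by (auto simp: A_def)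
      moreover have "finite {b \<in> K. power_bounded K D' ?e (?r * s ^ ?e) b}"
        using NK D' unfolding northcott_def by blast
      ultimately show ?thesis by (rule finite_subset)
    qed
    (* One point more than the degree of the norm of x - a as a polynomial in x. *)
    obtain Z where Z: "finite Z" "Z \<subseteq> K" "card Z = Suc (length rs)"
      using infinite_arbitrarily_large[OF False] by blast
    define \<Phi> where "\<Phi> a = (\<lambda>x\<in>Z. N x a)" for a
    have "finite A"
    proof (rule finite_of_finite_fibres[of \<Phi>])
      have "\<Phi> ` A \<subseteq> (\<Pi>\<^sub>E x\<in>Z. N x ` A)" by (auto simp: \<Phi>_def)
      moreover have "finite (\<Pi>\<^sub>E x\<in>Z. N x ` A)" using Z finN by (intro finite_PiE) auto
      ultimately show "finite (\<Phi> ` A)" by (rule finite_subset)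
    next
      fix a assume a: "a \<in> A"
      have "b \<in> (\<lambda>y. \<phi> y a) ` set rs" if b: "b \<in> A" "\<Phi> b = \<Phi> a" for b
      proof -
        have aE: "a \<in> ?E" "b \<in> ?E" using a b by (auto simp: A_def)
        have "\<exists>p\<in>carrier (poly_ring L). degree p = length rs \<and> (\<forall>x\<in>carrier L. eval p x = N x c)" if c: "c \<in> ?E" for c
        proof -
          have comp: "prodl (\<lambda>z. x \<ominus> z) (map (\<lambda>y. \<phi> y c) ys) = prodl (\<lambda>y. x \<ominus> \<phi> y c) ys" for x ys
            by (induction ys) auto
          show ?thesis
            using monic_with_roots[of "map (\<lambda>y. \<phi> y c) rs"] phic c unfolding N_def comp by auto
        qed
        then obtain p q where p: "p \<in> carrier (poly_ring L)" "degree p = length rs" "\<And>x. x \<in> carrier L \<Longrightarrow> eval p x = N x a"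
          and q: "q \<in> carrier (poly_ring L)" "degree q = length rs" "\<And>x. x \<in> carrier L \<Longrightarrow> eval q x = N x b"
          using aE by meson
        have "p = q"
        proof (rule poly_agree[OF p(1) q(1) Z(1)])
          show "Z \<subseteq> carrier L" using Z Kc by auto
          show "max (degree p) (degree q) < card Z" using p q Z by simp
          fix x assume x: "x \<in> Z"
          then have "N x b = N x a" using b(2) unfolding \<Phi>_def by (metis restrict_apply)
          then show "eval p x = eval q x" using p(3) q(3) x Z Kc by auto
        qed
        have bL: "b \<in> carrier L" using aE Ec by auto
        have "N b b = \<zero>"
          unfolding N_def
        proof (rule prodl_zero[OF th_rs])
          obtain p where "p \<in> carrier (K[X])" "b = eval p \<theta>" using aE(2) unfolding E by auto
          then show "b \<ominus> \<phi> \<theta> b = \<zero>" using phi[OF th_rs] bL by (simp add: r_right_minus_eq)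
        qed (use phic aE bL in auto)
        then have "prodl (\<lambda>y. b \<ominus> \<phi> y a) rs = \<zero>"
          using p(3)[OF bL] q(3)[OF bL] \<open>p = q\<close> unfolding N_def by simp
        then obtain y where "y \<in> set rs" "b \<ominus> \<phi> y a = \<zero>"
          using prodl_eq_zero[of "\<lambda>y. b \<ominus> \<phi> y a" rs] phic aE bL by auto
        then show ?thesis using phic aE bL by (auto simp: r_right_minus_eq)
      qed
      then have "{b \<in> A. \<Phi> b = \<Phi> a} \<subseteq> (\<lambda>y. \<phi> y a) ` set rs" by blast
      then show "finite {b \<in> A. \<Phi> b = \<Phi> a}" by (rule finite_subset) simp
    qed
    then show "finite {a \<in> ?E. power_bounded ?E D e r a}" unfolding A_def .
  qed
qed

end

section \<open>Finiteness passes to fields of fractions\<close>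

context field
begin

lemma inv_nonzero [simp]:
  assumes "x \<in> carrier R" "x \<noteq> \<zero>"
  shows "inv x \<in> carrier R" "x \<otimes> inv x = \<one>" "inv x \<otimes> x = \<one>" "inv x \<noteq> \<zero>"
proof -
  have u: "x \<in> Units R" using assms field_Units by auto
  show "inv x \<in> carrier R" "x \<otimes> inv x = \<one>" "inv x \<otimes> x = \<one>" using u by auto
  then show "inv x \<noteq> \<zero>" using assms one_not_zero by auto
qed

lemma pow_nonzero: "x \<in> carrier R \<Longrightarrow> x \<noteq> \<zero> \<Longrightarrow> x [^] (n::nat) \<noteq> \<zero>"
  by (induction n) (auto simp: integral_iff)

text \<open>The elements of the ambient field that are fractions over \<open>S\<close>; stating this with
  the multiple \<open>v x\<close> avoids inverses.\<close>

definition fractions :: "'a set \<Rightarrow> 'a set" where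
  "fractions S = {x \<in> carrier R. \<exists>v\<in>S. v \<noteq> \<zero> \<and> v \<otimes> x \<in> S}"

lemma fractions_subfield:
  assumes S: "subring S R"
  shows "subfield (fractions S) R" "S \<subseteq> fractions S"
proof -
  have Sc: "S \<subseteq> carrier R" using subringE(1)[OF S] .
  note SE = subringE(2,3,5,6,7)[OF S]
  show sub: "S \<subseteq> fractions S"
    using Sc SE unfolding fractions_def by (auto intro!: bexI[of _ \<one>])
  show "subfield (fractions S) R"
  proof (rule subfieldI')
    show "subring (fractions S) R"
    proof (rule subringI)
      show "fractions S \<subseteq> carrier R" by (auto simp: fractions_def)
      show "\<one> \<in> fractions S" using sub SE by auto
    next
      fix x assume "x \<in> fractions S"
      then obtain v where v: "v \<in> S" "v \<noteq> \<zero>" "v \<otimes> x \<in> S" "x \<in> carrier R" by (auto simp: fractions_def)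
      then have "v \<otimes> (\<ominus> x) \<in> S" using SE(3)[OF v(3)] Sc by (auto simp: r_minus subset_iff)
      then show "\<ominus> x \<in> fractions S" using v by (auto simp: fractions_def)
    next
      fix x y assume "x \<in> fractions S" "y \<in> fractions S"
      then obtain v w where v: "v \<in> S" "v \<noteq> \<zero>" "v \<otimes> x \<in> S" "x \<in> carrier R"
        and w: "w \<in> S" "w \<noteq> \<zero>" "w \<otimes> y \<in> S" "y \<in> carrier R" by (auto simp: fractions_def)
      have c: "v \<in> carrier R" "w \<in> carrier R" using v w Sc by auto
      have vw: "v \<otimes> w \<in> S" "v \<otimes> w \<noteq> \<zero>" using v w c SE by (auto simp: integral_iff)
      have "(v \<otimes> w) \<otimes> (x \<otimes> y) = (v \<otimes> x) \<otimes> (w \<otimes> y)" using v w c by (simp add: m_ac)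
      then show "x \<otimes> y \<in> fractions S"
        using v w vw SE(4)[OF v(3) w(3)] by (auto simp: fractions_def)
      have "(v \<otimes> w) \<otimes> (x \<oplus> y) = w \<otimes> (v \<otimes> x) \<oplus> v \<otimes> (w \<otimes> y)" using v w c by (simp add: r_distr m_ac)
      then show "x \<oplus> y \<in> fractions S"
        using v w vw SE(5)[OF SE(4)[OF w(1) v(3)] SE(4)[OF v(1) w(3)]] by (auto simp: fractions_def)
    qed
  next
    fix x assume "x \<in> fractions S - {\<zero>}"
    then obtain v where v: "v \<in> S" "v \<noteq> \<zero>" "v \<otimes> x \<in> S" "x \<in> carrier R" "x \<noteq> \<zero>" by (auto simp: fractions_def)
    have c: "v \<in> carrier R" using v Sc by auto
    have "(v \<otimes> x) \<otimes> inv x = v" using v c by (simp add: m_assoc)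
    moreover have "v \<otimes> x \<noteq> \<zero>" using v c by (auto simp: integral_iff)
    ultimately show "inv x \<in> fractions S"
      using v by (auto simp: fractions_def intro!: bexI[of _ "v \<otimes> x"])
  qed
qed

lemma common_denominator:
  assumes S: "subring S R" and D: "finite D" "D \<subseteq> fractions S"
  shows "\<exists>f\<in>S. f \<noteq> \<zero> \<and> (\<forall>d\<in>D. f \<otimes> d \<in> S)"
  using D
proof (induction D rule: finite_induct)
  case empty show ?case using subringE(3)[OF S] by (intro bexI[of _ \<one>]) auto
next
  case (insert d D)
  have Sc: "S \<subseteq> carrier R" using subringE(1)[OF S] .
  obtain f where f: "f \<in> S" "f \<noteq> \<zero>" "\<And>d. d \<in> D \<Longrightarrow> f \<otimes> d \<in> S" using insert by auto
  obtain v where v: "v \<in> S" "v \<noteq> \<zero>" "v \<otimes> d \<in> S" using insert by (auto simp: fractions_def)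
  have c: "f \<in> carrier R" "v \<in> carrier R" "d \<in> carrier R" "D \<subseteq> carrier R"
    using f v insert Sc by (auto simp: fractions_def)
  have "(f \<otimes> v) \<otimes> x \<in> S" if "x \<in> insert d D" for x
  proof (cases "x = d")
    case True
    then have "(f \<otimes> v) \<otimes> x = f \<otimes> (v \<otimes> d)" using c by (simp add: m_assoc)
    then show ?thesis using subringE(6)[OF S f(1) v(3)] by simp
  next
    case False
    then have x: "x \<in> D" "x \<in> carrier R" using that c by auto
    then have "(f \<otimes> v) \<otimes> x = v \<otimes> (f \<otimes> x)" using c by (simp add: m_ac)
    then show ?thesis using subringE(6)[OF S v(1) f(3)[OF x(1)]] by simp
  qed
  moreover have "f \<otimes> v \<in> S" "f \<otimes> v \<noteq> \<zero>" using f v c subringE(6)[OF S] by (auto simp: integral_iff)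
  ultimately show ?case by blast
qed

text \<open>A Euclidean domain is completely integrally closed. Among the nonzero \<open>h\<close> with all
  \<open>h a^m\<close> in \<open>S\<close> take one of least size; dividing \<open>h a\<close> by
  \<open>h\<close> leaves a remainder of the same kind, which must be zero.\<close>

lemma completely_integrally_closed:
  fixes \<delta> :: "'a \<Rightarrow> nat"
  assumes S: "subring S R"
    and division: "\<And>a b. a \<in> S \<Longrightarrow> b \<in> S \<Longrightarrow> b \<noteq> \<zero> \<Longrightarrow>
      \<exists>q\<in>S. a \<ominus> q \<otimes> b = \<zero> \<or> \<delta> (a \<ominus> q \<otimes> b) < \<delta> b"
    and g: "g \<in> S" "g \<noteq> \<zero>" and a: "a \<in> carrier R" "\<And>m::nat. g \<otimes> a [^] m \<in> S"
  shows "a \<in> S"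
proof -
  have Sc: "S \<subseteq> carrier R" using subringE(1)[OF S] .
  define I where "I = {h \<in> S. h \<noteq> \<zero> \<and> (\<forall>m::nat. h \<otimes> a [^] m \<in> S)}"
  have "g \<in> I" using g a by (auto simp: I_def)
  then obtain h where h: "h \<in> I" and min: "\<And>y. y \<in> I \<Longrightarrow> \<delta> h \<le> \<delta> y"
    using ex_has_least_nat[of "\<lambda>x. x \<in> I" g \<delta>] by blast
  have hS: "h \<in> S" "h \<noteq> \<zero>" "h \<in> carrier R" and hm: "\<And>m::nat. h \<otimes> a [^] m \<in> S"
    using h Sc by (auto simp: I_def)
  have ha: "h \<otimes> a \<in> S" using hm[of 1] a by simp
  obtain q where q: "q \<in> S" and alt: "h \<otimes> a \<ominus> q \<otimes> h = \<zero> \<or> \<delta> (h \<otimes> a \<ominus> q \<otimes> h) < \<delta> h"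
    using division[OF ha hS(1,2)] by blast
  have qc: "q \<in> carrier R" using q Sc by auto
  let ?r = "h \<otimes> a \<ominus> q \<otimes> h"
  have "?r \<otimes> a [^] m \<in> S" for m :: nat
  proof -
    have "?r \<otimes> a [^] m = (h \<otimes> a) \<otimes> a [^] m \<oplus> \<ominus> ((q \<otimes> h) \<otimes> a [^] m)"
      using a hS qc by (simp add: a_minus_def l_distr l_minus)
    also have "\<dots> = h \<otimes> a [^] Suc m \<oplus> \<ominus> (q \<otimes> (h \<otimes> a [^] m))"
      using a hS qc by (simp add: m_ac)
    finally have "?r \<otimes> a [^] m = h \<otimes> a [^] Suc m \<oplus> \<ominus> (q \<otimes> (h \<otimes> a [^] m))" .
    moreover have "h \<otimes> a [^] Suc m \<in> S" "q \<otimes> (h \<otimes> a [^] m) \<in> S"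
      using hm subringE(6)[OF S q] by blast+
    ultimately show ?thesis using subringE(5,7)[OF S] by simp
  qed
  moreover have "?r \<in> S"
    using ha subringE(5,6,7)[OF S] q hS by (simp add: a_minus_def)
  ultimately have "?r \<in> I" if "?r \<noteq> \<zero>" using that by (auto simp: I_def)
  with alt min have "?r = \<zero>" by (meson leD)
  then have "h \<otimes> a = h \<otimes> q" using a hS qc by (simp add: r_right_minus_eq m_comm)
  then have "a = q" using m_lcancel[of h a q] hS a qc by simp
  then show ?thesis using q by simp
qed

text \<open>Multiplying every factor from \<open>D\<close> by \<open>f\<close> multiplies a product of
  length \<open>m\<close> by \<open>f^m\<close>.\<close>

lemma sumprod_scale:
  assumes "sumprod D F m N x" "D \<subseteq> carrier R" "F \<subseteq> carrier R" "f \<in> carrier R" "g \<in> carrier R"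
  shows "sumprod ((\<otimes>) f ` D) ((\<otimes>) g ` F) m N (f [^] m \<otimes> (g \<otimes> x))"
  using assms(1)
proof induction
  case (base x)
  then have "sumprod ((\<otimes>) f ` D) ((\<otimes>) g ` F) 0 1 (g \<otimes> x)" by (intro sumprod.base) auto
  then show ?case using base assms by (auto simp: subset_iff)
next
  case (zero m N)
  then show ?case using assms by (simp add: sumprod.zero)
next
  case (mult c m N x)
  have c: "c \<in> carrier R" "x \<in> carrier R" using mult assms sumprod_carrier by blast+
  have "sumprod ((\<otimes>) f ` D) ((\<otimes>) g ` F) (Suc m) N ((f \<otimes> c) \<otimes> (f [^] m \<otimes> (g \<otimes> x)))"
    using mult by (intro sumprod.mult) auto
  moreover have "(f \<otimes> c) \<otimes> (f [^] m \<otimes> (g \<otimes> x)) = f [^] Suc m \<otimes> (g \<otimes> (c \<otimes> x))"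
    using assms c by (simp add: m_ac)
  ultimately show ?case by simp
next
  case (add m N x N' y)
  have c: "y \<in> carrier R" "x \<in> carrier R" using add assms sumprod_carrier by blast+
  show ?case using sumprod.add[OF add(3,4)] assms c by (simp add: r_distr)
qed

lemma power_bounded_clear_denominators:
  assumes S: "subring S R" and pb: "power_bounded (fractions S) D e r a" and D: "D \<subseteq> S"
    and a: "a \<in> carrier R"
  obtains F c g where "finite F" "F \<subseteq> S" "g \<in> S" "g \<noteq> \<zero>"
    "\<And>m. sumprod D F (e * m) (c * r ^ m) (g \<otimes> a [^] m)"
proof -
  obtain F c where F: "finite F" "F \<subseteq> fractions S"
    and bd: "\<And>m. sumprod D F (e * m) (c * r ^ m) (a [^] m)"
    using pb by (auto simp: power_bounded_def)
  obtain g where g: "g \<in> S" "g \<noteq> \<zero>" "\<And>d. d \<in> F \<Longrightarrow> g \<otimes> d \<in> S"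
    using common_denominator[OF S F] by blast
  have Sc: "S \<subseteq> carrier R" using subringE(1)[OF S] .
  have c: "D \<subseteq> carrier R" "F \<subseteq> carrier R" "g \<in> carrier R"
    using D Sc F g by (auto simp: fractions_def)
  have one: "(\<otimes>) \<one> ` D = D"
    using c by (simp add: image_cong[where g = id] subset_iff)
  have "sumprod D ((\<otimes>) g ` F) (e * m) (c * r ^ m) (g \<otimes> a [^] m)" for m
  proof -
    have "\<one> [^] (e * m) \<otimes> (g \<otimes> a [^] m) = g \<otimes> a [^] m" using a c by simp
    then show ?thesis
      using sumprod_scale[OF bd[of m] c(1,2) one_closed c(3)] unfolding one by simp
  qed
  then show thesis using F g by (intro that[of "(\<otimes>) g ` F" g c]) auto
qed

text \<open>If \<open>f\<close> is a common denominator of \<open>D\<close>, then \<open>f^e a\<close> is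
  power bounded with respect to a subset of \<open>S\<close>, and therefore lies in
  \<open>S\<close> by complete integral closure. So it is enough to count the power bounded
  elements of the Euclidean domain itself.\<close>

lemma northcott_fractionsI:
  fixes \<delta> :: "'a \<Rightarrow> nat"
  assumes S: "subring S R"
    and division: "\<And>a b. a \<in> S \<Longrightarrow> b \<in> S \<Longrightarrow> b \<noteq> \<zero> \<Longrightarrow>
      \<exists>q\<in>S. a \<ominus> q \<otimes> b = \<zero> \<or> \<delta> (a \<ominus> q \<otimes> b) < \<delta> b"
    and fin: "\<And>D e r. finite D \<Longrightarrow> D \<subseteq> S \<Longrightarrow> finite {b \<in> S. power_bounded (fractions S) D e r b}"
  shows "northcott (fractions S)"
  unfolding northcott_def
proof (intro allI impI)
  fix D e r assume D: "finite D \<and> D \<subseteq> fractions S"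
  let ?Q = "fractions S"
  have Sc: "S \<subseteq> carrier R" and Qc: "?Q \<subseteq> carrier R" and Q: "subfield ?Q R" and SQ: "S \<subseteq> ?Q"
    using subringE(1)[OF S] fractions_subfield[OF S] subfieldE(3)[OF fractions_subfield(1)[OF S]]
    by blast+
  have Qs: "subring ?Q R" using subfieldE(1)[OF Q] .
  obtain f where f: "f \<in> S" "f \<noteq> \<zero>" "\<And>d. d \<in> D \<Longrightarrow> f \<otimes> d \<in> S"
    using common_denominator[OF S, of D] D by auto
  have fc: "f \<in> carrier R" using f Sc by auto
  let ?D = "(\<otimes>) f ` D"
  have D': "finite ?D" "?D \<subseteq> S" using D f by auto
  have "f [^] e \<otimes> a \<in> {b \<in> S. power_bounded ?Q ?D e r b}" if a: "a \<in> ?Q" "power_bounded ?Q D e r a" for a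
  proof -
    obtain F c where F: "finite F" "F \<subseteq> ?Q" and bd: "\<And>m. sumprod D F (e * m) (c * r ^ m) (a [^] m)"
      using a by (auto simp: power_bounded_def)
    have cc: "D \<subseteq> carrier R" "F \<subseteq> carrier R" "a \<in> carrier R" using D F Qc a by auto
    have one: "(\<otimes>) \<one> ` F = F"
      using cc by (simp add: image_cong[where g = id] subset_iff)
    have "sumprod ?D F (e * m) (c * r ^ m) ((f [^] e \<otimes> a) [^] m)" for m
    proof -
      have "f [^] (e * m) \<otimes> (\<one> \<otimes> a [^] m) = (f [^] e \<otimes> a) [^] m"
        using fc cc by (simp add: nat_pow_distrib nat_pow_pow)
      then show ?thesis using sumprod_scale[OF bd[of m] cc(1,2) fc one_closed] unfolding one by simp
    qed
    then have pb: "power_bounded ?Q ?D e r (f [^] e \<otimes> a)"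
      unfolding power_bounded_def using F by (intro exI[of _ F] exI[of _ c]) simp
    have fa: "f [^] e \<otimes> a \<in> carrier R" using fc cc by simp
    obtain F' c' g where F': "F' \<subseteq> S" "g \<in> S" "g \<noteq> \<zero>"
      and bd': "\<And>m. sumprod ?D F' (e * m) (c' * r ^ m) (g \<otimes> (f [^] e \<otimes> a) [^] m)"
      by (rule power_bounded_clear_denominators[OF S pb D'(2) fa]) (rule that)
    have "f [^] e \<otimes> a \<in> S"
      by (rule completely_integrally_closed[OF S division F'(2,3) fa])
        (use sumprod_closed[OF bd' S D'(2) F'(1)] in auto)
    with pb show ?thesis by simp
  qed
  then have "(\<otimes>) (f [^] e) ` {a \<in> ?Q. power_bounded ?Q D e r a} \<subseteq> {b \<in> S. power_bounded ?Q ?D e r b}"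
    by blast
  then have "finite ((\<otimes>) (f [^] e) ` {a \<in> ?Q. power_bounded ?Q D e r a})"
    using finite_subset fin[OF D'] by blast
  moreover have "inj_on ((\<otimes>) (f [^] e)) {a \<in> ?Q. power_bounded ?Q D e r a}"
    using m_lcancel[OF pow_nonzero[OF fc f(2)]] Qc fc by (intro inj_onI) auto
  ultimately show "finite {a \<in> ?Q. power_bounded ?Q D e r a}" using finite_imageD by blast
qed

end

section \<open>Finiteness passes to transcendental extensions\<close>

context field
begin

text \<open>Since \<open>t\<close> is transcendental, the elements of \<open>K[t]\<close> have well-defined
  coefficients.\<close>

lemma transcendental_coefficients:
  assumes K: "subfield K R" and t: "t \<in> carrier R" "(transcendental over K) t"
  defines "E \<equiv> simple_extension K t"
  obtains co :: "'a \<Rightarrow> nat \<Rightarrow> 'a" where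
    "\<And>x i. x \<in> E \<Longrightarrow> co x i \<in> K"
    "\<And>x y i. x \<in> E \<Longrightarrow> y \<in> E \<Longrightarrow> co (x \<oplus> y) i = co x i \<oplus> co y i"
    "\<And>x y i. x \<in> E \<Longrightarrow> y \<in> E \<Longrightarrow> co (x \<otimes> y) i = (\<Oplus>k\<in>{..i}. co x k \<otimes> co y (i - k))"
    "\<And>x. x \<in> E \<Longrightarrow> \<exists>d. \<forall>i>d. co x i = \<zero>"
    "\<And>x. x \<in> E \<Longrightarrow> x \<noteq> \<zero> \<Longrightarrow> \<exists>d. co x d \<noteq> \<zero> \<and> (\<forall>i>d. co x i = \<zero>)"
    "\<And>k n. k \<in> K \<Longrightarrow> k \<otimes> t [^] n \<in> E \<and> (\<forall>i. co (k \<otimes> t [^] n) i = (if i = n then k else \<zero>))"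
proof -
  have Ks: "subring K R" and Kc: "K \<subseteq> carrier R" using subfieldE[OF K] by auto
  have E: "E = (\<lambda>p. eval p t) ` carrier (K[X])"
    unfolding E_def by (rule simple_extension_as_eval_img[OF Kc t(1)])
  interpret UP: domain "K[X]" by (rule univ_poly_is_domain[OF Ks])
  interpret ev: ring_hom_cring "K[X]" R "\<lambda>p. eval p t" by (rule eval_cring_hom[OF Ks t(1)])
  have inj: "inj_on (\<lambda>p. eval p t) (carrier (K[X]))"
    using t(2) by (simp add: over_def transcendental_def)
  define \<rho> where "\<rho> x = inv_into (carrier (K[X])) (\<lambda>p. eval p t) x" for x
  have rho: "\<rho> x \<in> carrier (K[X])" "eval (\<rho> x) t = x" if "x \<in> E" for x
    using that unfolding E \<rho>_def by (auto intro: inv_into_into f_inv_into_f)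
  have rho': "\<rho> (eval p t) = p" if "p \<in> carrier (K[X])" for p
    unfolding \<rho>_def using inv_into_f_f[OF inj that] .
  have set_rho: "set (\<rho> x) \<subseteq> K" "set (\<rho> x) \<subseteq> carrier R" if "x \<in> E" for x
    using rho(1)[OF that] Kc by (auto simp: univ_poly_carrier[symmetric] polynomial_def)
  show thesis
  proof (rule that[of "\<lambda>x. coeff (\<rho> x)"])
    fix x i assume x: "x \<in> E"
    have "coeff (\<rho> x) i \<in> set (\<rho> x) \<union> {\<zero>}"
      using coeff_img_restrict[of "\<rho> x"] coeff_length[of "\<rho> x" i] by (cases "i < length (\<rho> x)") auto
    then show "coeff (\<rho> x) i \<in> K" using set_rho[OF x] subringE(2)[OF Ks] by auto
    show "\<exists>d. \<forall>i>d. coeff (\<rho> x) i = \<zero>" using coeff_degree by blast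
    show "\<exists>d. coeff (\<rho> x) d \<noteq> \<zero> \<and> (\<forall>i>d. coeff (\<rho> x) i = \<zero>)" if "x \<noteq> \<zero>"
    proof -
      have "\<rho> x \<noteq> []" using rho(2)[OF x] that by auto
      then have "coeff (\<rho> x) (degree (\<rho> x)) \<noteq> \<zero>"
        using rho(1)[OF x] lead_coeff_simp[of "\<rho> x"]
        by (auto simp: univ_poly_carrier[symmetric] polynomial_def)
      then show ?thesis using coeff_degree by blast
    qed
  next
    fix x y i assume x: "x \<in> E" "y \<in> E"
    have "\<rho> (x \<oplus> y) = \<rho> x \<oplus>\<^bsub>K[X]\<^esub> \<rho> y"
      using rho'[of "\<rho> x \<oplus>\<^bsub>K[X]\<^esub> \<rho> y"] rho[OF x(1)] rho[OF x(2)] by simp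
    then show "coeff (\<rho> (x \<oplus> y)) i = coeff (\<rho> x) i \<oplus> coeff (\<rho> y) i"
      using poly_add_coeff[OF set_rho(2)[OF x(1)] set_rho(2)[OF x(2)]] by (simp add: univ_poly_add)
    have "\<rho> (x \<otimes> y) = \<rho> x \<otimes>\<^bsub>K[X]\<^esub> \<rho> y"
      using rho'[of "\<rho> x \<otimes>\<^bsub>K[X]\<^esub> \<rho> y"] rho[OF x(1)] rho[OF x(2)] by simp
    then show "coeff (\<rho> (x \<otimes> y)) i = (\<Oplus>k\<in>{..i}. coeff (\<rho> x) k \<otimes> coeff (\<rho> y) (i - k))"
      using poly_mult_coeff[OF set_rho(2)[OF x(1)] set_rho(2)[OF x(2)]] by (simp add: univ_poly_mult)
  next
    fix k n assume k: "k \<in> K"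
    have s: "set (monom k n) \<subseteq> K" using k subringE(2)[OF Ks] by (auto simp: monom_def)
    then have p: "normalize (monom k n) \<in> carrier (K[X])"
      using normalize_gives_polynomial by (simp add: univ_poly_carrier[symmetric])
    have ev: "eval (normalize (monom k n)) t = k \<otimes> t [^] n"
      using s Kc k t(1) eval_monom[of k t n] by (subst eval_normalize) auto
    have "coeff (normalize (monom k n)) i = (if i = n then k else \<zero>)" for i
      by (simp only: normalize_coeff[symmetric] monom_coeff)
    moreover have "\<rho> (k \<otimes> t [^] n) = normalize (monom k n)" using rho'[OF p] unfolding ev .
    moreover have "k \<otimes> t [^] n \<in> E" unfolding E ev[symmetric] using p by (rule imageI)
    ultimately show "k \<otimes> t [^] n \<in> E \<and> (\<forall>i. coeff (\<rho> (k \<otimes> t [^] n)) i = (if i = n then k else \<zero>))"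
      by simp
  qed
qed

lemma transcendental_division:
  assumes K: "subfield K R" and t: "t \<in> carrier R" "(transcendental over K) t"
  defines "E \<equiv> simple_extension K t"
  obtains \<delta> :: "'a \<Rightarrow> nat" where
    "\<And>a b. a \<in> E \<Longrightarrow> b \<in> E \<Longrightarrow> b \<noteq> \<zero> \<Longrightarrow> \<exists>q\<in>E. a \<ominus> q \<otimes> b = \<zero> \<or> \<delta> (a \<ominus> q \<otimes> b) < \<delta> b"
proof -
  have Ks: "subring K R" and Kc: "K \<subseteq> carrier R" using subfieldE[OF K] by auto
  have E: "E = (\<lambda>p. eval p t) ` carrier (K[X])"
    unfolding E_def by (rule simple_extension_as_eval_img[OF Kc t(1)])
  interpret UP: domain "K[X]" by (rule univ_poly_is_domain[OF Ks])
  interpret ev: ring_hom_cring "K[X]" R "\<lambda>p. eval p t" by (rule eval_cring_hom[OF Ks t(1)])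
  have inj: "inj_on (\<lambda>p. eval p t) (carrier (K[X]))"
    using t(2) by (simp add: over_def transcendental_def)
  define \<delta> where "\<delta> x = length (inv_into (carrier (K[X])) (\<lambda>p. eval p t) x)" for x
  have \<delta>: "\<delta> (eval p t) = length p" if "p \<in> carrier (K[X])" for p
    unfolding \<delta>_def using inv_into_f_f[OF inj that] by simp
  show thesis
  proof (rule that[of \<delta>])
    fix a b assume "a \<in> E" "b \<in> E" and nz: "b \<noteq> \<zero>"
    then obtain p q where p: "p \<in> carrier (K[X])" "a = eval p t" and q: "q \<in> carrier (K[X])" "b = eval q t"
      unfolding E by auto
    have qn: "q \<noteq> []" using q nz by auto
    obtain s r where s: "s \<in> carrier (K[X])" "r \<in> carrier (K[X])" "p = (q \<otimes>\<^bsub>K[X]\<^esub> s) \<oplus>\<^bsub>K[X]\<^esub> r"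
      "r = [] \<or> degree r < degree q"
      using subfield_long_division_theorem_shell[OF K p(1) q(1)] qn by (auto simp: univ_poly_zero)
    have c: "eval q t \<in> carrier R" "eval s t \<in> carrier R" "eval r t \<in> carrier R" using q s by auto
    have "a \<ominus> eval s t \<otimes> b = (eval s t \<otimes> eval q t \<oplus> eval r t) \<ominus> eval s t \<otimes> eval q t"
      using p q s c by (simp add: m_comm)
    also have "\<dots> = eval r t" using c by (simp add: a_minus_def a_ac r_neg r_neg1)
    finally have eq: "a \<ominus> eval s t \<otimes> b = eval r t" .
    show "\<exists>q\<in>E. a \<ominus> q \<otimes> b = \<zero> \<or> \<delta> (a \<ominus> q \<otimes> b) < \<delta> b"
    proof (rule bexI[of _ "eval s t"])
      show "a \<ominus> eval s t \<otimes> b = \<zero> \<or> \<delta> (a \<ominus> eval s t \<otimes> b) < \<delta> b"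
        unfolding eq using s(4) \<delta>[OF s(2)] \<delta>[OF q(1)] q(2) by (cases r) auto
      show "eval s t \<in> E" unfolding E using s by auto
    qed
  qed
qed

text \<open>The power bounded elements \<open>b\<close> of \<open>K[t]\<close> are counted. Comparing
  degrees in \<open>g b^m\<close> for large \<open>m\<close> bounds the degree of
  \<open>b\<close>; comparing leading coefficients shows that the leading coefficient of
  \<open>b\<close> is power bounded over \<open>K\<close>, so there are finitely many of them.
  Subtracting the leading term keeps the element power bounded (with other constants) and lowers
  the degree.\<close>

lemma northcott_transcendental:
  assumes K: "subfield K R" and NK: "northcott K" and t: "t \<in> carrier R" "(transcendental over K) t"
  shows "northcott (fractions (simple_extension K t))"
proof -
  define E where "E = simple_extension K t"
  have Ks: "subring K R" and Kc: "K \<subseteq> carrier R" using subfieldE[OF K] by auto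
  have Es: "subring E R" unfolding E_def by (rule simple_extension_is_subring[OF Ks t(1)])
  have Ec: "E \<subseteq> carrier R" using subringE(1)[OF Es] .
  let ?Q = "fractions E"
  have Q: "subfield ?Q R" and EQ: "E \<subseteq> ?Q" by (rule fractions_subfield[OF Es])+
  have Qs: "subring ?Q R" and Qc: "?Q \<subseteq> carrier R" using subfieldE[OF Q] by auto
  obtain co :: "'a \<Rightarrow> nat \<Rightarrow> 'a" where coK: "\<And>x i. x \<in> E \<Longrightarrow> co x i \<in> K"
    and co_add: "\<And>x y i. x \<in> E \<Longrightarrow> y \<in> E \<Longrightarrow> co (x \<oplus> y) i = co x i \<oplus> co y i"
    and co_mult: "\<And>x y i. x \<in> E \<Longrightarrow> y \<in> E \<Longrightarrow> co (x \<otimes> y) i = (\<Oplus>k\<in>{..i}. co x k \<otimes> co y (i - k))"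
    and co_bound: "\<And>x. x \<in> E \<Longrightarrow> \<exists>d. \<forall>i>d. co x i = \<zero>"
    and co_lead: "\<And>x. x \<in> E \<Longrightarrow> x \<noteq> \<zero> \<Longrightarrow> \<exists>d. co x d \<noteq> \<zero> \<and> (\<forall>i>d. co x i = \<zero>)"
    and co_monom: "\<And>k n. k \<in> K \<Longrightarrow> k \<otimes> t [^] n \<in> E \<and> (\<forall>i. co (k \<otimes> t [^] n) i = (if i = n then k else \<zero>))"
    by (rule transcendental_coefficients[OF K t, folded E_def]) (rule that)
  have coc: "co x i \<in> carrier R" if "x \<in> E" for x i using coK[OF that] Kc by auto
  have E0: "\<zero> \<in> E" "\<one> \<in> E" using subringE(2,3)[OF Es] by auto
  have co0: "co \<zero> i = \<zero>" for i
    using co_monom[of \<zero> 0] subringE(2)[OF Ks] by (auto split: if_splits)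
  have co1: "co \<one> i = (if i = 0 then \<one> else \<zero>)" for i
    using co_monom[of \<one> 0] subringE(3)[OF Ks] by auto
  have top: "co (x \<otimes> y) (a + b) = co x a \<otimes> co y b \<and> (\<forall>i>a + b. co (x \<otimes> y) i = \<zero>)"
    if xy: "x \<in> E" "y \<in> E" and x: "\<forall>i>a. co x i = \<zero>" and y: "\<forall>i>b. co y i = \<zero>" for x y a b
  proof
    have "(\<Oplus>k\<in>{..a + b}. co x k \<otimes> co y (a + b - k)) = (\<Oplus>k\<in>{..a + b}. if a = k then co x a \<otimes> co y b else \<zero>)"
    proof (rule finsum_cong')
      fix k assume k: "k \<in> {..a + b}"
      consider "k < a" | "k = a" | "k > a" by linarith
      then show "co x k \<otimes> co y (a + b - k) = (if a = k then co x a \<otimes> co y b else \<zero>)"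
      proof cases
        case 1 then have "a + b - k > b" by simp
        with y coc[OF xy(1)] 1 show ?thesis by auto
      next
        case 3 with x coc[OF xy(2)] show ?thesis by auto
      qed simp
    qed (use coc xy in auto)
    also have "\<dots> = co x a \<otimes> co y b" using coc xy by (intro finsum_singleton) auto
    finally show "co (x \<otimes> y) (a + b) = co x a \<otimes> co y b" using co_mult[OF xy] by simp
    show "\<forall>i>a + b. co (x \<otimes> y) i = \<zero>"
    proof (intro allI impI)
      fix i assume i: "i > a + b"
      have "co x k \<otimes> co y (i - k) = \<zero>" if "k \<in> {..i}" for k
      proof (cases "k > a")
        case True then show ?thesis using x coc[OF xy(2)] by auto
      next
        case False then have "i - k > b" using i by simp
        then show ?thesis using y coc[OF xy(1)] by auto
      qed
      then show "co (x \<otimes> y) i = \<zero>" unfolding co_mult[OF xy] by (intro add.finprod_one_eqI)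
    qed
  qed
  have powE: "x [^] m \<in> E" if "x \<in> E" for x and m :: nat
    by (induction m) (use that E0 subringE(6)[OF Es] in auto)
  have top_pow: "co (x [^] m) (d * m) = co x d [^] m \<and> (\<forall>i>d * m. co (x [^] m) i = \<zero>)"
    if x: "x \<in> E" "\<forall>i>d. co x i = \<zero>" for x d and m :: nat
  proof (induction m)
    case 0 show ?case using co1 by auto
  next
    case (Suc m)
    have "d * Suc m = d * m + d" by simp
    then show ?case using top[OF powE[OF x(1), of m] x(1), of "d * m" d] Suc x(2) by (simp add: add.commute)
  qed
  have gtop: "co (g \<otimes> x [^] m) (j + d * m) = co g j \<otimes> co x d [^] m \<and> (\<forall>i>j + d * m. co (g \<otimes> x [^] m) i = \<zero>)"
    if "x \<in> E" "g \<in> E" "\<forall>i>d. co x i = \<zero>" "\<forall>i>j. co g i = \<zero>" for x g d j and m :: nat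
    using top[OF that(2) powE[OF that(1), of m], of j "d * m"] top_pow[OF that(1,3), of m] that by simp
  have unif: "\<exists>d. \<forall>x\<in>D. \<forall>i>d. co x i = \<zero>" if "finite D" "D \<subseteq> E" for D
    using that
  proof (induction D rule: finite_induct)
    case (insert x D)
    then obtain d where d: "\<forall>x\<in>D. \<forall>i>d. co x i = \<zero>" by auto
    obtain d' where d': "\<forall>i>d'. co x i = \<zero>" using co_bound[of x] insert by auto
    show ?case using d d' by (intro exI[of _ "max d d'"]) auto
  qed simp
  have coord: "(\<forall>i>n0 * m + n1. co x i = \<zero>) \<and>
      (\<forall>i. sumprod ((\<lambda>(x,i). co x i) ` (D \<times> {..n0})) ((\<lambda>(x,i). co x i) ` (F \<times> {..n1})) m (N * Suc n0 ^ m) (co x i))"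
    if bd: "sumprod D F m N x" and D: "D \<subseteq> E" "\<forall>x\<in>D. \<forall>i>n0. co x i = \<zero>"
      and F: "F \<subseteq> E" "\<forall>x\<in>F. \<forall>i>n1. co x i = \<zero>" for D F m N x n0 n1
    using bd
  proof induction
    case (base x)
    have "sumprod ((\<lambda>(x,i). co x i) ` (D \<times> {..n0})) ((\<lambda>(x,i). co x i) ` (F \<times> {..n1})) 0 1 (co x i)" for i
    proof (cases "i \<le> n1")
      case True then show ?thesis using base by (intro sumprod.base) force
    next
      case False then show ?thesis using F base by (simp add: sumprod.zero del: One_nat_def)
    qed
    then show ?case using F base by simp
  next
    case (zero m N) then show ?case by (simp add: co0 sumprod.zero)
  next
    case (mult c m N x)
    have c: "c \<in> E" "x \<in> E" using mult sumprod_closed[OF _ Es D(1) F(1)] D by blast+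
    have "\<forall>i>n0 + (n0 * m + n1). co (c \<otimes> x) i = \<zero>"
      using top[OF c, of n0 "n0 * m + n1"] D(2) mult by blast
    moreover have "sumprod ((\<lambda>(x,i). co x i) ` (D \<times> {..n0})) ((\<lambda>(x,i). co x i) ` (F \<times> {..n1}))
        (Suc m) (N * Suc n0 ^ Suc m) (co (c \<otimes> x) i)" (is "sumprod ?D ?F _ _ _") for i
    proof -
      have carr: "?D \<subseteq> carrier R" "?F \<subseteq> carrier R" using coc D(1) F(1) by auto
      have "co (c \<otimes> x) i = (\<Oplus>k\<in>{..i}. co c k \<otimes> co x (i - k))" by (rule co_mult[OF c])
      also have "\<dots> = (\<Oplus>k\<in>{..min i n0}. co c k \<otimes> co x (i - k))"
        by (rule add.finprod_mono_neutral_cong_right) (use D(2) mult(1) coc c in auto)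
      finally have eq: "co (c \<otimes> x) i = (\<Oplus>k\<in>{..min i n0}. co c k \<otimes> co x (i - k))" .
      have "sumprod ?D ?F (Suc m) (card {..min i n0} * (N * Suc n0 ^ m)) (co (c \<otimes> x) i)"
        unfolding eq
      proof (rule sumprod_finsum)
        fix k assume "k \<in> {..min i n0}"
        then have "co c k \<in> ?D" using mult(1) by force
        moreover have "sumprod ?D ?F m (N * Suc n0 ^ m) (co x (i - k))" using mult by blast
        ultimately show "sumprod ?D ?F (Suc m) (N * Suc n0 ^ m) (co c k \<otimes> co x (i - k))"
          by (rule sumprod.mult)
      qed (use carr in auto)
      moreover have "card {..min i n0} * (N * Suc n0 ^ m) \<le> N * Suc n0 ^ Suc m"
      proof -
        have "card {..min i n0} * (N * Suc n0 ^ m) \<le> Suc n0 * (N * Suc n0 ^ m)"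
          by (intro mult_right_mono) auto
        then show ?thesis by (simp add: algebra_simps)
      qed
      ultimately show ?thesis using sumprod_mono_count carr by blast
    qed
    ultimately show ?case by (simp add: add.assoc)
  next
    case (add m N x N' y)
    have c: "x \<in> E" "y \<in> E" using add sumprod_closed[OF _ Es D(1) F(1)] by blast+
    have "(N + N') * Suc n0 ^ m = N * Suc n0 ^ m + N' * Suc n0 ^ m" by (rule distrib_right)
    then show ?case using add co_add[OF c] sumprod.add by simp
  qed
  have fin: "finite {b \<in> E. (\<forall>i\<ge>n. co b i = \<zero>) \<and> power_bounded ?Q D e r b}"
    if "finite D" "D \<subseteq> E" for n D e r
    using that
  proof (induction n arbitrary: D e r)
    case 0
    have "{b \<in> E. (\<forall>i\<ge>0. co b i = \<zero>) \<and> power_bounded ?Q D e r b} \<subseteq> {\<zero>}"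
      using co_lead by auto
    then show ?case using finite_subset by blast
  next
    case (Suc n)
    obtain n0 where n0: "\<forall>x\<in>D. \<forall>i>n0. co x i = \<zero>" using unif[OF Suc(2,3)] by auto
    let ?D1 = "(\<lambda>(x,i). co x i) ` (D \<times> {..n0})"
    let ?r = "r * Suc n0 ^ e"
    define Y where "Y = {p \<in> K. power_bounded K ?D1 e ?r p}"
    have D1: "finite ?D1" "?D1 \<subseteq> K" using Suc(2,3) coK by auto
    have Y: "finite Y" using NK D1 unfolding northcott_def Y_def by blast
    have lead: "co b n \<in> Y" if b: "b \<in> E" "\<forall>i\<ge>Suc n. co b i = \<zero>" "power_bounded ?Q D e r b" for b
    proof -
      have bc: "b \<in> carrier R" using b Ec by auto
      obtain F c g where F: "finite F" "F \<subseteq> E" "g \<in> E" "g \<noteq> \<zero>"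
        and bd: "\<And>m. sumprod D F (e * m) (c * r ^ m) (g \<otimes> b [^] m)"
        by (rule power_bounded_clear_denominators[OF Es b(3) Suc(3) bc]) (rule that)
      obtain n1 where n1: "\<forall>x\<in>F. \<forall>i>n1. co x i = \<zero>" using unif[OF F(1,2)] by auto
      obtain j where j: "co g j \<noteq> \<zero>" "\<forall>i>j. co g i = \<zero>" using co_lead[OF F(3,4)] by auto
      let ?F1 = "(\<lambda>(x,i). co x i) ` (F \<times> {..n1})"
      let ?u = "inv (co g j)"
      have F1: "finite ?F1" "?F1 \<subseteq> K" using F coK by auto
      have u: "?u \<in> K" "?u \<in> carrier R" using subfield_inv[OF K coK[OF F(3)] j(1)] Kc by auto
      have gc: "co g j \<in> carrier R" "co b n \<in> carrier R" using coc F b by auto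
      have cc: "?D1 \<subseteq> carrier R" "?F1 \<subseteq> carrier R" using D1 F1 Kc by auto
      have one: "(\<otimes>) \<one> ` ?D1 = ?D1"
        using cc(1) by (simp add: image_cong[where g = id] subset_iff)
      have "sumprod ?D1 ((\<otimes>) ?u ` ?F1) (e * m) (c * ?r ^ m) (co b n [^] m)" for m
      proof -
        have "sumprod ?D1 ?F1 (e * m) (c * r ^ m * Suc n0 ^ (e * m)) (co (g \<otimes> b [^] m) (j + n * m))"
          using coord[OF bd Suc(3) n0 F(2) n1] by blast
        moreover have "co (g \<otimes> b [^] m) (j + n * m) = co g j \<otimes> co b n [^] m"
          using gtop[OF b(1) F(3) _ j(2), of n m] b(2) by simp
        moreover have "c * r ^ m * Suc n0 ^ (e * m) = c * ?r ^ m"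
          by (simp add: power_mult_distrib power_mult)
        ultimately have 1: "sumprod ?D1 ?F1 (e * m) (c * ?r ^ m) (co g j \<otimes> co b n [^] m)" by simp
        have "\<one> [^] (e * m) \<otimes> (?u \<otimes> (co g j \<otimes> co b n [^] m)) = (?u \<otimes> co g j) \<otimes> co b n [^] m"
          using gc u by (simp add: m_assoc)
        also have "\<dots> = co b n [^] m" using gc j(1) by simp
        finally show ?thesis
          using sumprod_scale[OF 1 cc one_closed u(2)] unfolding one by simp
      qed
      moreover have "finite ((\<otimes>) ?u ` ?F1)" using F1 by simp
      moreover have "(\<otimes>) ?u ` ?F1 \<subseteq> K" using F1(2) u subringE(6)[OF Ks] by blast
      ultimately have "power_bounded K ?D1 e ?r (co b n)"
        unfolding power_bounded_def by blast
      then show ?thesis using coK[OF b(1)] by (simp add: Y_def)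
    qed
    have mon: "\<ominus> p \<otimes> t [^] n \<in> E" "co (\<ominus> p \<otimes> t [^] n) i = (if i = n then \<ominus> p else \<zero>)" if "p \<in> Y" for p i
      using co_monom[of "\<ominus> p" n] that subringE(5)[OF Ks] by (auto simp: Y_def)
    define B where "B p = {b \<in> E. (\<forall>i\<ge>n. co b i = \<zero>) \<and>
       power_bounded ?Q (insert (\<ominus> p \<otimes> t [^] n) (insert \<one> D)) (Suc e) (Suc r) b}" for p
    have finB: "finite (B p)" if "p \<in> Y" for p
      unfolding B_def by (rule Suc(1)) (use Suc(2,3) mon that E0 in auto)
    have "{b \<in> E. (\<forall>i\<ge>Suc n. co b i = \<zero>) \<and> power_bounded ?Q D e r b} \<subseteq>
       (\<Union>p\<in>Y. (\<lambda>b. b \<oplus> p \<otimes> t [^] n) ` B p)"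
    proof
      fix b assume "b \<in> {b \<in> E. (\<forall>i\<ge>Suc n. co b i = \<zero>) \<and> power_bounded ?Q D e r b}"
      then have b: "b \<in> E" "\<forall>i\<ge>Suc n. co b i = \<zero>" "power_bounded ?Q D e r b" by auto
      let ?p = "co b n" let ?b = "b \<oplus> \<ominus> ?p \<otimes> t [^] n"
      have p: "?p \<in> Y" by (rule lead[OF b])
      have pc: "?p \<in> carrier R" "b \<in> carrier R" using coc b Ec by auto
      have "?b \<in> E" using subringE(7)[OF Es b(1) mon(1)[OF p]] .
      moreover have "co ?b i = \<zero>" if "i \<ge> n" for i
        using co_add[OF b(1) mon(1)[OF p]] mon(2)[OF p] b(2) that pc
        by (cases "i = n") (auto simp: r_neg)
      moreover have "power_bounded ?Q (insert (\<ominus> ?p \<otimes> t [^] n) (insert \<one> D)) (Suc e) (Suc r) ?b"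
        by (rule power_bounded_add) (use b mon(1)[OF p] EQ Qc Suc(3) in auto)
      ultimately have "?b \<in> B ?p" by (simp add: B_def)
      moreover have "b = ?b \<oplus> ?p \<otimes> t [^] n"
        using pc t(1) by (simp add: a_assoc l_minus l_neg)
      ultimately show "b \<in> (\<Union>p\<in>Y. (\<lambda>b. b \<oplus> p \<otimes> t [^] n) ` B p)" using p by blast
    qed
    moreover have "finite (\<Union>p\<in>Y. (\<lambda>b. b \<oplus> p \<otimes> t [^] n) ` B p)"
      using Y finB by auto
    ultimately show ?case by (rule finite_subset)
  qed
  obtain \<delta> where division: "\<And>a b. a \<in> E \<Longrightarrow> b \<in> E \<Longrightarrow> b \<noteq> \<zero> \<Longrightarrow>
      \<exists>q\<in>E. a \<ominus> q \<otimes> b = \<zero> \<or> (\<delta> (a \<ominus> q \<otimes> b) :: nat) < \<delta> b"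
    by (rule transcendental_division[OF K t, folded E_def]) (rule that)
  have "northcott ?Q"
  proof (rule northcott_fractionsI[OF Es division])
    fix D e r assume D: "finite D" "D \<subseteq> E"
    obtain n0 where n0: "\<forall>x\<in>D. \<forall>i>n0. co x i = \<zero>" using unif[OF D] by auto
    have "co b i = \<zero>" if b: "b \<in> E" "power_bounded ?Q D e r b" and i: "i \<ge> Suc (n0 * e)" for b i
    proof (cases "b = \<zero>")
      case True then show ?thesis by (simp add: co0)
    next
      case False
      have bc: "b \<in> carrier R" using b Ec by auto
      obtain F c g where F: "finite F" "F \<subseteq> E" "g \<in> E" "g \<noteq> \<zero>"
        and bd: "\<And>m. sumprod D F (e * m) (c * r ^ m) (g \<otimes> b [^] m)"
        by (rule power_bounded_clear_denominators[OF Es b(2) D(2) bc]) (rule that)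
      obtain n1 where n1: "\<forall>x\<in>F. \<forall>i>n1. co x i = \<zero>" using unif[OF F(1,2)] by auto
      obtain j where j: "co g j \<noteq> \<zero>" "\<forall>i>j. co g i = \<zero>" using co_lead[OF F(3,4)] by auto
      obtain d where d: "co b d \<noteq> \<zero>" "\<forall>i>d. co b i = \<zero>" using co_lead[OF b(1) False] by auto
      have "d \<le> n0 * e"
      proof (rule ccontr)
        assume "\<not> d \<le> n0 * e"
        then have "Suc (n0 * e) * Suc n1 \<le> d * Suc n1" by (intro mult_right_mono) auto
        then have gt: "j + d * Suc n1 > n0 * (e * Suc n1) + n1" by (simp add: algebra_simps)
        have "co (g \<otimes> b [^] Suc n1) (j + d * Suc n1) = \<zero>"
          using coord[OF bd D(2) n0 F(2) n1, of "Suc n1"] gt by blast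
        moreover have "co (g \<otimes> b [^] Suc n1) (j + d * Suc n1) \<noteq> \<zero>"
          using gtop[OF b(1) F(3) d(2) j(2), of "Suc n1"] j(1) d(1) coc F b
            pow_nonzero[of "co b d" "Suc n1"] integral[of "co g j" "co b d [^] Suc n1"] by auto
        ultimately show False by simp
      qed
      then show ?thesis using d(2) i by auto
    qed
    then have "{b \<in> E. power_bounded ?Q D e r b} \<subseteq>
      {b \<in> E. (\<forall>i\<ge>Suc (n0 * e). co b i = \<zero>) \<and> power_bounded ?Q D e r b}" by blast
    then show "finite {b \<in> E. power_bounded ?Q D e r b}"
      using fin[OF D] finite_subset by blast
  qed
  then show ?thesis unfolding E_def .
qed

end

section \<open>Finitely generated fields\<close>

text \<open>The constant disappears on taking \<open>m\<close>-th roots and letting \<open>m\<close> grow.\<close>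

lemma nat_power_growth:
  fixes x B C :: nat
  assumes "\<And>m. x ^ m \<le> C * B ^ m"
  shows "x \<le> B"
proof (rule ccontr)
  assume "\<not> x \<le> B"
  then have xB: "B < x" by simp
  show False
  proof (cases "B = 0")
    case True with assms[of 1] xB show False by simp
  next
    case False
    have "real x / real B > 1" using xB False by (simp add: field_simps)
    then obtain m where m: "real C < (real x / real B) ^ m" using real_arch_pow by blast
    have "real (x ^ m) \<le> real (C * B ^ m)" using assms[of m] by (simp only: of_nat_le_iff)
    with m False show False by (simp add: power_divide field_simps)
  qed
qed

context field
begin

abbreviation from_int :: "int \<Rightarrow> 'a" where "from_int k \<equiv> [k] \<cdot> \<one>"

lemma from_int_closed [simp]: "from_int k \<in> carrier R" by simp

lemma from_int_add: "from_int (i + j) = from_int i \<oplus> from_int j"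
  by (rule add.int_pow_mult) simp

lemma from_int_minus: "from_int (- i) = \<ominus> from_int i"
  by (rule add.int_pow_neg) simp

lemma from_int_mult: "from_int (i * j) = from_int i \<otimes> from_int j"
proof -
  have "from_int i \<otimes> from_int j = [i] \<cdot> (\<one> \<otimes> from_int j)" by (rule add_pow_ldistr_int) simp_all
  then show ?thesis by (simp add: add.int_pow_pow mult.commute)
qed

lemma from_int_pow: "from_int (i ^ n) = from_int i [^] n"
proof (induction n)
  case 0
  have "from_int 1 = \<one>" by (rule add.int_pow_1) simp
  then show ?case by simp
next
  case (Suc n) then show ?case by (simp add: from_int_mult m_comm del: add.int_pow_1)
qed

lemma from_int_1 [simp]: "from_int 1 = \<one>" by (rule add.int_pow_1) simp

lemma from_int_of_nat: "from_int (int n) = [n] \<cdot> \<one>"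
  by (simp add: add_pow_int_ge)

lemma from_int_0 [simp]: "from_int 0 = \<zero>"
  using from_int_of_nat[of 0] by simp

lemma range_from_int: "subring (range from_int) R"
proof (rule subringI)
  show "range from_int \<subseteq> carrier R" by auto
  show "\<one> \<in> range from_int" using from_int_1 by (metis rangeI)
qed (auto simp: from_int_mult[symmetric] from_int_add[symmetric] from_int_minus[symmetric])

text \<open>In positive characteristic the prime field is finite. In characteristic zero a sum of
  \<open>N\<close> products of \<open>m\<close> integers of absolute value at most
  \<open>M\<close> is at most \<open>N M^m\<close>, which bounds the absolute value of a power
  bounded integer.\<close>

lemma northcott_prime_field: "northcott (fractions (range from_int))"
proof (cases "\<exists>n::nat. n > 0 \<and> [n] \<cdot> \<one> = \<zero>")
  case True
  then obtain n :: nat where n: "n > 0" "[n] \<cdot> \<one> = \<zero>" by auto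
  let ?S = "range from_int"
  have "from_int k \<in> from_int ` {0..<int n}" for k
  proof -
    have "from_int k = from_int (int n * (k div int n) + k mod int n)" by simp
    also have "\<dots> = from_int (k mod int n)"
      using n unfolding from_int_add from_int_mult from_int_of_nat by simp
    finally show ?thesis using n(1) by (intro image_eqI[of _ _ "k mod int n"]) auto
  qed
  then have "?S \<subseteq> from_int ` {0..<int n}" by blast
  then have fin: "finite ?S" by (rule finite_subset) simp
  have "fractions ?S \<subseteq> (\<lambda>(v,s). inv v \<otimes> s) ` (?S \<times> ?S)"
  proof
    fix x assume "x \<in> fractions ?S"
    then obtain v where v: "v \<in> ?S" "v \<noteq> \<zero>" "v \<otimes> x \<in> ?S" "x \<in> carrier R" by (auto simp: fractions_def)
    have vc: "v \<in> carrier R" using v by auto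
    have "x = inv v \<otimes> (v \<otimes> x)" using v vc by (simp add: m_assoc[symmetric])
    with v show "x \<in> (\<lambda>(v,s). inv v \<otimes> s) ` (?S \<times> ?S)" by (metis (mono_tags, lifting) SigmaI case_prod_conv image_eqI)
  qed
  then have "finite (fractions ?S)" using fin by (meson finite_SigmaI finite_imageI finite_subset)
  then show ?thesis by (rule northcott_finite)
next
  case False
  have inj0: "k = 0" if "from_int k = \<zero>" for k
  proof (rule ccontr)
    assume "k \<noteq> 0"
    have "from_int (int (nat \<bar>k\<bar>)) = \<zero>"
      using that from_int_minus[of k] by (cases "k \<ge> 0") auto
    then have "[nat \<bar>k\<bar>] \<cdot> \<one> = \<zero>" unfolding from_int_of_nat .
    moreover have "nat \<bar>k\<bar> > 0" using \<open>k \<noteq> 0\<close> by simp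
    ultimately show False using False by blast
  qed
  have inj: "inj from_int"
  proof (rule injI)
    fix i j assume "from_int i = from_int j"
    then have "from_int (i + - j) = \<zero>" unfolding from_int_add from_int_minus by (simp add: r_neg)
    then show "i = j" using inj0 by fastforce
  qed
  define \<delta> where "\<delta> x = nat \<bar>inv_into UNIV from_int x\<bar>" for x
  have \<delta>: "\<delta> (from_int k) = nat \<bar>k\<bar>" for k unfolding \<delta>_def using inv_into_f_f[OF inj] by simp
  show ?thesis
  proof (rule northcott_fractionsI[OF range_from_int])
    fix a b assume "a \<in> range from_int" "b \<in> range from_int" and nz: "b \<noteq> \<zero>"
    then obtain i j where ij: "a = from_int i" "b = from_int j" by auto
    with nz have j0: "j \<noteq> 0" by auto
    have "a \<ominus> from_int (i div j) \<otimes> b = from_int (i mod j)"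
    proof -
      have "a \<ominus> from_int (i div j) \<otimes> b = from_int (i + - (i div j * j))"
        unfolding ij from_int_add from_int_minus from_int_mult a_minus_def ..
      also have "i + - (i div j * j) = i mod j" by (simp add: minus_div_mult_eq_mod)
      finally show ?thesis .
    qed
    moreover have "nat \<bar>i mod j\<bar> < nat \<bar>j\<bar>" using abs_mod_less[OF j0, of i] by simp
    ultimately show "\<exists>q\<in>range from_int. a \<ominus> q \<otimes> b = \<zero> \<or> \<delta> (a \<ominus> q \<otimes> b) < \<delta> b"
      using \<delta> ij by (intro bexI[of _ "from_int (i div j)"]) auto
  next
    fix D e r assume D: "finite D" "D \<subseteq> range from_int"
    have bounds: "\<exists>M. \<forall>x\<in>D. \<exists>u. x = from_int u \<and> nat \<bar>u\<bar> \<le> M" if "finite D" "D \<subseteq> range from_int" for D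
      using that
    proof (induction D rule: finite_induct)
      case (insert x D)
      then obtain M u where "\<forall>x\<in>D. \<exists>u. x = from_int u \<and> nat \<bar>u\<bar> \<le> M" "x = from_int u" by auto
      then show ?case by (intro exI[of _ "max M (nat \<bar>u\<bar>)"]) (auto simp: le_max_iff_disj)
    qed simp
    obtain M where M: "\<And>x. x \<in> D \<Longrightarrow> \<exists>u. x = from_int u \<and> nat \<bar>u\<bar> \<le> M" using bounds[OF D] by auto
    have "b \<in> from_int ` {- int (r * M ^ e) .. int (r * M ^ e)}"
      if b: "b \<in> range from_int" "power_bounded (fractions (range from_int)) D e r b" for b
    proof -
      obtain k where k: "b = from_int k" using b by auto
      have bc: "b \<in> carrier R" using k by simp
      obtain F c g where F: "finite F" "F \<subseteq> range from_int" "g \<in> range from_int" "g \<noteq> \<zero>"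
        and bd: "\<And>m. sumprod D F (e * m) (c * r ^ m) (g \<otimes> b [^] m)"
        by (rule power_bounded_clear_denominators[OF range_from_int b(2) D(2) bc]) (rule that)
      obtain C where C: "\<And>x. x \<in> F \<Longrightarrow> \<exists>u. x = from_int u \<and> nat \<bar>u\<bar> \<le> C" using bounds[OF F(1,2)] by auto
      have size: "\<exists>u. x = from_int u \<and> nat \<bar>u\<bar> \<le> N * M ^ m * C" if "sumprod D F m N x" for m N x
        using that
      proof induction
        case (base x) then show ?case using C by simp
      next
        case (zero m N) show ?case by (intro exI[of _ 0]) simp
      next
        case (mult d m N x)
        obtain u v where u: "x = from_int u" "nat \<bar>u\<bar> \<le> N * M ^ m * C" and v: "d = from_int v" "nat \<bar>v\<bar> \<le> M"
          using mult M by blast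
        have "nat \<bar>v * u\<bar> = nat \<bar>v\<bar> * nat \<bar>u\<bar>" by (simp add: abs_mult nat_mult_distrib)
        also have "\<dots> \<le> M * (N * M ^ m * C)" by (intro mult_mono u v) auto
        finally have "nat \<bar>v * u\<bar> \<le> N * M ^ Suc m * C" by (simp add: mult_ac)
        moreover have "d \<otimes> x = from_int (v * u)" using u v by (simp only: from_int_mult)
        ultimately show ?case by blast
      next
        case (add m N x N' y)
        then obtain u v where u: "x = from_int u" "nat \<bar>u\<bar> \<le> N * M ^ m * C"
          and v: "y = from_int v" "nat \<bar>v\<bar> \<le> N' * M ^ m * C" by blast
        have "nat \<bar>u + v\<bar> \<le> nat \<bar>u\<bar> + nat \<bar>v\<bar>" by linarith
        also have "\<dots> \<le> (N + N') * M ^ m * C" using u v by (simp add: algebra_simps)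
        finally have "nat \<bar>u + v\<bar> \<le> (N + N') * M ^ m * C" .
        moreover have "x \<oplus> y = from_int (u + v)" using u v by (simp only: from_int_add)
        ultimately show ?case by blast
      qed
      obtain g' where g': "g = from_int g'" using F by auto
      then have g'0: "g' \<noteq> 0" using F(4) by auto
      have "nat \<bar>k\<bar> ^ m \<le> (c * C) * (r * M ^ e) ^ m" for m
      proof -
        obtain u where u: "g \<otimes> b [^] m = from_int u" "nat \<bar>u\<bar> \<le> c * r ^ m * M ^ (e * m) * C"
          using size[OF bd[of m]] by auto
        have "from_int (g' * k ^ m) = from_int u"
          using u(1) unfolding g' k from_int_mult from_int_pow by simp
        then have "u = g' * k ^ m" using injD[OF inj] by metis
        then have "nat \<bar>u\<bar> = nat \<bar>g'\<bar> * nat \<bar>k\<bar> ^ m"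
          by (simp add: abs_mult nat_mult_distrib power_abs nat_power_eq)
        moreover have "1 * nat \<bar>k\<bar> ^ m \<le> nat \<bar>g'\<bar> * nat \<bar>k\<bar> ^ m"
          using g'0 by (intro mult_right_mono) auto
        ultimately have "nat \<bar>k\<bar> ^ m \<le> c * r ^ m * M ^ (e * m) * C" using u(2) by linarith
        then show ?thesis by (simp add: power_mult_distrib power_mult mult_ac)
      qed
      then have "nat \<bar>k\<bar> \<le> r * M ^ e" by (rule nat_power_growth)
      then have "\<bar>k\<bar> \<le> int (r * M ^ e)" by linarith
      then show ?thesis unfolding k by (intro imageI) auto
    qed
    then have "{b \<in> range from_int. power_bounded (fractions (range from_int)) D e r b}
      \<subseteq> from_int ` {- int (r * M ^ e) .. int (r * M ^ e)}" by blast
    then show "finite {b \<in> range from_int. power_bounded (fractions (range from_int)) D e r b}"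
      by (rule finite_subset) simp
  qed
qed

end

context algebraically_closed
begin

text \<open>Adjoin the elements one at a time; each is algebraic or transcendental over the field reached so
  far.\<close>

lemma exists_northcott_subfield:
  assumes "finite S" "S \<subseteq> carrier L"
  shows "\<exists>E. subfield E L \<and> northcott E \<and> S \<subseteq> E"
  using assms
proof (induction S rule: finite_induct)
  case empty
  show ?case using northcott_prime_field fractions_subfield(1)[OF range_from_int] by blast
next
  case (insert x S)
  then obtain E where E: "subfield E L" "northcott E" "S \<subseteq> E" by auto
  have x: "x \<in> carrier L" using insert by auto
  have Ec: "E \<subseteq> carrier L" "subring E L" using subfieldE[OF E(1)] by auto
  let ?E = "simple_extension E x"
  have sub: "E \<subseteq> ?E" "x \<in> ?E" "subring ?E L"
    using simple_extension_incl[OF Ec(1) x] simple_extension_mem[OF Ec(2) x]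
      simple_extension_is_subring[OF Ec(2) x] by auto
  show ?case
  proof (cases "(algebraic over E) x")
    case True
    have "northcott ?E" by (rule northcott_simple_extension[OF E(1,2) x True])
    moreover have "subfield ?E L" using simple_extension_is_subfield[OF E(1) x] True by simp
    ultimately show ?thesis using sub E(3) by blast
  next
    case False
    then have t: "(transcendental over E) x" by (simp add: over_def)
    have "northcott (fractions ?E)" by (rule northcott_transcendental[OF E(1,2) x t])
    then show ?thesis using fractions_subfield[OF sub(3)] sub E(3) by blast
  qed
qed

text \<open>If \<open>a^n\<close> is a product of \<open>e n\<close> elements of \<open>D\<close>, then
  \<open>a^m\<close> is a product of at most \<open>e m\<close> elements of \<open>D\<close> with
  \<open>a^(m mod n)\<close>, so \<open>a\<close> is power bounded, uniformly in \<open>n\<close>.\<close>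

lemma northcott_division_hull:
  assumes E: "subfield E L" "northcott E" and D: "finite D" "D \<subseteq> E" "\<one> \<in> D"
  shows "finite {a \<in> E. \<exists>n>0. sumprod D {\<one>} (e * n) 1 (a [^] n)}"
proof -
  have Es: "subring E L" "E \<subseteq> carrier L" using subfieldE[OF E(1)] by auto
  have "power_bounded E D e 1 a" if a: "a \<in> E" and n: "n > 0" "sumprod D {\<one>} (e * n) 1 (a [^] n)" for a n
  proof -
    have ac: "a \<in> carrier L" using a Es by auto
    (* The finite set of extra factors may depend on a and n; only D and the growth rate are
       shared. *)
    let ?F = "(\<lambda>s. a [^] s) ` {..<n}"
    have Dc: "D \<subseteq> carrier L" "?F \<subseteq> carrier L" "{\<one>} \<subseteq> carrier L" using D Es ac by auto
    have aE: "a [^] m \<in> E" for m :: nat by (induction m) (use a subringE(3,6)[OF Es(1)] in auto)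
    have pow: "sumprod D {\<one>} (e * n * q) 1 (a [^] (n * q))" for q
    proof (induction q)
      case 0 then show ?case using sumprod.base[of \<one> "{\<one>}" D] by simp
    next
      case (Suc q)
      have "(\<lambda>(u, v). u \<otimes> v) ` ({\<one>} \<times> {\<one>}) = {\<one>}" by simp
      then have "sumprod D {\<one>} (e * n + e * n * q) (1 * 1) (a [^] n \<otimes> a [^] (n * q))"
        using sumprod_mult[OF n(2) Suc Dc(1,3,3)] by simp
      then show ?case using ac by (simp add: nat_pow_mult)
    qed
    have "sumprod D ?F (e * m) (1 * 1 ^ m) (a [^] m)" for m
    proof -
      have "a [^] (m mod n) \<in> ?F" using n(1) by simp
      then have b: "sumprod D ?F 0 1 (a [^] (m mod n))" by (rule sumprod.base)
      have im: "(\<lambda>(u, v). u \<otimes> v) ` ({\<one>} \<times> ?F) = ?F" using Dc(2) by (force simp: image_iff)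
      have "sumprod D ?F (e * n * (m div n) + 0) (1 * 1) (a [^] (n * (m div n)) \<otimes> a [^] (m mod n))"
        using sumprod_mult[OF pow[of "m div n"] b Dc(1,3,2)] unfolding im .
      then have "sumprod D ?F (e * (n * (m div n))) 1 (a [^] m)"
        using ac by (simp add: nat_pow_mult mult.assoc)
      then have "sumprod D ?F (e * m) 1 (a [^] m)"
        by (rule sumprod_pad[OF _ D(3) Dc(1,2)]) (simp add: mult_le_mono2)
      then show ?thesis by simp
    qed
    then show ?thesis unfolding power_bounded_def using aE
      by (intro exI[of _ ?F] exI[of _ 1]) auto
  qed
  then have "{a \<in> E. \<exists>n>0. sumprod D {\<one>} (e * n) 1 (a [^] n)} \<subseteq> {a \<in> E. power_bounded E D e 1 a}" by blast
  moreover have "finite {a \<in> E. power_bounded E D e 1 a}" using E(2) D unfolding northcott_def by blast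
  ultimately show ?thesis by (rule finite_subset)
qed

end

section \<open>Roots of prime exponent\<close>

context algebraically_closed
begin

lemma eval_in_subring:
  assumes "subring K L" "x \<in> K"
  shows "set p \<subseteq> K \<Longrightarrow> eval p x \<in> K"
proof (induction p)
  case (Cons a p)
  have "x [^] n \<in> K" for n :: nat
    by (induction n) (use assms(2) subringE(3,6)[OF assms(1)] in auto)
  then show ?case using Cons subringE(6,7)[OF assms(1)] by simp
qed (use subringE(2)[OF assms(1)] in simp)

lemma pow_in_subring: "subring K L \<Longrightarrow> x \<in> K \<Longrightarrow> x [^] (n::nat) \<in> K"
  by (induction n) (use subringE(3,6) in auto)

lemma degree_Irr_le:
  assumes K: "subfield K L" and z: "z \<in> carrier L" and q: "q \<in> carrier (K[X])" "q \<noteq> []" "eval q z = \<zero>"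
  shows "(algebraic over K) z" "degree (Irr K z) \<le> degree q"
    "\<And>y. y \<in> carrier L \<Longrightarrow> eval (Irr K z) y = \<zero> \<Longrightarrow> eval q y = \<zero>"
    "\<And>y. degree (Irr K z) = degree q \<Longrightarrow> y \<in> carrier L \<Longrightarrow> eval q y = \<zero> \<Longrightarrow> eval (Irr K z) y = \<zero>"
proof -
  have Ks: "subring K L" using subfieldE(1)[OF K] .
  interpret UP: domain "K[X]" by (rule univ_poly_is_domain[OF Ks])
  show alg: "(algebraic over K) z" using algebraicI[OF q] by (simp add: over_def)
  note I = IrrE[OF K z alg]
  have div: "Irr K z pdivides q" by (rule Irr_minimal[OF K z alg q(1,3)])
  show deg: "degree (Irr K z) \<le> degree q"
    by (rule pdivides_imp_degree_le[OF Ks I(1) q(1,2) div])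
  obtain w where w: "w \<in> carrier (K[X])" "q = Irr K z \<otimes>\<^bsub>K[X]\<^esub> w"
    using div pdivides_iff_shell[OF K I(1) q(1)] unfolding factor_def by auto
  have ev: "eval q y = eval (Irr K z) y \<otimes> eval w y" if y: "y \<in> carrier L" for y
  proof -
    interpret ev: ring_hom_cring "K[X]" L "\<lambda>p. eval p y" by (rule eval_cring_hom[OF Ks y])
    show ?thesis using w I(1) by simp
  qed
  have wc: "eval w y \<in> carrier L" if y: "y \<in> carrier L" for y
  proof -
    interpret ev: ring_hom_cring "K[X]" L "\<lambda>p. eval p y" by (rule eval_cring_hom[OF Ks y])
    show ?thesis using w by simp
  qed
  have Ic: "eval (Irr K z) y \<in> carrier L" if y: "y \<in> carrier L" for y
  proof -
    interpret ev: ring_hom_cring "K[X]" L "\<lambda>p. eval p y" by (rule eval_cring_hom[OF Ks y])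
    show ?thesis using I by simp
  qed
  show "eval q y = \<zero>" if "y \<in> carrier L" "eval (Irr K z) y = \<zero>" for y
    using ev[OF that(1)] wc[OF that(1)] that by simp
  show "eval (Irr K z) y = \<zero>" if d: "degree (Irr K z) = degree q" and y: "y \<in> carrier L" "eval q y = \<zero>" for y
  proof -
    have wn: "w \<noteq> []" using w q(2) UP.r_null[OF I(1)] by (auto simp: univ_poly_zero)
    have In: "Irr K z \<noteq> []" using w q(2) UP.l_null[OF w(1)] by (auto simp: univ_poly_zero)
    have "degree q = degree (Irr K z) + degree w"
      using poly_mult_degree_eq[OF Ks, of "Irr K z" w] I(1) w wn In
      by (simp add: univ_poly_mult univ_poly_carrier)
    then obtain k where k: "w = [k]" using d wn by (cases w) auto
    have "k \<noteq> \<zero>" "k \<in> carrier L"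
      using w(1) subringE(1)[OF Ks] unfolding k by (auto simp: univ_poly_carrier[symmetric] polynomial_def)
    moreover have "eval w y = k" using k calculation y by simp
    ultimately show ?thesis using ev[OF y(1)] y(2) Ic[OF y(1)] by (metis integral)
  qed
qed

lemma binomial_poly:
  assumes K: "subfield K L" and c: "c \<in> K" and n: "n > 0"
  obtains q where "q \<in> carrier (K[X])" "q \<noteq> []" "degree q \<le> n"
    "\<And>y. y \<in> carrier L \<Longrightarrow> eval q y = y [^] n \<ominus> c"
proof -
  have Ks: "subring K L" and Kc: "K \<subseteq> carrier L" using subfieldE[OF K] by auto
  have m: "monom \<one> n \<in> carrier (K[X])"
    using subringE(2,3)[OF Ks] by (auto simp: monom_def univ_poly_carrier[symmetric] polynomial_def)
  have k: "poly_of_const c \<in> carrier (K[X])"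
    using c by (auto simp: poly_of_const_def univ_poly_carrier[symmetric] polynomial_def)
  have "length (poly_of_const c) \<le> 1" by (simp add: poly_of_const_def)
  moreover have "length (monom \<one> n) = Suc n" by (simp add: monom_def)
  ultimately have ne: "monom \<one> n \<noteq> poly_of_const c" using n by auto
  obtain h where h: "h \<in> carrier (K[X])" "\<And>x. x \<in> carrier L \<Longrightarrow> eval h x = eval (monom \<one> n) x \<ominus> eval (poly_of_const c) x"
    "h \<noteq> []" "degree h \<le> max (degree (monom \<one> n)) (degree (poly_of_const c))"
    using poly_diff[OF Ks m k] ne by auto
  show thesis
  proof (rule that[OF h(1,3)])
    show "degree h \<le> n" using h(4) by (simp add: monom_def poly_of_const_def)
    show "eval h y = y [^] n \<ominus> c" if "y \<in> carrier L" for y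
      using h(2)[OF that] that c Kc eval_monom[of \<one> y n] by (auto simp: poly_of_const_def)
  qed
qed

lemma root_algebraic:
  assumes K: "subfield K L" and z: "z \<in> carrier L" "z [^] n \<in> K" and n: "(n::nat) > 0"
  shows "(algebraic over K) z" "degree (Irr K z) \<le> n"
    "\<And>y. y \<in> carrier L \<Longrightarrow> eval (Irr K z) y = \<zero> \<Longrightarrow> y [^] n = z [^] n"
    "\<And>y. degree (Irr K z) = n \<Longrightarrow> y \<in> carrier L \<Longrightarrow> y [^] n = z [^] n \<Longrightarrow> eval (Irr K z) y = \<zero>"
proof -
  obtain q where q: "q \<in> carrier (K[X])" "q \<noteq> []" "degree q \<le> n"
    "\<And>y. y \<in> carrier L \<Longrightarrow> eval q y = y [^] n \<ominus> z [^] n"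
    by (rule binomial_poly[OF K z(2) n]) (rule that)
  have q0: "eval q z = \<zero>" using q(4)[OF z(1)] z(1) by (simp add: a_minus_def r_neg)
  note d = degree_Irr_le[OF K z(1) q(1,2) q0]
  show "(algebraic over K) z" by (rule d(1))
  show "degree (Irr K z) \<le> n" using d(2) q(3) by simp
  show "y [^] n = z [^] n" if "y \<in> carrier L" "eval (Irr K z) y = \<zero>" for y
    using d(3)[OF that] q(4)[OF that(1)] that(1) z(1) by (simp add: r_right_minus_eq)
  show "eval (Irr K z) y = \<zero>" if "degree (Irr K z) = n" "y \<in> carrier L" "y [^] n = z [^] n" for y
    using d(4)[OF _ that(2)] d(2) q(3) q(4)[OF that(2)] that z(1) by (simp add: a_minus_def r_neg)
qed

lemma prodl_pow:
  "(\<And>x. x \<in> set xs \<Longrightarrow> f x \<in> carrier L) \<Longrightarrow> prodl f xs [^] (n::nat) = prodl (\<lambda>x. f x [^] n) xs"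
  by (induction xs) (auto simp: nat_pow_distrib)

lemma inv_pow_field:
  assumes "x \<in> carrier L" "x \<noteq> \<zero>" shows "inv x [^] (n::nat) = inv (x [^] n)"
proof -
  have "x [^] n \<otimes> inv x [^] n = \<one>"
    using assms by (simp add: nat_pow_distrib[symmetric])
  then show ?thesis using assms by (metis comm_inv_char inv_nonzero(1) nat_pow_closed)
qed

text \<open>The product of the conjugates of \<open>z\<close> lies in \<open>K\<close> and equals
  \<open>\<eta>' z^s\<close> with \<open>s\<close> the degree of \<open>z\<close> and
  \<open>\<eta>'\<close> a \<open>p\<close>-th root of unity. If \<open>s < p\<close>, then
  \<open>s\<close> is invertible modulo \<open>p\<close>, and a power of this element is
  \<open>\<eta> z\<close> up to a power of \<open>z^p\<close>.\<close>

lemma prime_root_degree: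
  assumes K: "subfield K L" and z: "z \<in> carrier L" "z \<noteq> \<zero>" and p: "Factorial_Ring.prime p" and zp: "z [^] p \<in> K"
  shows "degree (Irr K z) = p \<or> (\<exists>\<eta>\<in>carrier L. \<eta> [^] p = \<one> \<and> \<eta> \<otimes> z \<in> K)"
proof -
  have Ks: "subring K L" and Kc: "K \<subseteq> carrier L" using subfieldE[OF K] by auto
  have p0: "p > 0" using p by (simp add: prime_gt_0_nat)
  note ra = root_algebraic[OF K z(1) zp p0]
  let ?P = "Irr K z"
  note P = IrrE[OF K z(1) ra(1)]
  have Pn: "?P \<noteq> []" and deg1: "degree ?P \<ge> 1" using pirreducible_degree[OF K P(1,2)] by auto
  obtain rs where rs: "set rs \<subseteq> carrier L" "length rs = degree ?P"
    "\<And>x. x \<in> carrier L \<Longrightarrow> eval ?P x = lead_coeff ?P \<otimes> prodl (\<lambda>y. x \<ominus> y) rs"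
    by (rule poly_factors[OF carrier_polynomial_shell[OF Ks P(1)] Pn]) (rule that)
  let ?s = "length rs"
  have yp: "y [^] p = z [^] p" if y: "y \<in> set rs" for y
  proof -
    have yc: "y \<in> carrier L" using y rs by auto
    have "prodl (\<lambda>z. y \<ominus> z) rs = \<zero>"
      using y rs(1) yc by (intro prodl_zero[of y]) (auto simp: r_right_minus_eq)
    then show ?thesis using rs(3)[OF yc] P(3) ra(3)[OF yc] by simp
  qed
  define \<eta> where "\<eta> y = y \<otimes> inv z" for y
  have eta: "\<eta> y \<in> carrier L" "\<eta> y [^] p = \<one>" "y = \<eta> y \<otimes> z" if y: "y \<in> set rs" for y
  proof -
    have yc: "y \<in> carrier L" using y rs by auto
    show "\<eta> y \<in> carrier L" "y = \<eta> y \<otimes> z" using yc z by (auto simp: \<eta>_def m_assoc)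
    have "z [^] p \<noteq> \<zero>" using pow_nonzero[OF z] .
    then show "\<eta> y [^] p = \<one>"
      using yc z yp[OF y] by (simp add: \<eta>_def nat_pow_distrib inv_pow_field)
  qed
  let ?\<eta> = "prodl \<eta> rs"
  have eta0: "?\<eta> \<in> carrier L" using eta by simp
  have "?\<eta> [^] p = prodl (\<lambda>y. \<one>) rs" using eta by (simp add: prodl_pow cong: prodl_cong)
  then have eta1: "?\<eta> [^] p = \<one>" by (simp add: prodl_const)
  have pr: "prodl (\<lambda>y. y) rs = ?\<eta> \<otimes> z [^] ?s"
  proof -
    have "prodl (\<lambda>y. y) rs = prodl (\<lambda>y. \<eta> y \<otimes> z) rs" by (rule prodl_cong) (use eta(3) in auto)
    then show ?thesis using eta z by (simp add: prodl_mult prodl_const)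
  qed
  have prK: "?\<eta> \<otimes> z [^] ?s \<in> K"
  proof -
    have "eval ?P \<zero> \<in> K"
      by (rule eval_in_subring[OF Ks subringE(2)[OF Ks]])
        (use P(1) in \<open>auto simp: univ_poly_carrier[symmetric] polynomial_def\<close>)
    have rsc: "prodl (\<lambda>y. y) rs \<in> carrier L" by (rule prodl_closed) (use rs in auto)
    have "eval ?P \<zero> = prodl (\<lambda>y. \<zero> \<ominus> y) rs"
      using rs(3)[OF zero_closed] P(3) prodl_closed[of rs "\<lambda>y. \<zero> \<ominus> y"] rs(1) by (auto simp: subset_iff)
    also have "\<dots> = prodl (\<lambda>y. \<ominus> \<one> \<otimes> y) rs"
      by (rule prodl_cong) (use rs in \<open>auto simp: a_minus_def l_minus subset_iff\<close>)
    also have "\<dots> = (\<ominus> \<one>) [^] ?s \<otimes> prodl (\<lambda>y. y) rs"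
      using rs by (subst prodl_mult) (auto simp: prodl_const)
    finally have e: "eval ?P \<zero> = (\<ominus> \<one>) [^] ?s \<otimes> prodl (\<lambda>y. y) rs" .
    have m1: "(\<ominus> \<one>) [^] ?s \<in> K" using pow_in_subring[OF Ks] subringE(3,5)[OF Ks] by auto
    have "(\<ominus> \<one>) [^] ?s \<otimes> (\<ominus> \<one>) [^] ?s = ((\<ominus> \<one>) \<otimes> (\<ominus> \<one>)) [^] ?s"
      by (simp add: nat_pow_distrib)
    then have "(\<ominus> \<one>) [^] ?s \<otimes> (\<ominus> \<one>) [^] ?s = \<one>" by (simp add: l_minus r_minus)
    then have "prodl (\<lambda>y. y) rs = (\<ominus> \<one>) [^] ?s \<otimes> eval ?P \<zero>"
      unfolding e using rsc by (simp add: m_assoc[symmetric])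
    then show ?thesis using subringE(6)[OF Ks m1 \<open>eval ?P \<zero> \<in> K\<close>] pr by simp
  qed
  show ?thesis
  proof (cases "?s = p")
    case True then show ?thesis using rs(2) by simp
  next
    case False
    then have s: "0 < ?s" "?s < p" using ra(2) rs(2) deg1 by auto
    then have "coprime ?s p" using p by (metis coprime_commute prime_imp_coprime_nat nat_dvd_not_less)
    then obtain u w where uw: "?s * u = p * w + 1"
      using bezout_nat[of ?s p] s by (auto simp: coprime_iff_gcd_eq_1)
    let ?e = "?\<eta> [^] u" let ?c = "(z [^] p) [^] w"
    have cK: "?c \<in> K" "?c \<noteq> \<zero>" "?c \<in> carrier L"
      using pow_in_subring[OF Ks zp] pow_nonzero[of "z [^] p"] pow_nonzero[OF z] z by auto
    have "(?\<eta> \<otimes> z [^] ?s) [^] u = ?e \<otimes> z [^] (p * w + 1)"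
      using eta0 z uw by (simp add: nat_pow_distrib nat_pow_pow)
    also have "\<dots> = ?c \<otimes> (?e \<otimes> z)"
      using eta0 z by (simp add: nat_pow_mult[symmetric] nat_pow_pow m_ac)
    finally have "?c \<otimes> (?e \<otimes> z) \<in> K" using pow_in_subring[OF Ks prK] by metis
    then have "?e \<otimes> z \<in> K"
      using subfield_m_inv_simprule[OF K, of ?c "?e \<otimes> z"] cK eta0 z by auto
    moreover have "?e [^] p = \<one>"
    proof -
      have "?e [^] p = (?\<eta> [^] p) [^] u" using eta0 by (simp add: nat_pow_pow mult.commute)
      then show ?thesis using eta1 by simp
    qed
    ultimately show ?thesis using eta0 by blast
  qed
qed

lemma lin_independent_reindex:
  assumes K: "subfield K L" and ind: "lin_independent K J v" and J: "finite J" "v \<in> J \<rightarrow> carrier L"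
    and s: "s \<in> I \<rightarrow> J" "inj_on s I" and e: "\<And>i. i \<in> I \<Longrightarrow> e i \<in> K - {\<zero>}"
    and c: "\<And>i. i \<in> I \<Longrightarrow> c i = e i \<otimes> v (s i)"
  shows "lin_independent K I c"
  unfolding lin_independent_def
proof (intro ballI impI)
  fix f i assume f: "f \<in> I \<rightarrow> K" and eq: "(\<Oplus>i\<in>I. f i \<otimes> c i) = \<zero>" and i: "i \<in> I"
  have Ks: "subring K L" and Kc: "K \<subseteq> carrier L" using subfieldE[OF K] by auto
  define F where "F j = (if j \<in> s ` I then f (inv_into I s j) \<otimes> e (inv_into I s j) else \<zero>)" for j
  have Fs: "F (s i) = f i \<otimes> e i" if "i \<in> I" for i
    using that inv_into_f_f[OF s(2) that] by (simp add: F_def)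
  have FK: "F j \<in> K" for j
    using f e subringE(2,6)[OF Ks] inv_into_into[of j s I] by (auto simp: F_def Pi_iff)
  have FKc: "F j \<in> carrier L" and F0: "j \<notin> s ` I \<Longrightarrow> F j = \<zero>" for j
    using FK[of j] Kc by (auto simp: F_def)
  have "(\<Oplus>j\<in>J. F j \<otimes> v j) = (\<Oplus>j\<in>s ` I. F j \<otimes> v j)"
    by (rule add.finprod_mono_neutral_cong_right) (use J s FKc F0 in \<open>auto simp: Pi_iff\<close>)
  also have "\<dots> = (\<Oplus>i\<in>I. F (s i) \<otimes> v (s i))"
    by (rule finsum_reindex[OF _ s(2)]) (use FKc J(2) s(1) in \<open>auto simp: Pi_iff\<close>)
  also have "\<dots> = (\<Oplus>i\<in>I. f i \<otimes> c i)"
  proof (rule finsum_cong')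
    fix i assume i: "i \<in> I"
    have "f i \<in> carrier L" "e i \<in> carrier L" "v (s i) \<in> carrier L"
      using f e[OF i] i J(2) s(1) Kc by (auto simp: Pi_iff)
    then show "F (s i) \<otimes> v (s i) = f i \<otimes> c i" using Fs[OF i] c[OF i] by (simp add: m_assoc)
  qed (use f e c J(2) s(1) Kc in \<open>auto simp: Pi_iff subset_iff\<close>)
  finally have "(\<Oplus>j\<in>J. F j \<otimes> v j) = \<zero>" using eq by simp
  moreover have "F \<in> J \<rightarrow> K" using FK by auto
  moreover have "s i \<in> J" using s(1) i by auto
  ultimately have "F (s i) = \<zero>" using ind unfolding lin_independent_def by blast
  then have "f i \<otimes> e i = \<zero>" using Fs[OF i] by simp
  moreover have "f i \<in> carrier L" "e i \<in> carrier L" "e i \<noteq> \<zero>" using f e[OF i] i Kc by auto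
  ultimately show "f i = \<zero>" using integral by blast
qed

lemma power_basis:
  assumes K: "subfield K L" and z: "z \<in> carrier L" "(algebraic over K) z" and n: "degree (Irr K z) = n"
  shows "lin_independent K {..<n} (\<lambda>s. z [^] s)"
    "\<And>y. y \<in> simple_extension K z \<Longrightarrow> \<exists>k\<in>{..<n} \<rightarrow> K. y = (\<Oplus>s\<in>{..<n}. k s \<otimes> z [^] s)"
proof -
  have Ks: "subring K L" and Kc: "K \<subseteq> carrier L" using subfieldE[OF K] by auto
  let ?U = "exp_base z n"
  have len: "length ?U = n" and nth: "\<And>i. i < n \<Longrightarrow> ?U ! i = z [^] (n - 1 - i)"
    by (auto simp: exp_base_def rev_nth)
  have Uc: "set ?U \<subseteq> carrier L" using exp_base_closed[OF z(1)] .
  have ind: "lin_independent K {..<n} (\<lambda>i. ?U ! i)"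
    using independent_imp_lin_independent[OF K exp_base_independent[OF K z]] n len by simp
  show "lin_independent K {..<n} (\<lambda>s. z [^] s)"
  proof (rule lin_independent_reindex[OF K ind, where s = "\<lambda>i. n - 1 - i" and e = "\<lambda>_. \<one>"])
    show "inj_on (\<lambda>i. n - 1 - i) {..<n}" by (rule inj_onI) auto
    fix i assume "i \<in> {..<n}"
    then show "z [^] i = \<one> \<otimes> ?U ! (n - 1 - i)" using nth[of "n - 1 - i"] z by simp
  qed (use Uc len subringE(3)[OF Ks] in auto)
  fix y assume "y \<in> simple_extension K z"
  then have "y \<in> Span K ?U" using Span_exp_base[OF K z] n by simp
  then obtain Ks' where Ks': "set Ks' \<subseteq> K" "length Ks' = length ?U" "y = combine Ks' ?U"
    using Span_mem_iff_length_version[OF K Uc] by auto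
  have kc: "Ks' ! i \<in> K" if "i < n" for i using Ks' len that by auto
  have "y = (\<Oplus>i\<in>{..<n}. Ks' ! i \<otimes> ?U ! i)"
    using combine_eq_finsum[OF Ks'(2) _ Uc] Ks' Kc len by auto
  also have "{..<n} = (\<lambda>i. n - 1 - i) ` {..<n}"
  proof (intro equalityI subsetI)
    fix x assume "x \<in> {..<n}"
    then show "x \<in> (\<lambda>i. n - 1 - i) ` {..<n}" by (intro image_eqI[of _ _ "n - 1 - x"]) auto
  qed auto
  also have "(\<Oplus>i\<in>(\<lambda>i. n - 1 - i) ` {..<n}. Ks' ! i \<otimes> ?U ! i) =
      (\<Oplus>s\<in>{..<n}. Ks' ! (n - 1 - s) \<otimes> ?U ! (n - 1 - s))"
    by (rule finsum_reindex) (use kc Kc nth z in \<open>auto intro!: inj_onI m_closed\<close>)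
  also have "\<dots> = (\<Oplus>s\<in>{..<n}. Ks' ! (n - 1 - s) \<otimes> z [^] s)"
  proof (rule finsum_cong')
    fix s assume "s \<in> {..<n}"
    then show "Ks' ! (n - 1 - s) \<otimes> ?U ! (n - 1 - s) = Ks' ! (n - 1 - s) \<otimes> z [^] s"
      using nth[of "n - 1 - s"] by simp
  qed (use kc Kc z in \<open>auto simp: subset_iff\<close>)
  finally show "\<exists>k\<in>{..<n} \<rightarrow> K. y = (\<Oplus>s\<in>{..<n}. k s \<otimes> z [^] s)"
    using kc by (intro bexI[of _ "\<lambda>s. Ks' ! (n - 1 - s)"]) auto
qed

lemma prime_order_injective:
  fixes p i j :: nat
  assumes p: "Factorial_Ring.prime p" and z: "\<zeta> \<in> carrier L" "\<zeta> [^] p = \<one>" "\<zeta> \<noteq> \<one>"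
    and ij: "i < p" "j < p" "\<zeta> [^] i = \<zeta> [^] j"
  shows "i = j"
proof -
  have p2: "p \<ge> 2" using prime_ge_2_nat[OF p] .
  have z0: "\<zeta> \<noteq> \<zero>" using z(2) p2 one_not_zero by (auto simp: nat_pow_zero)
  have order: False if d: "0 < d" "d < p" "\<zeta> [^] d = \<one>" for d
  proof -
    have "coprime d p" using p d by (metis coprime_commute prime_imp_coprime_nat nat_dvd_not_less)
    then obtain u w where uw: "d * u = p * w + 1"
      using bezout_nat[of d p] d by (auto simp: coprime_iff_gcd_eq_1)
    have "\<zeta> [^] (d * u) = \<one>" using z(1) d(3) by (simp add: nat_pow_pow[symmetric])
    moreover have "\<zeta> [^] (p * w + 1) = \<zeta>" using z by (simp add: nat_pow_mult[symmetric] nat_pow_pow[symmetric])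
    ultimately show False using uw z(3) by simp
  qed
  have *: "i = j" if "i \<le> j" "j < p" "\<zeta> [^] i = \<zeta> [^] j" for i j
  proof (rule ccontr)
    assume "i \<noteq> j"
    have "\<zeta> [^] i \<otimes> \<zeta> [^] (j - i) = \<zeta> [^] j" using that(1) z(1) by (simp add: nat_pow_mult)
    then have "\<zeta> [^] i \<otimes> \<zeta> [^] (j - i) = \<zeta> [^] i \<otimes> \<one>" using that(3) z(1) by simp
    then have "\<zeta> [^] (j - i) = \<one>" using m_lcancel[OF pow_nonzero[OF z(1) z0]] z(1) by (meson nat_pow_closed one_closed)
    then show False using order[of "j - i"] less_imp_diff_less[OF that(2), of i] that(1) \<open>i \<noteq> j\<close> by simp
  qed
  show ?thesis using *[of i j] *[of j i] ij by (cases "i \<le> j") auto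
qed

text \<open>A zero of \<open>1 + X + ... + X^(p-1)\<close>; this polynomial also bounds the degree of the
  root over every subfield. It is not \<open>1\<close> because \<open>p\<close> is not the
  characteristic.\<close>

lemma primitive_root_of_unity:
  assumes p: "Factorial_Ring.prime p" and char: "[p] \<cdot> \<one> \<noteq> \<zero>"
  obtains \<zeta> where "\<zeta> \<in> carrier L" "\<zeta> [^] p = \<one>" "\<And>i j. i < p \<Longrightarrow> j < p \<Longrightarrow> \<zeta> [^] i = \<zeta> [^] j \<Longrightarrow> i = j"
    "\<And>K. subfield K L \<Longrightarrow> (algebraic over K) \<zeta> \<and> degree (Irr K \<zeta>) < p"
proof -
  have p2: "p \<ge> 2" using prime_ge_2_nat[OF p] .
  let ?q = "replicate p \<one>"
  have qK: "?q \<in> carrier (K[X])" if "subring K L" for K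
    using subringE(3)[OF that] by (cases p) (auto simp: univ_poly_carrier[symmetric] polynomial_def)
  have qn: "?q \<noteq> []" using p2 by auto
  have ev: "eval (replicate n \<one>) x \<otimes> (x \<ominus> \<one>) = x [^] n \<ominus> \<one> \<and> eval (replicate n \<one>) x \<in> carrier L"
    if x: "x \<in> carrier L" for x n
  proof (induction n)
    case 0 show ?case using x by (simp add: a_minus_def r_neg)
  next
    case (Suc n)
    have "eval (replicate (Suc n) \<one>) x \<otimes> (x \<ominus> \<one>) = x [^] n \<otimes> (x \<ominus> \<one>) \<oplus> eval (replicate n \<one>) x \<otimes> (x \<ominus> \<one>)"
      using x Suc by (simp add: l_distr)
    also have "\<dots> = (x [^] n \<otimes> x \<ominus> x [^] n) \<oplus> (x [^] n \<ominus> \<one>)"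
      using x Suc by (simp add: a_minus_def r_distr r_minus)
    also have "\<dots> = x [^] Suc n \<ominus> \<one>"
      using x by (simp add: a_minus_def a_assoc r_neg1)
    finally show ?case using Suc x by simp
  qed
  have e1: "eval (replicate n \<one>) \<one> = [n] \<cdot> \<one>" for n
    by (induction n) (auto simp: a_comm)
  obtain rs where rs: "set rs \<subseteq> carrier L" "length rs = degree ?q"
    "\<And>x. x \<in> carrier L \<Longrightarrow> eval ?q x = lead_coeff ?q \<otimes> prodl (\<lambda>y. x \<ominus> y) rs"
    by (rule poly_factors[OF qK[OF carrier_is_subring] qn]) (rule that)
  then obtain \<zeta> where z: "\<zeta> \<in> set rs" using p2 by (cases rs) auto
  have zc: "\<zeta> \<in> carrier L" using z rs by auto
  have "prodl (\<lambda>y. \<zeta> \<ominus> y) rs = \<zero>"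
    using z rs(1) zc by (intro prodl_zero[of \<zeta>]) (auto simp: r_right_minus_eq)
  then have root: "eval ?q \<zeta> = \<zero>" using rs(3)[OF zc] p2 by (cases p) auto
  have "\<zero> \<otimes> (\<zeta> \<ominus> \<one>) = \<zeta> [^] p \<ominus> \<one>" using ev[OF zc, of p] unfolding root by blast
  then have "\<zeta> [^] p \<ominus> \<one> = \<zero>" using zc by simp
  then have zp: "\<zeta> [^] p = \<one>" using zc by (simp add: r_right_minus_eq)
  have z1: "\<zeta> \<noteq> \<one>" using root e1[of p] char by auto
  note inj = prime_order_injective[OF p zc zp z1]
  have "(algebraic over K) \<zeta> \<and> degree (Irr K \<zeta>) < p" if K: "subfield K L" for K
    using degree_Irr_le[OF K zc qK[OF subfieldE(1)[OF K]] qn root] p2 by auto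
  then show thesis using that[OF zc zp inj] by blast
qed

end

section \<open>Kummer extensions of prime degree\<close>

text \<open>The order of the roots of unity that Kummer theory needs for radicals of \<open>p\<close>-power
  exponent: for \<open>p = 2\<close> square roots of unity do not suffice, as \<open>(1 + i)^4 =
  -4\<close> shows.\<close>

definition root_exponent :: "nat \<Rightarrow> nat" where
  "root_exponent p = (if p = 2 then 4 else p)"

context algebraically_closed
begin

lemma additive_finsum:
  assumes E: "subring E L" and I: "finite I" and f: "f \<in> I \<rightarrow> E"
    and h: "\<And>x y. x \<in> E \<Longrightarrow> y \<in> E \<Longrightarrow> h (x \<oplus> y) = h x \<oplus> h y" "h \<zero> = \<zero>" "\<And>x. x \<in> E \<Longrightarrow> h x \<in> carrier L"
  shows "h (\<Oplus>i\<in>I. f i) = (\<Oplus>i\<in>I. h (f i))"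
  using I f
proof (induction I rule: finite_induct)
  case empty then show ?case using h by simp
next
  case (insert i I)
  have fc: "f i \<in> E" "f \<in> I \<rightarrow> E" using insert by auto
  have s: "(\<Oplus>i\<in>I. f i) \<in> E" by (rule finsum_in_subring[OF E]) (use fc in auto)
  have Ec: "E \<subseteq> carrier L" using subringE(1)[OF E] .
  have "(\<Oplus>i\<in>insert i I. f i) = f i \<oplus> (\<Oplus>i\<in>I. f i)"
    using insert fc Ec by (intro finsum_insert) auto
  moreover have "(\<Oplus>i\<in>insert i I. h (f i)) = h (f i) \<oplus> (\<Oplus>i\<in>I. h (f i))"
    using insert fc h(3) by (intro finsum_insert) (auto simp: Pi_iff)
  ultimately show ?case using h(1)[OF fc(1) s] insert.IH[OF fc(2)] by simp
qed

text \<open>As \<open>g\<close> has degree \<open>p\<close>, its minimal polynomial is \<open>X^p -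
  g^p\<close>, and \<open>\<zeta> g\<close> is another zero; so there is a conjugation sending
  \<open>g\<close> to \<open>\<zeta> g\<close>.\<close>

lemma kummer_automorphism:
  assumes V: "subfield V L" and p: "Factorial_Ring.prime p" and g: "g \<in> carrier L" "g [^] p \<in> V" and deg: "degree (Irr V g) = p"
    and z: "\<zeta> \<in> V" "\<zeta> [^] p = \<one>"
  defines "E \<equiv> simple_extension V g"
  obtains \<sigma> where "\<And>x y. x \<in> E \<Longrightarrow> y \<in> E \<Longrightarrow> \<sigma> (x \<otimes> y) = \<sigma> x \<otimes> \<sigma> y" "\<And>x. x \<in> E \<Longrightarrow> \<sigma> x \<in> E"
    "\<And>x. x \<in> V \<Longrightarrow> \<sigma> x = x"
    "\<And>a. a \<in> {..<p} \<rightarrow> V \<Longrightarrow> \<sigma> (\<Oplus>s\<in>{..<p}. a s \<otimes> g [^] s) = (\<Oplus>s\<in>{..<p}. (a s \<otimes> \<zeta> [^] s) \<otimes> g [^] s)"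
proof -
  have Vs: "subring V L" and Vc: "V \<subseteq> carrier L" using subfieldE[OF V] by auto
  have p0: "p > 0" using p by (simp add: prime_gt_0_nat)
  note ra = root_algebraic[OF V g p0]
  have zc: "\<zeta> \<in> carrier L" using z Vc by auto
  have Es: "subring E L" unfolding E_def by (rule simple_extension_is_subring[OF Vs g(1)])
  have Ec: "E \<subseteq> carrier L" using subringE(1)[OF Es] .
  have VE: "V \<subseteq> E" and gE: "g \<in> E"
    unfolding E_def using simple_extension_incl[OF Vc g(1)] simple_extension_mem[OF Vs g(1)] by auto
  have E: "E = (\<lambda>q. eval q g) ` carrier (V[X])"
    unfolding E_def by (rule simple_extension_as_eval_img[OF Vc g(1)])
  have zg: "\<zeta> \<otimes> g \<in> E" using subringE(6)[OF Es] VE gE z by auto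
  have root: "eval (Irr V g) (\<zeta> \<otimes> g) = \<zero>"
    by (rule ra(4)[OF deg]) (use zc g z in \<open>auto simp: nat_pow_distrib\<close>)
  obtain \<sigma> where hom: "\<sigma> \<in> ring_hom (L\<lparr>carrier := E\<rparr>) L"
    and ev: "\<And>q. q \<in> carrier (V[X]) \<Longrightarrow> \<sigma> (eval q g) = eval q (\<zeta> \<otimes> g)"
    using conjugation[OF V g(1) ra(1) _ root] zg Ec unfolding E_def by blast
  have mult: "\<sigma> (x \<otimes> y) = \<sigma> x \<otimes> \<sigma> y" and add: "\<sigma> (x \<oplus> y) = \<sigma> x \<oplus> \<sigma> y" if "x \<in> E" "y \<in> E" for x y
    using ring_hom_mult[OF hom, of x y] ring_hom_add[OF hom, of x y] that by auto
  have closed: "\<sigma> x \<in> E" if "x \<in> E" for x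
  proof -
    obtain q where q: "q \<in> carrier (V[X])" "x = eval q g" using \<open>x \<in> E\<close> unfolding E by auto
    have "set q \<subseteq> E" using q(1) VE by (auto simp: univ_poly_carrier[symmetric] polynomial_def)
    then show ?thesis using ev[OF q(1)] q(2) eval_in_subring[OF Es zg] by simp
  qed
  have fix_V: "\<sigma> x = x" if x: "x \<in> V" for x
  proof -
    have "poly_of_const x \<in> carrier (V[X])"
      using x by (auto simp: poly_of_const_def univ_poly_carrier[symmetric] polynomial_def)
    from ev[OF this] show ?thesis using x Vc g zc by (auto simp: poly_of_const_def split: if_splits)
  qed
  have sg: "\<sigma> g = \<zeta> \<otimes> g"
  proof -
    have "monom \<one> 1 \<in> carrier (V[X])"
      using subringE(2,3)[OF Vs] by (auto simp: monom_def univ_poly_carrier[symmetric] polynomial_def)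
    from ev[OF this] show ?thesis using g zc eval_monom[of \<one> g 1] eval_monom[of \<one> "\<zeta> \<otimes> g" 1] by simp
  qed
  have powE: "x [^] (n::nat) \<in> E" if "x \<in> E" for x n using pow_in_subring[OF Es that] .
  have spow: "\<sigma> (g [^] n) = \<zeta> [^] n \<otimes> g [^] n" for n :: nat
  proof (induction n)
    case 0 show ?case using fix_V[OF subringE(3)[OF Vs]] by simp
  next
    case (Suc n) then show ?case using mult[OF powE[OF gE] gE, of n] sg zc g(1) by (simp add: m_ac)
  qed
  show thesis
  proof (rule that[OF mult closed fix_V])
    fix a assume a: "a \<in> {..<p} \<rightarrow> V"
    have aE: "a s \<otimes> g [^] s \<in> E" if "s < p" for s
      using a that VE subringE(6)[OF Es _ powE[OF gE]] by auto
    have "\<sigma> (\<Oplus>s\<in>{..<p}. a s \<otimes> g [^] s) = (\<Oplus>s\<in>{..<p}. \<sigma> (a s \<otimes> g [^] s))"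
      by (rule additive_finsum[OF Es]) (use aE add closed Ec fix_V subringE(2)[OF Vs] in auto)
    also have "\<dots> = (\<Oplus>s\<in>{..<p}. (a s \<otimes> \<zeta> [^] s) \<otimes> g [^] s)"
    proof (rule finsum_cong')
      fix s assume s: "s \<in> {..<p}"
      then have as: "a s \<in> V" "a s \<in> carrier L" using a Vc by auto
      then show "\<sigma> (a s \<otimes> g [^] s) = (a s \<otimes> \<zeta> [^] s) \<otimes> g [^] s"
        using mult[of "a s" "g [^] s"] powE[OF gE] VE fix_V spow zc g(1) by (auto simp: m_assoc)
    qed (use a Vc zc g in \<open>auto simp: Pi_iff subset_iff\<close>)
    finally show "\<sigma> (\<Oplus>s\<in>{..<p}. a s \<otimes> g [^] s) = (\<Oplus>s\<in>{..<p}. (a s \<otimes> \<zeta> [^] s) \<otimes> g [^] s)" .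
  qed auto
qed

text \<open>If \<open>x\<close> in \<open>V(g)\<close> has a \<open>p\<close>-power in \<open>V\<close>,
  then \<open>\<sigma> x = \<eta> x\<close> with \<open>\<eta>\<close> a root of unity of
  \<open>p\<close>-power order. If \<open>\<eta>\<close> lies in \<open>V\<close>, comparing
  coefficients in the basis \<open>1, g, ..., g^(p-1)\<close> shows that \<open>x\<close> has a
  single nonzero coefficient. That \<open>\<eta>\<close> lies in \<open>V\<close> is where the
  fourth roots of unity are needed for \<open>p = 2\<close>.\<close>

lemma kummer_step:
  assumes V: "subfield V L" and p: "Factorial_Ring.prime p" and char: "[p] \<cdot> \<one> \<noteq> \<zero>"
    and unity: "\<And>y. y \<in> carrier L \<Longrightarrow> y [^] root_exponent p = \<one> \<Longrightarrow> y \<in> V"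
    and g: "g \<in> carrier L" "g [^] p \<in> V" "g \<notin> V"
  shows "degree (Irr V g) = p"
    "\<And>x n. x \<in> simple_extension V g \<Longrightarrow> x \<noteq> \<zero> \<Longrightarrow> x [^] (p ^ n) \<in> V \<Longrightarrow> \<exists>s<p. \<exists>e\<in>V. x = e \<otimes> g [^] s"
proof -
  have Vs: "subring V L" and Vc: "V \<subseteq> carrier L" using subfieldE[OF V] by auto
  have p0: "p > 0" and p2: "p \<ge> 2" using p by (simp_all add: prime_gt_0_nat prime_ge_2_nat)
  have g0: "g \<noteq> \<zero>" using g subringE(2)[OF Vs] by auto
  have unity_p: "y \<in> V" if "y \<in> carrier L" "y [^] p = \<one>" for y
  proof (rule unity[OF that(1)])
    have "y [^] (4::nat) = \<one>" if "p = 2"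
    proof -
      have "y [^] (4::nat) = (y [^] p) [^] (2::nat)" using \<open>y \<in> carrier L\<close> \<open>p = 2\<close> by (simp add: nat_pow_pow)
      then show ?thesis using \<open>y [^] p = \<one>\<close> by simp
    qed
    then show "y [^] root_exponent p = \<one>" using that by (simp add: root_exponent_def)
  qed
  show deg: "degree (Irr V g) = p"
  proof (rule ccontr)
    assume "degree (Irr V g) \<noteq> p"
    then obtain \<eta> where e: "\<eta> \<in> carrier L" "\<eta> [^] p = \<one>" "\<eta> \<otimes> g \<in> V"
      using prime_root_degree[OF V g(1) g0 p g(2)] by auto
    have "\<eta> \<in> V" "\<eta> \<noteq> \<zero>" using unity_p e p0 by (auto simp: nat_pow_zero)
    then have "g \<in> V" using subfield_m_inv_simprule[OF V, of \<eta> g] e g by auto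
    with g show False by simp
  qed
  let ?E = "simple_extension V g"
  note ra = root_algebraic[OF V g(1,2) p0]
  have E: "subfield ?E L" using simple_extension_is_subfield[OF V g(1)] ra(1) by simp
  have Es: "subring ?E L" and Ec: "?E \<subseteq> carrier L" using subfieldE[OF E] by auto
  have VE: "V \<subseteq> ?E" using simple_extension_incl[OF Vc g(1)] .
  note basis = power_basis[OF V g(1) ra(1) deg]
  obtain \<zeta> where z: "\<zeta> \<in> carrier L" "\<zeta> [^] p = \<one>" "\<And>i j. i < p \<Longrightarrow> j < p \<Longrightarrow> \<zeta> [^] i = \<zeta> [^] j \<Longrightarrow> i = j"
    by (rule primitive_root_of_unity[OF p char]) (rule that)
  have zV: "\<zeta> \<in> V" using unity_p z by auto
  obtain \<sigma> where mult: "\<And>x y. x \<in> ?E \<Longrightarrow> y \<in> ?E \<Longrightarrow> \<sigma> (x \<otimes> y) = \<sigma> x \<otimes> \<sigma> y"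
    and closed: "\<And>x. x \<in> ?E \<Longrightarrow> \<sigma> x \<in> ?E" and fix_V: "\<And>x. x \<in> V \<Longrightarrow> \<sigma> x = x"
    and coords: "\<And>a. a \<in> {..<p} \<rightarrow> V \<Longrightarrow> \<sigma> (\<Oplus>s\<in>{..<p}. a s \<otimes> g [^] s) = (\<Oplus>s\<in>{..<p}. (a s \<otimes> \<zeta> [^] s) \<otimes> g [^] s)"
    by (rule kummer_automorphism[OF V p g(1,2) deg zV z(2)]) (rule that)
  have spow: "\<sigma> (x [^] n) = \<sigma> x [^] n" if "x \<in> ?E" for x and n :: nat
  proof (induction n)
    case 0 show ?case using fix_V[OF subringE(3)[OF Vs]] by simp
  next
    case (Suc n) then show ?case using mult[OF pow_in_subring[OF Es that] that, of n] by simp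
  qed
  have order: "(\<sigma> ^^ p) x = x" if x: "x \<in> ?E" for x
  proof -
    obtain a where a: "a \<in> {..<p} \<rightarrow> V" "x = (\<Oplus>s\<in>{..<p}. a s \<otimes> g [^] s)" using basis(2)[OF x] by auto
    have zs: "(\<zeta> [^] s) [^] i \<in> V" for s i :: nat using pow_in_subring[OF Vs pow_in_subring[OF Vs zV]] .
    have it: "(\<sigma> ^^ i) x = (\<Oplus>s\<in>{..<p}. (a s \<otimes> (\<zeta> [^] s) [^] i) \<otimes> g [^] s)" for i
    proof (induction i)
      case 0
      show ?case unfolding a(2) using a(1) Vc g by (auto intro!: finsum_cong' simp: Pi_iff subset_iff)
    next
      case (Suc i)
      have aV: "(\<lambda>s. a s \<otimes> (\<zeta> [^] s) [^] i) \<in> {..<p} \<rightarrow> V" using a(1) zs subringE(6)[OF Vs] by (auto simp: Pi_iff)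
      have "(\<sigma> ^^ Suc i) x = (\<Oplus>s\<in>{..<p}. ((a s \<otimes> (\<zeta> [^] s) [^] i) \<otimes> \<zeta> [^] s) \<otimes> g [^] s)"
        using Suc coords[OF aV] by simp
      also have "\<dots> = (\<Oplus>s\<in>{..<p}. (a s \<otimes> (\<zeta> [^] s) [^] Suc i) \<otimes> g [^] s)"
        by (rule finsum_cong') (use a(1) Vc g z in \<open>auto simp: Pi_iff subset_iff m_assoc\<close>)
      finally show ?case .
    qed
    have "(\<zeta> [^] s) [^] p = \<one>" for s :: nat
    proof -
      have "(\<zeta> [^] s) [^] p = (\<zeta> [^] p) [^] s" using z(1) by (simp add: nat_pow_pow mult.commute)
      then show ?thesis using z(2) by simp
    qed
    then have "(\<sigma> ^^ p) x = (\<Oplus>s\<in>{..<p}. a s \<otimes> g [^] s)"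
      unfolding it by (intro finsum_cong') (use a(1) Vc g in \<open>auto simp: Pi_iff subset_iff\<close>)
    then show ?thesis using a by simp
  qed
  fix x n assume x: "x \<in> ?E" "x \<noteq> \<zero>" "x [^] (p ^ n) \<in> V"
  have xc: "x \<in> carrier L" using x Ec by auto
  have sxc: "\<sigma> x \<in> carrier L" using closed[OF x(1)] Ec by auto
  have spx: "\<sigma> x [^] (p ^ n) = x [^] (p ^ n)" using spow[OF x(1)] fix_V[OF x(3)] by simp
  define \<eta> where "\<eta> = \<sigma> x \<otimes> inv x"
  have ec: "\<eta> \<in> carrier L" and sx: "\<sigma> x = \<eta> \<otimes> x" using sxc xc x(2) by (auto simp: \<eta>_def m_assoc)
  have eE: "\<eta> \<in> ?E" unfolding \<eta>_def using closed[OF x(1)] subfield_inv[OF E x(1,2)] subringE(6)[OF Es] by auto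
  have epn: "\<eta> [^] (p ^ n) = \<one>"
    unfolding \<eta>_def using spx sxc xc x(2) pow_nonzero[OF xc x(2)]
    by (simp add: nat_pow_distrib inv_pow_field)
  have eV: "\<eta> \<in> V"
  proof (rule ccontr)
    assume nV: "\<eta> \<notin> V"
    (* Replacing \<eta> by the last power \<theta> outside V, and x by the same power y, reduces to
       a root of unity with \<theta>^p in V. Since \<sigma> has order p, iterating \<sigma> y =
       \<theta> y yields \<epsilon>^(p(p-1)/2) \<theta>^p = 1. *)
    define t where "t = (LEAST t. \<eta> [^] (p ^ t) \<in> V)"
    have tV: "\<eta> [^] (p ^ t) \<in> V"
      unfolding t_def by (rule LeastI[of _ n]) (use epn subringE(3)[OF Vs] in simp)
    have "t \<noteq> 0" using tV nV ec by (metis nat_pow_eone power_0)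
    then obtain t' where t': "t = Suc t'" using not0_implies_Suc by blast
    let ?m = "p ^ t'"
    define \<theta> where "\<theta> = \<eta> [^] ?m"
    have thV: "\<theta> \<notin> V" unfolding \<theta>_def using not_less_Least[of t' "\<lambda>t. \<eta> [^] (p ^ t) \<in> V"] t' unfolding t_def by auto
    have thp: "\<theta> [^] p \<in> V" unfolding \<theta>_def using tV t' ec by (simp add: nat_pow_pow mult.commute)
    have thE: "\<theta> \<in> ?E" "\<theta> \<in> carrier L" unfolding \<theta>_def using pow_in_subring[OF Es eE] ec by auto
    have th0: "\<theta> \<noteq> \<zero>" using thV subringE(2)[OF Vs] by auto
    define y where "y = x [^] ?m"
    have y: "y \<in> ?E" "y \<in> carrier L" "y \<noteq> \<zero>" unfolding y_def using pow_in_subring[OF Es x(1)] xc pow_nonzero[OF xc x(2)] by auto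
    have sy: "\<sigma> y = \<theta> \<otimes> y" unfolding y_def \<theta>_def using spow[OF x(1)] sx ec xc by (simp add: nat_pow_distrib)
    define \<epsilon> where "\<epsilon> = \<sigma> \<theta> \<otimes> inv \<theta>"
    have sthc: "\<sigma> \<theta> \<in> carrier L" using closed[OF thE(1)] Ec by auto
    have epc: "\<epsilon> \<in> carrier L" and sth: "\<sigma> \<theta> = \<epsilon> \<otimes> \<theta>" using sthc thE th0 by (auto simp: \<epsilon>_def m_assoc)
    have ep1: "\<epsilon> [^] p = \<one>"
    proof -
      have "\<sigma> \<theta> [^] p = \<theta> [^] p" using spow[OF thE(1), of p] fix_V[OF thp] by simp
      then show ?thesis unfolding \<epsilon>_def using sthc thE th0 pow_nonzero[OF thE(2) th0]
        by (simp add: nat_pow_distrib inv_pow_field)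
    qed
    have epV: "\<epsilon> \<in> V" using unity_p[OF epc ep1] .
    (* The exponent 0 + 1 + ... + (i - 1) that accumulates when \<sigma> is iterated on y. *)
    define T where "T i = i * (i - 1) div 2" for i :: nat
    have TS: "T (Suc i) = T i + i" for i
    proof -
      have "Suc i * i = i * (i - 1) + 2 * i" by (cases i) auto
      then show ?thesis unfolding T_def by simp
    qed
    have it: "(\<sigma> ^^ i) y = (\<epsilon> [^] T i \<otimes> \<theta> [^] i) \<otimes> y" for i
    proof (induction i)
      case 0 show ?case using y by (simp add: T_def)
    next
      case (Suc i)
      have eT: "\<epsilon> [^] T i \<in> V" using pow_in_subring[OF Vs epV] .
      have 1: "\<epsilon> [^] T i \<in> ?E" "\<theta> [^] i \<in> ?E" using eT VE pow_in_subring[OF Es thE(1)] by auto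
      have "(\<sigma> ^^ Suc i) y = \<sigma> ((\<epsilon> [^] T i \<otimes> \<theta> [^] i) \<otimes> y)" using Suc by simp
      also have "\<dots> = (\<epsilon> [^] T i \<otimes> (\<epsilon> \<otimes> \<theta>) [^] i) \<otimes> (\<theta> \<otimes> y)"
        using mult[OF subringE(6)[OF Es 1] y(1)] mult[OF 1] fix_V[OF eT] spow[OF thE(1)] sth sy by simp
      also have "\<dots> = (\<epsilon> [^] (T i + i) \<otimes> \<theta> [^] Suc i) \<otimes> y"
        using epc thE(2) y(2) by (simp add: nat_pow_distrib nat_pow_mult[symmetric] m_ac)
      finally show ?case unfolding TS .
    qed
    have "(\<epsilon> [^] T p \<otimes> \<theta> [^] p) \<otimes> y = \<one> \<otimes> y" using it[of p] order[OF y(1)] y(2) by simp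
    then have one: "\<epsilon> [^] T p \<otimes> \<theta> [^] p = \<one>"
      using y(2,3) epc thE(2) m_rcancel[of y "\<epsilon> [^] T p \<otimes> \<theta> [^] p" \<one>] by simp
    have "\<theta> [^] root_exponent p = \<one>"
    proof (cases "p = 2")
      case True
      then have "T p = 1" by (simp add: T_def)
      then have o: "\<epsilon> \<otimes> \<theta> [^] (2::nat) = \<one>" using one True epc by simp
      have "(\<epsilon> \<otimes> \<theta> [^] (2::nat)) [^] (2::nat) = \<epsilon> [^] (2::nat) \<otimes> \<theta> [^] (4::nat)"
        using epc thE(2) by (simp add: nat_pow_distrib nat_pow_pow)
      moreover have "\<epsilon> [^] (2::nat) = \<one>" using ep1 True by simp
      ultimately have "\<one> \<otimes> \<theta> [^] (4::nat) = \<one> [^] (2::nat)" unfolding o by simp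
      then have "\<theta> [^] (4::nat) = \<one>" using thE(2) by simp
      then show ?thesis using True by (simp add: root_exponent_def)
    next
      case False
      then have "odd p" using p p2 prime_odd_nat by auto
      then have "even (p - 1)" by simp
      then have "T p = p * ((p - 1) div 2)" unfolding T_def by (metis div_mult_swap)
      then have "\<epsilon> [^] T p = \<one>" using epc ep1 by (simp add: nat_pow_pow[symmetric])
      then show ?thesis using one False thE(2) by (simp add: root_exponent_def)
    qed
    then have "\<theta> \<in> V" using unity thE(2) by blast
    with thV show False by simp
  qed
  obtain a where a: "a \<in> {..<p} \<rightarrow> V" "x = (\<Oplus>s\<in>{..<p}. a s \<otimes> g [^] s)" using basis(2)[OF x(1)] by auto
  have ac: "a s \<in> V" "a s \<in> carrier L" if "s < p" for s using a(1) that Vc by auto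
  have gc: "(\<lambda>s. g [^] s) \<in> {..<p} \<rightarrow> carrier L" using g by auto
  have "(\<Oplus>s\<in>{..<p}. (a s \<otimes> \<zeta> [^] s) \<otimes> g [^] s) = \<sigma> x" using coords[OF a(1)] a(2) by simp
  also have "\<sigma> x = (\<Oplus>s\<in>{..<p}. (\<eta> \<otimes> a s) \<otimes> g [^] s)"
  proof -
    have "\<eta> \<otimes> x = (\<Oplus>s\<in>{..<p}. \<eta> \<otimes> (a s \<otimes> g [^] s))"
      unfolding a(2) by (rule finsum_rdistr) (use ec ac g in auto)
    also have "\<dots> = (\<Oplus>s\<in>{..<p}. (\<eta> \<otimes> a s) \<otimes> g [^] s)"
      by (rule finsum_cong') (use ec ac g in \<open>auto simp: m_assoc\<close>)
    finally show ?thesis using sx by simp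
  qed
  finally have eq: "(\<Oplus>s\<in>{..<p}. (a s \<otimes> \<zeta> [^] s) \<otimes> g [^] s) = (\<Oplus>s\<in>{..<p}. (\<eta> \<otimes> a s) \<otimes> g [^] s)" .
  have "a s \<otimes> \<zeta> [^] s = \<eta> \<otimes> a s" if "s < p" for s
    by (rule lin_independent_unique[OF Vs basis(1) _ gc _ _ eq])
      (use ac pow_in_subring[OF Vs zV] eV subringE(6)[OF Vs] that in auto)
  then have zs: "a s = \<zero> \<or> \<zeta> [^] s = \<eta>" if "s < p" for s
    using that ac(2)[OF that] ec z(1) m_lcancel[of "a s" "\<zeta> [^] s" \<eta>] by (auto simp: m_comm)
  obtain s where s: "s < p" "a s \<noteq> \<zero>"
  proof -
    have "\<exists>s<p. a s \<noteq> \<zero>"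
    proof (rule ccontr)
      assume "\<not> (\<exists>s<p. a s \<noteq> \<zero>)"
      then have "x = \<zero>" unfolding a(2) using g by (intro add.finprod_one_eqI) auto
      with x show False by simp
    qed
    then show thesis using that by blast
  qed
  have others: "a s' = \<zero>" if "s' < p" "s' \<noteq> s" for s'
    using zs[OF s(1)] zs[OF that(1)] s z(3)[OF that(1) s(1)] that by auto
  have "x = (\<Oplus>s'\<in>{..<p}. if s = s' then a s \<otimes> g [^] s else \<zero>)"
    unfolding a(2) by (rule finsum_cong') (use others ac g s in auto)
  also have "\<dots> = a s \<otimes> g [^] s" using s ac[OF s(1)] g by (intro finsum_singleton) auto
  finally show "\<exists>s<p. \<exists>e\<in>V. x = e \<otimes> g [^] s" using s ac[OF s(1)] by blast
qed

end

section \<open>Independence of radicals of prime power exponent\<close>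

context algebraically_closed
begin

lemma lin_independent_cong:
  assumes "lin_independent K I w" "\<And>i. i \<in> I \<Longrightarrow> w i = w' i" "K \<subseteq> carrier L" "w \<in> I \<rightarrow> carrier L"
  shows "lin_independent K I w'"
  unfolding lin_independent_def
proof (intro ballI impI)
  fix f i assume f: "f \<in> I \<rightarrow> K" and eq: "(\<Oplus>i\<in>I. f i \<otimes> w' i) = \<zero>" and i: "i \<in> I"
  have "(\<Oplus>i\<in>I. f i \<otimes> w i) = (\<Oplus>i\<in>I. f i \<otimes> w' i)"
    by (rule finsum_cong') (use assms f in \<open>auto simp: Pi_iff subset_iff\<close>)
  with eq have "(\<Oplus>i\<in>I. f i \<otimes> w i) = \<zero>" by simp
  with bspec[OF assms(1)[unfolded lin_independent_def] f] i show "f i = \<zero>" by blast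
qed

lemma lin_independent_subsingleton:
  assumes K: "K \<subseteq> carrier L" and w: "\<And>i. i \<in> I \<Longrightarrow> w i \<in> carrier L - {\<zero>}" and I: "\<And>i j. i \<in> I \<Longrightarrow> j \<in> I \<Longrightarrow> i = j"
  shows "lin_independent K I w"
  unfolding lin_independent_def
proof (intro ballI impI)
  fix f i assume f: "f \<in> I \<rightarrow> K" and eq: "(\<Oplus>i\<in>I. f i \<otimes> w i) = \<zero>" and i: "i \<in> I"
  have "I = {i}" using I i by auto
  moreover have "f i \<in> carrier L" "w i \<in> carrier L" "w i \<noteq> \<zero>" using f w[OF i] i K by auto
  ultimately show "f i = \<zero>" using eq integral[of "f i" "w i"] by simp
qed

lemma quotient_simps:
  assumes "x \<in> carrier L" "y \<in> carrier L" "z \<in> carrier L" "x \<noteq> \<zero>" "y \<noteq> \<zero>" "z \<noteq> \<zero>"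
  shows "(x \<otimes> inv y) \<otimes> (y \<otimes> inv z) = x \<otimes> inv z" "inv (x \<otimes> inv y) = y \<otimes> inv x"
    "(x \<otimes> inv y) \<otimes> y = x" "x \<otimes> inv y \<noteq> \<zero>" "(x \<otimes> inv z) \<otimes> inv (y \<otimes> inv z) = x \<otimes> inv y"
proof -
  have key: "(a \<otimes> inv b) \<otimes> (b \<otimes> c) = a \<otimes> c"
    if "a \<in> carrier L" "b \<in> carrier L" "c \<in> carrier L" "b \<noteq> \<zero>" for a b c
  proof -
    have "inv b \<otimes> (b \<otimes> c) = c" using that by (simp add: m_assoc[symmetric])
    then show ?thesis using that by (simp add: m_assoc)
  qed
  have inv_q: "inv (a \<otimes> inv b) = b \<otimes> inv a"
    if "a \<in> carrier L" "b \<in> carrier L" "a \<noteq> \<zero>" "b \<noteq> \<zero>" for a b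
    using key[of a b "inv a"] that by (intro comm_inv_char) auto
  show "(x \<otimes> inv y) \<otimes> (y \<otimes> inv z) = x \<otimes> inv z" using key[of x y "inv z"] assms by simp
  show "inv (x \<otimes> inv y) = y \<otimes> inv x" by (rule inv_q) (use assms in auto)
  show "(x \<otimes> inv y) \<otimes> y = x" using assms by (simp add: m_assoc)
  show "x \<otimes> inv y \<noteq> \<zero>" using assms integral[of x "inv y"] by auto
  show "(x \<otimes> inv z) \<otimes> inv (y \<otimes> inv z) = x \<otimes> inv y"
    using inv_q[of y z] key[of x z "inv y"] assms by simp
qed

text \<open>A choice function for the classes of the relation \<open>w i \<equiv> w j\<close> modulo the
  multiplicative group of \<open>V\<close>.\<close>

lemma congruence_representatives:
  assumes V: "subfield V L" and w: "\<And>i. i \<in> I \<Longrightarrow> w i \<in> carrier L - {\<zero>}"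
  obtains r where "\<And>i. i \<in> I \<Longrightarrow> r i \<in> I" "\<And>i. i \<in> I \<Longrightarrow> w i \<otimes> inv (w (r i)) \<in> V"
    "\<And>a b. a \<in> r ` I \<Longrightarrow> b \<in> r ` I \<Longrightarrow> w a \<otimes> inv (w b) \<in> V \<Longrightarrow> a = b"
proof -
  have Vs: "subring V L" using subfieldE[OF V] by auto
  have wc: "w i \<in> carrier L" "w i \<noteq> \<zero>" if "i \<in> I" for i using w[OF that] by auto
  define P where "P i j \<longleftrightarrow> j \<in> I \<and> w i \<otimes> inv (w j) \<in> V" for i j
  define r where "r i = (SOME j. P i j)" for i
  have "P i (r i)" if i: "i \<in> I" for i
    unfolding r_def by (rule someI[of _ i]) (use i wc subringE(3)[OF Vs] in \<open>auto simp: P_def\<close>)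
  then have r: "r i \<in> I" "w i \<otimes> inv (w (r i)) \<in> V" if "i \<in> I" for i using that by (auto simp: P_def)
  have sub: "P j k" if "i \<in> I" "j \<in> I" "w i \<otimes> inv (w j) \<in> V" "P i k" for i j k
  proof -
    have k: "k \<in> I" "w i \<otimes> inv (w k) \<in> V" using that by (auto simp: P_def)
    have "inv (w i \<otimes> inv (w j)) \<in> V"
      by (rule subfield_inv[OF V that(3)]) (use quotient_simps(4) wc that in blast)
    then have ji: "w j \<otimes> inv (w i) \<in> V"
      using quotient_simps(2)[of "w i" "w j" "w j"] wc that by simp
    have "(w j \<otimes> inv (w i)) \<otimes> (w i \<otimes> inv (w k)) \<in> V" using subringE(6)[OF Vs ji k(2)] .
    then show ?thesis using quotient_simps(1)[of "w j" "w i" "w k"] wc that k by (simp add: P_def)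
  qed
  have sym: "w j \<otimes> inv (w i) \<in> V" if "i \<in> I" "j \<in> I" "w i \<otimes> inv (w j) \<in> V" for i j
  proof -
    have "P i i" using that wc subringE(3)[OF Vs] by (auto simp: P_def)
    from sub[OF that this] show ?thesis by (simp add: P_def)
  qed
  have same: "r i = r j" if "i \<in> I" "j \<in> I" "w i \<otimes> inv (w j) \<in> V" for i j
  proof -
    have "P i = P j" using sub[OF that] sub[OF that(2,1) sym[OF that]] by blast
    then show ?thesis by (simp add: r_def)
  qed
  show thesis
  proof (rule that[OF r])
    fix a b assume ab: "a \<in> r ` I" "b \<in> r ` I" "w a \<otimes> inv (w b) \<in> V"
    have fixp: "r a = a" if "a \<in> r ` I" for a
    proof -
      obtain i where i: "i \<in> I" "a = r i" using \<open>a \<in> r ` I\<close> by auto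
      then show ?thesis using same[OF i(1) r(1)[OF i(1)] r(2)[OF i(1)]] by simp
    qed
    have "a \<in> I" "b \<in> I" using ab r by auto
    from same[OF this ab(3)] show "a = b" unfolding fixp[OF ab(1)] fixp[OF ab(2)] .
  qed auto
qed

text \<open>Choose a power \<open>g\<close> of some \<open>w i\<close> with \<open>g^p\<close> in
  \<open>V\<close> but \<open>g\<close> outside, and pass to \<open>W = V(g)\<close>: the
  exponents needed to reach \<open>W\<close> are smaller in total. Representatives of the classes
  modulo \<open>W\<close> are independent over \<open>W\<close> by induction; within one class the
  quotients are \<open>e g^s\<close> with \<open>e\<close> in \<open>V\<close> by
  \<open>kummer_step\<close>, with different \<open>s\<close> for incongruent elements, hence
  independent over \<open>V\<close>.\<close>

lemma prime_power_roots_independent: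
  assumes p: "Factorial_Ring.prime p" and char: "[p] \<cdot> \<one> \<noteq> \<zero>"
  shows "subfield V L \<Longrightarrow> (\<And>y. y \<in> carrier L \<Longrightarrow> y [^] root_exponent p = \<one> \<Longrightarrow> y \<in> V) \<Longrightarrow> finite I \<Longrightarrow>
    (\<And>i. i \<in> I \<Longrightarrow> w i \<in> carrier L - {\<zero>}) \<Longrightarrow> (\<And>i. i \<in> I \<Longrightarrow> \<exists>n. w i [^] (p ^ n) \<in> V) \<Longrightarrow>
    (\<And>i j. i \<in> I \<Longrightarrow> j \<in> I \<Longrightarrow> w i \<otimes> inv (w j) \<in> V \<Longrightarrow> i = j) \<Longrightarrow> lin_independent V I w"
proof (induction "\<Sum>i\<in>I. LEAST n. w i [^] (p ^ n) \<in> V" arbitrary: V I rule: less_induct)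
  case (less V I)
  note V = less(2) and unity = less(3) and I = less(4) and w = less(5) and tor = less(6) and nc = less(7)
  have Vs: "subring V L" and Vc: "V \<subseteq> carrier L" using subfieldE[OF V] by auto
  have wc: "w i \<in> carrier L" "w i \<noteq> \<zero>" if "i \<in> I" for i using w[OF that] by auto
  show ?case
  proof (cases "\<forall>i\<in>I. w i \<in> V")
    case True
    have "i = j" if "i \<in> I" "j \<in> I" for i j
    proof (rule nc[OF that])
      have "w i \<in> V" "inv (w j) \<in> V" using True that subfield_inv[OF V] wc(2) by auto
      then show "w i \<otimes> inv (w j) \<in> V" by (rule subringE(6)[OF Vs])
    qed
    then show ?thesis by (intro lin_independent_subsingleton[OF Vc w])
  next
    case False
    then obtain i0 where i0: "i0 \<in> I" "w i0 \<notin> V" by auto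
    define \<nu> where "\<nu> W i = (LEAST n. w i [^] (p ^ n) \<in> W)" for W i
    have nu: "w i [^] (p ^ \<nu> V i) \<in> V" if "i \<in> I" for i unfolding \<nu>_def using tor[OF that] by (rule LeastI_ex)
    have "\<nu> V i0 \<noteq> 0" using nu[OF i0(1)] i0 wc by (metis nat_pow_eone power_0)
    then obtain n where n: "\<nu> V i0 = Suc n" using not0_implies_Suc by blast
    define g where "g = w i0 [^] (p ^ n)"
    have gc: "g \<in> carrier L" unfolding g_def using wc[OF i0(1)] by simp
    have gV: "g \<notin> V" unfolding g_def using not_less_Least[of n "\<lambda>n. w i0 [^] (p ^ n) \<in> V"] n by (auto simp: \<nu>_def)
    have gp: "g [^] p \<in> V" unfolding g_def using nu[OF i0(1)] n wc[OF i0(1)] by (simp add: nat_pow_pow mult.commute)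
    note K = kummer_step[OF V p char unity gc gp gV]
    have p0: "p > 0" using p by (simp add: prime_gt_0_nat)
    note ra = root_algebraic[OF V gc gp p0]
    let ?W = "simple_extension V g"
    have W: "subfield ?W L" using simple_extension_is_subfield[OF V gc] ra(1) by simp
    have Ws: "subring ?W L" and Wc: "?W \<subseteq> carrier L" using subfieldE[OF W] by auto
    have VW: "V \<subseteq> ?W" and gW: "g \<in> ?W"
      using simple_extension_incl[OF Vc gc] simple_extension_mem[OF Vs gc] by auto
    obtain r where r: "\<And>i. i \<in> I \<Longrightarrow> r i \<in> I" "\<And>i. i \<in> I \<Longrightarrow> w i \<otimes> inv (w (r i)) \<in> ?W"
      "\<And>a b. a \<in> r ` I \<Longrightarrow> b \<in> r ` I \<Longrightarrow> w a \<otimes> inv (w b) \<in> ?W \<Longrightarrow> a = b"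
      by (rule congruence_representatives[OF W w]) (blast, rule that)
    have rI: "r ` I \<subseteq> I" using r(1) by auto
    define c where "c i = w i \<otimes> inv (w (r i))" for i
    have wcr: "w i = c i \<otimes> w (r i)" "c i \<noteq> \<zero>" "c i \<in> carrier L" if i: "i \<in> I" for i
      unfolding c_def using quotient_simps(3,4)[of "w i" "w (r i)" "w i"] wc[OF i] wc[OF r(1)[OF i]] by simp_all
    have ctor: "\<exists>n. c i [^] (p ^ n) \<in> V" if i: "i \<in> I" for i
    proof -
      let ?a = "\<nu> V i" and ?b = "\<nu> V (r i)"
      have 1: "w i [^] (p ^ (?a + ?b)) \<in> V"
        using pow_in_subring[OF Vs nu[OF i], of "p ^ ?b"] wc[OF i] by (simp add: nat_pow_pow power_add)
      have 2: "w (r i) [^] (p ^ (?a + ?b)) \<in> V"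
        using pow_in_subring[OF Vs nu[OF r(1)[OF i]], of "p ^ ?a"] wc[OF r(1)[OF i]]
        by (simp add: nat_pow_pow power_add mult.commute)
      have "c i [^] (p ^ (?a + ?b)) = w i [^] (p ^ (?a + ?b)) \<otimes> inv (w (r i) [^] (p ^ (?a + ?b)))"
        unfolding c_def using wc[OF i] wc[OF r(1)[OF i]] by (simp add: nat_pow_distrib inv_pow_field)
      also have "\<dots> \<in> V"
        using subringE(6)[OF Vs 1 subfield_inv[OF V 2 pow_nonzero[OF wc[OF r(1)[OF i]]]]] .
      finally show ?thesis by blast
    qed
    have ind: "lin_independent ?W (r ` I) w"
    proof (rule less(1))
      have le: "\<nu> ?W i \<le> \<nu> V i" if "i \<in> I" for i
        unfolding \<nu>_def[of ?W] by (rule Least_le) (use nu[OF that] VW in blast)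
      have "\<nu> ?W i0 \<le> n" unfolding \<nu>_def[of ?W] by (rule Least_le) (use gW in \<open>simp add: g_def\<close>)
      then have lt: "\<nu> ?W i0 < \<nu> V i0" using n by simp
      have "(\<Sum>i\<in>r ` I. \<nu> ?W i) \<le> (\<Sum>i\<in>I. \<nu> ?W i)" by (rule sum_mono2) (use I rI in auto)
      also have "\<dots> < (\<Sum>i\<in>I. \<nu> V i)"
        by (rule sum_strict_mono_ex1) (use I le lt i0 in auto)
      finally show "(\<Sum>i\<in>r ` I. LEAST n. w i [^] (p ^ n) \<in> ?W) < (\<Sum>i\<in>I. LEAST n. w i [^] (p ^ n) \<in> V)"
        by (simp add: \<nu>_def)
      show "\<exists>n. w i [^] (p ^ n) \<in> ?W" if "i \<in> r ` I" for i using tor[of i] that rI VW by blast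
      show "y \<in> ?W" if "y \<in> carrier L" "y [^] root_exponent p = \<one>" for y using unity[OF that] VW by blast
      show "i = j" if "i \<in> r ` I" "j \<in> r ` I" "w i \<otimes> inv (w j) \<in> ?W" for i j using r(3)[OF that] .
    qed (use W I w rI in auto)
    have "lin_independent V I (\<lambda>i. c i \<otimes> w (r i))"
    proof (rule lin_independent_fibres[OF Vs Ws VW I, where b = w and r = r and c = c])
      show "w (r i) \<in> carrier L" "c i \<in> ?W" if "i \<in> I" for i
        using wc r that by (auto simp: c_def)
      show "lin_independent ?W (r ` I) w" by (rule ind)
      fix i assume i: "i \<in> I"
      let ?F = "{i' \<in> I. r i' = r i}"
      have "\<exists>s e. s < p \<and> e \<in> V \<and> c i' = e \<otimes> g [^] s" if "i' \<in> I" for i'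
        using K(2)[of "c i'"] ctor[OF that] wcr[OF that] r(2)[OF that] unfolding c_def by blast
      then obtain s e where se: "\<And>i'. i' \<in> I \<Longrightarrow> s i' < p" "\<And>i'. i' \<in> I \<Longrightarrow> e i' \<in> V"
        "\<And>i'. i' \<in> I \<Longrightarrow> c i' = e i' \<otimes> g [^] s i'" by metis
      have e0: "e i' \<noteq> \<zero>" "e i' \<in> carrier L" if "i' \<in> I" for i'
        using se(2)[OF that] se(3)[OF that] wcr(2)[OF that] Vc gc by auto
      have g0: "g \<noteq> \<zero>" using gV subringE(2)[OF Vs] by auto
      show "lin_independent V ?F c"
      proof (rule lin_independent_reindex[OF V power_basis(1)[OF V gc ra(1) K(1)], where s = s and e = e])
        show "inj_on s ?F"
        proof (rule inj_onI)
          fix a b assume ab: "a \<in> ?F" "b \<in> ?F" "s a = s b"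
          then have aI: "a \<in> I" "b \<in> I" "r a = r b" by auto
          have gs: "g [^] s a \<in> carrier L" "g [^] s a \<noteq> \<zero>" using gc pow_nonzero[OF gc g0] by auto
          have "w a \<otimes> inv (w b) = c a \<otimes> inv (c b)"
            unfolding c_def aI(3) using wc[OF aI(1)] wc[OF aI(2)] wc[OF r(1)[OF aI(2)]]
              quotient_simps(5)[of "w a" "w b" "w (r b)"] by simp
          also have "\<dots> = e a \<otimes> inv (e b)"
          proof -
            have "c b \<otimes> inv (g [^] s a) = e b" "c a \<otimes> inv (g [^] s a) = e a"
              using se(3)[OF aI(1)] se(3)[OF aI(2)] ab(3) e0[OF aI(1)] e0[OF aI(2)] gs by (simp_all add: m_assoc)
            moreover have "c a \<otimes> inv (c b) = (c a \<otimes> inv (g [^] s a)) \<otimes> inv (c b \<otimes> inv (g [^] s a))"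
              using quotient_simps(5)[of "c a" "c b" "g [^] s a"] wcr[OF aI(1)] wcr[OF aI(2)] gs by simp
            ultimately show ?thesis by simp
          qed
          also have "\<dots> \<in> V"
            using subringE(6)[OF Vs se(2)[OF aI(1)] subfield_inv[OF V se(2)[OF aI(2)] e0(1)[OF aI(2)]]] .
          finally show "a = b" using nc[OF aI(1,2)] by simp
        qed
      qed (use se e0 gc in auto)
    qed
    then show ?thesis
      by (rule lin_independent_cong) (use wcr Vc wc r in auto)
  qed
qed

end

section \<open>Independence of radicals of arbitrary exponent\<close>

context algebraically_closed
begin

lemma inv_mult_field:
  assumes "x \<in> carrier L" "y \<in> carrier L" "x \<noteq> \<zero>" "y \<noteq> \<zero>"
  shows "inv (x \<otimes> y) = inv x \<otimes> inv y"
proof (rule comm_inv_char)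
  have "(x \<otimes> y) \<otimes> (inv x \<otimes> inv y) = (x \<otimes> inv x) \<otimes> (y \<otimes> inv y)" using assms by (simp add: m_ac)
  then show "(x \<otimes> y) \<otimes> (inv x \<otimes> inv y) = \<one>" using assms by simp
qed (use assms in auto)

text \<open>Named after smooth numbers, the integers without large prime factors.\<close>

definition smooth_extension :: "nat \<Rightarrow> 'a set \<Rightarrow> 'a set \<Rightarrow> bool" where
  "smooth_extension b E W \<longleftrightarrow> subfield W L \<and> E \<subseteq> W \<and>
     (\<exists>n. dimension n E W \<and> (\<forall>q. Factorial_Ring.prime q \<longrightarrow> q dvd n \<longrightarrow> q < b))"

lemma smooth_extension_refl: "subfield E L \<Longrightarrow> smooth_extension b E E"
  unfolding smooth_extension_def using dimension_one[of E] by (auto intro!: exI[of _ "1::nat"])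

lemma smooth_extension_simple:
  assumes E: "subfield E L" and W: "smooth_extension b E W"
    and z: "z \<in> carrier L" "(algebraic over W) z" "degree (Irr W z) < b"
  shows "smooth_extension b E (simple_extension W z)"
proof -
  obtain n where n: "subfield W L" "E \<subseteq> W" "dimension n E W"
    "\<And>q. Factorial_Ring.prime q \<Longrightarrow> q dvd n \<Longrightarrow> q < b"
    using W by (auto simp: smooth_extension_def)
  let ?d = "degree (Irr W z)"
  have Wc: "W \<subseteq> carrier L" using subfieldE(3)[OF n(1)] .
  have d: "dimension ?d W (simple_extension W z)" by (rule dimension_simple_extension[OF n(1) z(1,2)])
  have d0: "?d > 0" using pirreducible_degree[OF n(1) IrrE(1,2)[OF n(1) z(1,2)]] by simp
  have "dimension (n * ?d) E (simple_extension W z)" by (rule telescopic_base[OF E n(1) n(3) d])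
  moreover have "q < b" if q: "Factorial_Ring.prime q" "q dvd n * ?d" for q
  proof -
    have "q dvd n \<or> q dvd ?d" using q prime_dvd_mult_iff by blast
    moreover have "q \<le> ?d" if "q dvd ?d" using dvd_imp_le[OF that d0] .
    ultimately show ?thesis using n(4)[OF q(1)] z(3) by auto
  qed
  moreover have "subfield (simple_extension W z) L" using simple_extension_is_subfield[OF n(1) z(1)] z(2) by simp
  moreover have "E \<subseteq> simple_extension W z" using simple_extension_incl[OF Wc z(1)] n(2) by auto
  ultimately show ?thesis unfolding smooth_extension_def by blast
qed

lemma smooth_extension_root:
  assumes E: "subfield E L"
  shows "smooth_extension b E W \<Longrightarrow> z \<in> carrier L \<Longrightarrow> z [^] N \<in> W \<Longrightarrow> N > 0 \<Longrightarrow>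
    (\<And>q. Factorial_Ring.prime q \<Longrightarrow> q dvd N \<Longrightarrow> q < b) \<Longrightarrow>
    \<exists>W'. smooth_extension b E W' \<and> W \<subseteq> W' \<and> z \<in> W'"
proof (induction N arbitrary: W rule: less_induct)
  case (less N)
  have W: "subfield W L" using less(2) by (auto simp: smooth_extension_def)
  have Wc: "W \<subseteq> carrier L" and Ws: "subring W L" using subfieldE[OF W] by auto
  show ?case
  proof (cases "N = 1")
    case True then show ?thesis using less by auto
  next
    case False
    then obtain q where q: "Factorial_Ring.prime q" "q dvd N" using prime_factor_nat by blast
    then obtain M where M: "N = q * M" by auto
    let ?y = "z [^] M"
    have y: "?y \<in> carrier L" "?y [^] q \<in> W" using less(3,4) M by (simp_all add: nat_pow_pow mult.commute)
    have q0: "q > 0" using q by (simp add: prime_gt_0_nat)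
    note ra = root_algebraic[OF W y q0]
    let ?W = "simple_extension W ?y"
    have "smooth_extension b E ?W"
      by (rule smooth_extension_simple[OF E less(2) y(1) ra(1)]) (use ra(2) less(6)[OF q] in simp)
    moreover have "?y \<in> ?W" using simple_extension_mem[OF Ws y(1)] .
    moreover have "M < N" "M > 0" using M less(5) prime_gt_1_nat[OF q(1)] by auto
    moreover have "\<And>r. Factorial_Ring.prime r \<Longrightarrow> r dvd M \<Longrightarrow> r < b" using less(6) M by auto
    ultimately obtain W' where "smooth_extension b E W'" "?W \<subseteq> W'" "z \<in> W'"
      using less(1)[of M ?W] less(3) by blast
    then show ?thesis using simple_extension_incl[OF Wc y(1)] by blast
  qed
qed

lemma smooth_extension_roots:
  assumes E: "subfield E L" and I: "finite I"
    and z: "\<And>i. i \<in> I \<Longrightarrow> z i \<in> carrier L \<and> (\<exists>N>0. z i [^] N \<in> E \<and> (\<forall>q. Factorial_Ring.prime q \<longrightarrow> q dvd N \<longrightarrow> q < b))"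
  shows "\<exists>W. smooth_extension b E W \<and> (\<forall>i\<in>I. z i \<in> W)"
  using I z
proof (induction I rule: finite_induct)
  case empty then show ?case using smooth_extension_refl[OF E] by blast
next
  case (insert i I)
  then obtain W where W: "smooth_extension b E W" "\<forall>i\<in>I. z i \<in> W" by auto
  obtain N where N: "N > 0" "z i [^] N \<in> E" "\<And>q. Factorial_Ring.prime q \<Longrightarrow> q dvd N \<Longrightarrow> q < b" "z i \<in> carrier L"
    using insert(4)[of i] by auto
  have "z i [^] N \<in> W" using N(2) W(1) by (auto simp: smooth_extension_def)
  from smooth_extension_root[OF E W(1) N(4) this N(1,3)]
  obtain W' where "smooth_extension b E W'" "W \<subseteq> W'" "z i \<in> W'" by blast
  then show ?case using W(2) by blast
qed

text \<open>If \<open>z\<close> had degree \<open>p\<close> over \<open>E\<close>, then \<open>p\<close>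
  would divide the degree of \<open>W\<close>.\<close>

lemma smooth_extension_prime_root:
  assumes E: "subfield E L" and W: "smooth_extension b E W" and p: "Factorial_Ring.prime p" "b \<le> p"
    and z: "z \<in> W" "z [^] p \<in> E"
  shows "\<exists>\<eta>\<in>carrier L. \<eta> [^] p = \<one> \<and> \<eta> \<otimes> z \<in> E"
proof (cases "z = \<zero>")
  case True
  then show ?thesis using subringE(2)[OF subfieldE(1)[OF E]] by (intro bexI[of _ \<one>]) auto
next
  case False
  obtain n where n: "subfield W L" "E \<subseteq> W" "dimension n E W"
    "\<And>q. Factorial_Ring.prime q \<Longrightarrow> q dvd n \<Longrightarrow> q < b"
    using W by (auto simp: smooth_extension_def)
  have Ws: "subring W L" and Wc: "W \<subseteq> carrier L" using subfieldE[OF n(1)] by auto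
  have Ec: "E \<subseteq> carrier L" and Es: "subring E L" using subfieldE[OF E] by auto
  have zc: "z \<in> carrier L" using z Wc by auto
  have p0: "p > 0" using p by (simp add: prime_gt_0_nat)
  note ra = root_algebraic[OF E zc z(2) p0]
  have "degree (Irr E z) \<noteq> p"
  proof
    assume d: "degree (Irr E z) = p"
    let ?F = "simple_extension E z"
    have F: "subfield ?F L" using simple_extension_is_subfield[OF E zc] ra(1) by simp
    have FW: "?F \<subseteq> W" by (rule simple_extension_subring_incl[OF Ws n(2) z(1)])
    have dF: "dimension p E ?F" using dimension_simple_extension[OF E zc ra(1)] d by simp
    obtain Us where Us: "set Us \<subseteq> carrier L" "Span E Us = W" using exists_base[OF E n(3)] by auto
    have UW: "set Us \<subseteq> W" using Span_base_incl[OF E Us(1)] Us(2) by simp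
    have "subgroup W (add_monoid L)" using subring.axioms(1)[OF Ws] .
    then have "Span ?F Us \<subseteq> W"
      by (rule Span_min[OF F Us(1)]) (use FW UW subringE(6)[OF Ws] in \<open>auto simp: set_mult_def\<close>)
    moreover have "W \<subseteq> Span ?F Us"
    proof
      fix w assume "w \<in> W"
      then obtain Ks where "set Ks \<subseteq> E" "w = combine Ks Us"
        using Span_eq_combine_set[OF E Us(1)] Us(2) by auto
      then show "w \<in> Span ?F Us"
        using Span_eq_combine_set[OF F Us(1)] simple_extension_incl[OF Ec zc] by auto
    qed
    ultimately have "finite_dimension ?F W" using Span_finite_dimension[OF F Us(1)] by simp
    then obtain m where "dimension m ?F W" by auto
    then have "dimension (p * m) E W" by (rule telescopic_base[OF E F dF])
    then have "n = p * m" using dimension_is_inj[OF E n(3)] by simp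
    then have "p < b" using n(4)[OF p(1)] by simp
    with p(2) show False by simp
  qed
  then show ?thesis using prime_root_degree[OF E zc False p(1) z(2)] by auto
qed

lemma smooth_extension_prime_power_root:
  assumes E: "subfield E L" and W: "smooth_extension b E W" and p: "Factorial_Ring.prime p" "b \<le> p"
    and G: "\<And>y n. y \<in> G \<Longrightarrow> y [^] (n::nat) \<in> G"
    and good: "\<And>y \<eta>. y \<in> G \<Longrightarrow> y [^] p \<in> E \<Longrightarrow> \<eta> \<in> carrier L \<Longrightarrow> \<eta> [^] p = \<one> \<Longrightarrow> \<eta> \<otimes> y \<in> E \<Longrightarrow> y \<in> E"
    and z: "z \<in> W" "z \<in> G" "z [^] (p ^ n) \<in> E"
  shows "z \<in> E"
proof (rule ccontr)
  assume nE: "z \<notin> E"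
  have Ws: "subring W L" using W subfieldE(1) by (auto simp: smooth_extension_def)
  have zc: "z \<in> carrier L" using z(1) subringE(1)[OF Ws] by auto
  define t where "t = (LEAST t. z [^] (p ^ t) \<in> E)"
  have tE: "z [^] (p ^ t) \<in> E" unfolding t_def using z(3) by (rule LeastI)
  have "t \<noteq> 0" using tE nE zc by (metis nat_pow_eone power_0)
  then obtain t' where t': "t = Suc t'" using not0_implies_Suc by blast
  let ?y = "z [^] (p ^ t')"
  have y: "?y \<notin> E" using not_less_Least[of t' "\<lambda>t. z [^] (p ^ t) \<in> E"] t' unfolding t_def by auto
  have yp: "?y [^] p \<in> E" using tE t' zc by (simp add: nat_pow_pow mult.commute)
  obtain \<eta> where "\<eta> \<in> carrier L" "\<eta> [^] p = \<one>" "\<eta> \<otimes> ?y \<in> E"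
    using smooth_extension_prime_root[OF E W p pow_in_subring[OF Ws z(1)] yp] by auto
  from good[OF G[OF z(2)] yp this] y show False by simp
qed

lemma all_roots_of_unity:
  assumes p: "(p::nat) > 0" and z: "\<zeta> \<in> carrier L" "\<zeta> [^] p = \<one>" "\<And>i j. i < p \<Longrightarrow> j < p \<Longrightarrow> \<zeta> [^] i = \<zeta> [^] j \<Longrightarrow> i = j"
    and y: "y \<in> carrier L" "y [^] p = \<one>"
  shows "\<exists>s::nat. y = \<zeta> [^] s"
proof (rule ccontr)
  assume no: "\<not> ?thesis"
  obtain q where q: "q \<in> carrier (poly_ring L)" "q \<noteq> []" "degree q \<le> p"
    "\<And>y. y \<in> carrier L \<Longrightarrow> eval q y = y [^] p \<ominus> \<one>"
    by (rule binomial_poly[OF carrier_is_subfield one_closed p]) (rule that)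
  let ?Z = "insert y ((\<lambda>s. \<zeta> [^] s) ` {..<p})"
  have "inj_on (\<lambda>s. \<zeta> [^] s) {..<p}" using z(3) by (intro inj_onI) auto
  then have "card ?Z = Suc p" using no by (subst card_insert_disjoint) (auto simp: card_image)
  have "q = []"
  proof (rule poly_agree[OF q(1), of _ ?Z])
    show "[] \<in> carrier (poly_ring L)" by (simp add: univ_poly_carrier[symmetric] polynomial_def)
    show "max (degree q) (degree []) < card ?Z" using q(3) \<open>card ?Z = Suc p\<close> by simp
    fix x assume x: "x \<in> ?Z"
    have "x [^] p = \<one>"
    proof (cases "x = y")
      case False
      then obtain s :: nat where "x = \<zeta> [^] s" using x by auto
      then have "x [^] p = (\<zeta> [^] p) [^] s" using z(1) by (simp add: nat_pow_pow mult.commute)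
      then show ?thesis using z(2) by simp
    qed (use y in simp)
    moreover have "x \<in> carrier L" using x y z by auto
    ultimately show "eval q x = eval [] x" using q(4)[of x] by (simp add: a_minus_def r_neg)
  qed (use y z in auto)
  with q(2) show False by simp
qed

text \<open>Induction on the bound \<open>b\<close> for the primes of \<open>N\<close>. When
  \<open>b\<close> itself is such a prime, each \<open>w i\<close> is split as \<open>x1 i\<close>
  times \<open>x2 i\<close>, where \<open>x1 i\<close> has \<open>b\<close>-power exponent and the
  exponent of \<open>x2 i\<close> is prime to \<open>b\<close>. All \<open>x2 i\<close> and a
  primitive \<open>b\<close>-th root of unity lie in a field \<open>W\<close> whose degree over
  \<open>E\<close> has only primes below \<open>b\<close>. Representatives of the \<open>x1
  i\<close> modulo \<open>E\<close> stay incongruent modulo \<open>W\<close>, so they are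
  independent over \<open>W\<close>; inside a fibre the \<open>x2 i\<close> are incongruent and
  the induction hypothesis applies.\<close>

lemma roots_independent:
  fixes b N :: nat
  assumes E: "subfield E L"
    and i4: "add_pow L (2::nat) \<one> \<noteq> \<zero> \<Longrightarrow> (\<And>y. y \<in> carrier L \<Longrightarrow> y [^] (4::nat) = \<one> \<Longrightarrow> y \<in> E)"
    and G: "G \<subseteq> carrier L - {\<zero>}" "\<And>x y. x \<in> G \<Longrightarrow> y \<in> G \<Longrightarrow> x \<otimes> y \<in> G" "\<And>x. x \<in> G \<Longrightarrow> inv x \<in> G" "\<one> \<in> G"
    and good: "\<And>(p::nat) y \<eta>. Factorial_Ring.prime p \<Longrightarrow> [p] \<cdot> \<one> \<noteq> \<zero> \<Longrightarrow> y \<in> G \<Longrightarrow> y [^] p \<in> E \<Longrightarrow> \<eta> \<in> carrier L \<Longrightarrow>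
       \<eta> [^] p = \<one> \<Longrightarrow> \<eta> \<otimes> y \<in> E \<Longrightarrow> y \<in> E"
  shows "finite I \<Longrightarrow> (\<And>i. i \<in> I \<Longrightarrow> w i \<in> G) \<Longrightarrow> N > 0 \<Longrightarrow> (\<And>i. i \<in> I \<Longrightarrow> w i [^] N \<in> E) \<Longrightarrow>
    (\<And>q. Factorial_Ring.prime q \<Longrightarrow> q dvd N \<Longrightarrow> q < b \<and> [q] \<cdot> \<one> \<noteq> \<zero>) \<Longrightarrow>
    (\<And>i j. i \<in> I \<Longrightarrow> j \<in> I \<Longrightarrow> w i \<otimes> inv (w j) \<in> E \<Longrightarrow> i = j) \<Longrightarrow> lin_independent E I w"
proof (induction b arbitrary: N I w)
  case (0 N I w)
  have Es: "subring E L" and Ec: "E \<subseteq> carrier L" using subfieldE[OF E] by auto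
  have "N = 1" using 0(5) prime_factor_nat by blast
  then have wE: "w i \<in> E - {\<zero>}" if "i \<in> I" for i using 0(2,4)[OF that] G(1) by auto
  have "i = j" if "i \<in> I" "j \<in> I" for i j
    by (rule 0(6)[OF that]) (use wE that subfield_inv[OF E] subringE(6)[OF Es] in auto)
  then show ?case using wE Ec by (intro lin_independent_subsingleton) auto
next
  case (Suc b N I w)
  have Es: "subring E L" and Ec: "E \<subseteq> carrier L" using subfieldE[OF E] by auto
  show ?case
  proof (cases "Factorial_Ring.prime b \<and> b dvd N")
    case False
    show ?thesis
    proof (rule Suc(1)[of I w N])
      fix q :: nat assume q: "Factorial_Ring.prime q" "q dvd N"
      then have "q \<noteq> b" using False by auto
      with Suc(6)[OF q] show "q < b \<and> [q] \<cdot> \<one> \<noteq> \<zero>" by simp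
    qed (use Suc in auto)
  next
    case True
    then have p: "Factorial_Ring.prime b" and char: "[b] \<cdot> \<one> \<noteq> \<zero>" using Suc(6) by auto
    have b1: "b > 1" "b \<ge> 2" using prime_gt_1_nat[OF p] prime_ge_2_nat[OF p] by auto
    obtain a M where NM: "N = b ^ a * M" "\<not> b dvd M"
      using multiplicity_decompose'[of N b] Suc(4) p
      by (metis not_prime_unit mult.commute neq0_conv)
    have M0: "M > 0" using NM Suc(4) by (cases M) auto
    have Mq: "q < b \<and> [q] \<cdot> \<one> \<noteq> \<zero>" if "Factorial_Ring.prime q" "q dvd M" for q
      using Suc(6)[OF that(1)] that NM by (metis dvd_mult less_Suc_eq)
    have "coprime M (b ^ a)" using NM(2) p by (metis coprime_commute coprime_power_left_iff prime_imp_coprime_nat)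
    then obtain u v where uv: "M * u = b ^ a * v + 1"
      using bezout_nat[of M "b ^ a"] M0 by (auto simp: coprime_iff_gcd_eq_1)
    have wc: "w i \<in> carrier L" "w i \<noteq> \<zero>" if "i \<in> I" for i using Suc(3)[OF that] G(1) by auto
    have Gpow: "x [^] (n::nat) \<in> G" if "x \<in> G" for x n
      by (induction n) (use that G in auto)
    define x1 where "x1 i = w i [^] (M * u)" for i
    define x2 where "x2 i = inv (w i [^] (b ^ a * v))" for i
    have x1: "x1 i \<in> G" "x1 i \<in> carrier L" "x1 i \<noteq> \<zero>" "x1 i [^] (b ^ a) \<in> E" if i: "i \<in> I" for i
    proof -
      show "x1 i \<in> G" unfolding x1_def using Gpow Suc(3)[OF i] .
      then show "x1 i \<in> carrier L" "x1 i \<noteq> \<zero>" using G(1) by auto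
      have "x1 i [^] (b ^ a) = (w i [^] N) [^] u"
        unfolding x1_def NM(1) using wc[OF i] by (simp add: nat_pow_pow mult_ac)
      then show "x1 i [^] (b ^ a) \<in> E" using pow_in_subring[OF Es Suc(5)[OF i]] by simp
    qed
    have x2: "x2 i \<in> G" "x2 i \<in> carrier L" "x2 i \<noteq> \<zero>" "x2 i [^] M \<in> E" if i: "i \<in> I" for i
    proof -
      show "x2 i \<in> G" unfolding x2_def using G(3)[OF Gpow[OF Suc(3)[OF i]]] .
      then show "x2 i \<in> carrier L" "x2 i \<noteq> \<zero>" using G(1) by auto
      have "x2 i [^] M = inv ((w i [^] N) [^] v)"
        unfolding x2_def NM(1) using wc[OF i] pow_nonzero[OF wc[OF i]]
        by (simp add: inv_pow_field nat_pow_pow mult_ac)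
      also have "\<dots> \<in> E"
        using subfield_inv[OF E pow_in_subring[OF Es Suc(5)[OF i]]] wc[OF i] pow_nonzero by simp
      finally show "x2 i [^] M \<in> E" .
    qed
    have w12: "w i = x2 i \<otimes> x1 i" if i: "i \<in> I" for i
    proof -
      let ?c = "w i [^] (b ^ a * v)"
      have c: "?c \<in> carrier L" "?c \<noteq> \<zero>" using wc[OF i] pow_nonzero by auto
      have "x2 i \<otimes> x1 i = inv ?c \<otimes> (?c \<otimes> w i)"
        unfolding x1_def x2_def uv using wc[OF i] by (simp add: nat_pow_mult[symmetric])
      also have "\<dots> = w i" using c wc[OF i] by (simp add: m_assoc[symmetric])
      finally show ?thesis by simp
    qed
    obtain V where V: "smooth_extension b E V" "\<And>i. i \<in> I \<Longrightarrow> x2 i \<in> V"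
      using smooth_extension_roots[OF E Suc(2), of x2 b] x2 Mq M0 by blast
    obtain \<zeta> where z: "\<zeta> \<in> carrier L" "\<zeta> [^] b = \<one>" "\<And>i j. i < b \<Longrightarrow> j < b \<Longrightarrow> \<zeta> [^] i = \<zeta> [^] j \<Longrightarrow> i = j"
      "\<And>K. subfield K L \<Longrightarrow> (algebraic over K) \<zeta> \<and> degree (Irr K \<zeta>) < b"
      by (rule primitive_root_of_unity[OF p char]) (rule that)
    have Vf: "subfield V L" "E \<subseteq> V" using V by (auto simp: smooth_extension_def)
    let ?W = "simple_extension V \<zeta>"
    have VW: "V \<subseteq> ?W" "\<zeta> \<in> ?W"
      using simple_extension_incl[OF subfieldE(3)[OF Vf(1)] z(1)] simple_extension_mem[OF subfieldE(1)[OF Vf(1)] z(1)] by auto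
    have W: "smooth_extension b E ?W"
      using smooth_extension_simple[OF E V(1) z(1)] z(4)[OF Vf(1)] by auto
    have Wf: "subfield ?W L" "E \<subseteq> ?W" using W by (auto simp: smooth_extension_def)
    have Ws: "subring ?W L" and Wc: "?W \<subseteq> carrier L" using subfieldE[OF Wf(1)] by auto
    have unity: "y \<in> ?W" if y: "y \<in> carrier L" "y [^] root_exponent b = \<one>" for y
    proof (cases "b = 2")
      case True then show ?thesis using i4 y char Wf(2) by (auto simp: root_exponent_def)
    next
      case False
      then have "y [^] b = \<one>" using y by (simp add: root_exponent_def)
      moreover have "b > 0" using b1 by simp
      ultimately obtain s :: nat where "y = \<zeta> [^] s"
        using all_roots_of_unity[OF _ z(1,2,3) y(1)] by blast
      then show ?thesis using pow_in_subring[OF Ws VW(2)] by simp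
    qed
    have x1nz: "x1 i \<in> carrier L - {\<zero>}" if "i \<in> I" for i using x1[OF that] by auto
    obtain r where r: "\<And>i. i \<in> I \<Longrightarrow> r i \<in> I" "\<And>i. i \<in> I \<Longrightarrow> x1 i \<otimes> inv (x1 (r i)) \<in> E"
      "\<And>a b. a \<in> r ` I \<Longrightarrow> b \<in> r ` I \<Longrightarrow> x1 a \<otimes> inv (x1 b) \<in> E \<Longrightarrow> a = b"
      by (rule congruence_representatives[OF E x1nz]) (assumption, rule that)
    have rI: "r ` I \<subseteq> I" using r(1) by auto
    define e where "e i = x1 i \<otimes> inv (x1 (r i))" for i
    have e: "e i \<in> E - {\<zero>}" "e i \<otimes> x1 (r i) = x1 i" if i: "i \<in> I" for i
      unfolding e_def using r(2)[OF i] quotient_simps(3,4)[of "x1 i" "x1 (r i)" "x1 i"] x1[OF i] x1[OF r(1)[OF i]] by auto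
    define c where "c i = e i \<otimes> x2 i" for i
    have ec: "e i \<in> carrier L" if "i \<in> I" for i using e(1)[OF that] Ec by auto
    have ind: "lin_independent ?W (r ` I) x1"
    proof (rule prime_power_roots_independent[OF p char Wf(1) unity])
      show "finite (r ` I)" using Suc(2) by simp
      show "x1 i \<in> carrier L - {\<zero>}" if "i \<in> r ` I" for i using x1[of i] that rI by auto
      show "\<exists>n. x1 i [^] (b ^ n) \<in> ?W" if "i \<in> r ` I" for i using x1(4)[of i] that rI Wf(2) by blast
      fix i j assume ij: "i \<in> r ` I" "j \<in> r ` I" "x1 i \<otimes> inv (x1 j) \<in> ?W"
      then have I: "i \<in> I" "j \<in> I" using rI by auto
      have "x1 i \<otimes> inv (x1 j) \<in> E"
      proof (rule smooth_extension_prime_power_root[OF E W p order_refl Gpow good[OF p char] ij(3)])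
        show "x1 i \<otimes> inv (x1 j) \<in> G" using G(2)[OF x1(1)[OF I(1)] G(3)[OF x1(1)[OF I(2)]]] .
        have "(x1 i \<otimes> inv (x1 j)) [^] (b ^ a) = x1 i [^] (b ^ a) \<otimes> inv (x1 j [^] (b ^ a))"
          using x1[OF I(1)] x1[OF I(2)] by (simp add: nat_pow_distrib inv_pow_field)
        also have "\<dots> \<in> E"
          by (rule subringE(6)[OF Es x1(4)[OF I(1)] subfield_inv[OF E x1(4)[OF I(2)] pow_nonzero[OF x1(2,3)[OF I(2)]]]])
        finally show "(x1 i \<otimes> inv (x1 j)) [^] (b ^ a) \<in> E" .
      qed auto
      then show "i = j" using r(3) ij by blast
    qed
    have "lin_independent E I (\<lambda>i. c i \<otimes> x1 (r i))"
    proof (rule lin_independent_fibres[OF Es Ws Wf(2) Suc(2), where b = x1 and r = r and c = c])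
      show "x1 (r i) \<in> carrier L" if "i \<in> I" for i using x1(2)[OF r(1)[OF that]] .
      show "c i \<in> ?W" if "i \<in> I" for i
        unfolding c_def using subringE(6)[OF Ws] e(1)[OF that] V(2)[OF that] VW Wf(2) by blast
      show "lin_independent ?W (r ` I) x1" by (rule ind)
      fix i assume i: "i \<in> I"
      let ?F = "{i' \<in> I. r i' = r i}"
      have F2: "lin_independent E ?F x2"
      proof (rule Suc(1)[of ?F x2 M])
        show "finite ?F" using Suc(2) by simp
        fix i' j assume ij: "i' \<in> ?F" "j \<in> ?F" "x2 i' \<otimes> inv (x2 j) \<in> E"
        then have I: "i' \<in> I" "j \<in> I" "r i' = r j" by auto
        have wj: "w k = (x2 k \<otimes> e k) \<otimes> x1 (r j)" if "k = i' \<or> k = j" for k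
        proof -
          have k: "k \<in> I" "r k = r j" using that I by auto
          show ?thesis using w12[OF k(1)] e(2)[OF k(1)] k(2) ec[OF k(1)] x1(2)[OF r(1)[OF I(2)]] x2(2)[OF k(1)]
            by (simp add: m_assoc)
        qed
        have nz: "x2 k \<otimes> e k \<noteq> \<zero>" if "k \<in> I" for k
          using integral[of "x2 k" "e k"] x2[OF that] e(1)[OF that] ec[OF that] by auto
        have "w i' \<otimes> inv (w j) = (x2 i' \<otimes> e i') \<otimes> inv (x2 j \<otimes> e j)"
        proof -
          let ?t = "x1 (r j)"
          have t: "?t \<in> carrier L" "?t \<noteq> \<zero>" using x1(2,3)[OF r(1)[OF I(2)]] .
          have 1: "x2 i' \<otimes> e i' = w i' \<otimes> inv ?t" "x2 j \<otimes> e j = w j \<otimes> inv ?t"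
            using wj[of i'] wj[of j] t x2(2)[OF I(1)] x2(2)[OF I(2)] ec[OF I(1)] ec[OF I(2)] by (simp_all add: m_assoc)
          show ?thesis unfolding 1 using quotient_simps(5)[of "w i'" "w j" ?t] wc[OF I(1)] wc[OF I(2)] t by simp
        qed
        also have "\<dots> = (x2 i' \<otimes> inv (x2 j)) \<otimes> (e i' \<otimes> inv (e j))"
          using x2[OF I(1)] x2[OF I(2)] ec[OF I(1)] ec[OF I(2)] e(1)[OF I(1)] e(1)[OF I(2)]
          by (simp add: inv_mult_field m_ac)
        also have "\<dots> \<in> E"
          using subringE(6)[OF Es ij(3) subringE(6)[OF Es, of "e i'" "inv (e j)"]] subfield_inv[OF E] e(1)[OF I(1)] e(1)[OF I(2)] by auto
        finally show "i' = j" using Suc(7)[OF I(1,2)] by simp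
      qed (use x2 M0 Mq in auto)
      show "lin_independent E ?F c"
        by (rule lin_independent_reindex[OF E F2, where s = "\<lambda>i. i" and e = e])
          (use Suc(2) x2 e c_def in auto)
    qed
    then show ?thesis
    proof (rule lin_independent_cong)
      fix i assume i: "i \<in> I"
      show "c i \<otimes> x1 (r i) = w i"
        unfolding c_def using w12[OF i] e(2)[OF i] ec[OF i] x1(2)[OF r(1)[OF i]] x2(2)[OF i]
        by (metis m_assoc m_comm)
    next
      show "(\<lambda>i. c i \<otimes> x1 (r i)) \<in> I \<rightarrow> carrier L"
        using ec x1(2) r(1) x2(2) unfolding c_def by auto
    qed (rule Ec)
  qed
qed

end

section \<open>Groups embedded in fields\<close>

context algebraically_closed
begin

lemma northcott_mono: "northcott F \<Longrightarrow> K \<subseteq> F \<Longrightarrow> northcott K"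
  unfolding northcott_def
proof (intro allI impI)
  fix D e r assume N: "\<forall>D e r. finite D \<and> D \<subseteq> F \<longrightarrow> finite {a \<in> F. power_bounded F D e r a}"
    and K: "K \<subseteq> F" and D: "finite D \<and> D \<subseteq> K"
  have "finite {a \<in> F. power_bounded F D e r a}" using N D K by blast
  moreover have "{a \<in> K. power_bounded K D e r a} \<subseteq> {a \<in> F. power_bounded F D e r a}"
    using K power_bounded_mono[OF _ order_refl K] by blast
  ultimately show "finite {a \<in> K. power_bounded K D e r a}" by (rule finite_subset[rotated])
qed

text \<open>The larger field is obtained by adjoining a basis.\<close>

lemma northcott_finite_dimension:
  assumes K: "subfield K L" "northcott K" and W: "subfield W L" "K \<subseteq> W" "finite_dimension K W"
  shows "northcott W"
proof -
  have Ws: "subring W L" using subfieldE[OF W(1)] by auto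
  have Ks: "subring K L" "K \<subseteq> carrier L" using subfieldE[OF K(1)] by auto
  obtain Us where Us: "set Us \<subseteq> carrier L" "Span K Us = W" using exists_base[OF K(1)] W(3) by (metis finite_dimensionE')
  have UW: "set Us \<subseteq> W" using Span_base_incl[OF K(1) Us(1)] Us(2) by simp
  have alg: "(algebraic over K) x" if "x \<in> W" for x by (rule finite_dimension_imp_algebraic[OF K(1) Ws W(3) that])
  have "northcott (finite_extension K xs)" if "set xs \<subseteq> W" for xs
    using that
  proof (induction xs)
    case Nil then show ?case using K(2) by simp
  next
    case (Cons x xs)
    have xs: "set xs \<subseteq> carrier L" "x \<in> carrier L" using Cons(2) subringE(1)[OF Ws] by auto
    have sub: "subfield (finite_extension K xs) L"
      by (rule finite_extension_is_subfield[OF K(1) xs(1)]) (use alg Cons(2) in auto)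
    have "(algebraic over finite_extension K xs) x"
      by (rule algebraic_mono[OF finite_extension_incl[OF Ks(2) xs(1)]]) (use alg Cons(2) in auto)
    then show ?case using northcott_simple_extension[OF sub _ xs(2)] Cons by simp
  qed
  from this[OF UW] show ?thesis
  proof (rule northcott_mono)
    have sub: "subring (finite_extension K Us) L" by (rule finite_extension_is_subring[OF Ks(1) Us(1)])
    have "K <#>\<^bsub>L\<^esub> set Us \<subseteq> finite_extension K Us"
      using subringE(6)[OF sub] finite_extension_incl[OF Ks(2) Us(1)] finite_extension_mem[OF Ks(1) Us(1)]
      by (auto simp: set_mult_def)
    then show "W \<subseteq> finite_extension K Us"
      using Span_min[OF K(1) Us(1) subring.axioms(1)[OF sub]] Us(2) by simp
  qed
qed

lemma sumprod_prodl:
  assumes D: "D \<subseteq> carrier L" "\<one> \<in> D" and r: "\<And>d. d \<in> set ds \<Longrightarrow> d \<in> D \<and> r d \<le> n"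
  shows "sumprod D {\<one>} (length ds * n) 1 (prodl (\<lambda>d. d [^] (r d :: nat)) ds)"
  using r
proof (induction ds)
  case Nil then show ?case using sumprod.base[of \<one> "{\<one>}" D] by simp
next
  case (Cons d ds)
  have one: "{\<one>} \<subseteq> carrier L" by simp
  have im: "(\<lambda>(u, v). u \<otimes> v) ` ({\<one>} \<times> {\<one>}) = {\<one>}" by simp
  have d: "d \<in> D" "d \<in> carrier L" "r d \<le> n" using Cons(2)[of d] D by auto
  have "sumprod D {\<one>} m 1 (d [^] m)" for m :: nat
  proof (induction m)
    case 0 then show ?case using sumprod.base[of \<one> "{\<one>}" D] by simp
  next
    case (Suc m) then show ?case using sumprod.mult[OF d(1) Suc] d(2) by (simp add: m_comm)
  qed
  then have 1: "sumprod D {\<one>} n 1 (d [^] r d)" using sumprod_pad D one d(3) by blast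
  have "sumprod D {\<one>} (n + length ds * n) (1 * 1) (d [^] r d \<otimes> prodl (\<lambda>d. d [^] r d) ds)"
    using sumprod_mult[OF 1 Cons(1)[OF Cons(2)] D(1) one one] unfolding im by simp
  then show ?case by simp
qed

lemma root_of_unity_mem:
  fixes p :: nat
  assumes p: "Factorial_Ring.prime p" and e: "\<epsilon> \<in> E" "\<epsilon> [^] p = \<one>" "\<epsilon> \<noteq> \<one>" and E: "subring E L"
    and y: "\<eta> \<in> carrier L" "\<eta> [^] p = \<one>"
  shows "\<eta> \<in> E"
proof -
  have ec: "\<epsilon> \<in> carrier L" using e subringE(1)[OF E] by auto
  obtain s :: nat where "\<eta> = \<epsilon> [^] s"
    using all_roots_of_unity[OF prime_gt_0_nat[OF p] ec e(2) prime_order_injective[OF p ec e(2,3)] y] by blast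
  then show ?thesis using pow_in_subring[OF E e(1)] by simp
qed

lemma coprime_pow_mem:
  assumes E: "subfield E L" and x: "x \<in> carrier L" "x \<noteq> \<zero>" and c: "coprime m n" "x [^] (m::nat) \<in> E" "x [^] (n::nat) \<in> E" "m > 0"
  shows "x \<in> E"
proof -
  have Es: "subring E L" using subfieldE[OF E] by auto
  obtain u v where uv: "m * u = n * v + 1" using bezout_nat[of m n] c by (auto simp: coprime_iff_gcd_eq_1)
  have 1: "x [^] (m * u) \<in> E" "x [^] (n * v) \<in> E"
    using pow_in_subring[OF Es c(2), of u] pow_in_subring[OF Es c(3), of v] x by (simp_all add: nat_pow_pow)
  have nz: "x [^] (n * v) \<noteq> \<zero>" using pow_nonzero[OF x] .
  have "x [^] (n * v) \<otimes> x \<in> E" using 1(1) uv x by simp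
  then show ?thesis using subfield_m_inv_simprule[OF E, of "x [^] (n * v)" x] 1 nz x by auto
qed

lemma finite_roots_of_unity:
  assumes "(n::nat) > 0" shows "finite {y \<in> carrier L. y [^] n = \<one>}"
proof -
  obtain q where q: "q \<in> carrier (poly_ring L)" "q \<noteq> []" "\<And>y. y \<in> carrier L \<Longrightarrow> eval q y = y [^] n \<ominus> \<one>"
    by (rule binomial_poly[OF carrier_is_subfield one_closed assms]) (rule that)
  have "{y \<in> carrier L. y [^] n = \<one>} \<subseteq> {y. is_root q y}"
    using q by (auto simp: is_root_def a_minus_def r_neg)
  then show ?thesis using finite_number_of_roots[OF q(1)] finite_subset by blast
qed

lemma nat_mult_one: "add_pow L (m * n) \<one> = add_pow L m \<one> \<otimes> add_pow L n \<one>" for m n :: nat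
  using from_int_mult[of "int m" "int n"] by (simp only: of_nat_mult[symmetric] from_int_of_nat)

end

text \<open>The group is kept abstract, with an injective homomorphism \<open>\<gamma>\<close> into the
  nonzero elements of \<open>L\<close>; its image is a group of units of \<open>L\<close> only,
  while torsion and generation are notions of \<open>G\<close>.\<close>

locale group_in_field = algebraically_closed L + G: comm_group G
  for L :: "('a, 'b) ring_scheme" (structure) and G :: "('g, 'h) monoid_scheme" +
  fixes \<gamma> :: "'g \<Rightarrow> 'a"
  assumes gam_closed: "\<And>g. g \<in> carrier G \<Longrightarrow> \<gamma> g \<in> carrier L"
    and gam_nonzero: "\<And>g. g \<in> carrier G \<Longrightarrow> \<gamma> g \<noteq> \<zero>"
    and gam_mult: "\<And>g h. g \<in> carrier G \<Longrightarrow> h \<in> carrier G \<Longrightarrow> \<gamma> (g \<otimes>\<^bsub>G\<^esub> h) = \<gamma> g \<otimes> \<gamma> h"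
    and gam_inj: "inj_on \<gamma> (carrier G)"
begin

lemma gam_one: "\<gamma> \<one>\<^bsub>G\<^esub> = \<one>"
proof -
  have "\<gamma> \<one>\<^bsub>G\<^esub> \<otimes> \<gamma> \<one>\<^bsub>G\<^esub> = \<gamma> \<one>\<^bsub>G\<^esub> \<otimes> \<one>"
    using gam_mult[of "\<one>\<^bsub>G\<^esub>" "\<one>\<^bsub>G\<^esub>"] gam_closed[of "\<one>\<^bsub>G\<^esub>"] by simp
  then show ?thesis by (subst (asm) m_lcancel) (auto simp: gam_nonzero gam_closed)
qed

lemma gam_inv: "g \<in> carrier G \<Longrightarrow> \<gamma> (inv\<^bsub>G\<^esub> g) = inv (\<gamma> g)"
  using gam_mult[of g "inv\<^bsub>G\<^esub> g"] gam_one gam_closed[of g] gam_closed[of "inv\<^bsub>G\<^esub> g"]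
  by (metis G.inv_closed G.r_inv comm_inv_char)

lemma gam_pow: "g \<in> carrier G \<Longrightarrow> \<gamma> (g [^]\<^bsub>G\<^esub> (n::nat)) = \<gamma> g [^] n"
  by (induction n) (simp_all add: gam_one gam_mult)

text \<open>Listing the generators together with their inverses makes nonnegative exponents sufficient.\<close>

lemma generated_products:
  assumes S: "finite S" "S \<subseteq> carrier G"
  obtains ds where "set ds = \<gamma> ` S \<union> (\<lambda>s. inv (\<gamma> s)) ` S"
    "\<And>h. h \<in> generate G S \<Longrightarrow> \<exists>m. \<gamma> h = prodl (\<lambda>d. d [^] (m d :: nat)) ds"
    "\<And>m. \<exists>h\<in>generate G S. \<gamma> h = prodl (\<lambda>d. d [^] (m d :: nat)) ds"
proof -
  let ?D = "\<gamma> ` S \<union> (\<lambda>s. inv (\<gamma> s)) ` S"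
  obtain ds where ds: "set ds = ?D" "distinct ds" using S finite_distinct_list[of ?D] by auto
  have gen: "subgroup (generate G S) G" by (rule G.generate_is_subgroup[OF S(2)])
  note genE = subgroup.m_closed[OF gen] subgroup.m_inv_closed[OF gen] subgroup.one_closed[OF gen] subgroup.subset[OF gen]
  have Dc: "d \<in> carrier L" "\<exists>h\<in>generate G S. \<gamma> h = d" if d: "d \<in> ?D" for d
  proof -
    from d obtain s where s: "s \<in> S" "d = \<gamma> s \<or> d = inv (\<gamma> s)" by auto
    have sc: "s \<in> carrier G" using s S by auto
    have sg: "s \<in> generate G S" using s(1) by (rule generate.incl)
    show "d \<in> carrier L" using s sc gam_closed gam_nonzero by auto
    show "\<exists>h\<in>generate G S. \<gamma> h = d" using s sg genE(2)[OF sg] gam_inv[OF sc] by auto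
  qed
  have single: "\<exists>m. d = prodl (\<lambda>d. d [^] (m d :: nat)) ds" if d: "d \<in> ?D" for d
  proof -
    have "prodl (\<lambda>x. x [^] (if x = d then 1 else 0 :: nat)) xs = (if d \<in> set xs then d else \<one>)"
      if "distinct xs" "set xs \<subseteq> ?D" for xs
      using that by (induction xs) (use Dc d in auto)
    from this[OF ds(2)] show ?thesis using d ds(1) by (intro exI[of _ "\<lambda>x. if x = d then 1 else 0"]) simp
  qed
  show thesis
  proof (rule that[OF ds(1)])
    fix h assume "h \<in> generate G S"
    then show "\<exists>m. \<gamma> h = prodl (\<lambda>d. d [^] (m d :: nat)) ds"
    proof induction
      case one
      have "prodl (\<lambda>d. d [^] (0::nat)) ds = \<one>" by (induction ds) auto
      then show ?case using gam_one by (intro exI[of _ "\<lambda>_. 0"]) simp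
    next
      case (incl h) then show ?case using single by blast
    next
      case (inv h)
      have "\<gamma> (inv\<^bsub>G\<^esub> h) = inv (\<gamma> h)" using inv S by (intro gam_inv) auto
      then show ?case using single[of "inv (\<gamma> h)"] inv by auto
    next
      case (eng h k)
      then obtain m m' where m: "\<gamma> h = prodl (\<lambda>d. d [^] (m d :: nat)) ds" "\<gamma> k = prodl (\<lambda>d. d [^] (m' d :: nat)) ds" by auto
      have "\<gamma> (h \<otimes>\<^bsub>G\<^esub> k) = \<gamma> h \<otimes> \<gamma> k" using eng genE(4) by (intro gam_mult) auto
      also have "\<dots> = prodl (\<lambda>d. d [^] m d \<otimes> d [^] m' d) ds"
        unfolding m by (rule prodl_mult[symmetric]) (use Dc ds in auto)
      also have "\<dots> = prodl (\<lambda>d. d [^] (m d + m' d)) ds"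
        by (rule prodl_cong) (use Dc ds in \<open>auto simp: nat_pow_mult\<close>)
      finally show ?case by (intro exI[of _ "\<lambda>d. m d + m' d"])
    qed
  next
    fix m :: "'a \<Rightarrow> nat"
    have "\<exists>h\<in>generate G S. \<gamma> h = prodl (\<lambda>d. d [^] m d) xs" if "set xs \<subseteq> ?D" for xs
      using that
    proof (induction xs)
      case Nil then show ?case using genE(3) gam_one by auto
    next
      case (Cons d xs)
      then obtain h where h: "h \<in> generate G S" "\<gamma> h = prodl (\<lambda>d. d [^] m d) xs" by auto
      obtain k where k: "k \<in> generate G S" "\<gamma> k = d" using Dc(2)[of d] Cons by auto
      have kc: "k \<in> carrier G" "h \<in> carrier G" using h k genE(4) by auto
      have kp: "k [^]\<^bsub>G\<^esub> n \<in> generate G S" for n :: nat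
        by (induction n) (use k genE in auto)
      have "\<gamma> (k [^]\<^bsub>G\<^esub> m d \<otimes>\<^bsub>G\<^esub> h) = prodl (\<lambda>d. d [^] m d) (d # xs)"
        using gam_mult[of "k [^]\<^bsub>G\<^esub> m d" h] gam_pow[OF kc(1)] h k kc by simp
      then show ?case using genE(1)[OF kp h(1)] by blast
    qed
    then show "\<exists>h\<in>generate G S. \<gamma> h = prodl (\<lambda>d. d [^] m d) ds" using ds(1) by simp
  qed
qed

text \<open>Let \<open>a^n\<close> be a product of powers of generators. Reducing all exponents modulo
  \<open>n\<close> changes \<open>a\<close> by an element of the group; afterwards
  \<open>a^n\<close> is a product of at most \<open>e n\<close> generators, where \<open>e\<close>
  is their number, and \<open>northcott_division_hull\<close> leaves finitely many possibilities.\<close>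

lemma finite_division_hull:
  assumes F: "subfield F L" "northcott F" and S: "finite S" "S \<subseteq> carrier G" "\<gamma> ` S \<subseteq> F"
  shows "\<exists>Y. finite Y \<and> Y \<subseteq> carrier L \<and>
    (\<forall>a\<in>F. (\<exists>n>0. \<exists>h\<in>generate G S. a [^] (n::nat) = \<gamma> h) \<longrightarrow> (\<exists>y\<in>Y. \<exists>h\<in>generate G S. a = y \<otimes> \<gamma> h))"
proof -
  have Fs: "subring F L" and Fc: "F \<subseteq> carrier L" using subfieldE[OF F(1)] by auto
  obtain ds where ds: "set ds = \<gamma> ` S \<union> (\<lambda>s. inv (\<gamma> s)) ` S"
    and exp: "\<And>h. h \<in> generate G S \<Longrightarrow> \<exists>m. \<gamma> h = prodl (\<lambda>d. d [^] (m d :: nat)) ds"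
    and mem: "\<And>m. \<exists>h\<in>generate G S. \<gamma> h = prodl (\<lambda>d. d [^] (m d :: nat)) ds"
    by (rule generated_products[OF S(1,2)]) (rule that)
  have gen: "generate G S \<subseteq> carrier G" by (rule G.generate_incl[OF S(2)])
  let ?D = "insert \<one> (set ds)"
  have dF: "d \<in> F" "d \<noteq> \<zero>" "d \<in> carrier L" if d: "d \<in> set ds" for d
  proof -
    from d obtain s where s: "s \<in> S" "d = \<gamma> s \<or> d = inv (\<gamma> s)" using ds by auto
    have g: "\<gamma> s \<in> F" "\<gamma> s \<noteq> \<zero>" "\<gamma> s \<in> carrier L" using s(1) S gam_nonzero gam_closed by auto
    show "d \<in> F" using s(2) g(1) subfield_inv[OF F(1) g(1,2)] by blast
    show "d \<noteq> \<zero>" using s(2) g(2) inv_nonzero(4)[OF g(3,2)] by (elim disjE) simp_all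
    show "d \<in> carrier L" using s(2) g(3) inv_nonzero(1)[OF g(3,2)] by blast
  qed
  have D: "finite ?D" "?D \<subseteq> F" "\<one> \<in> ?D" using dF subringE(3)[OF Fs] by auto
  define Y where "Y = {a \<in> F. \<exists>n>0. sumprod ?D {\<one>} (length ds * n) 1 (a [^] n)}"
  have finY: "finite Y" unfolding Y_def by (rule northcott_division_hull[OF F D])
  have Yc: "Y \<subseteq> carrier L" using Fc by (auto simp: Y_def)
  have main: "\<exists>y\<in>Y. \<exists>h\<in>generate G S. a = y \<otimes> \<gamma> h"
    if a: "a \<in> F" and n: "(n::nat) > 0" and h: "h \<in> generate G S" "a [^] n = \<gamma> h" for a n h
  proof -
    obtain m where m: "\<gamma> h = prodl (\<lambda>d. d [^] (m d :: nat)) ds" using exp[OF h(1)] by (elim exE)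
    obtain k where k: "k \<in> generate G S" "\<gamma> k = prodl (\<lambda>d. d [^] (m d div n)) ds"
      using mem[of "\<lambda>d. m d div n"] by (elim bexE)
    have kG: "k \<in> carrier G" using k(1) gen by auto
    note kc = kG gam_closed[OF kG] gam_nonzero[OF kG]
    have ac: "a \<in> carrier L" using a Fc by auto
    let ?y = "a \<otimes> inv (\<gamma> k)"
    have "prodl (\<lambda>d. d [^] (m d div n)) ds \<in> F"
      by (rule prodl_in_subring[OF Fs]) (use dF pow_in_subring[OF Fs] in auto)
    then have "?y \<in> F" using k(2) subfield_inv[OF F(1)] kc subringE(6)[OF Fs a] by simp
    moreover have "?y [^] n = prodl (\<lambda>d. d [^] (m d mod n)) ds"
    proof -
      have rc: "prodl (\<lambda>d. d [^] (m d mod n)) ds \<in> carrier L" by (rule prodl_closed) (use dF in auto)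
      have "\<gamma> h = prodl (\<lambda>d. (d [^] (m d div n)) [^] n \<otimes> d [^] (m d mod n)) ds"
        unfolding m by (rule prodl_cong) (use dF in \<open>auto simp: nat_pow_pow nat_pow_mult\<close>)
      also have "\<dots> = \<gamma> k [^] n \<otimes> prodl (\<lambda>d. d [^] (m d mod n)) ds"
        unfolding k(2) using dF by (subst prodl_mult) (auto simp: prodl_pow)
      finally have "a [^] n = \<gamma> k [^] n \<otimes> prodl (\<lambda>d. d [^] (m d mod n)) ds" using h(2) by simp
      moreover have "?y [^] n = inv (\<gamma> k [^] n) \<otimes> a [^] n"
        using ac kc pow_nonzero[OF kc(2,3)] by (simp add: nat_pow_distrib inv_pow_field m_comm)
      ultimately show ?thesis using rc kc pow_nonzero[OF kc(2,3)] by (simp add: m_assoc[symmetric])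
    qed
    moreover have "sumprod ?D {\<one>} (length ds * n) 1 (prodl (\<lambda>d. d [^] (m d mod n)) ds)"
      by (rule sumprod_prodl) (use D Fc n in \<open>auto simp: less_imp_le\<close>)
    ultimately have "?y \<in> Y" using n by (auto simp: Y_def)
    moreover have "a = ?y \<otimes> \<gamma> k" using ac kc by (simp add: m_assoc)
    ultimately show ?thesis using k(1) by blast
  qed
  show ?thesis
  proof (intro exI[of _ Y] conjI ballI impI finY Yc)
    fix a assume a: "a \<in> F" "\<exists>n>0. \<exists>h\<in>generate G S. a [^] (n::nat) = \<gamma> h"
    then obtain n h where "(n::nat) > 0" "h \<in> generate G S" "a [^] n = \<gamma> h" by auto
    then show "\<exists>y\<in>Y. \<exists>h\<in>generate G S. a = y \<otimes> \<gamma> h" by (rule main[OF a(1)])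
  qed
qed

text \<open>One element of the group for each of the finitely many classes of
  \<open>finite_division_hull\<close>, together with \<open>S\<close>, generates.\<close>

lemma fin_gen_group_of_field:
  assumes F: "subfield F L" "northcott F" and S: "finite S" "S \<subseteq> carrier G" "\<gamma> ` S \<subseteq> F"
    and tor: "\<And>g. g \<in> carrier G \<Longrightarrow> \<exists>n>0. g [^]\<^bsub>G\<^esub> (n::nat) \<in> generate G S"
  shows "\<exists>T. finite T \<and> T \<subseteq> carrier G \<and> generate G T = {g \<in> carrier G. \<gamma> g \<in> F}"
    "subgroup {g \<in> carrier G. \<gamma> g \<in> F} G"
proof -
  have Fs: "subring F L" and Fc: "F \<subseteq> carrier L" using subfieldE[OF F(1)] by auto
  let ?K = "{g \<in> carrier G. \<gamma> g \<in> F}"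
  show K: "subgroup ?K G"
  proof (rule G.subgroupI)
    show "?K \<noteq> {}" using gam_one subringE(3)[OF Fs] by auto
    fix a b assume "a \<in> ?K" "b \<in> ?K"
    then show "a \<otimes>\<^bsub>G\<^esub> b \<in> ?K" using gam_mult subringE(6)[OF Fs] by auto
  next
    fix a assume "a \<in> ?K"
    then show "inv\<^bsub>G\<^esub> a \<in> ?K" using gam_inv gam_nonzero subfield_inv[OF F(1)] by auto
  qed auto
  have gen: "subgroup (generate G S) G" by (rule G.generate_is_subgroup[OF S(2)])
  have genc: "generate G S \<subseteq> carrier G" by (rule G.generate_incl[OF S(2)])
  have HK: "generate G S \<subseteq> ?K" by (rule G.generate_subgroup_incl[OF _ K]) (use S in auto)
  obtain Y where Y: "finite Y" "Y \<subseteq> carrier L" "\<And>a n h. a \<in> F \<Longrightarrow> n > 0 \<Longrightarrow> h \<in> generate G S \<Longrightarrow> a [^] (n::nat) = \<gamma> h \<Longrightarrow>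
      \<exists>y\<in>Y. \<exists>h\<in>generate G S. a = y \<otimes> \<gamma> h"
    using finite_division_hull[OF F S] by meson
  define P where "P y g \<longleftrightarrow> g \<in> ?K \<and> (\<exists>h\<in>generate G S. \<gamma> g = y \<otimes> \<gamma> h)" for y g
  define c where "c y = (SOME g. P y g)" for y
  let ?T = "S \<union> c ` {y \<in> Y. \<exists>g. P y g}"
  have cP: "P y (c y)" if "\<exists>g. P y g" for y unfolding c_def using someI_ex[OF that] .
  have TK: "?T \<subseteq> ?K" using cP S by (auto simp: P_def)
  have "?K \<subseteq> generate G ?T"
  proof
    fix g assume g: "g \<in> ?K"
    obtain n where n: "n > 0" "g [^]\<^bsub>G\<^esub> (n::nat) \<in> generate G S" using tor[of g] g by auto
    have "\<gamma> g [^] n = \<gamma> (g [^]\<^bsub>G\<^esub> n)" using gam_pow g by simp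
    then obtain y h where y: "y \<in> Y" "h \<in> generate G S" "\<gamma> g = y \<otimes> \<gamma> h" using Y(3)[of "\<gamma> g" n] n g by blast
    have ex: "\<exists>g. P y g" using y g by (auto simp: P_def)
    obtain k where k: "k \<in> generate G S" "\<gamma> (c y) = y \<otimes> \<gamma> k" using cP[OF ex] by (auto simp: P_def)
    have cc: "c y \<in> carrier G" "k \<in> carrier G" "h \<in> carrier G" "g \<in> carrier G" "y \<in> carrier L"
      using cP[OF ex] k y g genc Y by (auto simp: P_def)
    have "\<gamma> (g \<otimes>\<^bsub>G\<^esub> k) = \<gamma> (c y \<otimes>\<^bsub>G\<^esub> h)"
      using cc y k gam_closed by (simp add: gam_mult m_ac)
    then have "g \<otimes>\<^bsub>G\<^esub> k = c y \<otimes>\<^bsub>G\<^esub> h" using gam_inj cc by (auto dest: inj_onD)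
    then have "g = (c y \<otimes>\<^bsub>G\<^esub> h) \<otimes>\<^bsub>G\<^esub> inv\<^bsub>G\<^esub> k" using cc by (metis G.inv_solve_right G.m_closed)
    moreover have "generate G S \<subseteq> generate G ?T" by (rule G.mono_generate) auto
    then have "h \<in> generate G ?T" "k \<in> generate G ?T" using y(2) k(1) by auto
    moreover have "c y \<in> generate G ?T" using y(1) ex by (intro generate.incl) auto
    moreover have T: "subgroup (generate G ?T) G" by (rule G.generate_is_subgroup) (use TK in auto)
    ultimately show "g \<in> generate G ?T"
      by (simp only: subgroup.m_closed[OF T] subgroup.m_inv_closed[OF T])
  qed
  moreover have "generate G ?T \<subseteq> ?K" by (rule G.generate_subgroup_incl[OF TK K])
  moreover have "finite ?T" using S Y by auto
  moreover have "?T \<subseteq> carrier G" using TK by blast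
  ultimately show "\<exists>T. finite T \<and> T \<subseteq> carrier G \<and> generate G T = ?K" by (intro exI[of _ ?T]) auto
qed

end

section \<open>The field of independence\<close>

context group_in_field
begin

text \<open>The element \<open>a = \<eta> \<gamma> g\<close> of \<open>F\<close> and its powers have
  \<open>p\<close>-th powers in \<open>\<gamma> K\<close>, where \<open>K\<close> is the group of
  all \<open>g\<close> with \<open>\<gamma> g \<in> F\<close>. They fall into at most \<open>card
  Y\<close> classes modulo \<open>\<gamma> K\<close>, so \<open>a^d\<close> lies in
  \<open>\<gamma> K\<close> for some \<open>0 < d < p\<close>, and with \<open>a^p\<close> also
  \<open>a\<close> itself. Hence \<open>\<eta>\<close> is in \<open>\<gamma> G\<close>, which has
  no \<open>p\<close>-torsion.\<close>

lemma large_primes_good: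
  assumes F: "subfield F L" "northcott F" and S: "finite S" "S \<subseteq> carrier G" "\<gamma> ` S \<subseteq> F"
    and tor: "\<And>g. g \<in> carrier G \<Longrightarrow> \<exists>n>0. g [^]\<^bsub>G\<^esub> (n::nat) \<in> generate G S"
    and primes: "finite (torsion_primes G)"
  obtains b :: nat where "\<And>p g \<eta>. Factorial_Ring.prime p \<Longrightarrow> b \<le> p \<Longrightarrow> g \<in> carrier G \<Longrightarrow> \<eta> \<in> carrier L \<Longrightarrow>
    \<gamma> g [^] p \<in> F \<Longrightarrow> \<eta> [^] p = \<one> \<Longrightarrow> \<eta> \<otimes> \<gamma> g \<in> F \<Longrightarrow> \<gamma> g \<in> F"
proof -
  have Fs: "subring F L" and Fc: "F \<subseteq> carrier L" using subfieldE[OF F(1)] by auto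
  let ?K = "{g \<in> carrier G. \<gamma> g \<in> F}"
  obtain T where T: "finite T" "T \<subseteq> carrier G" "generate G T = ?K"
    using fin_gen_group_of_field(1)[OF F S tor] by blast
  have K: "subgroup ?K G" by (rule fin_gen_group_of_field(2)[OF F S tor])
  have TF: "\<gamma> ` T \<subseteq> F" using generate.incl[of _ T G] T(3) by auto
  obtain Y where Y: "finite Y" "Y \<subseteq> carrier L" "\<And>a n h. a \<in> F \<Longrightarrow> n > 0 \<Longrightarrow> h \<in> ?K \<Longrightarrow> a [^] (n::nat) = \<gamma> h \<Longrightarrow>
      \<exists>y\<in>Y. \<exists>h\<in>?K. a = y \<otimes> \<gamma> h"
    using finite_division_hull[OF F T(1,2) TF] unfolding T(3) by meson
  (* Beyond the torsion primes, and large enough for the pigeonhole principle on Y to give an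
     exponent below p. *)
  define b where "b = Suc (max (card Y) (Max (insert 0 (torsion_primes G))))"
  show thesis
  proof (rule that[of b])
    fix p g \<eta> assume p: "Factorial_Ring.prime (p::nat)" "b \<le> p" and g: "g \<in> carrier G" and e: "\<eta> \<in> carrier L"
      and gp: "\<gamma> g [^] p \<in> F" and ep: "\<eta> [^] p = \<one>" and a: "\<eta> \<otimes> \<gamma> g \<in> F"
    have p0: "p > 0" using prime_gt_0_nat[OF p(1)] .
    have np: "p \<notin> torsion_primes G"
    proof
      assume "p \<in> torsion_primes G"
      then have "p \<le> Max (insert 0 (torsion_primes G))" using primes by (intro Max_ge) auto
      with p(2) show False by (simp add: b_def)
    qed
    have Yp: "card Y < p" using p(2) by (simp add: b_def)
    have gc: "\<gamma> g \<in> carrier L" "\<gamma> g \<noteq> \<zero>" using g gam_closed gam_nonzero by auto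
    let ?a = "\<eta> \<otimes> \<gamma> g"
    have ac: "?a \<in> carrier L" using a Fc by auto
    have e0: "\<eta> \<noteq> \<zero>" using ep p0 by (auto simp: nat_pow_zero)
    have a0: "?a \<noteq> \<zero>" using integral[of \<eta> "\<gamma> g"] e e0 gc by auto
    have ap: "?a [^] p = \<gamma> (g [^]\<^bsub>G\<^esub> p)" using e gc ep gam_pow[OF g] by (simp add: nat_pow_distrib)
    have gpK: "g [^]\<^bsub>G\<^esub> p \<in> ?K" using gam_pow[OF g] gp g by simp
    have Kpow: "k [^]\<^bsub>G\<^esub> n \<in> ?K" if "k \<in> ?K" for k and n :: nat
      by (induction n) (use that subgroup.m_closed[OF K] subgroup.one_closed[OF K] in auto)
    have "\<exists>y\<in>Y. \<exists>h\<in>?K. ?a [^] i = y \<otimes> \<gamma> h" for i :: nat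
    proof (rule Y(3)[OF pow_in_subring[OF Fs a] p0 Kpow[OF gpK, of i]])
      have "(?a [^] i) [^] p = (?a [^] p) [^] i" using ac by (simp add: nat_pow_pow mult.commute)
      then show "(?a [^] i) [^] p = \<gamma> ((g [^]\<^bsub>G\<^esub> p) [^]\<^bsub>G\<^esub> i)" using ap gam_pow[of "g [^]\<^bsub>G\<^esub> p" i] g by simp
    qed
    then obtain y h where y: "\<And>i. y i \<in> Y" and h: "\<And>i. h i \<in> ?K" and yh: "\<And>i. ?a [^] (i::nat) = y i \<otimes> \<gamma> (h i)" by metis
    have "\<not> inj_on y {0..card Y}"
    proof
      assume "inj_on y {0..card Y}"
      moreover have "y ` {0..card Y} \<subseteq> Y" using y by auto
      ultimately have "card {0..card Y} \<le> card Y" using card_inj_on_le[OF _ _ Y(1)] by blast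
      then show False by simp
    qed
    then obtain i0 j0 where ij0: "i0 \<le> card Y" "j0 \<le> card Y" "y i0 = y j0" "i0 \<noteq> j0" by (auto simp: inj_on_def)
    obtain i j where ij: "i < j" "j \<le> card Y" "y i = y j"
      using ij0 by (cases "i0 < j0") (auto intro: that[of i0 j0] that[of j0 i0])
    let ?d = "j - i"
    have hc: "h i \<in> carrier G" "h j \<in> carrier G" "\<gamma> (h i) \<in> carrier L" "\<gamma> (h j) \<in> carrier L" "\<gamma> (h i) \<noteq> \<zero>"
      using h[of i] h[of j] gam_closed gam_nonzero by auto
    have yc: "y i \<in> carrier L" using y Y(2) by blast
    define k where "k = h j \<otimes>\<^bsub>G\<^esub> inv\<^bsub>G\<^esub> (h i)"
    have kK: "k \<in> ?K" unfolding k_def using subgroup.m_closed[OF K h subgroup.m_inv_closed[OF K h]] .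
    have ad: "?a [^] ?d = \<gamma> k"
    proof -
      have "?a [^] i \<otimes> ?a [^] ?d = ?a [^] j" using ac ij(1) by (simp add: nat_pow_mult)
      also have "\<dots> = y i \<otimes> (\<gamma> k \<otimes> \<gamma> (h i))"
        unfolding yh[of j] k_def ij(3) using hc by (simp add: gam_mult gam_inv m_assoc)
      also have "\<dots> = ?a [^] i \<otimes> \<gamma> k" unfolding yh[of i] using hc yc kK gam_closed[of k] by (simp add: m_ac)
      finally show ?thesis using m_lcancel[OF pow_nonzero[OF ac a0, of i]] ac kK gam_closed[of k] by simp
    qed
    have "coprime ?d p" using p(1) ij Yp
      by (metis coprime_commute diff_less_mono2 less_imp_diff_less linorder_not_le nat_dvd_not_less order_le_less_trans prime_imp_coprime_nat zero_less_diff)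
    then obtain u w where uw: "?d * u = p * w + 1" using bezout_nat[of ?d p] ij by (auto simp: coprime_iff_gcd_eq_1)
    define l where "l = k [^]\<^bsub>G\<^esub> u \<otimes>\<^bsub>G\<^esub> inv\<^bsub>G\<^esub> ((g [^]\<^bsub>G\<^esub> p) [^]\<^bsub>G\<^esub> w)"
    have lK: "l \<in> ?K" unfolding l_def
      using subgroup.m_closed[OF K Kpow[OF kK] subgroup.m_inv_closed[OF K Kpow[OF gpK]]] .
    have al: "?a = \<gamma> l"
    proof -
      let ?c = "?a [^] (p * w)"
      have c: "?c \<in> carrier L" "?c \<noteq> \<zero>" using ac pow_nonzero[OF ac a0] by auto
      have "\<gamma> ((g [^]\<^bsub>G\<^esub> p) [^]\<^bsub>G\<^esub> w) = ?c"
        using gam_pow[of "g [^]\<^bsub>G\<^esub> p" w] ap ac g by (simp add: nat_pow_pow[symmetric])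
      moreover have "\<gamma> (k [^]\<^bsub>G\<^esub> u) = ?a [^] (p * w + 1)"
        unfolding uw[symmetric] using gam_pow[of k u] ad ac kK by (simp add: nat_pow_pow[symmetric])
      ultimately have "\<gamma> l = ?a [^] (p * w + 1) \<otimes> inv ?c"
        unfolding l_def using kK g by (simp add: gam_mult gam_inv)
      also have "\<dots> = (?c \<otimes> inv ?c) \<otimes> ?a" using c ac by (simp add: m_ac)
      also have "\<dots> = ?a" using c ac by simp
      finally show ?thesis by simp
    qed
    define q where "q = l \<otimes>\<^bsub>G\<^esub> inv\<^bsub>G\<^esub> g"
    have lc: "l \<in> carrier G" using lK by auto
    have qc: "q \<in> carrier G" using lc g by (simp add: q_def)
    have "\<gamma> q = \<eta>" unfolding q_def using al[symmetric] lc g e gc by (simp add: gam_mult gam_inv m_assoc)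
    then have "\<gamma> (q [^]\<^bsub>G\<^esub> p) = \<gamma> \<one>\<^bsub>G\<^esub>" using gam_pow[OF qc] ep gam_one by simp
    then have qp: "q [^]\<^bsub>G\<^esub> p = \<one>\<^bsub>G\<^esub>" using inj_onD[OF gam_inj] qc by simp
    have "q = \<one>\<^bsub>G\<^esub>"
    proof (rule ccontr)
      assume nq: "q \<noteq> \<one>\<^bsub>G\<^esub>"
      have "G.ord q dvd p" using G.pow_eq_id[OF qc] qp by simp
      then have "G.ord q = 1 \<or> G.ord q = p" using p(1) by (simp add: prime_nat_iff)
      then have "p dvd G.ord q" using nq G.ord_eq_1[OF qc] by auto
      moreover have "q \<in> torsion_part G" using qc qp p0 by (auto simp: torsion_part_def)
      ultimately have "p \<in> torsion_primes G" using p(1) by (auto simp: torsion_primes_def)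
      with np show False by simp
    qed
    then have "l = g" using lc g unfolding q_def by (metis G.inv_equality G.inv_inv G.inv_closed)
    then show "\<gamma> g \<in> F" using lK by simp
  qed
qed

text \<open>The field \<open>E\<close> arises from \<open>F\<close> by adjoining the roots of unity
  belonging to all primes below \<open>b\<close>. The point is that for \<open>p \<ge> b\<close>
  the condition of \<open>large_primes_good\<close> is inherited by \<open>E\<close>: as the
  degree of \<open>E\<close> over \<open>F\<close> is prime to \<open>p\<close>, a
  \<open>p\<close>-power radical over \<open>F\<close> lying in \<open>E\<close> already lies in
  \<open>F\<close> when \<open>E\<close> has no \<open>p\<close>-th roots of unity but
  \<open>1\<close>.\<close>

theorem independence_field:
  assumes S: "finite S" "S \<subseteq> carrier L" and S1: "finite S1" "S1 \<subseteq> carrier G"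
    and tor: "\<And>g. g \<in> carrier G \<Longrightarrow> \<exists>n>0. [n] \<cdot> \<one> \<noteq> \<zero> \<and> g [^]\<^bsub>G\<^esub> (n::nat) \<in> generate G S1"
    and primes: "finite (torsion_primes G)"
  shows "\<exists>E. subfield E L \<and> S \<subseteq> E \<and> fin_gen_subgroup G {g \<in> carrier G. \<gamma> g \<in> E} \<and>
    (\<forall>I. finite I \<and> I \<subseteq> carrier G \<and> (\<forall>g\<in>I. \<forall>h\<in>I. \<gamma> g \<otimes> inv (\<gamma> h) \<in> E \<longrightarrow> g = h) \<longrightarrow> lin_independent E I \<gamma>)"
proof -
  have tor': "\<exists>n>0. g [^]\<^bsub>G\<^esub> (n::nat) \<in> generate G S1" if "g \<in> carrier G" for g using tor[OF that] by blast
  have "finite (S \<union> \<gamma> ` S1)" "S \<union> \<gamma> ` S1 \<subseteq> carrier L" using S S1 gam_closed by auto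
  from exists_northcott_subfield[OF this]
  obtain F where F: "subfield F L" "northcott F" "S \<subseteq> F" "\<gamma> ` S1 \<subseteq> F" by auto
  have Fs: "subring F L" and Fc: "F \<subseteq> carrier L" using subfieldE[OF F(1)] by auto
  obtain b0 :: nat where b0: "\<And>p g \<eta>. Factorial_Ring.prime p \<Longrightarrow> b0 \<le> p \<Longrightarrow> g \<in> carrier G \<Longrightarrow> \<eta> \<in> carrier L \<Longrightarrow>
    \<gamma> g [^] p \<in> F \<Longrightarrow> \<eta> [^] p = \<one> \<Longrightarrow> \<eta> \<otimes> \<gamma> g \<in> F \<Longrightarrow> \<gamma> g \<in> F"
    by (rule large_primes_good[OF F(1,2) S1 F(4) tor' primes]) (assumption, rule that)
  (* At least 3, so that the prime 2, and with it the fourth roots of unity, is among the small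
     ones. *)
  define b where "b = max b0 3"
  let ?U = "\<Union>p\<in>{p. Factorial_Ring.prime p \<and> p < b}. {y \<in> carrier L. y [^] root_exponent p = \<one>}"
  have re0: "root_exponent p > 0" if "Factorial_Ring.prime p" for p
    using prime_gt_0_nat[OF that] by (simp add: root_exponent_def)
  have "finite ?U"
  proof (rule finite_UN_I)
    show "finite {p::nat. Factorial_Ring.prime p \<and> p < b}" by (rule finite_subset[of _ "{..<b}"]) auto
  qed (use finite_roots_of_unity re0 in auto)
  moreover have "y \<in> carrier L \<and> (\<exists>N>0. y [^] (N::nat) \<in> F \<and> (\<forall>q. Factorial_Ring.prime q \<longrightarrow> q dvd N \<longrightarrow> q < b))"
    if y: "y \<in> ?U" for y
  proof -
    from y obtain p where p: "Factorial_Ring.prime p" "p < b" "y \<in> carrier L" "y [^] root_exponent p = \<one>" by auto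
    have "q < b" if q: "Factorial_Ring.prime q" "q dvd root_exponent p" for q
    proof -
      have "root_exponent p = p \<or> root_exponent p = p * p" by (auto simp: root_exponent_def)
      then have "q dvd p" using q prime_dvd_mult_iff by (metis)
      then have "q = p" using q(1) p(1) primes_dvd_imp_eq by blast
      then show ?thesis using p by simp
    qed
    then show ?thesis using p re0[OF p(1)] subringE(3)[OF Fs] by (intro conjI exI[of _ "root_exponent p"]) auto
  qed
  ultimately obtain E where E: "smooth_extension b F E" "\<forall>y\<in>?U. y \<in> E"
    using smooth_extension_roots[OF F(1), of ?U "\<lambda>y. y" b] by blast
  have Ef: "subfield E L" "F \<subseteq> E" "finite_dimension F E"
    using E(1) by (auto simp: smooth_extension_def finite_dimension_def)
  have Es: "subring E L" and Ec: "E \<subseteq> carrier L" using subfieldE[OF Ef(1)] by auto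
  have NE: "northcott E" by (rule northcott_finite_dimension[OF F(1,2) Ef])
  have S1E: "\<gamma> ` S1 \<subseteq> E" using F(4) Ef(2) by auto
  have fg: "fin_gen_subgroup G {g \<in> carrier G. \<gamma> g \<in> E}"
    using fin_gen_group_of_field[OF Ef(1) NE S1 S1E tor'] unfolding fin_gen_subgroup_def by blast
  have small_roots: "\<eta> \<in> E" if "Factorial_Ring.prime p" "p < b" "\<eta> \<in> carrier L" "\<eta> [^] root_exponent p = \<one>" for p \<eta>
    using E(2) that by blast
  have good: "\<gamma> g \<in> E" if p: "Factorial_Ring.prime (p::nat)" and g: "g \<in> carrier G" and e: "\<eta> \<in> carrier L"
      and gp: "\<gamma> g [^] p \<in> E" and ep: "\<eta> [^] p = \<one>" and a: "\<eta> \<otimes> \<gamma> g \<in> E" for p g \<eta>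
  proof -
    have p0: "p > 0" using prime_gt_0_nat[OF p] .
    have gc: "\<gamma> g \<in> carrier L" "\<gamma> g \<noteq> \<zero>" using g gam_closed gam_nonzero by auto
    have e0: "\<eta> \<noteq> \<zero>" using ep p0 by (auto simp: nat_pow_zero)
    have inside: ?thesis if "\<eta> \<in> E"
      using subfield_m_inv_simprule[OF Ef(1), of \<eta> "\<gamma> g"] that e0 a gc by auto
    show ?thesis
    proof (cases "\<eta> \<in> E")
      case True then show ?thesis by (rule inside)
    next
      case nE: False
      have pb: "b \<le> p"
      proof (rule ccontr)
        assume "\<not> b \<le> p"
        then have pb: "p < b" by simp
        have "\<eta> [^] root_exponent p = \<one>"
        proof (cases "p = 2")
          case True
          have "\<eta> [^] (4::nat) = (\<eta> [^] (2::nat)) [^] (2::nat)" using e by (simp add: nat_pow_pow)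
          then show ?thesis using ep True by (simp add: root_exponent_def)
        next
          case False then show ?thesis using ep by (simp add: root_exponent_def)
        qed
        from small_roots[OF p pb e this] nE show False by simp
      qed
      (* One nontrivial p-th root of unity in E would generate all of them, \<eta> included. *)
      have only1: "\<epsilon> = \<one>" if "\<epsilon> \<in> E" "\<epsilon> [^] p = \<one>" for \<epsilon>
        using root_of_unity_mem[OF p that _ Es e ep] nE by blast
      obtain n where n: "n > 0" "g [^]\<^bsub>G\<^esub> (n::nat) \<in> generate G S1" using tor'[OF g] by blast
      have "generate G S1 \<subseteq> {g \<in> carrier G. \<gamma> g \<in> F}"
        by (rule G.generate_subgroup_incl[OF _ fin_gen_group_of_field(2)[OF F(1,2) S1 F(4) tor']]) (use S1 F(4) in auto)
      then have gn: "\<gamma> g [^] n \<in> F" using n gam_pow[OF g] by auto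
      obtain k m where km: "n = p ^ k * m" "\<not> p dvd m"
        using multiplicity_decompose'[of n p] n(1) p by (metis not_prime_unit mult.commute neq0_conv)
      have m0: "m > 0" using km n by (cases m) auto
      have cop: "coprime m p" using km(2) p by (metis coprime_commute prime_imp_coprime_nat)
      have em: "\<eta> [^] m \<notin> E"
      proof
        assume "\<eta> [^] m \<in> E"
        then have "\<eta> \<in> E"
          by (intro coprime_pow_mem[OF Ef(1) e e0 cop]) (use ep subringE(3)[OF Es] m0 in auto)
        with nE show False by simp
      qed
      (* Raising to the power m turns the element into a p-power radical over F and keeps \<eta> out
         of E, as m is prime to p. *)
      let ?y = "\<gamma> g [^] m" let ?a = "(\<eta> \<otimes> \<gamma> g) [^] m"
      have a': "?a = \<eta> [^] m \<otimes> ?y" using e gc by (simp add: nat_pow_distrib)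
      have aE: "?a \<in> E" using pow_in_subring[OF Es a] .
      have y: "?y \<in> carrier L" "?y \<noteq> \<zero>" using gc pow_nonzero by auto
      have yk: "?y [^] (p ^ k) \<in> F" using gn gc km(1) by (simp add: nat_pow_pow mult.commute)
      have emp: "(\<eta> [^] m) [^] p = \<one>"
      proof -
        have "(\<eta> [^] m) [^] p = (\<eta> [^] p) [^] m" using e by (simp add: nat_pow_pow mult.commute)
        then show ?thesis using ep by simp
      qed
      have not_both: False if "?y \<in> E"
      proof -
        have "\<eta> [^] m = ?a \<otimes> inv ?y" unfolding a' using e y by (simp add: m_assoc)
        also have "\<dots> \<in> E" using subringE(6)[OF Es aE subfield_inv[OF Ef(1) that y(2)]] .
        finally show False using em by simp
      qed
      have k0: "k \<noteq> 0"
      proof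
        assume "k = 0"
        then have "?y \<in> F" using yk y by simp
        then show False using not_both Ef(2) by blast
      qed
      have "?a \<in> F"
      proof (rule smooth_extension_prime_power_root[OF F(1) E(1) p pb, of E])
        fix x \<epsilon> assume x: "x \<in> E" "x [^] p \<in> F" "\<epsilon> \<in> carrier L" "\<epsilon> [^] p = \<one>" "\<epsilon> \<otimes> x \<in> F"
        show "x \<in> F"
        proof (cases "x = \<zero>")
          case True then show ?thesis using subringE(2)[OF Fs] by simp
        next
          case False
          have xc: "x \<in> carrier L" using x Ec by auto
          have "\<epsilon> = (\<epsilon> \<otimes> x) \<otimes> inv x" using x(3) xc False by (simp add: m_assoc)
          also have "\<dots> \<in> E" using subringE(6)[OF Es _ subfield_inv[OF Ef(1) x(1) False]] x(5) Ef(2) by blast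
          finally have "\<epsilon> = \<one>" using only1 x(4) by simp
          then show ?thesis using x(5) xc by simp
        qed
      next
        have "(\<eta> [^] m) [^] (p ^ k) = ((\<eta> [^] m) [^] p) [^] (p ^ (k - 1))"
          using e k0 by (simp add: nat_pow_pow mult.assoc power_eq_if)
        then have "(\<eta> [^] m) [^] (p ^ k) = \<one>" using emp by simp
        then show "?a [^] (p ^ k) \<in> F" using yk e y unfolding a' by (simp add: nat_pow_distrib)
      qed (use aE pow_in_subring[OF Es] in auto)
      moreover have "?y [^] p \<in> F"
      proof -
        have "?a [^] p = ?y [^] p" unfolding a' using e y emp by (simp add: nat_pow_distrib)
        then show ?thesis using pow_in_subring[OF Fs \<open>?a \<in> F\<close>, of p] by simp
      qed
      ultimately have "\<gamma> (g [^]\<^bsub>G\<^esub> m) \<in> F"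
        using b0[OF p _ G.nat_pow_closed[OF g], of "\<eta> [^] m" m] pb e emp gam_pow[OF g, of m] a' by (simp add: b_def)
      then have "?y \<in> F" using gam_pow[OF g] by simp
      then show ?thesis using not_both Ef(2) by blast
    qed
  qed
  have "lin_independent E I \<gamma>"
    if I: "finite I" "I \<subseteq> carrier G" and nc: "\<And>g h. g \<in> I \<Longrightarrow> h \<in> I \<Longrightarrow> \<gamma> g \<otimes> inv (\<gamma> h) \<in> E \<Longrightarrow> g = h" for I
  proof -
    have ex: "\<exists>N>0. [N] \<cdot> \<one> \<noteq> \<zero> \<and> (\<forall>g\<in>I. \<gamma> g [^] (N::nat) \<in> E)"
      using I
    proof (induction I rule: finite_induct)
      case empty show ?case by (intro exI[of _ 1]) auto
    next
      case (insert g I)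
      then obtain N where N: "N > 0" "[N] \<cdot> \<one> \<noteq> \<zero>" "\<forall>g\<in>I. \<gamma> g [^] (N::nat) \<in> E" by auto
      have g: "g \<in> carrier G" using insert by auto
      obtain n where n: "n > 0" "[n] \<cdot> \<one> \<noteq> \<zero>" "g [^]\<^bsub>G\<^esub> (n::nat) \<in> generate G S1" using tor[OF g] by blast
      have "generate G S1 \<subseteq> {g \<in> carrier G. \<gamma> g \<in> E}"
        by (rule G.generate_subgroup_incl[OF _ fin_gen_group_of_field(2)[OF Ef(1) NE S1 S1E tor']]) (use S1 S1E in auto)
      then have gn: "\<gamma> g [^] n \<in> E" using n gam_pow[OF g] by auto
      have "\<gamma> h [^] (N * n) \<in> E" if h: "h \<in> insert g I" for h
      proof -
        have hc: "\<gamma> h \<in> carrier L" using h insert(4) gam_closed by auto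
        show ?thesis
        proof (cases "h = g")
          case True
          have "\<gamma> h [^] (N * n) = (\<gamma> g [^] n) [^] N" using hc True by (simp add: nat_pow_pow mult.commute)
          then show ?thesis using pow_in_subring[OF Es gn] by simp
        next
          case False
          then have "\<gamma> h [^] N \<in> E" using h N by auto
          then have "(\<gamma> h [^] N) [^] n \<in> E" by (rule pow_in_subring[OF Es])
          then show ?thesis using hc by (simp add: nat_pow_pow)
        qed
      qed
      moreover have "add_pow L (N * n) \<one> \<noteq> \<zero>" unfolding nat_mult_one using N n integral[of "[N] \<cdot> \<one>" "[n] \<cdot> \<one>"] by auto
      ultimately show ?case using N n by (intro exI[of _ "N * n"]) auto
    qed
    then obtain N where N: "N > 0" "[N] \<cdot> \<one> \<noteq> \<zero>" "\<And>g. g \<in> I \<Longrightarrow> \<gamma> g [^] (N::nat) \<in> E" by auto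
    show ?thesis
    proof (rule roots_independent[OF Ef(1), where G = "\<gamma> ` carrier G" and N = N and b = "Suc N"])
      fix y assume "y \<in> carrier L" "y [^] (4::nat) = \<one>"
      then show "y \<in> E" by (intro small_roots[of 2]) (auto simp: b_def root_exponent_def)
    next
      show "\<gamma> ` carrier G \<subseteq> carrier L - {\<zero>}" using gam_closed gam_nonzero by auto
      show "\<one> \<in> \<gamma> ` carrier G" using gam_one by (metis G.one_closed imageI)
      show "x \<otimes> y \<in> \<gamma> ` carrier G" if "x \<in> \<gamma> ` carrier G" "y \<in> \<gamma> ` carrier G" for x y
        using that gam_mult by (auto simp flip: gam_mult)
      show "inv x \<in> \<gamma> ` carrier G" if "x \<in> \<gamma> ` carrier G" for x
        using that by (auto simp flip: gam_inv)
    next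
      fix p y \<eta> assume "Factorial_Ring.prime (p::nat)" "y \<in> \<gamma> ` carrier G" "y [^] p \<in> E" "\<eta> \<in> carrier L" "\<eta> [^] p = \<one>" "\<eta> \<otimes> y \<in> E"
      then show "y \<in> E" using good[of p] by auto
    next
      fix q :: nat assume q: "Factorial_Ring.prime q" "q dvd N"
      then obtain m where m: "N = q * m" by auto
      have "[q] \<cdot> \<one> \<noteq> \<zero>" using N(2) unfolding m nat_mult_one by auto
      moreover have "q \<le> N" using dvd_imp_le[OF q(2) N(1)] .
      ultimately show "q < Suc N \<and> [q] \<cdot> \<one> \<noteq> \<zero>" by simp
    qed (use I N nc in auto)
  qed
  then show ?thesis using Ef F(3) fg by (intro exI[of _ E]) auto
qed

end

section \<open>Abelian groups of finite rank\<close>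

text \<open>A finite infimum of extended naturals is attained.\<close>

lemma prufer_rank_finite:
  assumes "prufer_rank G < \<infinity>"
  obtains m where "prufer_rank G = enat m"
    and "\<And>H. fin_gen_subgroup G H \<Longrightarrow>
      \<exists>S. finite S \<and> card S \<le> m \<and> S \<subseteq> carrier G \<and> generate G S = H"
proof -
  let ?A = "{enat m | m. \<forall>H. fin_gen_subgroup G H \<longrightarrow>
     (\<exists>S. finite S \<and> card S \<le> m \<and> S \<subseteq> carrier G \<and> generate G S = H)}"
  have ne: "?A \<noteq> {}"
  proof
    assume "?A = {}"
    then have "prufer_rank G = \<infinity>" unfolding prufer_rank_def by (simp only: Inf_enat_def) simp
    then show False using assms by simp
  qed
  then have "prufer_rank G \<in> ?A" unfolding prufer_rank_def Inf_enat_def by (simp only: if_False) (metis (no_types, lifting) LeastI ex_in_conv)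
  then obtain m where "prufer_rank G = enat m" "\<forall>H. fin_gen_subgroup G H \<longrightarrow>
     (\<exists>S. finite S \<and> card S \<le> m \<and> S \<subseteq> carrier G \<and> generate G S = H)" by auto
  then show ?thesis using that by blast
qed

context comm_group
begin

lemma torsion_part_subgroup: "subgroup (torsion_part G) G"
proof (rule subgroupI)
  show "torsion_part G \<noteq> {}" using one_closed by (auto simp: torsion_part_def intro!: exI[of _ \<one>] exI[of _ 1])
next
  fix a assume "a \<in> torsion_part G"
  then obtain n where n: "n > 0" "a \<in> carrier G" "a [^] (n::nat) = \<one>" by (auto simp: torsion_part_def)
  then have "inv a [^] n = \<one>" by (simp add: nat_pow_inv)
  then show "inv a \<in> torsion_part G" using n by (auto simp: torsion_part_def)
next
  fix a b assume "a \<in> torsion_part G" "b \<in> torsion_part G"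
  then obtain n k where n: "n > 0" "a \<in> carrier G" "a [^] (n::nat) = \<one>" and k: "k > 0" "b \<in> carrier G" "b [^] (k::nat) = \<one>"
    by (auto simp: torsion_part_def)
  have "a [^] (n * k) = (a [^] n) [^] k" "b [^] (n * k) = (b [^] k) [^] n"
    using n(2) k(2) by (simp_all add: nat_pow_pow mult.commute)
  then have "(a \<otimes> b) [^] (n * k) = \<one>" using n k by (simp add: nat_pow_distrib)
  then show "a \<otimes> b \<in> torsion_part G" using n k by (auto simp: torsion_part_def intro!: exI[of _ "n * k"])
qed (auto simp: torsion_part_def)

text \<open>For the trivial subgroup this is the \<open>p\<close>-component.\<close>

lemma power_into_subgroup:
  assumes H: "subgroup H G" and p: "p > (0::nat)"
  shows "subgroup {g \<in> carrier G. \<exists>n::nat. g [^] (p ^ n) \<in> H} G"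
proof (rule subgroupI)
  show "{g \<in> carrier G. \<exists>n::nat. g [^] (p ^ n) \<in> H} \<noteq> {}"
    using one_closed subgroup.one_closed[OF H] by (auto intro!: exI[of _ \<one>])
next
  fix a assume "a \<in> {g \<in> carrier G. \<exists>n::nat. g [^] (p ^ n) \<in> H}"
  then obtain n where n: "a \<in> carrier G" "a [^] (p ^ n) \<in> H" by auto
  then have "inv a [^] (p ^ n) \<in> H" using subgroup.m_inv_closed[OF H] by (simp add: nat_pow_inv)
  then show "inv a \<in> {g \<in> carrier G. \<exists>n::nat. g [^] (p ^ n) \<in> H}" using n by auto
next
  fix a b assume "a \<in> {g \<in> carrier G. \<exists>n::nat. g [^] (p ^ n) \<in> H}" "b \<in> {g \<in> carrier G. \<exists>n::nat. g [^] (p ^ n) \<in> H}"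
  then obtain n k where n: "a \<in> carrier G" "a [^] (p ^ n) \<in> H" and k: "b \<in> carrier G" "b [^] (p ^ k) \<in> H" by auto
  have pw: "x [^] (i::nat) \<in> H" if "x \<in> H" for x i
    using that by (induction i) (auto simp: subgroup.one_closed[OF H] subgroup.m_closed[OF H])
  have "a [^] (p ^ (n + k)) = (a [^] (p ^ n)) [^] (p ^ k)" "b [^] (p ^ (n + k)) = (b [^] (p ^ k)) [^] (p ^ n)"
    using n k by (simp_all add: nat_pow_pow power_add mult.commute)
  then have "(a \<otimes> b) [^] (p ^ (n + k)) \<in> H"
    using n k pw subgroup.m_closed[OF H] by (simp add: nat_pow_distrib)
  then show "a \<otimes> b \<in> {g \<in> carrier G. \<exists>n::nat. g [^] (p ^ n) \<in> H}" using n k by blast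
qed auto

lemma p_component_subgroup:
  assumes "p > 0"
  shows "subgroup (p_component G p) G"
proof -
  have one: "subgroup {\<one>} G" by (rule triv_subgroup)
  have "p_component G p = {g \<in> carrier G. \<exists>n::nat. g [^] (p ^ n) \<in> {\<one>}}"
    using assms by (auto simp: p_component_def torsion_part_def intro: zero_less_power)
  then show ?thesis using power_into_subgroup[OF one assms] by simp
qed

text \<open>Each prime dividing the order of a torsion element contributes at least \<open>1\<close> to the
  total rank.\<close>

lemma finite_torsion_primes:
  assumes "total_rank G < \<infinity>"
  shows "finite (torsion_primes G)"
proof -
  let ?r = "\<lambda>p. prufer_rank (G\<lparr>carrier := p_component G p\<rparr>)"
  let ?T = "SUP F\<in>{F. finite F \<and> F \<subseteq> torsion_primes G}. \<Sum>p\<in>F. ?r p"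
  have "?T \<le> total_rank G" unfolding total_rank_def by simp
  then have "?T < \<infinity>" using assms by (rule le_less_trans)
  then obtain N where N: "?T = enat N" by (rule less_infinityE)
  have pos: "1 \<le> ?r p" if p: "p \<in> torsion_primes G" for p
  proof (rule ccontr)
    assume "\<not> 1 \<le> ?r p"
    then have r0: "?r p = 0" by (simp add: not_le one_eSuc iless_Suc_eq)
    obtain x where pp: "Factorial_Ring.prime p" and x: "x \<in> torsion_part G" "p dvd ord x"
      using p by (auto simp: torsion_primes_def)
    have xG: "x \<in> carrier G" using x by (simp add: torsion_part_def)
    obtain n where "n > 0" "x [^] (n::nat) = \<one>" using x by (auto simp: torsion_part_def)
    then have o: "ord x > 0" using pow_eq_id[OF xG, of n] by (auto intro!: Nat.gr0I)
    obtain d where d: "ord x = p * d" using x by blast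
    have p1: "p > 1" "p > 0" using pp prime_gt_1_nat by (auto simp: prime_gt_0_nat)
    have d0: "d > 0" "d < ord x" using o d p1 by auto
    define y where "y = x [^] d"
    have yG: "y \<in> carrier G" using xG by (simp add: y_def)
    have y1: "y \<noteq> \<one>" using pow_eq_id[OF xG, of d] d0 by (auto simp: y_def dest: dvd_imp_le)
    have yp: "y [^] p = \<one>" using pow_eq_id[OF xG, of "ord x"] xG d by (simp add: y_def nat_pow_pow mult.commute)
    have yP: "y \<in> p_component G p"
    proof -
      have "y \<in> torsion_part G" using yG yp p1(2) by (auto simp: torsion_part_def)
      moreover have "y [^] (p ^ 1) = \<one>" using yp by simp
      ultimately show ?thesis unfolding p_component_def by blast
    qed
    let ?P = "G\<lparr>carrier := p_component G p\<rparr>"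
    interpret P: group ?P by (rule subgroup.subgroup_is_group[OF p_component_subgroup[OF p1(2)] is_group])
    have fg: "fin_gen_subgroup ?P (generate ?P {y})"
      unfolding fin_gen_subgroup_def using yP P.generate_is_subgroup[of "{y}"] by (auto intro!: exI[of _ "{y}"])
    have "?r p < \<infinity>" using r0 by simp
    then obtain m where m: "?r p = enat m" "\<And>H. fin_gen_subgroup ?P H \<Longrightarrow>
      \<exists>S. finite S \<and> card S \<le> m \<and> S \<subseteq> carrier ?P \<and> generate ?P S = H" by (rule prufer_rank_finite) blast
    have "m = 0" using m(1) r0 by (simp add: enat_0_iff)
    then have "generate ?P {y} = generate ?P {}" using m(2)[OF fg] by auto
    then have "y \<in> {\<one>}" using P.generate_empty generate.incl[of y "{y}" ?P] by auto
    then show False using y1 by simp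
  qed
  have "finite (torsion_primes G) \<and> card (torsion_primes G) \<le> N"
  proof (rule finite_if_finite_subsets_card_bdd)
    fix F assume F: "F \<subseteq> torsion_primes G" "finite F"
    have "of_nat (card F) = (\<Sum>p\<in>F. 1::enat)" by simp
    also have "\<dots> \<le> (\<Sum>p\<in>F. ?r p)" by (rule sum_mono) (use F pos in blast)
    also have "\<dots> \<le> ?T" by (rule SUP_upper) (use F in auto)
    finally show "card F \<le> N" unfolding N by (simp add: of_nat_eq_enat)
  qed
  then show ?thesis by blast
qed

lemma generate_insert_decompose:
  assumes x: "x \<in> carrier G" and S: "S \<subseteq> carrier G" and z: "z \<in> generate G (insert x S)"
  obtains i :: int and w where "w \<in> generate G S" "z = x [^] i \<otimes> w"
proof -
  have gc: "generate G S \<subseteq> carrier G" using generate_incl[OF S] by auto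
  have sg: "subgroup (generate G S) G" by (rule generate_is_subgroup[OF S])
  have "\<exists>i::int. \<exists>w\<in>generate G S. z = x [^] i \<otimes> w"
    using z
  proof (induction rule: generate.induct)
    case one
    show ?case using subgroup.one_closed[OF sg] by (intro exI[of _ 0] bexI[of _ \<one>]) auto
  next
    case (incl h)
    then show ?case
    proof
      assume "h = x" then show ?thesis using subgroup.one_closed[OF sg] x by (intro exI[of _ 1] bexI[of _ \<one>]) auto
    next
      assume "h \<in> S" then show ?thesis using S by (intro exI[of _ 0] bexI[of _ h]) (auto intro: generate.incl)
    qed
  next
    case (inv h)
    then show ?case
    proof
      assume "h = x" then show ?thesis using subgroup.one_closed[OF sg] x by (intro exI[of _ "-1"] bexI[of _ \<one>]) (auto simp: int_pow_neg)
    next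
      assume "h \<in> S" then show ?thesis using S by (intro exI[of _ 0] bexI[of _ "inv h"]) (auto intro: generate.inv)
    qed
  next
    case (eng h1 h2)
    then obtain i j u v where *: "u \<in> generate G S" "v \<in> generate G S" "h1 = x [^] (i::int) \<otimes> u" "h2 = x [^] (j::int) \<otimes> v" by blast
    have c: "u \<in> carrier G" "v \<in> carrier G" using * gc by auto
    have "h1 \<otimes> h2 = x [^] (i + j) \<otimes> (u \<otimes> v)" using * c x by (simp add: int_pow_mult m_ac)
    then show ?case using * by (intro exI[of _ "i + j"] bexI[of _ "u \<otimes> v"]) (auto intro: generate.eng)
  qed
  then show ?thesis using that by blast
qed

text \<open>A group generated by \<open>n\<close> elements has at most \<open>2^n\<close> classes modulo
  squares, represented by the products over subsets of the generators.\<close>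

lemma square_class_representatives:
  assumes "finite T" "T \<subseteq> carrier G" "x \<in> generate G T"
  shows "\<exists>A\<subseteq>T. \<exists>z\<in>generate G T. x = finprod G (\<lambda>t. t) A \<otimes> (z \<otimes> z)"
  using assms
proof (induction T arbitrary: x rule: finite_induct)
  case empty
  then have "x = \<one>" using generate_empty by auto
  then show ?case by (intro exI[of _ "{}"] conjI bexI[of _ \<one>]) (auto intro: generate.one)
next
  case (insert t T)
  have t: "t \<in> carrier G" and T: "T \<subseteq> carrier G" using insert by auto
  obtain i w where w: "w \<in> generate G T" "x = t [^] (i::int) \<otimes> w"
    by (rule generate_insert_decompose[OF t T insert(5)])
  obtain A z where A: "A \<subseteq> T" "z \<in> generate G T" "w = finprod G (\<lambda>t. t) A \<otimes> (z \<otimes> z)"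
    using insert.IH[OF T w(1)] by blast
  have sub: "generate G T \<subseteq> generate G (insert t T)" by (rule mono_generate) auto
  have sg: "subgroup (generate G (insert t T)) G" by (rule generate_is_subgroup) (use insert in auto)
  have fA: "finite A" "t \<notin> A" "A \<subseteq> carrier G" using A insert finite_subset by auto
  have zc: "z \<in> carrier G" using A(2) generate_in_carrier[OF T] by blast
  have pc: "finprod G (\<lambda>t. t) A \<in> carrier G" by (rule finprod_closed) (use fA in auto)
  define j where "j = i div 2"
  have tj: "t [^] j \<in> generate G (insert t T)"
    by (rule subgroup_int_pow_closed[OF sg]) (auto intro: generate.incl)
  have zz: "t [^] j \<otimes> z \<in> generate G (insert t T)" using tj A(2) sub by (auto intro: generate.eng)
  have tjc: "t [^] j \<in> carrier G" using t by simp
  show ?case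
  proof (cases "even i")
    case True
    then have "i = j + j" by (auto simp: j_def)
    then have "t [^] i = t [^] j \<otimes> t [^] j" by (simp only: int_pow_mult[OF t])
    then have "x = finprod G (\<lambda>t. t) A \<otimes> ((t [^] j \<otimes> z) \<otimes> (t [^] j \<otimes> z))"
      using w A pc zc tjc by (simp add: m_ac)
    then show ?thesis using A zz by blast
  next
    case False
    then have "i = 1 + (j + j)" unfolding j_def by presburger
    then have "t [^] i = t \<otimes> (t [^] j \<otimes> t [^] j)" using t by (simp only: int_pow_mult[OF t] int_pow_1)
    moreover have "finprod G (\<lambda>t. t) (insert t A) = t \<otimes> finprod G (\<lambda>t. t) A"
      by (rule finprod_insert) (use fA t in auto)
    ultimately have "x = finprod G (\<lambda>t. t) (insert t A) \<otimes> ((t [^] j \<otimes> z) \<otimes> (t [^] j \<otimes> z))"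
      using w A pc zc tjc t by (simp add: m_ac)
    then show ?thesis using A zz by (intro exI[of _ "insert t A"] conjI bexI[of _ "t [^] j \<otimes> z"]) auto
  qed
qed

text \<open>If no finite set spanned up to torsion, one could keep adding elements \<open>x\<close> none of
  whose powers lies in the group generated so far. Each step doubles the number of classes modulo
  squares, since an exponent of \<open>x\<close> in \<open>{-1, 0, 1}\<close> is even only when it
  is zero. After \<open>m + 1\<close> steps this contradicts generation by \<open>m\<close>
  elements.\<close>

lemma finite_rank_spanning:
  assumes rank: "\<And>H. fin_gen_subgroup G H \<Longrightarrow>
      \<exists>S. finite S \<and> card S \<le> m \<and> S \<subseteq> carrier G \<and> generate G S = H"
  shows "\<exists>S. finite S \<and> S \<subseteq> carrier G \<and> (\<forall>g\<in>carrier G. \<exists>n::nat. n > 0 \<and> g [^] n \<in> generate G S)"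
proof (rule ccontr)
  assume neg: "\<not> ?thesis"
  (* D consists of elements of the group generated by S that are distinct modulo squares. *)
  define indep where "indep = (\<lambda>S D. D \<subseteq> generate G S \<and> (\<forall>a\<in>D. \<forall>b\<in>D. \<forall>z\<in>generate G S. a \<otimes> inv b = z \<otimes> z \<longrightarrow> a = b))"
  have step: "\<exists>S D. finite S \<and> S \<subseteq> carrier G \<and> finite D \<and> card D = 2 ^ k \<and> indep S D" for k :: nat
  proof (induction k)
    case 0
    have "indep {} {\<one>}" unfolding indep_def by (auto intro: generate.one)
    then show ?case by (intro exI[of _ "{}"] exI[of _ "{\<one>}"]) auto
  next
    case (Suc k)
    then obtain S D where S: "finite S" "S \<subseteq> carrier G" and D: "finite D" "card D = 2 ^ k" "indep S D" by blast
    have "\<exists>x\<in>carrier G. \<forall>n::nat. n > 0 \<longrightarrow> x [^] n \<notin> generate G S" using neg S by meson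
    then obtain x where x: "x \<in> carrier G" and xn: "\<And>n::nat. n > 0 \<Longrightarrow> x [^] n \<notin> generate G S" by blast
    have sg: "subgroup (generate G S) G" by (rule generate_is_subgroup[OF S(2)])
    have gc: "\<And>u. u \<in> generate G S \<Longrightarrow> u \<in> carrier G" using generate_in_carrier[OF S(2)] .
    have xi: "i = 0" if i: "x [^] (i::int) \<in> generate G S" for i
    proof (rule ccontr)
      assume "i \<noteq> 0"
      then consider "i > 0" | "- i > 0" by linarith
      then show False
      proof cases
        case 1
        then have "x [^] nat i \<in> generate G S" using i int_pow_int[of G x "nat i"] by simp
        then show False using xn[of "nat i"] 1 by simp
      next
        case 2
        have "x [^] (- i) \<in> generate G S" using subgroup.m_inv_closed[OF sg i] x by (simp add: int_pow_neg)
        then have "x [^] nat (- i) \<in> generate G S" using 2 int_pow_int[of G x "nat (- i)"] by simp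
        then show False using xn[of "nat (- i)"] 2 by simp
      qed
    qed
    have Dg: "D \<subseteq> generate G S" using D by (simp add: indep_def)
    let ?D = "D \<union> (\<lambda>d. x \<otimes> d) ` D"
    have key: "a = b"
      if ab: "\<epsilon> \<in> {0,1}" "\<delta> \<in> {0,1}" "a' \<in> D" "b' \<in> D" "a = x [^] \<epsilon> \<otimes> a'" "b = x [^] \<delta> \<otimes> b'" and z: "z \<in> generate G (insert x S)"
        and eq: "a \<otimes> inv b = z \<otimes> z" for a b z a' b' and \<epsilon> \<delta> :: int
    proof -
      obtain i w where w: "w \<in> generate G S" "z = x [^] (i::int) \<otimes> w" by (rule generate_insert_decompose[OF x S(2) z])
      have c: "a' \<in> carrier G" "b' \<in> carrier G" "w \<in> carrier G" using ab w Dg gc by auto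
      have xc: "x [^] j \<in> carrier G" for j :: int using x by simp
      have e1: "x [^] (\<epsilon> - \<delta>) \<otimes> (a' \<otimes> inv b') = x [^] (i + i) \<otimes> (w \<otimes> w)"
      proof -
        have "a \<otimes> inv b = x [^] \<epsilon> \<otimes> inv (x [^] \<delta>) \<otimes> (a' \<otimes> inv b')" using ab c xc by (simp add: inv_mult m_ac)
        moreover have "x [^] (\<epsilon> - \<delta>) = x [^] \<epsilon> \<otimes> inv (x [^] \<delta>)" using x by (simp add: int_pow_diff)
        moreover have "z \<otimes> z = x [^] (i + i) \<otimes> (w \<otimes> w)" unfolding int_pow_mult[OF x] w(2) using c xc by (simp add: m_ac)
        ultimately show ?thesis using eq by simp
      qed
      have "x [^] (\<epsilon> - \<delta> - (i + i)) = (w \<otimes> w) \<otimes> inv (a' \<otimes> inv b')"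
      proof -
        have "x [^] (\<epsilon> - \<delta> - (i + i)) \<otimes> (a' \<otimes> inv b') = inv (x [^] (i + i)) \<otimes> (x [^] (\<epsilon> - \<delta>) \<otimes> (a' \<otimes> inv b'))"
          using x c xc int_pow_diff[OF x, of "\<epsilon> - \<delta>" "i + i"] by (simp add: m_ac)
        also have "\<dots> = w \<otimes> w" unfolding e1 using xc[of "i + i"] c by (simp add: m_assoc[symmetric])
        finally have "x [^] (\<epsilon> - \<delta> - (i + i)) \<otimes> (a' \<otimes> inv b') = w \<otimes> w" .
        then show ?thesis using c xc by (metis inv_solve_right m_closed inv_closed)
      qed
      moreover have "(w \<otimes> w) \<otimes> inv (a' \<otimes> inv b') \<in> generate G S"
        using w ab Dg by (intro subgroup.m_closed[OF sg] subgroup.m_inv_closed[OF sg]) auto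
      ultimately have ei: "\<epsilon> - \<delta> - (i + i) = 0" using xi[of "\<epsilon> - \<delta> - (i + i)"] by simp
      have "\<epsilon> = 0 \<or> \<epsilon> = 1" "\<delta> = 0 \<or> \<delta> = 1" using ab(1,2) by auto
      then have i0: "i = 0" "\<epsilon> = \<delta>" using ei by presburger+
      then have "a' \<otimes> inv b' = w \<otimes> w" using e1 c by simp
      then have "a' = b'" using D(3) ab w unfolding indep_def by blast
      then show ?thesis using ab i0 by simp
    qed
    have rep: "\<exists>\<epsilon>::int. \<exists>a'\<in>D. \<epsilon> \<in> {0,1} \<and> a = x [^] \<epsilon> \<otimes> a'" if "a \<in> ?D" for a
    proof (cases "a \<in> D")
      case True then show ?thesis using Dg gc by (intro exI[of _ 0] bexI[of _ a]) auto
    next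
      case False then obtain d where "d \<in> D" "a = x \<otimes> d" using \<open>a \<in> ?D\<close> by auto
      then show ?thesis using x by (intro exI[of _ 1] bexI[of _ d]) auto
    qed
    have ind: "indep (insert x S) ?D"
    proof -
      have sub: "generate G S \<subseteq> generate G (insert x S)" by (rule mono_generate) auto
      have "?D \<subseteq> generate G (insert x S)" using Dg sub by (auto intro!: generate.eng[OF generate.incl])
      moreover have "\<forall>a\<in>?D. \<forall>b\<in>?D. \<forall>z\<in>generate G (insert x S). a \<otimes> inv b = z \<otimes> z \<longrightarrow> a = b"
      proof (intro ballI impI)
        fix a b z assume ab: "a \<in> ?D" "b \<in> ?D" and z: "z \<in> generate G (insert x S)" "a \<otimes> inv b = z \<otimes> z"
        obtain \<epsilon> a' where a: "a' \<in> D" "\<epsilon> \<in> {0,1::int}" "a = x [^] \<epsilon> \<otimes> a'" using rep[OF ab(1)] by blast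
        obtain \<delta> b' where b: "b' \<in> D" "\<delta> \<in> {0,1::int}" "b = x [^] \<delta> \<otimes> b'" using rep[OF ab(2)] by blast
        show "a = b" by (rule key[OF a(2) b(2) a(1) b(1) a(3) b(3) z])
      qed
      ultimately show ?thesis unfolding indep_def by blast
    qed
    have inj: "inj_on (\<lambda>d. x \<otimes> d) D"
    proof (rule inj_onI)
      fix a b assume ab: "a \<in> D" "b \<in> D" "x \<otimes> a = x \<otimes> b"
      have "a \<in> carrier G" "b \<in> carrier G" using ab Dg gc by auto
      then show "a = b" using ab(3) x by simp
    qed
    have disj: "D \<inter> (\<lambda>d. x \<otimes> d) ` D = {}"
    proof -
      have False if d: "d \<in> D" "x \<otimes> d \<in> D" for d
      proof -
        have "x \<otimes> d \<in> generate G S" "d \<in> generate G S" using d Dg by blast+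
        then have "(x \<otimes> d) \<otimes> inv d \<in> generate G S" by (rule subgroup.m_closed[OF sg _ subgroup.m_inv_closed[OF sg]])
        moreover have "(x \<otimes> d) \<otimes> inv d = x" using d Dg gc x by (simp add: m_assoc subset_iff)
        ultimately show False using xn[of 1] x by simp
      qed
      then show ?thesis by auto
    qed
    have "card ?D = 2 ^ Suc k" using card_Un_disjoint[OF D(1) _ disj] D card_image[OF inj] by simp
    then show ?case using ind S D x by (intro exI[of _ "insert x S"] exI[of _ ?D]) auto
  qed
  obtain S D where S: "finite S" "S \<subseteq> carrier G" and D: "finite D" "card D = 2 ^ Suc m" "indep S D" using step by blast
  have "fin_gen_subgroup G (generate G S)" unfolding fin_gen_subgroup_def using S generate_is_subgroup by blast
  then obtain T where T: "finite T" "card T \<le> m" "T \<subseteq> carrier G" "generate G T = generate G S" using rank by blast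
  define P where "P = (\<lambda>a A. A \<subseteq> T \<and> (\<exists>z\<in>generate G T. a = finprod G (\<lambda>t. t) A \<otimes> (z \<otimes> z)))"
  define A where "A = (\<lambda>a. SOME A. P a A)"
  have A: "P a (A a)" if "a \<in> D" for a
  proof -
    have "a \<in> generate G T" using that D(3) T(4) unfolding indep_def by auto
    then have "\<exists>A. P a A" unfolding P_def by (rule square_class_representatives[OF T(1,3)])
    then show ?thesis unfolding A_def by (rule someI_ex)
  qed
  have "inj_on A D"
  proof (rule inj_onI)
    fix a b assume ab: "a \<in> D" "b \<in> D" "A a = A b"
    obtain z where z: "z \<in> generate G T" "a = finprod G (\<lambda>t. t) (A a) \<otimes> (z \<otimes> z)"
      using A[OF ab(1)] unfolding P_def by blast
    obtain w where w: "w \<in> generate G T" "b = finprod G (\<lambda>t. t) (A a) \<otimes> (w \<otimes> w)"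
      using A[OF ab(2)] unfolding P_def ab(3) by blast
    have pc: "finprod G (\<lambda>t. t) (A a) \<in> carrier G"
      by (rule finprod_closed) (use A[OF ab(1)] T in \<open>auto simp: P_def\<close>)
    have c: "z \<in> carrier G" "w \<in> carrier G" using z w generate_in_carrier[OF T(3)] by auto
    define q where "q = finprod G (\<lambda>t. t) (A a)"
    have pc: "q \<in> carrier G" using pc by (simp add: q_def)
    have "a = q \<otimes> (z \<otimes> z)" "b = q \<otimes> (w \<otimes> w)" using z(2) w(2) unfolding q_def by auto
    moreover have "inv (q \<otimes> (w \<otimes> w)) = inv q \<otimes> (inv w \<otimes> inv w)" using pc c by (simp add: inv_mult)
    moreover have "(q \<otimes> (z \<otimes> z)) \<otimes> (q' \<otimes> (v \<otimes> v)) = (q \<otimes> q') \<otimes> ((z \<otimes> v) \<otimes> (z \<otimes> v))"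
      if "q' \<in> carrier G" "v \<in> carrier G" for q' v using that pc c by (simp add: m_ac)
    ultimately have "a \<otimes> inv b = (q \<otimes> inv q) \<otimes> ((z \<otimes> inv w) \<otimes> (z \<otimes> inv w))"
      using pc c by simp
    also have "\<dots> = (z \<otimes> inv w) \<otimes> (z \<otimes> inv w)" using pc c by simp
    finally have "a \<otimes> inv b = (z \<otimes> inv w) \<otimes> (z \<otimes> inv w)" .
    moreover have "z \<otimes> inv w \<in> generate G S"
      using z(1) w(1) unfolding T(4) by (intro subgroup.m_closed[OF generate_is_subgroup[OF S(2)]] subgroup.m_inv_closed[OF generate_is_subgroup[OF S(2)]])
    ultimately show "a = b" using D(3) ab unfolding indep_def by blast
  qed
  moreover have "A ` D \<subseteq> Pow T" using A by (auto simp: P_def)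
  ultimately have "card D \<le> card (Pow T)" by (rule card_inj_on_le) (simp add: T(1))
  also have "\<dots> \<le> 2 ^ m" using T(1,2) by (simp add: card_Pow)
  finally show False using D(2) by simp
qed

end

context comm_group
begin

lemma (in group) power_coset_hom:
  assumes "N \<lhd> G"
  shows "group_hom G (G Mod N) (\<lambda>a. N #> a)"
proof -
  interpret N: normal N G by fact
  show ?thesis using N.r_coset_hom_Mod N.factorgroup_is_group is_group
    by (simp add: group_hom_def group_hom_axioms_def)
qed

text \<open>Apply \<open>finite_rank_spanning\<close> to the quotient by the torsion subgroup and lift: the
  error is a torsion element, which a further power removes.\<close>

lemma fin_gen_torsion_quotient:
  assumes "total_rank G < \<infinity>"
  shows "\<exists>S. finite S \<and> S \<subseteq> carrier G \<and> (\<forall>g\<in>carrier G. \<exists>n::nat. n > 0 \<and> g [^] n \<in> generate G S)"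
proof -
  let ?t = "torsion_part G" and ?Q = "G Mod torsion_part G" and ?\<pi> = "\<lambda>a. torsion_part G #> a"
  have tn: "?t \<lhd> G" using torsion_part_subgroup normal_iff_subgroup by blast
  interpret N: normal ?t G by (rule tn)
  interpret Q: comm_group ?Q by (rule abelian_FactGroup[OF torsion_part_subgroup])
  interpret h: group_hom G ?Q ?\<pi> by (rule power_coset_hom[OF tn])
  have "prufer_rank ?Q \<le> total_rank G" unfolding total_rank_def by simp
  then have "prufer_rank ?Q < \<infinity>" using assms by (rule le_less_trans)
  then obtain m where "\<And>H. fin_gen_subgroup ?Q H \<Longrightarrow>
      \<exists>S. finite S \<and> card S \<le> m \<and> S \<subseteq> carrier ?Q \<and> generate ?Q S = H" by (rule prufer_rank_finite) blast
  then have "\<exists>S. finite S \<and> S \<subseteq> carrier ?Q \<and> (\<forall>g\<in>carrier ?Q. \<exists>n::nat. n > 0 \<and> g [^]\<^bsub>?Q\<^esub> n \<in> generate ?Q S)"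
    by (rule Q.finite_rank_spanning)
  then obtain S' where S': "finite S'" "S' \<subseteq> carrier ?Q"
    "\<And>g. g \<in> carrier ?Q \<Longrightarrow> \<exists>n::nat. n > 0 \<and> g [^]\<^bsub>?Q\<^esub> n \<in> generate ?Q S'" by blast
  have "carrier ?Q = ?\<pi> ` carrier G" by (auto simp: carrier_FactGroup)
  then obtain S where S: "finite S" "S \<subseteq> carrier G" "S' = ?\<pi> ` S"
    using finite_subset_image[OF S'(1), of ?\<pi> "carrier G"] S'(2) by blast
  have "\<exists>n::nat. n > 0 \<and> g [^] n \<in> generate G S" if g: "g \<in> carrier G" for g
  proof -
    have "?\<pi> g \<in> carrier ?Q" using h.hom_closed[OF g] .
    then obtain n where n: "n > 0" "?\<pi> g [^]\<^bsub>?Q\<^esub> (n::nat) \<in> generate ?Q S'" using S'(3) by blast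
    have "?\<pi> g [^]\<^bsub>?Q\<^esub> n = ?\<pi> (g [^] n)" using h.hom_nat_pow[OF g] by simp
    then obtain u where u: "u \<in> generate G S" "?\<pi> (g [^] n) = ?\<pi> u"
      using n(2) h.generate_img[OF S(2)] unfolding S(3) by auto
    have uc: "u \<in> carrier G" using u(1) generate_in_carrier[OF S(2)] by blast
    have "g [^] n \<in> ?\<pi> u" using rcos_self[OF _ torsion_part_subgroup, of "g [^] n"] g u(2) by simp
    then have "\<exists>\<tau>\<in>?t. g [^] n = \<tau> \<otimes> u" by (simp add: r_coset_def)
    then obtain \<tau> where \<tau>: "\<tau> \<in> ?t" "g [^] n = \<tau> \<otimes> u" by (rule bexE)
    have \<tau>': "\<tau> \<in> carrier G \<and> (\<exists>k::nat. k > 0 \<and> \<tau> [^] k = \<one>)"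
      using \<tau>(1) unfolding torsion_part_def by (rule CollectD)
    have \<tau>c: "\<tau> \<in> carrier G" by (rule conjunct1[OF \<tau>'])
    obtain k where k: "k > 0" "\<tau> [^] (k::nat) = \<one>"
      by (rule conjunct2[OF \<tau>', THEN exE]) (erule conjE, rule that)
    have "g [^] (n * k) = (g [^] n) [^] k" using g by (simp add: nat_pow_pow)
    also have "\<dots> = u [^] k" using k \<tau> \<tau>c uc by (simp add: nat_pow_distrib)
    also have "\<dots> \<in> generate G S"
      using subgroup_int_pow_closed[OF generate_is_subgroup[OF S(2)] u(1), of "int k"] by (simp only: int_pow_int)
    finally show ?thesis using n k by (intro exI[of _ "n * k"]) auto
  qed
  then show ?thesis using S by blast
qed

text \<open>The elements with a \<open>c\<close>-power in the given subgroup form a group whose quotient is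
  a \<open>c\<close>-section of \<open>G\<close>, hence finite; add representatives of its cosets.\<close>

lemma finite_extension_by_p_part:
  assumes c: "Factorial_Ring.prime (c::nat)" "c \<notin> Sp G" and S: "finite S" "S \<subseteq> carrier G"
  shows "\<exists>S'. finite S' \<and> S' \<subseteq> carrier G \<and> (\<forall>g\<in>carrier G. (\<exists>n::nat. g [^] (c ^ n) \<in> generate G S) \<longrightarrow> g \<in> generate G S')"
proof -
  define P where "P = {g \<in> carrier G. \<exists>n::nat. g [^] (c ^ n) \<in> generate G S}"
  let ?H = "generate G S" and ?P = "G\<lparr>carrier := P\<rparr>"
  have c0: "c > 0" using c by (simp add: prime_gt_0_nat)
  have H: "subgroup ?H G" by (rule generate_is_subgroup[OF S(2)])
  have P: "subgroup P G" unfolding P_def by (rule power_into_subgroup[OF H c0])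
  have HP: "?H \<subseteq> P"
    using generate_in_carrier[OF S(2)] by (auto simp: P_def intro!: exI[of _ 0])
  interpret P: comm_group ?P using subgroup.subgroup_is_group[OF P is_group] P by (intro group.group_comm_groupI) (auto simp: m_comm subset_iff dest: subgroup.subset)
  have HsP: "subgroup ?H ?P" by (rule subgroup_incl[OF H P HP])
  have n: "?H \<lhd> ?P" using HsP P.normal_iff_subgroup by blast
  interpret N: normal ?H ?P by (rule n)
  let ?\<pi> = "\<lambda>a. ?H #>\<^bsub>?P\<^esub> a"
  interpret h: group_hom ?P "?P Mod ?H" ?\<pi> by (rule P.power_coset_hom[OF n])
  have car: "carrier (?P Mod ?H) = ?\<pi> ` P" by (auto simp: carrier_FactGroup)
  have "p_group c (?P Mod ?H)"
    unfolding p_group_def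
  proof (intro conjI ballI)
    show "group (?P Mod ?H)" by (rule N.factorgroup_is_group)
    fix x assume "x \<in> carrier (?P Mod ?H)"
    then obtain g where g: "g \<in> P" "x = ?\<pi> g" using car by blast
    obtain k where k: "g [^] (c ^ k) \<in> ?H" using g by (auto simp: P_def)
    have "x [^]\<^bsub>?P Mod ?H\<^esub> (c ^ k) = ?\<pi> (g [^]\<^bsub>?P\<^esub> (c ^ k))" using h.hom_nat_pow[of g "c ^ k"] g by simp
    also have "g [^]\<^bsub>?P\<^esub> (c ^ k) = g [^] (c ^ k)" by (simp add: nat_pow_consistent[symmetric])
    also have "?\<pi> (g [^] (c ^ k)) = ?H" using P.coset_join2[OF _ HsP k] k HP by auto
    finally show "\<exists>n::nat. x [^]\<^bsub>?P Mod ?H\<^esub> (c ^ n) = \<one>\<^bsub>?P Mod ?H\<^esub>" by (auto simp: one_FactGroup)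
  qed
  then have "finite (carrier (?P Mod ?H))" using c P n unfolding Sp_def by blast
  then obtain S2 where S2: "finite S2" "S2 \<subseteq> P" "carrier (?P Mod ?H) = ?\<pi> ` S2"
    using finite_subset_image[of "carrier (?P Mod ?H)" ?\<pi> P] car by blast
  have PG: "P \<subseteq> carrier G" by (auto simp: P_def)
  have "g \<in> generate G (S \<union> S2)" if g: "g \<in> P" for g
  proof -
    have "?\<pi> g \<in> ?\<pi> ` S2" using g car S2 by blast
    then obtain s where s: "s \<in> S2" "?\<pi> g = ?\<pi> s" by blast
    have "g \<in> ?\<pi> g" using P.rcos_self[OF _ HsP, of g] g by simp
    then obtain u where u: "u \<in> ?H" "g = u \<otimes> s" using s(2) unfolding r_coset_def by auto
    have "u \<in> generate G (S \<union> S2)" using u(1) mono_generate[of S "S \<union> S2"] by blast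
    then show ?thesis unfolding u(2) by (rule generate.eng) (rule generate.incl, use s(1) in simp)
  qed
  then show ?thesis using S S2 PG unfolding P_def by (intro exI[of _ "S \<union> S2"]) auto
qed

text \<open>For \<open>c = 0\<close> the condition on \<open>n\<close> is empty. Otherwise split off from an
  exponent \<open>n\<close> its \<open>c\<close>-part, which
  \<open>finite_extension_by_p_part\<close> takes care of.\<close>

lemma torsion_quotient_coprime_to_char:
  assumes tr: "total_rank G < \<infinity>" and c: "c = 0 \<or> Factorial_Ring.prime (c::nat)" "c \<notin> Sp G"
  obtains S where "finite S" "S \<subseteq> carrier G"
    and "\<And>g. g \<in> carrier G \<Longrightarrow> \<exists>n::nat. n > 0 \<and> (c = 0 \<or> \<not> c dvd n) \<and> g [^] n \<in> generate G S"
proof -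
  obtain S where S: "finite S" "S \<subseteq> carrier G" and Sn: "\<And>g. g \<in> carrier G \<Longrightarrow> \<exists>n::nat. n > 0 \<and> g [^] n \<in> generate G S"
    using fin_gen_torsion_quotient[OF tr] by blast
  show ?thesis
  proof (cases "c = 0")
    case True then show ?thesis using that[OF S] Sn by blast
  next
    case False
    then have pc: "Factorial_Ring.prime c" using c by blast
    obtain S' where S': "finite S'" "S' \<subseteq> carrier G"
      and S'n: "\<And>g n. g \<in> carrier G \<Longrightarrow> g [^] (c ^ (n::nat)) \<in> generate G S \<Longrightarrow> g \<in> generate G S'"
      using finite_extension_by_p_part[OF pc c(2) S] by metis
    have "\<exists>n::nat. n > 0 \<and> \<not> c dvd n \<and> g [^] n \<in> generate G S'" if g: "g \<in> carrier G" for g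
    proof -
      obtain n where n: "n > 0" "g [^] (n::nat) \<in> generate G S" using Sn[OF g] by blast
      have nu: "n \<noteq> 0" "\<not> is_unit c" using n pc by auto
      obtain d where d: "n = c ^ multiplicity c n * d" "\<not> c dvd d"
        by (rule multiplicity_decompose'[OF nu]) blast
      have "(g [^] d) [^] (c ^ multiplicity c n) \<in> generate G S"
        using n(2) g d(1) by (simp add: nat_pow_pow mult.commute)
      then have "g [^] d \<in> generate G S'" using S'n[of "g [^] d"] g by blast
      then show ?thesis using d by (intro exI[of _ d]) (auto intro: Nat.gr0I)
    qed
    then show ?thesis using that[OF S'] by blast
  qed
qed

end

lemma ring_char_field:
  assumes "field K"
  shows "ring_char K = 0 \<or> Factorial_Ring.prime (ring_char K)"
    and "n > 0 \<Longrightarrow> ring_char K = 0 \<or> \<not> ring_char K dvd n \<Longrightarrow> add_pow K (n::nat) \<one>\<^bsub>K\<^esub> \<noteq> \<zero>\<^bsub>K\<^esub>"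
proof -
  interpret field K by fact
  let ?P = "\<lambda>n::nat. n > 0 \<and> add_pow K n \<one>\<^bsub>K\<^esub> = \<zero>\<^bsub>K\<^esub>"
  define c where "c = (LEAST n. ?P n)"
  have rc: "ring_char K = (if \<exists>n. ?P n then c else 0)" unfolding ring_char_def c_def by simp
  have mult: "add_pow K (a * b) \<one>\<^bsub>K\<^esub> = add_pow K a \<one>\<^bsub>K\<^esub> \<otimes>\<^bsub>K\<^esub> add_pow K b \<one>\<^bsub>K\<^esub>" for a b :: nat
    using add_pow_ldistr[of "\<one>\<^bsub>K\<^esub>" "add_pow K b \<one>\<^bsub>K\<^esub>" a] add.nat_pow_pow[of "\<one>\<^bsub>K\<^esub>" a b]
    by (simp add: mult.commute)
  show prime: "ring_char K = 0 \<or> Factorial_Ring.prime (ring_char K)"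
  proof (cases "\<exists>n. ?P n")
    case True
    have Pc: "?P c" unfolding c_def using True by (rule LeastI_ex)
    have min: "\<not> ?P k" if "k < c" for k using that unfolding c_def by (rule not_less_Least)
    have "Factorial_Ring.prime c"
    proof (rule ccontr)
      assume np: "\<not> Factorial_Ring.prime c"
      have "c \<noteq> 1" using Pc one_not_zero by auto
      then have "\<exists>a. a dvd c \<and> a \<noteq> 1 \<and> a \<noteq> c" using np Pc unfolding prime_nat_iff
        by (metis One_nat_def Suc_lessI)
      then obtain a b where a: "c = a * b" "a \<noteq> 1" "a \<noteq> c" by (auto elim!: dvdE)
      have ab0: "a > 0" "b > 0" using Pc a(1) by (auto intro: Nat.gr0I)
      have "b \<noteq> 1" using a by auto
      then have ab: "c = a * b" "a < c" "b < c" using a ab0 by auto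
      have "add_pow K a \<one>\<^bsub>K\<^esub> = \<zero>\<^bsub>K\<^esub> \<or> add_pow K b \<one>\<^bsub>K\<^esub> = \<zero>\<^bsub>K\<^esub>" using Pc mult[of a b] ab(1) integral[of "add_pow K a \<one>\<^bsub>K\<^esub>" "add_pow K b \<one>\<^bsub>K\<^esub>"] by simp
      then show False using min[OF ab(2)] min[OF ab(3)] ab0 by blast
    qed
    then show ?thesis unfolding rc if_P[OF True] by simp
  next
    case False
    then have "ring_char K = 0" unfolding rc by (rule if_not_P)
    then show ?thesis by simp
  qed
  assume n: "n > 0" "ring_char K = 0 \<or> \<not> ring_char K dvd n"
  show "add_pow K (n::nat) \<one>\<^bsub>K\<^esub> \<noteq> \<zero>\<^bsub>K\<^esub>"
  proof
    assume z: "add_pow K n \<one>\<^bsub>K\<^esub> = \<zero>\<^bsub>K\<^esub>"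
    have ex: "\<exists>n. ?P n" using n z by blast
    have Pc: "?P c" unfolding c_def using ex by (rule LeastI_ex)
    have cn: "\<not> c dvd n" using n(2) Pc unfolding rc if_P[OF ex] by auto
    have "add_pow K n \<one>\<^bsub>K\<^esub> = add_pow K (n div c * c) \<one>\<^bsub>K\<^esub> \<oplus>\<^bsub>K\<^esub> add_pow K (n mod c) \<one>\<^bsub>K\<^esub>"
      by (simp add: add.nat_pow_mult del: div_mult_mod_eq)
    then have "add_pow K (n mod c) \<one>\<^bsub>K\<^esub> = \<zero>\<^bsub>K\<^esub>" using z Pc mult[of "n div c" c] by simp
    then have "?P (n mod c)" using cn by (auto simp: dvd_eq_mod_eq_0)
    moreover have "n mod c < c" using Pc by simp
    ultimately show False unfolding c_def using not_less_Least by blast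
  qed
qed

section \<open>Simple modules inside fields\<close>

text \<open>Any nonzero \<open>m\<close> generates \<open>M\<close>, and its annihilator \<open>I\<close> is
  maximal: an ideal \<open>J\<close> above it gives the submodule \<open>J m\<close>, which is
  \<open>0\<close> or \<open>M\<close>. The map \<open>\<psi>\<close> is reduction modulo
  \<open>I\<close> followed by the embedding of the residue field in an algebraic closure.\<close>

lemma simple_module_embeds_in_closed_field:
  assumes sm: "simple_module R M"
  shows "\<exists>m (L :: ((('c set list \<times> nat) multiset \<Rightarrow> 'c set) ring)) \<psi>. algebraically_closed L \<and> \<psi> \<in> ring_hom R L \<and> m \<in> carrier M \<and>
    carrier M = (\<lambda>r::'c. r \<odot>\<^bsub>M\<^esub> m) ` carrier R \<and> (\<forall>r\<in>carrier R. \<psi> r = \<zero>\<^bsub>L\<^esub> \<longleftrightarrow> r \<odot>\<^bsub>M\<^esub> m = \<zero>\<^bsub>M\<^esub>)"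
proof -
  interpret module R M using sm by (simp add: simple_module_def)
  have simple: "N = {\<zero>\<^bsub>M\<^esub>} \<or> N = carrier M" if "submodule N R M" for N using sm that by (simp add: simple_module_def)
  have "carrier M \<noteq> {\<zero>\<^bsub>M\<^esub>}" using sm by (simp add: simple_module_def)
  then obtain m where m: "m \<in> carrier M" "m \<noteq> \<zero>\<^bsub>M\<^esub>" using M.zero_closed by blast
  have cyclic: "J = I \<or> (\<lambda>r. r \<odot>\<^bsub>M\<^esub> m) ` J = carrier M"
    if J: "ideal J R" and I: "I = {r \<in> carrier R. r \<odot>\<^bsub>M\<^esub> m = \<zero>\<^bsub>M\<^esub>}" "I \<subseteq> J" for I J
  proof -
    interpret J: ideal J R by (rule J)
    have Jc: "J \<subseteq> carrier R" by (rule J.a_subset)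
    have "submodule ((\<lambda>r. r \<odot>\<^bsub>M\<^esub> m) ` J) R M"
    proof (rule submoduleI)
      show "(\<lambda>r. r \<odot>\<^bsub>M\<^esub> m) ` J \<subseteq> carrier M" using Jc m by auto
      have "\<zero>\<^bsub>R\<^esub> \<odot>\<^bsub>M\<^esub> m \<in> (\<lambda>r. r \<odot>\<^bsub>M\<^esub> m) ` J" using J.zero_closed by (rule imageI)
      then show "\<zero>\<^bsub>M\<^esub> \<in> (\<lambda>r. r \<odot>\<^bsub>M\<^esub> m) ` J" using m smult_l_null by simp
    next
      fix a assume "a \<in> (\<lambda>r. r \<odot>\<^bsub>M\<^esub> m) ` J"
      then obtain r where r: "r \<in> J" "a = r \<odot>\<^bsub>M\<^esub> m" by blast
      have "\<ominus>\<^bsub>M\<^esub> a = (\<ominus>\<^bsub>R\<^esub> r) \<odot>\<^bsub>M\<^esub> m" using r Jc m smult_l_minus[of r m] by auto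
      then show "\<ominus>\<^bsub>M\<^esub> a \<in> (\<lambda>r. r \<odot>\<^bsub>M\<^esub> m) ` J" using J.a_inv_closed[OF r(1)] by blast
    next
      fix a b assume "a \<in> (\<lambda>r. r \<odot>\<^bsub>M\<^esub> m) ` J" "b \<in> (\<lambda>r. r \<odot>\<^bsub>M\<^esub> m) ` J"
      then obtain r s where r: "r \<in> J" "a = r \<odot>\<^bsub>M\<^esub> m" "s \<in> J" "b = s \<odot>\<^bsub>M\<^esub> m" by blast
      have "a \<oplus>\<^bsub>M\<^esub> b = (r \<oplus>\<^bsub>R\<^esub> s) \<odot>\<^bsub>M\<^esub> m" using r Jc m smult_l_distr[of r s m] by auto
      then show "a \<oplus>\<^bsub>M\<^esub> b \<in> (\<lambda>r. r \<odot>\<^bsub>M\<^esub> m) ` J" using J.a_closed[OF r(1,3)] by blast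
    next
      fix a x assume a: "a \<in> carrier R" "x \<in> (\<lambda>r. r \<odot>\<^bsub>M\<^esub> m) ` J"
      then obtain r where r: "r \<in> J" "x = r \<odot>\<^bsub>M\<^esub> m" by blast
      have "a \<odot>\<^bsub>M\<^esub> x = (a \<otimes>\<^bsub>R\<^esub> r) \<odot>\<^bsub>M\<^esub> m" using r a Jc m smult_assoc1[of a r m] by auto
      then show "a \<odot>\<^bsub>M\<^esub> x \<in> (\<lambda>r. r \<odot>\<^bsub>M\<^esub> m) ` J" using J.I_l_closed[OF r(1) a(1)] by blast
    qed
    then consider "(\<lambda>r. r \<odot>\<^bsub>M\<^esub> m) ` J = {\<zero>\<^bsub>M\<^esub>}" | "(\<lambda>r. r \<odot>\<^bsub>M\<^esub> m) ` J = carrier M" using simple by blast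
    then show ?thesis
    proof cases
      case 1
      then have "J \<subseteq> I" using Jc I(1) by blast
      then show ?thesis using I by blast
    qed simp
  qed
  define I where "I = {r \<in> carrier R. r \<odot>\<^bsub>M\<^esub> m = \<zero>\<^bsub>M\<^esub>}"
  have I: "ideal I R"
  proof (rule idealI)
    show "ring R" by (rule ring_axioms)
    show "subgroup I (add_monoid R)"
    proof (rule R.add.subgroupI)
      show "I \<noteq> {}" using m smult_l_null by (auto simp: I_def intro!: exI[of _ "\<zero>\<^bsub>R\<^esub>"])
    qed (use m in \<open>auto simp: I_def smult_l_minus smult_l_distr\<close>)
  next
    fix a x assume a: "a \<in> I" "x \<in> carrier R"
    then have ax: "(x \<otimes>\<^bsub>R\<^esub> a) \<odot>\<^bsub>M\<^esub> m = \<zero>\<^bsub>M\<^esub>" using m by (simp add: I_def smult_assoc1)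
    then show "x \<otimes>\<^bsub>R\<^esub> a \<in> I" using a by (simp add: I_def)
    then show "a \<otimes>\<^bsub>R\<^esub> x \<in> I" using a by (simp add: I_def R.m_comm)
  qed
  have Ic: "I \<subseteq> carrier R" by (auto simp: I_def)
  have one: "\<one>\<^bsub>R\<^esub> \<notin> I" using m by (simp add: I_def)
  have max: "maximalideal I R"
  proof (rule maximalidealI[OF I])
    show "carrier R \<noteq> I" using one by auto
    fix J assume J: "ideal J R" "I \<subseteq> J" "J \<subseteq> carrier R"
    interpret J: ideal J R by (rule J)
    consider "J = I" | "(\<lambda>r. r \<odot>\<^bsub>M\<^esub> m) ` J = carrier M" using cyclic[OF J(1) I_def J(2)] by blast
    then show "J = I \<or> J = carrier R"
    proof cases
      case 2
      then obtain r where r: "r \<in> J" "r \<odot>\<^bsub>M\<^esub> m = m" using m by (metis imageE)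
      have rc: "r \<in> carrier R" using r J by blast
      have "(\<one>\<^bsub>R\<^esub> \<oplus>\<^bsub>R\<^esub> \<ominus>\<^bsub>R\<^esub> r) \<odot>\<^bsub>M\<^esub> m = \<zero>\<^bsub>M\<^esub>" using r rc m by (simp add: smult_l_distr smult_l_minus M.r_neg)
      then have "\<one>\<^bsub>R\<^esub> \<oplus>\<^bsub>R\<^esub> \<ominus>\<^bsub>R\<^esub> r \<in> J" using J(2) rc by (auto simp: I_def)
      then have "(\<one>\<^bsub>R\<^esub> \<oplus>\<^bsub>R\<^esub> \<ominus>\<^bsub>R\<^esub> r) \<oplus>\<^bsub>R\<^esub> r \<in> J" using J.a_closed r(1) by blast
      then have "\<one>\<^bsub>R\<^esub> \<in> J" using rc by (simp add: R.a_assoc R.l_neg)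
      then show ?thesis using J.one_imp_carrier by blast
    qed simp
  qed
  interpret I: ideal I R by (rule I)
  let ?F = "R Quot I"
  have F: "field ?F" by (rule maximalideal.quotient_is_field[OF max R.is_cring])
  interpret F: field ?F by (rule F)
  let ?L = "F.alg_closure"
  let ?c = "F.indexed_const :: 'c set \<Rightarrow> (('c set list \<times> nat) multiset \<Rightarrow> 'c set)"
  interpret L: algebraic_closure ?L "?c ` carrier ?F" by (rule F.alg_closureE(1))
  have L: "algebraically_closed ?L" by (rule L.algebraically_closed_axioms)
  interpret h: ring_hom_ring ?F ?L ?c
    by (rule ring_hom_ringI2[OF F.ring_axioms L.ring_axioms F.alg_closureE(2)])
  have inj: "inj_on ?c (carrier ?F)"
    by (rule non_trivial_field_hom_is_inj[OF F.alg_closureE(2) F L.field_axioms])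
  let ?\<psi> = "?c \<circ> (\<lambda>r. I +>\<^bsub>R\<^esub> r)"
  have \<psi>: "?\<psi> \<in> ring_hom R ?L" by (rule ring_hom_trans[OF I.rcos_ring_hom F.alg_closureE(2)])
  have zero: "\<zero>\<^bsub>?F\<^esub> = I" by (simp add: FactRing_def)
  have ker: "?\<psi> r = \<zero>\<^bsub>?L\<^esub> \<longleftrightarrow> r \<odot>\<^bsub>M\<^esub> m = \<zero>\<^bsub>M\<^esub>" if r: "r \<in> carrier R" for r
  proof -
    have rF: "I +>\<^bsub>R\<^esub> r \<in> carrier ?F" using ring_hom_closed[OF I.rcos_ring_hom r] .
    have "?\<psi> r = \<zero>\<^bsub>?L\<^esub> \<longleftrightarrow> ?c (I +>\<^bsub>R\<^esub> r) = ?c \<zero>\<^bsub>?F\<^esub>" by simp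
    also have "\<dots> \<longleftrightarrow> I +>\<^bsub>R\<^esub> r = \<zero>\<^bsub>?F\<^esub>" by (rule inj_on_eq_iff[OF inj rF F.zero_closed])
    also have "\<dots> \<longleftrightarrow> r \<in> I" unfolding zero
    proof
      assume "I +>\<^bsub>R\<^esub> r = I" then show "r \<in> I" by (rule I.rcos_const_imp_mem[OF r])
    next
      assume "r \<in> I" then show "I +>\<^bsub>R\<^esub> r = I" by (rule R.a_rcos_zero[OF I])
    qed
    also have "\<dots> \<longleftrightarrow> r \<odot>\<^bsub>M\<^esub> m = \<zero>\<^bsub>M\<^esub>" using r by (simp only: I_def mem_Collect_eq simp_thms)
    finally show ?thesis .
  qed
  have "carrier M = (\<lambda>r. r \<odot>\<^bsub>M\<^esub> m) ` carrier R"
  proof -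
    have "carrier R \<noteq> I" using one by auto
    then show ?thesis using cyclic[OF R.oneideal I_def Ic] by (elim disjE) simp_all
  qed
  then show ?thesis
    by (intro exI[of _ m] exI[of _ ?L] exI[of _ ?\<psi>] conjI ballI L \<psi> m(1) ker)
qed

section \<open>The group ring acting on a cyclic module\<close>

text \<open>A representation generated by \<open>m\<close>, whose annihilator is the kernel of a ring
  homomorphism \<open>\<psi>\<close> into a field; so \<open>r m\<close> and \<open>\<psi>
  r\<close> determine each other.\<close>

locale cyclic_representation =
  G: comm_group G + K: field K + M: module "group_ring K G" M + L: field L
  for G :: "('g, 'a) monoid_scheme" and K :: "('k, 'r) ring_scheme"
    and M :: "('g \<Rightarrow> 'k, 'm, 'x) module_scheme" and L :: "('l, 'y) ring_scheme" +
  fixes \<psi> :: "('g \<Rightarrow> 'k) \<Rightarrow> 'l" and m :: 'm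
  assumes psi_hom: "\<psi> \<in> ring_hom (group_ring K G) L"
    and m_closed: "m \<in> carrier M"
    and cyclic: "carrier M = (\<lambda>r. r \<odot>\<^bsub>M\<^esub> m) ` carrier (group_ring K G)"
    and annihilator: "\<And>r. r \<in> carrier (group_ring K G) \<Longrightarrow> \<psi> r = \<zero>\<^bsub>L\<^esub> \<longleftrightarrow> r \<odot>\<^bsub>M\<^esub> m = \<zero>\<^bsub>M\<^esub>"
begin

abbreviation KG where "KG \<equiv> group_ring K G"
abbreviation e where "e \<equiv> group_ring_elem K G"
definition scalar where "scalar k = (\<lambda>x\<in>carrier G. if x = \<one>\<^bsub>G\<^esub> then k else \<zero>\<^bsub>K\<^esub>)"

lemma coeff_closed: "r \<in> carrier KG \<Longrightarrow> x \<in> carrier G \<Longrightarrow> r x \<in> carrier K"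
  by (auto simp: group_ring_def PiE_iff)

lemma supp_finite: "r \<in> carrier KG \<Longrightarrow> finite (group_ring_supp K G r)"
  by (simp add: group_ring_def)

lemma KG_eqI: "r \<in> carrier KG \<Longrightarrow> s \<in> carrier KG \<Longrightarrow> (\<And>x. x \<in> carrier G \<Longrightarrow> r x = s x) \<Longrightarrow> r = s"
  by (auto simp: group_ring_def intro: PiE_ext)

lemma e_closed: "e g \<in> carrier KG"
  by (rule group_ring_elem_closed[OF K.is_cring])

lemma e_times: "g \<in> carrier G \<Longrightarrow> r \<in> carrier KG \<Longrightarrow> x \<in> carrier G \<Longrightarrow> (e g \<otimes>\<^bsub>KG\<^esub> r) x = r (inv\<^bsub>G\<^esub> g \<otimes>\<^bsub>G\<^esub> x)"
  by (rule group_ring_elem_mult[OF G.is_group K.is_cring])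

lemma e_mult:
  assumes "g \<in> carrier G" "h \<in> carrier G"
  shows "e g \<otimes>\<^bsub>KG\<^esub> e h = e (g \<otimes>\<^bsub>G\<^esub> h)"
proof (rule KG_eqI)
  fix x assume x: "x \<in> carrier G"
  have "inv\<^bsub>G\<^esub> g \<otimes>\<^bsub>G\<^esub> x = h \<longleftrightarrow> x = g \<otimes>\<^bsub>G\<^esub> h" using G.inv_solve_left'[of h g x] assms x by auto
  then show "(e g \<otimes>\<^bsub>KG\<^esub> e h) x = e (g \<otimes>\<^bsub>G\<^esub> h) x"
    using assms x e_times[OF assms(1) e_closed x] by (simp add: group_ring_elem_def)
qed (use e_closed in auto)

lemma e_one: "e \<one>\<^bsub>G\<^esub> = \<one>\<^bsub>KG\<^esub>"
  by (simp add: group_ring_def)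

lemma KG_add: "x \<in> carrier G \<Longrightarrow> (r \<oplus>\<^bsub>KG\<^esub> s) x = r x \<oplus>\<^bsub>K\<^esub> s x"
  by (simp add: group_ring_def)

lemma KG_zero: "x \<in> carrier G \<Longrightarrow> \<zero>\<^bsub>KG\<^esub> x = \<zero>\<^bsub>K\<^esub>"
  by (simp add: group_ring_def)

lemma KG_minus: "r \<in> carrier KG \<Longrightarrow> x \<in> carrier G \<Longrightarrow> (\<ominus>\<^bsub>KG\<^esub> r) x = \<ominus>\<^bsub>K\<^esub> r x"
proof -
  assume r: "r \<in> carrier KG" and x: "x \<in> carrier G"
  have "(\<ominus>\<^bsub>KG\<^esub> r) x \<oplus>\<^bsub>K\<^esub> r x = \<zero>\<^bsub>K\<^esub>" using KG_add[OF x, of "\<ominus>\<^bsub>KG\<^esub> r" r] r x KG_zero by (simp add: M.R.l_neg)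
  then show ?thesis using r x coeff_closed[OF _ x] by (metis K.minus_equality M.R.a_inv_closed)
qed

lemma KG_finsum:
  assumes "finite A" "f \<in> A \<rightarrow> carrier KG" "x \<in> carrier G"
  shows "(finsum KG f A) x = (\<Oplus>\<^bsub>K\<^esub>a\<in>A. f a x)"
  using assms
proof (induction A rule: finite_induct)
  case empty then show ?case by (simp add: KG_zero)
next
  case (insert a A)
  have fx: "(\<lambda>a. f a x) \<in> A \<rightarrow> carrier K" "f a x \<in> carrier K" using insert coeff_closed by (auto simp: Pi_iff)
  have f: "f \<in> A \<rightarrow> carrier KG" "f a \<in> carrier KG" using insert by auto
  show ?case using insert fx f by (simp add: M.R.finsum_insert K.finsum_insert KG_add del: Pi_split_insert_domain)
qed

lemma supp_times:
  assumes "r \<in> carrier KG" "s \<in> carrier KG"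
  shows "group_ring_supp K G (r \<otimes>\<^bsub>KG\<^esub> s) \<subseteq> (\<lambda>(x,y). x \<otimes>\<^bsub>G\<^esub> y) ` (group_ring_supp K G r \<times> group_ring_supp K G s)"
  by (rule group_ring_mult_supp[OF G.is_group K.is_cring assms])

lemma scalar_closed: "k \<in> carrier K \<Longrightarrow> scalar k \<in> carrier KG"
proof -
  assume k: "k \<in> carrier K"
  have "group_ring_supp K G (scalar k) \<subseteq> {\<one>\<^bsub>G\<^esub>}" by (auto simp: group_ring_supp_def scalar_def)
  then have "finite (group_ring_supp K G (scalar k))" by (rule finite_subset) simp
  then show ?thesis using k by (auto simp: group_ring_def scalar_def)
qed

lemma scalar_times:
  assumes "k \<in> carrier K" "r \<in> carrier KG" "x \<in> carrier G"
  shows "(scalar k \<otimes>\<^bsub>KG\<^esub> r) x = k \<otimes>\<^bsub>K\<^esub> r x"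
proof -
  have "(scalar k \<otimes>\<^bsub>KG\<^esub> r) x = (\<Oplus>\<^bsub>K\<^esub>y\<in>{\<one>\<^bsub>G\<^esub>}. scalar k y \<otimes>\<^bsub>K\<^esub> r (inv\<^bsub>G\<^esub> y \<otimes>\<^bsub>G\<^esub> x))"
    by (rule group_ring_mult_superset[OF G.is_group K.is_cring scalar_closed[OF assms(1)] assms(2) _ _ _ assms(3)])
      (auto simp: group_ring_supp_def scalar_def)
  also have "\<dots> = k \<otimes>\<^bsub>K\<^esub> r x" using assms coeff_closed by (simp add: scalar_def)
  finally show ?thesis .
qed

definition \<iota> where "\<iota> k = \<psi> (scalar k)"
definition \<gamma> where "\<gamma> g = \<psi> (e g)"

lemma iota_hom: "\<iota> \<in> ring_hom K L"
proof (rule ring_hom_memI)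
  fix k assume "k \<in> carrier K" then show "\<iota> k \<in> carrier L" unfolding \<iota>_def using ring_hom_closed[OF psi_hom] scalar_closed by blast
next
  fix k l assume kl: "k \<in> carrier K" "l \<in> carrier K"
  have "scalar (k \<otimes>\<^bsub>K\<^esub> l) = scalar k \<otimes>\<^bsub>KG\<^esub> scalar l"
  proof (rule KG_eqI)
    fix x assume x: "x \<in> carrier G"
    show "scalar (k \<otimes>\<^bsub>K\<^esub> l) x = (scalar k \<otimes>\<^bsub>KG\<^esub> scalar l) x"
      unfolding scalar_times[OF kl(1) scalar_closed[OF kl(2)] x] using x kl by (simp add: scalar_def)
  qed (use kl scalar_closed in auto)
  then show "\<iota> (k \<otimes>\<^bsub>K\<^esub> l) = \<iota> k \<otimes>\<^bsub>L\<^esub> \<iota> l"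
    unfolding \<iota>_def using ring_hom_mult[OF psi_hom] scalar_closed kl by simp
  have "scalar (k \<oplus>\<^bsub>K\<^esub> l) = scalar k \<oplus>\<^bsub>KG\<^esub> scalar l"
    by (rule KG_eqI) (use kl scalar_closed in \<open>auto simp: KG_add scalar_def\<close>)
  then show "\<iota> (k \<oplus>\<^bsub>K\<^esub> l) = \<iota> k \<oplus>\<^bsub>L\<^esub> \<iota> l"
    unfolding \<iota>_def using ring_hom_add[OF psi_hom] scalar_closed kl by simp
next
  have "scalar \<one>\<^bsub>K\<^esub> = \<one>\<^bsub>KG\<^esub>" unfolding e_one[symmetric] by (simp add: scalar_def group_ring_elem_def)
  then show "\<iota> \<one>\<^bsub>K\<^esub> = \<one>\<^bsub>L\<^esub>" unfolding \<iota>_def using ring_hom_one[OF psi_hom] by simp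
qed

lemma gamma_closed: "\<gamma> g \<in> carrier L"
  unfolding \<gamma>_def by (rule ring_hom_closed[OF psi_hom e_closed])

lemma gamma_mult: "g \<in> carrier G \<Longrightarrow> h \<in> carrier G \<Longrightarrow> \<gamma> (g \<otimes>\<^bsub>G\<^esub> h) = \<gamma> g \<otimes>\<^bsub>L\<^esub> \<gamma> h"
  unfolding \<gamma>_def e_mult[symmetric] by (rule ring_hom_mult[OF psi_hom e_closed e_closed])

lemma gamma_nonzero: "g \<in> carrier G \<Longrightarrow> \<gamma> g \<noteq> \<zero>\<^bsub>L\<^esub>"
proof
  assume g: "g \<in> carrier G" "\<gamma> g = \<zero>\<^bsub>L\<^esub>"
  have "\<gamma> \<one>\<^bsub>G\<^esub> = \<gamma> g \<otimes>\<^bsub>L\<^esub> \<gamma> (inv\<^bsub>G\<^esub> g)" using gamma_mult[of g "inv\<^bsub>G\<^esub> g"] g by simp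
  then have "\<gamma> \<one>\<^bsub>G\<^esub> = \<zero>\<^bsub>L\<^esub>" using g gamma_closed by simp
  then show False unfolding \<gamma>_def e_one using ring_hom_one[OF psi_hom] by simp
qed

lemma action_eq_iff:
  assumes r: "r \<in> carrier KG" and s: "s \<in> carrier KG"
  shows "\<psi> r = \<psi> s \<longleftrightarrow> r \<odot>\<^bsub>M\<^esub> m = s \<odot>\<^bsub>M\<^esub> m"
proof -
  interpret h: ring_hom_ring KG L \<psi> by (rule ring_hom_ringI2[OF M.R.ring_axioms L.ring_axioms psi_hom])
  have rs: "r \<ominus>\<^bsub>KG\<^esub> s \<in> carrier KG" using r s by simp
  have "\<psi> r = \<psi> s \<longleftrightarrow> \<psi> r \<ominus>\<^bsub>L\<^esub> \<psi> s = \<zero>\<^bsub>L\<^esub>" using r s h.hom_closed by (simp add: L.r_right_minus_eq)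
  also have "\<psi> r \<ominus>\<^bsub>L\<^esub> \<psi> s = \<psi> (r \<ominus>\<^bsub>KG\<^esub> s)" using r s by (simp add: a_minus_def)
  also have "\<psi> (r \<ominus>\<^bsub>KG\<^esub> s) = \<zero>\<^bsub>L\<^esub> \<longleftrightarrow> (r \<ominus>\<^bsub>KG\<^esub> s) \<odot>\<^bsub>M\<^esub> m = \<zero>\<^bsub>M\<^esub>" by (rule annihilator[OF rs])
  also have "(r \<ominus>\<^bsub>KG\<^esub> s) \<odot>\<^bsub>M\<^esub> m = r \<odot>\<^bsub>M\<^esub> m \<ominus>\<^bsub>M\<^esub> s \<odot>\<^bsub>M\<^esub> m"
    using r s m_closed by (simp add: a_minus_def M.smult_l_distr M.smult_l_minus)
  also have "\<dots> = \<zero>\<^bsub>M\<^esub> \<longleftrightarrow> r \<odot>\<^bsub>M\<^esub> m = s \<odot>\<^bsub>M\<^esub> m"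
  proof -
    have "a \<ominus>\<^bsub>M\<^esub> b = \<zero>\<^bsub>M\<^esub> \<longleftrightarrow> a = b" if "a \<in> carrier M" "b \<in> carrier M" for a b
    proof
      assume "a \<ominus>\<^bsub>M\<^esub> b = \<zero>\<^bsub>M\<^esub>"
      then have "\<ominus>\<^bsub>M\<^esub> (\<ominus>\<^bsub>M\<^esub> b) = a" using that by (intro M.M.minus_equality) (simp_all add: a_minus_def)
      then show "a = b" using that by simp
    qed (use that in \<open>simp add: a_minus_def M.M.r_neg\<close>)
    then show ?thesis using r s m_closed by simp
  qed
  finally show ?thesis .
qed

lemma gamma_inj:
  assumes faithful: "rep_centralizer K G M = {\<one>\<^bsub>G\<^esub>}"
  shows "inj_on \<gamma> (carrier G)"
proof (rule inj_onI)
  fix g h assume gh: "g \<in> carrier G" "h \<in> carrier G" "\<gamma> g = \<gamma> h"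
  let ?x = "inv\<^bsub>G\<^esub> h \<otimes>\<^bsub>G\<^esub> g"
  have "\<gamma> ?x = \<gamma> (inv\<^bsub>G\<^esub> h) \<otimes>\<^bsub>L\<^esub> \<gamma> h" using gh by (simp add: gamma_mult)
  also have "\<dots> = \<gamma> (inv\<^bsub>G\<^esub> h \<otimes>\<^bsub>G\<^esub> h)" by (rule gamma_mult[symmetric]) (use gh in auto)
  finally have "\<gamma> ?x = \<gamma> (inv\<^bsub>G\<^esub> h \<otimes>\<^bsub>G\<^esub> h)" .
  then have "\<psi> (e ?x) = \<psi> \<one>\<^bsub>KG\<^esub>" using gh unfolding \<gamma>_def by (simp add: e_one)
  then have fix_m: "e ?x \<odot>\<^bsub>M\<^esub> m = m" using action_eq_iff[OF e_closed M.R.one_closed] m_closed by simp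
  have "e ?x \<odot>\<^bsub>M\<^esub> v = v" if v: "v \<in> carrier M" for v
  proof -
    obtain r where r: "r \<in> carrier KG" "v = r \<odot>\<^bsub>M\<^esub> m" using v cyclic by blast
    have "e ?x \<odot>\<^bsub>M\<^esub> v = (e ?x \<otimes>\<^bsub>KG\<^esub> r) \<odot>\<^bsub>M\<^esub> m" unfolding r(2) by (rule M.smult_assoc1[symmetric, OF e_closed r(1) m_closed])
    also have "\<dots> = (r \<otimes>\<^bsub>KG\<^esub> e ?x) \<odot>\<^bsub>M\<^esub> m" using M.R.m_comm[OF e_closed r(1)] by simp
    also have "\<dots> = r \<odot>\<^bsub>M\<^esub> (e ?x \<odot>\<^bsub>M\<^esub> m)" by (rule M.smult_assoc1[OF r(1) e_closed m_closed])
    finally show ?thesis using fix_m r by simp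
  qed
  then have "?x \<in> rep_centralizer K G M" using gh by (simp add: rep_centralizer_def)
  then have "?x = \<one>\<^bsub>G\<^esub>" using faithful by blast
  then show "g = h" using gh by (metis G.inv_closed G.inv_inv G.inv_equality)
qed

text \<open>\<open>r\<close> is the sum of its coefficients times group elements.\<close>

lemma psi_in_subring:
  assumes E: "subring E L" and k: "\<And>k. k \<in> carrier K \<Longrightarrow> \<iota> k \<in> E" and r: "r \<in> carrier KG"
    and g: "\<And>g. g \<in> group_ring_supp K G r \<Longrightarrow> \<gamma> g \<in> E"
  shows "\<psi> r \<in> E"
proof -
  let ?A = "group_ring_supp K G r"
  interpret h: ring_hom_ring KG L \<psi> by (rule ring_hom_ringI2[OF M.R.ring_axioms L.ring_axioms psi_hom])
  have A: "finite ?A" "?A \<subseteq> carrier G" using supp_finite[OF r] by (auto simp: group_ring_supp_def)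
  have f: "(\<lambda>g. scalar (r g) \<otimes>\<^bsub>KG\<^esub> e g) \<in> ?A \<rightarrow> carrier KG" using A coeff_closed[OF r] scalar_closed e_closed by (auto simp: Pi_iff)
  have "r = finsum KG (\<lambda>g. scalar (r g) \<otimes>\<^bsub>KG\<^esub> e g) ?A"
  proof (rule KG_eqI[OF r])
    show "finsum KG (\<lambda>g. scalar (r g) \<otimes>\<^bsub>KG\<^esub> e g) ?A \<in> carrier KG" by (rule M.R.finsum_closed[OF f])
    fix x assume x: "x \<in> carrier G"
    have "finsum KG (\<lambda>g. scalar (r g) \<otimes>\<^bsub>KG\<^esub> e g) ?A x = (\<Oplus>\<^bsub>K\<^esub>g\<in>?A. (scalar (r g) \<otimes>\<^bsub>KG\<^esub> e g) x)" by (rule KG_finsum[OF A(1) f x])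
    also have "\<dots> = (\<Oplus>\<^bsub>K\<^esub>g\<in>?A. if x = g then r g else \<zero>\<^bsub>K\<^esub>)"
    proof (rule K.finsum_cong')
      show "(\<lambda>g. if x = g then r g else \<zero>\<^bsub>K\<^esub>) \<in> ?A \<rightarrow> carrier K" using A coeff_closed[OF r] by (auto simp: Pi_iff)
      fix g assume "g \<in> ?A"
      then have g: "g \<in> carrier G" using A by blast
      show "(scalar (r g) \<otimes>\<^bsub>KG\<^esub> e g) x = (if x = g then r g else \<zero>\<^bsub>K\<^esub>)"
        unfolding scalar_times[OF coeff_closed[OF r g] e_closed x] using x coeff_closed[OF r g] by (simp add: group_ring_elem_def)
    qed simp
    also have "\<dots> = r x"
    proof (cases "x \<in> ?A")
      case True
      show ?thesis by (rule K.finsum_singleton[OF True A(1)]) (use A coeff_closed[OF r] in \<open>auto simp: Pi_iff\<close>)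
    next
      case False
      then have "r x = \<zero>\<^bsub>K\<^esub>" using x by (simp add: group_ring_supp_def)
      moreover have "(\<Oplus>\<^bsub>K\<^esub>g\<in>?A. if x = g then r g else \<zero>\<^bsub>K\<^esub>) = (\<Oplus>\<^bsub>K\<^esub>g\<in>?A. \<zero>\<^bsub>K\<^esub>)"
        by (rule K.finsum_cong') (use False in auto)
      ultimately show ?thesis by simp
    qed
    finally show "r x = finsum KG (\<lambda>g. scalar (r g) \<otimes>\<^bsub>KG\<^esub> e g) ?A x" by simp
  qed
  then have "\<psi> r = \<psi> (finsum KG (\<lambda>g. scalar (r g) \<otimes>\<^bsub>KG\<^esub> e g) ?A)" by simp
  also have "\<dots> = finsum L (\<lambda>g. \<psi> (scalar (r g) \<otimes>\<^bsub>KG\<^esub> e g)) ?A" using h.hom_finsum[OF f] by (simp add: comp_def)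
  also have "\<dots> \<in> E"
  proof (rule L.finsum_in_subring[OF E])
    fix g assume g': "g \<in> ?A"
    have rg: "r g \<in> carrier K" using g' A coeff_closed[OF r] by blast
    have "\<psi> (scalar (r g) \<otimes>\<^bsub>KG\<^esub> e g) = \<iota> (r g) \<otimes>\<^bsub>L\<^esub> \<gamma> g" unfolding \<iota>_def \<gamma>_def using h.hom_mult[OF scalar_closed[OF rg] e_closed] .
    then show "\<psi> (scalar (r g) \<otimes>\<^bsub>KG\<^esub> e g) \<in> E" using subringE(6)[OF E k[OF rg] g[OF g']] by simp
  qed
  finally show ?thesis .
qed

end

lemma (in module) finsum_smult_vector:
  assumes "finite A" "f \<in> A \<rightarrow> carrier R" "v \<in> carrier M"
  shows "(\<Oplus>i\<in>A. f i) \<odot>\<^bsub>M\<^esub> v = (\<Oplus>\<^bsub>M\<^esub>i\<in>A. f i \<odot>\<^bsub>M\<^esub> v)"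
  using assms
proof (induction A rule: finite_induct)
  case empty then show ?case by (simp add: smult_l_null)
next
  case (insert a A)
  then have f: "f \<in> A \<rightarrow> carrier R" "f a \<in> carrier R" by auto
  then have fv: "(\<lambda>i. f i \<odot>\<^bsub>M\<^esub> v) \<in> A \<rightarrow> carrier M" "f a \<odot>\<^bsub>M\<^esub> v \<in> carrier M" using insert(5) by (auto simp: Pi_iff)
  have "(\<Oplus>i\<in>insert a A. f i) \<odot>\<^bsub>M\<^esub> v = (f a \<oplus> (\<Oplus>i\<in>A. f i)) \<odot>\<^bsub>M\<^esub> v" using R.finsum_insert[OF insert(1,2) f] by simp
  also have "\<dots> = f a \<odot>\<^bsub>M\<^esub> v \<oplus>\<^bsub>M\<^esub> (\<Oplus>i\<in>A. f i) \<odot>\<^bsub>M\<^esub> v" by (rule smult_l_distr[OF f(2) R.finsum_closed[OF f(1)] insert(5)])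
  also have "\<dots> = (\<Oplus>\<^bsub>M\<^esub>i\<in>insert a A. f i \<odot>\<^bsub>M\<^esub> v)"
    using insert.IH[OF f(1) insert(5)] M.finsum_insert[OF insert(1,2) fv] by simp
  finally show ?case .
qed

text \<open>A transversal given as the image of a map that is constant on cosets; the map sends each element
  to the representative of its coset.\<close>

lemma (in group) right_transversal_retraction:
  assumes H: "subgroup H G"
  obtains \<tau> where "right_transversal G H (\<tau> ` carrier G)"
    and "\<And>g. g \<in> carrier G \<Longrightarrow> \<tau> g \<in> carrier G"
    and "\<And>g. g \<in> carrier G \<Longrightarrow> g \<otimes> inv (\<tau> g) \<in> H"
    and "\<And>g h. g \<in> carrier G \<Longrightarrow> h \<in> carrier G \<Longrightarrow> g \<otimes> inv h \<in> H \<Longrightarrow> \<tau> g = \<tau> h"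
    and "\<And>g. g \<in> carrier G \<Longrightarrow> \<tau> (\<tau> g) = \<tau> g"
proof -
  define \<tau> where "\<tau> g = (SOME x. x \<in> H #> g)" for g
  have Hc: "H \<subseteq> carrier G" using subgroup.subset[OF H] .
  have t1: "\<tau> g \<in> H #> g" if g: "g \<in> carrier G" for g
    unfolding \<tau>_def using rcos_self[OF g H] by (rule someI)
  have tc: "\<tau> g \<in> carrier G" if g: "g \<in> carrier G" for g
    using t1[OF g] r_coset_subset_G[OF Hc g] by blast
  have co: "H #> g = H #> \<tau> g" if g: "g \<in> carrier G" for g
    by (rule repr_independence[OF t1[OF g] g H])
  have eq: "H #> g = H #> h" if gh: "g \<in> carrier G" "h \<in> carrier G" "g \<otimes> inv h \<in> H" for g h
  proof -
    have "g = (g \<otimes> inv h) \<otimes> h" using gh by (simp add: m_assoc)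
    then have "g \<in> H #> h" using gh(3) unfolding r_coset_def by blast
    then show ?thesis using repr_independence[OF _ gh(2) H] by simp
  qed
  have teq: "\<tau> g = \<tau> h" if "H #> g = H #> h" for g h unfolding \<tau>_def that ..
  have "g \<otimes> inv (\<tau> g) \<in> H" if g: "g \<in> carrier G" for g
  proof -
    have "g \<in> H #> \<tau> g" using rcos_self[OF g H] co[OF g] by simp
    then obtain h where h: "h \<in> H" "g = h \<otimes> \<tau> g" unfolding r_coset_def by blast
    have "g \<otimes> inv (\<tau> g) = h" using inv_solve_right'[of h g "\<tau> g"] h tc[OF g] g Hc by auto
    then show ?thesis using h by simp
  qed
  moreover have "right_transversal G H (\<tau> ` carrier G)"
    unfolding right_transversal_def
  proof (intro conjI ballI)
    show "\<tau> ` carrier G \<subseteq> carrier G" using tc by blast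
    fix C assume "C \<in> rcosets H"
    then obtain g where g: "g \<in> carrier G" "C = H #> g" unfolding RCOSETS_def by blast
    show "\<exists>!t. t \<in> \<tau> ` carrier G \<inter> C"
    proof (rule ex1I)
      show "\<tau> g \<in> \<tau> ` carrier G \<inter> C" using g t1 by blast
      fix t assume "t \<in> \<tau> ` carrier G \<inter> C"
      then obtain h where h: "h \<in> carrier G" "t = \<tau> h" "t \<in> H #> g" using g by blast
      have "H #> g = H #> \<tau> h" using repr_independence[OF _ g(1) H] h by simp
      then show "t = \<tau> g" using teq[of g h] co[OF h(1)] h(2) by simp
    qed
  qed
  ultimately show ?thesis using that[of \<tau>] tc teq eq co by metis
qed

context cyclic_representation
begin

text \<open>The image of \<open>KH\<close> in \<open>KG\<close>.\<close>

definition supported_in :: "'g set \<Rightarrow> ('g \<Rightarrow> 'k) set" where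
  "supported_in H = {r \<in> carrier KG. group_ring_supp K G r \<subseteq> H}"

text \<open>The \<open>KH\<close>-submodule generated by \<open>m\<close>.\<close>

definition orbit :: "'g set \<Rightarrow> 'm set" where
  "orbit H = (\<lambda>r. r \<odot>\<^bsub>M\<^esub> m) ` supported_in H"

context
  fixes H
  assumes H: "subgroup H G"
begin

lemma supported_add: "r \<in> supported_in H \<Longrightarrow> s \<in> supported_in H \<Longrightarrow> r \<oplus>\<^bsub>KG\<^esub> s \<in> supported_in H"
  unfolding supported_in_def using KG_add by (force simp: group_ring_supp_def)

lemma supported_minus: "r \<in> supported_in H \<Longrightarrow> \<ominus>\<^bsub>KG\<^esub> r \<in> supported_in H"
  unfolding supported_in_def using KG_minus by (force simp: group_ring_supp_def)

lemma supported_zero: "\<zero>\<^bsub>KG\<^esub> \<in> supported_in H"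
  unfolding supported_in_def using KG_zero by (auto simp: group_ring_supp_def)

lemma supported_mult:
  assumes "r \<in> supported_in H" "s \<in> supported_in H"
  shows "r \<otimes>\<^bsub>KG\<^esub> s \<in> supported_in H"
proof -
  have r: "r \<in> carrier KG" "group_ring_supp K G r \<subseteq> H" and s: "s \<in> carrier KG" "group_ring_supp K G s \<subseteq> H"
    using assms by (auto simp: supported_in_def)
  have "(\<lambda>(x,y). x \<otimes>\<^bsub>G\<^esub> y) ` (group_ring_supp K G r \<times> group_ring_supp K G s) \<subseteq> H"
    using r(2) s(2) subgroup.m_closed[OF H] by auto
  then show ?thesis using supp_times[OF r(1) s(1)] r(1) s(1) by (simp add: supported_in_def)
qed

lemma translate_subgroup:
  assumes a: "a \<in> carrier KG"
  shows "subgroup ((\<lambda>u. a \<odot>\<^bsub>M\<^esub> u) ` orbit H) (add_monoid M)"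
proof (rule M.M.add.subgroupI)
  have Sc: "supported_in H \<subseteq> carrier KG" by (auto simp: supported_in_def)
  have im: "(\<lambda>u. a \<odot>\<^bsub>M\<^esub> u) ` orbit H = (\<lambda>r. a \<odot>\<^bsub>M\<^esub> (r \<odot>\<^bsub>M\<^esub> m)) ` supported_in H"
    by (simp add: orbit_def image_image)
  have mem: "a \<odot>\<^bsub>M\<^esub> (r \<odot>\<^bsub>M\<^esub> m) \<in> (\<lambda>u. a \<odot>\<^bsub>M\<^esub> u) ` orbit H" if "r \<in> supported_in H" for r
    unfolding im using that by (rule imageI)
  show "(\<lambda>u. a \<odot>\<^bsub>M\<^esub> u) ` orbit H \<subseteq> carrier M" unfolding im using Sc a m_closed by auto
  show "(\<lambda>u. a \<odot>\<^bsub>M\<^esub> u) ` orbit H \<noteq> {}" using mem[OF supported_zero] by blast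
  fix x assume "x \<in> (\<lambda>u. a \<odot>\<^bsub>M\<^esub> u) ` orbit H"
  then obtain r where r: "r \<in> supported_in H" "x = a \<odot>\<^bsub>M\<^esub> (r \<odot>\<^bsub>M\<^esub> m)" unfolding im by (rule imageE)
  have rc: "r \<in> carrier KG" using r Sc by blast
  have "\<ominus>\<^bsub>M\<^esub> x = a \<odot>\<^bsub>M\<^esub> ((\<ominus>\<^bsub>KG\<^esub> r) \<odot>\<^bsub>M\<^esub> m)" using r rc a m_closed by (simp add: M.smult_l_minus M.smult_r_minus)
  then show "\<ominus>\<^bsub>M\<^esub> x \<in> (\<lambda>u. a \<odot>\<^bsub>M\<^esub> u) ` orbit H" using mem[OF supported_minus[OF r(1)]] by simp
  fix y assume "y \<in> (\<lambda>u. a \<odot>\<^bsub>M\<^esub> u) ` orbit H"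
  then obtain s where s: "s \<in> supported_in H" "y = a \<odot>\<^bsub>M\<^esub> (s \<odot>\<^bsub>M\<^esub> m)" unfolding im by (rule imageE)
  have sc: "s \<in> carrier KG" using s Sc by blast
  have "x \<oplus>\<^bsub>M\<^esub> y = a \<odot>\<^bsub>M\<^esub> ((r \<oplus>\<^bsub>KG\<^esub> s) \<odot>\<^bsub>M\<^esub> m)"
    using r s rc sc a m_closed by (simp add: M.smult_l_distr M.smult_r_distr)
  then show "x \<oplus>\<^bsub>M\<^esub> y \<in> (\<lambda>u. a \<odot>\<^bsub>M\<^esub> u) ` orbit H" using mem[OF supported_add[OF r(1) s(1)]] by simp
qed

lemma incl_supported:
  assumes a: "a \<in> carrier (group_ring K (G\<lparr>carrier := H\<rparr>))"
  shows "group_ring_incl K G H a \<in> supported_in H"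
proof -
  have Hc: "H \<subseteq> carrier G" using subgroup.subset[OF H] .
  have a': "a \<in> H \<rightarrow>\<^sub>E carrier K" "finite (group_ring_supp K (G\<lparr>carrier := H\<rparr>) a)" using a by (simp_all add: group_ring_def)
  have "group_ring_supp K G (group_ring_incl K G H a) \<subseteq> group_ring_supp K (G\<lparr>carrier := H\<rparr>) a"
    by (auto simp: group_ring_supp_def group_ring_incl_def split: if_splits)
  then have fin: "finite (group_ring_supp K G (group_ring_incl K G H a))" using a'(2) by (rule finite_subset)
  have "group_ring_incl K G H a \<in> carrier G \<rightarrow>\<^sub>E carrier K" using a'(1) Hc by (auto simp: group_ring_incl_def PiE_iff)
  then show ?thesis using fin
    by (auto simp: supported_in_def group_ring_def group_ring_supp_def group_ring_incl_def split: if_splits)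
qed

lemma orbit_submodule:
  "submodule (orbit H) (group_ring K (G\<lparr>carrier := H\<rparr>)) (restrict_rep K G H M)"
proof -
  have Oc: "orbit H \<subseteq> carrier M" using m_closed by (auto simp: orbit_def supported_in_def)
  have "(\<lambda>u. \<one>\<^bsub>KG\<^esub> \<odot>\<^bsub>M\<^esub> u) ` orbit H = (\<lambda>u. u) ` orbit H" by (rule image_cong) (use Oc in auto)
  then have "subgroup (orbit H) (add_monoid M)" using translate_subgroup[OF M.R.one_closed] by simp
  moreover have "add_monoid (restrict_rep K G H M) = add_monoid M" by (simp add: restrict_rep_def)
  ultimately have "subgroup (orbit H) (add_monoid (restrict_rep K G H M))" by simp
  moreover have "group_ring_incl K G H a \<odot>\<^bsub>M\<^esub> x \<in> orbit H"
    if a: "a \<in> carrier (group_ring K (G\<lparr>carrier := H\<rparr>))" and x: "x \<in> orbit H" for a x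
  proof -
    obtain r where r: "r \<in> supported_in H" "x = r \<odot>\<^bsub>M\<^esub> m" using x unfolding orbit_def by (rule imageE)
    let ?a = "group_ring_incl K G H a"
    have "?a \<otimes>\<^bsub>KG\<^esub> r \<in> supported_in H" by (rule supported_mult[OF incl_supported[OF a] r(1)])
    moreover have "?a \<odot>\<^bsub>M\<^esub> x = (?a \<otimes>\<^bsub>KG\<^esub> r) \<odot>\<^bsub>M\<^esub> m"
      using r incl_supported[OF a] m_closed M.smult_assoc1[of ?a r m] by (simp add: supported_in_def)
    ultimately show ?thesis unfolding orbit_def by simp
  qed
  ultimately show ?thesis unfolding submodule_def submodule_axioms_def by (simp add: restrict_rep_def)
qed

text \<open>Split an element of \<open>KG\<close> into the parts supported on the single cosets.\<close>

lemma coset_expansion: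
  assumes \<tau>: "right_transversal G H (\<tau> ` carrier G)"
    "\<And>g. g \<in> carrier G \<Longrightarrow> \<tau> g \<in> carrier G"
    "\<And>g. g \<in> carrier G \<Longrightarrow> g \<otimes>\<^bsub>G\<^esub> inv\<^bsub>G\<^esub> (\<tau> g) \<in> H"
    and v: "v \<in> carrier M"
  shows "\<exists>w. w \<in> (\<Pi>\<^sub>E t\<in>\<tau> ` carrier G. (\<lambda>u. e t \<odot>\<^bsub>M\<^esub> u) ` orbit H) \<and>
    finite {t \<in> \<tau> ` carrier G. w t \<noteq> \<zero>\<^bsub>M\<^esub>} \<and> v = (\<Oplus>\<^bsub>M\<^esub>t\<in>{t \<in> \<tau> ` carrier G. w t \<noteq> \<zero>\<^bsub>M\<^esub>}. w t)"
proof -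
  let ?T = "\<tau> ` carrier G"
  obtain r where r: "r \<in> carrier KG" "v = r \<odot>\<^bsub>M\<^esub> m" using v cyclic by blast
  (* The part of r supported on the coset of t. *)
  define part where "part t = (\<lambda>x\<in>carrier G. if \<tau> x = t then r x else \<zero>\<^bsub>K\<^esub>)" for t
  let ?A = "group_ring_supp K G r"
  let ?B = "\<tau> ` ?A"
  have A: "finite ?A" "?A \<subseteq> carrier G" using supp_finite[OF r(1)] by (auto simp: group_ring_supp_def)
  have part: "part t \<in> carrier KG" for t
  proof -
    have "group_ring_supp K G (part t) \<subseteq> ?A" by (auto simp: group_ring_supp_def part_def split: if_splits)
    then have "finite (group_ring_supp K G (part t))" using A(1) by (rule finite_subset)
    then show ?thesis using coeff_closed[OF r(1)] by (auto simp: group_ring_def part_def)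
  qed
  have part0: "part t = \<zero>\<^bsub>KG\<^esub>" if "t \<notin> ?B" for t
  proof (rule KG_eqI[OF part M.R.zero_closed])
    fix x assume x: "x \<in> carrier G"
    show "part t x = \<zero>\<^bsub>KG\<^esub> x" unfolding KG_zero[OF x] using that x by (auto simp: part_def group_ring_supp_def)
  qed
  have split: "r = finsum KG part ?B"
  proof (rule KG_eqI[OF r(1)])
    have pc: "part \<in> ?B \<rightarrow> carrier KG" using part by simp
    then show "finsum KG part ?B \<in> carrier KG" by (rule M.R.finsum_closed)
    fix x assume x: "x \<in> carrier G"
    have "finsum KG part ?B x = (\<Oplus>\<^bsub>K\<^esub>t\<in>?B. part t x)" by (rule KG_finsum[OF _ pc x]) (use A in simp)
    also have "\<dots> = (\<Oplus>\<^bsub>K\<^esub>t\<in>?B. if \<tau> x = t then r x else \<zero>\<^bsub>K\<^esub>)"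
      by (rule K.finsum_cong') (use x coeff_closed[OF r(1) x] in \<open>auto simp: part_def\<close>)
    also have "\<dots> = r x"
    proof (cases "\<tau> x \<in> ?B")
      case True
      have "finite ?B" using A by simp
      from K.finsum_singleton[OF True this, of "\<lambda>_. r x"] show ?thesis using coeff_closed[OF r(1) x] by simp
    next
      case False
      then have "r x = \<zero>\<^bsub>K\<^esub>" using x by (auto simp: group_ring_supp_def)
      moreover have "(\<Oplus>\<^bsub>K\<^esub>t\<in>?B. if \<tau> x = t then r x else \<zero>\<^bsub>K\<^esub>) = \<zero>\<^bsub>K\<^esub>"
        by (rule K.add.finprod_one_eqI) (simp add: \<open>r x = \<zero>\<^bsub>K\<^esub>\<close>)
      ultimately show ?thesis by simp
    qed
    finally show "r x = finsum KG part ?B x" by simp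
  qed
  define w where "w = (\<lambda>t\<in>?T. part t \<odot>\<^bsub>M\<^esub> m)"
  have mem: "part t \<odot>\<^bsub>M\<^esub> m \<in> (\<lambda>u. e t \<odot>\<^bsub>M\<^esub> u) ` orbit H" if t: "t \<in> ?T" for t
  proof -
    have tc: "t \<in> carrier G" using t \<tau>(2) by blast
    let ?a = "e (inv\<^bsub>G\<^esub> t) \<otimes>\<^bsub>KG\<^esub> part t"
    have a: "?a \<in> carrier KG" using e_closed part by simp
    have "group_ring_supp K G ?a \<subseteq> H"
    proof
      fix x assume "x \<in> group_ring_supp K G ?a"
      then have x: "x \<in> carrier G" "?a x \<noteq> \<zero>\<^bsub>K\<^esub>" by (auto simp: group_ring_supp_def)
      have "?a x = part t (t \<otimes>\<^bsub>G\<^esub> x)" using e_times[OF G.inv_closed[OF tc] part x(1), of t] tc by simp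
      then have "\<tau> (t \<otimes>\<^bsub>G\<^esub> x) = t" using x tc by (auto simp: part_def split: if_splits)
      then have "(t \<otimes>\<^bsub>G\<^esub> x) \<otimes>\<^bsub>G\<^esub> inv\<^bsub>G\<^esub> t \<in> H" using \<tau>(3)[of "t \<otimes>\<^bsub>G\<^esub> x"] x tc by simp
      moreover have "(t \<otimes>\<^bsub>G\<^esub> x) \<otimes>\<^bsub>G\<^esub> inv\<^bsub>G\<^esub> t = x" using x tc G.m_comm[of t x] by (simp add: G.m_assoc)
      ultimately show "x \<in> H" by simp
    qed
    then have u: "?a \<odot>\<^bsub>M\<^esub> m \<in> orbit H" using a by (simp add: orbit_def supported_in_def)
    have "e t \<otimes>\<^bsub>KG\<^esub> ?a = (e t \<otimes>\<^bsub>KG\<^esub> e (inv\<^bsub>G\<^esub> t)) \<otimes>\<^bsub>KG\<^esub> part t" using e_closed part by (simp add: M.R.m_assoc)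
    also have "\<dots> = part t" using e_mult[OF tc G.inv_closed[OF tc]] tc part by (simp add: e_one)
    finally have "e t \<odot>\<^bsub>M\<^esub> (?a \<odot>\<^bsub>M\<^esub> m) = part t \<odot>\<^bsub>M\<^esub> m" using M.smult_assoc1[OF e_closed a m_closed, of t] by simp
    then show ?thesis using u by (metis imageI)
  qed
  have wP: "w \<in> (\<Pi>\<^sub>E t\<in>?T. (\<lambda>u. e t \<odot>\<^bsub>M\<^esub> u) ` orbit H)" unfolding w_def using mem by (simp add: restrict_PiE_iff)
  let ?S = "{t \<in> ?T. w t \<noteq> \<zero>\<^bsub>M\<^esub>}"
  have BT: "?B \<subseteq> ?T" using A by blast
  have SB: "?S \<subseteq> ?B"
  proof
    fix t assume t: "t \<in> ?S"
    show "t \<in> ?B"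
    proof (rule ccontr)
      assume "t \<notin> ?B"
      then have "w t = \<zero>\<^bsub>M\<^esub>" using part0[of t] t m_closed by (simp add: w_def M.smult_l_null)
      then show False using t by simp
    qed
  qed
  have finB: "finite ?B" using A by simp
  have "v = (\<Oplus>\<^bsub>M\<^esub>t\<in>?B. part t \<odot>\<^bsub>M\<^esub> m)"
    unfolding r(2) by (subst split, rule M.finsum_smult_vector[OF finB _ m_closed]) (use part in simp)
  also have "\<dots> = (\<Oplus>\<^bsub>M\<^esub>t\<in>?S. w t)"
  proof (rule M.M.add.finprod_mono_neutral_cong_right[OF finB SB])
    show "\<And>t. t \<in> ?B - ?S \<Longrightarrow> part t \<odot>\<^bsub>M\<^esub> m = \<zero>\<^bsub>M\<^esub>" using BT by (auto simp: w_def)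
  qed (use part m_closed in \<open>auto simp: w_def\<close>)
  finally show ?thesis using wP finite_subset[OF SB finB] by blast
qed

end
end

context cyclic_representation
begin

text \<open>The embedding of the module into the field, \<open>r m \<mapsto> \<psi> r\<close>.\<close>

definition evaluate :: "'m \<Rightarrow> 'l" where
  "evaluate v = \<psi> (SOME r. r \<in> carrier KG \<and> r \<odot>\<^bsub>M\<^esub> m = v)"

lemma evaluate_action:
  assumes r: "r \<in> carrier KG"
  shows "evaluate (r \<odot>\<^bsub>M\<^esub> m) = \<psi> r"
proof -
  let ?P = "\<lambda>s. s \<in> carrier KG \<and> s \<odot>\<^bsub>M\<^esub> m = r \<odot>\<^bsub>M\<^esub> m"
  have "?P (SOME s. ?P s)" by (rule someI[of ?P r]) (use r in simp)
  then show ?thesis unfolding evaluate_def using action_eq_iff[OF _ r] by blast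
qed

lemma evaluate_closed: "v \<in> carrier M \<Longrightarrow> evaluate v \<in> carrier L"
  unfolding cyclic using evaluate_action ring_hom_closed[OF psi_hom] by auto

lemma evaluate_inject:
  assumes "v \<in> carrier M" "w \<in> carrier M" "evaluate v = evaluate w"
  shows "v = w"
proof -
  obtain r where r: "r \<in> carrier KG" "v = r \<odot>\<^bsub>M\<^esub> m" using assms(1) cyclic by blast
  obtain s where s: "s \<in> carrier KG" "w = s \<odot>\<^bsub>M\<^esub> m" using assms(2) cyclic by blast
  show ?thesis using assms(3) action_eq_iff[OF r(1) s(1)] unfolding r(2) s(2) evaluate_action[OF r(1)] evaluate_action[OF s(1)] by simp
qed

lemma evaluate_add:
  assumes "v \<in> carrier M" "w \<in> carrier M"
  shows "evaluate (v \<oplus>\<^bsub>M\<^esub> w) = evaluate v \<oplus>\<^bsub>L\<^esub> evaluate w"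
proof -
  obtain r where r: "r \<in> carrier KG" "v = r \<odot>\<^bsub>M\<^esub> m" using assms(1) cyclic by blast
  obtain s where s: "s \<in> carrier KG" "w = s \<odot>\<^bsub>M\<^esub> m" using assms(2) cyclic by blast
  have "v \<oplus>\<^bsub>M\<^esub> w = (r \<oplus>\<^bsub>KG\<^esub> s) \<odot>\<^bsub>M\<^esub> m" using r s m_closed by (simp add: M.smult_l_distr)
  then have "evaluate (v \<oplus>\<^bsub>M\<^esub> w) = \<psi> (r \<oplus>\<^bsub>KG\<^esub> s)" using evaluate_action[of "r \<oplus>\<^bsub>KG\<^esub> s"] r s by simp
  then show ?thesis using ring_hom_add[OF psi_hom r(1) s(1)] evaluate_action r s by simp
qed

lemma evaluate_finsum:
  assumes "finite A" "f \<in> A \<rightarrow> carrier M"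
  shows "evaluate (\<Oplus>\<^bsub>M\<^esub>t\<in>A. f t) = (\<Oplus>\<^bsub>L\<^esub>t\<in>A. evaluate (f t))"
  using assms
proof (induction A rule: finite_induct)
  case empty
  interpret h: ring_hom_ring KG L \<psi> by (rule ring_hom_ringI2[OF M.R.ring_axioms L.ring_axioms psi_hom])
  have "evaluate (\<zero>\<^bsub>KG\<^esub> \<odot>\<^bsub>M\<^esub> m) = \<zero>\<^bsub>L\<^esub>" using evaluate_action[OF M.R.zero_closed] by simp
  then show ?case using m_closed M.smult_l_null by simp
next
  case (insert a A)
  then have f: "f \<in> A \<rightarrow> carrier M" "f a \<in> carrier M" by auto
  then have ef: "(\<lambda>t. evaluate (f t)) \<in> A \<rightarrow> carrier L" "evaluate (f a) \<in> carrier L" using evaluate_closed by (auto simp: Pi_iff)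
  have "evaluate (\<Oplus>\<^bsub>M\<^esub>t\<in>insert a A. f t) = evaluate (f a \<oplus>\<^bsub>M\<^esub> (\<Oplus>\<^bsub>M\<^esub>t\<in>A. f t))"
    using M.M.finsum_insert[OF insert(1,2) f] by simp
  also have "\<dots> = evaluate (f a) \<oplus>\<^bsub>L\<^esub> evaluate (\<Oplus>\<^bsub>M\<^esub>t\<in>A. f t)" by (rule evaluate_add[OF f(2) M.M.finsum_closed[OF f(1)]])
  also have "\<dots> = (\<Oplus>\<^bsub>L\<^esub>t\<in>insert a A. evaluate (f t))"
    using insert.IH[OF f(1)] L.finsum_insert[OF insert(1,2) ef] by simp
  finally show ?case .
qed

text \<open>Evaluated in the field, an expansion becomes a linear combination of the elements
  \<open>\<gamma> t\<close> with coefficients in \<open>E\<close>.\<close>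

lemma coset_expansion_unique:
  assumes E: "subring E L" and EH: "\<And>r. r \<in> supported_in H \<Longrightarrow> \<psi> r \<in> E"
    and T: "T \<subseteq> carrier G" and ind: "\<And>A. finite A \<Longrightarrow> A \<subseteq> T \<Longrightarrow> L.lin_independent E A \<gamma>"
    and w: "w \<in> (\<Pi>\<^sub>E t\<in>T. (\<lambda>u. e t \<odot>\<^bsub>M\<^esub> u) ` orbit H)" "finite {t\<in>T. w t \<noteq> \<zero>\<^bsub>M\<^esub>}"
    and w': "w' \<in> (\<Pi>\<^sub>E t\<in>T. (\<lambda>u. e t \<odot>\<^bsub>M\<^esub> u) ` orbit H)" "finite {t\<in>T. w' t \<noteq> \<zero>\<^bsub>M\<^esub>}"
    and eq: "(\<Oplus>\<^bsub>M\<^esub>t\<in>{t\<in>T. w t \<noteq> \<zero>\<^bsub>M\<^esub>}. w t) = (\<Oplus>\<^bsub>M\<^esub>t\<in>{t\<in>T. w' t \<noteq> \<zero>\<^bsub>M\<^esub>}. w' t)"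
  shows "w = w'"
proof -
  let ?A = "{t\<in>T. w t \<noteq> \<zero>\<^bsub>M\<^esub>} \<union> {t\<in>T. w' t \<noteq> \<zero>\<^bsub>M\<^esub>}"
  have A: "finite ?A" "?A \<subseteq> T" using w(2) w'(2) by auto
  have coeff: "\<exists>c\<in>E. evaluate x = c \<otimes>\<^bsub>L\<^esub> \<gamma> t" and closed: "x \<in> carrier M"
    if t: "t \<in> T" and x: "x \<in> (\<lambda>u. e t \<odot>\<^bsub>M\<^esub> u) ` orbit H" for x t
  proof -
    obtain r where r: "r \<in> supported_in H" "x = e t \<odot>\<^bsub>M\<^esub> (r \<odot>\<^bsub>M\<^esub> m)" using x by (auto simp: orbit_def)
    have rc: "r \<in> carrier KG" using r by (simp add: supported_in_def)
    have x: "x = (e t \<otimes>\<^bsub>KG\<^esub> r) \<odot>\<^bsub>M\<^esub> m" unfolding r(2) using M.smult_assoc1[OF e_closed rc m_closed] by simp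
    have "evaluate x = \<psi> (e t \<otimes>\<^bsub>KG\<^esub> r)" unfolding x by (rule evaluate_action) (use e_closed rc in simp)
    also have "\<dots> = \<gamma> t \<otimes>\<^bsub>L\<^esub> \<psi> r" unfolding \<gamma>_def by (rule ring_hom_mult[OF psi_hom e_closed rc])
    also have "\<dots> = \<psi> r \<otimes>\<^bsub>L\<^esub> \<gamma> t" by (rule L.m_comm[OF gamma_closed ring_hom_closed[OF psi_hom rc]])
    finally show "\<exists>c\<in>E. evaluate x = c \<otimes>\<^bsub>L\<^esub> \<gamma> t" using EH[OF r(1)] by blast
    show "x \<in> carrier M" unfolding x using e_closed rc m_closed by simp
  qed
  define c where "c u t = (SOME c. c \<in> E \<and> evaluate (u t) = c \<otimes>\<^bsub>L\<^esub> \<gamma> t)" for u t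
  have c: "c u t \<in> E \<and> evaluate (u t) = c u t \<otimes>\<^bsub>L\<^esub> \<gamma> t"
    if "u \<in> (\<Pi>\<^sub>E t\<in>T. (\<lambda>u. e t \<odot>\<^bsub>M\<^esub> u) ` orbit H)" "t \<in> T" for u t
  proof -
    have "u t \<in> (\<lambda>u. e t \<odot>\<^bsub>M\<^esub> u) ` orbit H" by (rule PiE_mem[OF that])
    then have "\<exists>c. c \<in> E \<and> evaluate (u t) = c \<otimes>\<^bsub>L\<^esub> \<gamma> t" using coeff[OF that(2)] by blast
    then show ?thesis unfolding c_def by (rule someI_ex)
  qed
  have mem: "u t \<in> carrier M" if "u \<in> (\<Pi>\<^sub>E t\<in>T. (\<lambda>u. e t \<odot>\<^bsub>M\<^esub> u) ` orbit H)" "t \<in> T" for u t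
    by (rule closed[OF that(2) PiE_mem[OF that]])
  have ev: "evaluate (\<Oplus>\<^bsub>M\<^esub>t\<in>{t\<in>T. u t \<noteq> \<zero>\<^bsub>M\<^esub>}. u t) = (\<Oplus>\<^bsub>L\<^esub>t\<in>?A. c u t \<otimes>\<^bsub>L\<^esub> \<gamma> t)"
    if u: "u \<in> (\<Pi>\<^sub>E t\<in>T. (\<lambda>u. e t \<odot>\<^bsub>M\<^esub> u) ` orbit H)" and sub: "{t\<in>T. u t \<noteq> \<zero>\<^bsub>M\<^esub>} \<subseteq> ?A" for u
  proof -
    have uM: "u \<in> ?A \<rightarrow> carrier M" using mem[OF u] A(2) by auto
    have "(\<Oplus>\<^bsub>M\<^esub>t\<in>{t\<in>T. u t \<noteq> \<zero>\<^bsub>M\<^esub>}. u t) = (\<Oplus>\<^bsub>M\<^esub>t\<in>?A. u t)"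
      by (rule M.M.add.finprod_mono_neutral_cong_left[OF A(1) sub]) (use uM in auto)
    then have "evaluate (\<Oplus>\<^bsub>M\<^esub>t\<in>{t\<in>T. u t \<noteq> \<zero>\<^bsub>M\<^esub>}. u t) = (\<Oplus>\<^bsub>L\<^esub>t\<in>?A. evaluate (u t))" using evaluate_finsum[OF A(1) uM] by simp
    also have "\<dots> = (\<Oplus>\<^bsub>L\<^esub>t\<in>?A. c u t \<otimes>\<^bsub>L\<^esub> \<gamma> t)"
    proof (rule L.finsum_cong')
      show "(\<lambda>t. c u t \<otimes>\<^bsub>L\<^esub> \<gamma> t) \<in> ?A \<rightarrow> carrier L"
        using c[OF u] A(2) gamma_closed subringE(1)[OF E] by (auto simp: Pi_iff)
    qed (use c[OF u] A(2) in auto)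
    finally show ?thesis .
  qed
  have ceq: "c w t = c w' t" if t: "t \<in> ?A" for t
  proof (rule L.lin_independent_unique[OF E ind[OF A] A(1) _ _ _ _ t])
    show "\<gamma> \<in> ?A \<rightarrow> carrier L" using gamma_closed by simp
    show "c w \<in> ?A \<rightarrow> E" "c w' \<in> ?A \<rightarrow> E" using c[OF w(1)] c[OF w'(1)] by auto
    show "(\<Oplus>\<^bsub>L\<^esub>t\<in>?A. c w t \<otimes>\<^bsub>L\<^esub> \<gamma> t) = (\<Oplus>\<^bsub>L\<^esub>t\<in>?A. c w' t \<otimes>\<^bsub>L\<^esub> \<gamma> t)"
      using ev[OF w(1)] ev[OF w'(1)] eq by simp
  qed
  show "w = w'"
  proof (rule PiE_ext[OF w(1) w'(1)])
    fix t assume t: "t \<in> T"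
    show "w t = w' t"
    proof (cases "t \<in> ?A")
      case True
      have "evaluate (w t) = evaluate (w' t)" using c[OF w(1) t] c[OF w'(1) t] ceq[OF True] by simp
      then show ?thesis by (rule evaluate_inject[OF mem[OF w(1) t] mem[OF w'(1) t]])
    qed (use t in auto)
  qed
qed

theorem induced_from_orbit:
  assumes E: "subfield E L" and k: "\<And>k. k \<in> carrier K \<Longrightarrow> \<iota> k \<in> E"
    and H: "H = {g \<in> carrier G. \<gamma> g \<in> E}" "subgroup H G"
    and ind: "\<And>I. finite I \<Longrightarrow> I \<subseteq> carrier G \<Longrightarrow>
      (\<And>g h. g \<in> I \<Longrightarrow> h \<in> I \<Longrightarrow> \<gamma> g \<otimes>\<^bsub>L\<^esub> inv\<^bsub>L\<^esub> (\<gamma> h) \<in> E \<Longrightarrow> g = h) \<Longrightarrow> L.lin_independent E I \<gamma>"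
  shows "induced_from K G M H (orbit H)"
proof -
  have Es: "subring E L" using subfieldE(1)[OF E] .
  obtain \<tau> where \<tau>: "right_transversal G H (\<tau> ` carrier G)"
    "\<And>g. g \<in> carrier G \<Longrightarrow> \<tau> g \<in> carrier G"
    "\<And>g. g \<in> carrier G \<Longrightarrow> g \<otimes>\<^bsub>G\<^esub> inv\<^bsub>G\<^esub> (\<tau> g) \<in> H"
    "\<And>g h. g \<in> carrier G \<Longrightarrow> h \<in> carrier G \<Longrightarrow> g \<otimes>\<^bsub>G\<^esub> inv\<^bsub>G\<^esub> h \<in> H \<Longrightarrow> \<tau> g = \<tau> h"
    "\<And>g. g \<in> carrier G \<Longrightarrow> \<tau> (\<tau> g) = \<tau> g"
    by (rule G.right_transversal_retraction[OF H(2)]) (rule that)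
  let ?T = "\<tau> ` carrier G"
  have T: "?T \<subseteq> carrier G" using \<tau>(2) by blast
  have EH: "\<psi> r \<in> E" if "r \<in> supported_in H" for r
    using that H(1) by (intro psi_in_subring[OF Es k]) (auto simp: supported_in_def)
  have indT: "L.lin_independent E A \<gamma>" if A: "finite A" "A \<subseteq> ?T" for A
  proof (rule ind[OF A(1)])
    show "A \<subseteq> carrier G" using A(2) T by blast
    fix g h assume gh: "g \<in> A" "h \<in> A" "\<gamma> g \<otimes>\<^bsub>L\<^esub> inv\<^bsub>L\<^esub> (\<gamma> h) \<in> E"
    have c: "g \<in> carrier G" "h \<in> carrier G" using gh A(2) T by auto
    have "\<gamma> h \<otimes>\<^bsub>L\<^esub> \<gamma> (inv\<^bsub>G\<^esub> h) = \<one>\<^bsub>L\<^esub>"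
      using gamma_mult[of h "inv\<^bsub>G\<^esub> h"] c ring_hom_one[OF psi_hom] by (simp add: \<gamma>_def e_one)
    then have "inv\<^bsub>L\<^esub> (\<gamma> h) = \<gamma> (inv\<^bsub>G\<^esub> h)" by (rule L.comm_inv_char[OF gamma_closed gamma_closed])
    then have "\<gamma> (g \<otimes>\<^bsub>G\<^esub> inv\<^bsub>G\<^esub> h) \<in> E" using gh(3) gamma_mult[of g "inv\<^bsub>G\<^esub> h"] c by simp
    then have "g \<otimes>\<^bsub>G\<^esub> inv\<^bsub>G\<^esub> h \<in> H" using H(1) c by simp
    then have "\<tau> g = \<tau> h" by (rule \<tau>(4)[OF c])
    moreover have "\<tau> g = g" "\<tau> h = h" using gh(1,2) A(2) \<tau>(5) by auto
    ultimately show "g = h" by simp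
  qed
  have "internal_direct_sum M ?T (\<lambda>t. (\<lambda>u. e t \<odot>\<^bsub>M\<^esub> u) ` orbit H)"
    unfolding internal_direct_sum_def
  proof (intro conjI ballI)
    fix t show "subgroup ((\<lambda>u. e t \<odot>\<^bsub>M\<^esub> u) ` orbit H) (add_monoid M)"
      by (rule translate_subgroup[OF H(2) e_closed])
  next
    fix v assume v: "v \<in> carrier M"
    let ?P = "\<lambda>w. w \<in> (\<Pi>\<^sub>E t\<in>?T. (\<lambda>u. e t \<odot>\<^bsub>M\<^esub> u) ` orbit H) \<and>
      finite {t \<in> ?T. w t \<noteq> \<zero>\<^bsub>M\<^esub>} \<and> v = (\<Oplus>\<^bsub>M\<^esub>t\<in>{t \<in> ?T. w t \<noteq> \<zero>\<^bsub>M\<^esub>}. w t)"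
    obtain w where w: "?P w" using coset_expansion[OF H(2) \<tau>(1-3) v] by blast
    show "\<exists>!w. ?P w"
    proof (rule ex1I[of _ w])
      show "?P w" by (rule w)
      fix w' assume w': "?P w'"
      show "w' = w"
        by (rule coset_expansion_unique[OF Es EH T indT]) (use w w' in auto)
    qed
  qed
  then show ?thesis unfolding induced_from_def using H(2) \<tau>(1) orbit_submodule[OF H(2)] by blast
qed

end

section \<open>The induction theorem\<close>

lemma generated_field_image:
  assumes K: "field K" and L: "field L" and h: "h \<in> ring_hom K L" and E: "subfield E L"
    and S: "S \<subseteq> carrier K" "h ` S \<subseteq> E" and k: "k \<in> generate_field K S"
  shows "h k \<in> E"
proof -
  interpret K: field K by fact
  interpret L: field L by fact
  interpret h: ring_hom_ring K L h by (rule ring_hom_ringI2[OF K.ring_axioms L.ring_axioms h])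
  have Es: "subring E L" using subfieldE(1)[OF E] .
  show ?thesis
    using k
  proof (induction rule: generate_field.induct)
    case one
    show ?case using subringE(3)[OF Es] by simp
  next
    case (incl x)
    then show ?case using S by blast
  next
    case (a_inv x)
    then show ?case using subringE(5)[OF Es] K.generate_field_in_carrier[OF S(1)] by simp
  next
    case (m_inv x)
    have x: "x \<in> carrier K" using K.generate_field_in_carrier[OF S(1) m_inv(1)] .
    then have xi: "inv\<^bsub>K\<^esub> x \<in> carrier K" "x \<otimes>\<^bsub>K\<^esub> inv\<^bsub>K\<^esub> x = \<one>\<^bsub>K\<^esub>" using m_inv(2) K.field_Units by auto
    have "h x \<otimes>\<^bsub>L\<^esub> h (inv\<^bsub>K\<^esub> x) = h (x \<otimes>\<^bsub>K\<^esub> inv\<^bsub>K\<^esub> x)" using h.hom_mult[OF x xi(1)] by simp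
    then have e: "h x \<otimes>\<^bsub>L\<^esub> h (inv\<^bsub>K\<^esub> x) = \<one>\<^bsub>L\<^esub>" unfolding xi(2) by simp
    then have "h x \<noteq> \<zero>\<^bsub>L\<^esub>" using h.hom_closed[OF xi(1)] by auto
    then have "inv\<^bsub>L\<^esub> (h x) \<in> E" using L.subfield_m_inv(1)[OF E] m_inv(3) by blast
    moreover have "inv\<^bsub>L\<^esub> (h x) = h (inv\<^bsub>K\<^esub> x)" by (rule L.comm_inv_char[OF h.hom_closed[OF x] h.hom_closed[OF xi(1)] e])
    ultimately show ?case by simp
  next
    case (eng_add x y)
    then show ?case using subringE(7)[OF Es] K.generate_field_in_carrier[OF S(1)] by simp
  next
    case (eng_mult x y)
    then show ?case using subringE(6)[OF Es] K.generate_field_in_carrier[OF S(1)] by simp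
  qed
qed

lemma field_hom_nat_multiple_one:
  assumes K: "field K" and L: "field L" and h: "h \<in> ring_hom K L"
    and n: "add_pow K (n::nat) \<one>\<^bsub>K\<^esub> \<noteq> \<zero>\<^bsub>K\<^esub>"
  shows "add_pow L n \<one>\<^bsub>L\<^esub> \<noteq> \<zero>\<^bsub>L\<^esub>"
proof -
  interpret K: field K by fact
  interpret L: field L by fact
  interpret h: ring_hom_ring K L h by (rule ring_hom_ringI2[OF K.ring_axioms L.ring_axioms h])
  have "h (add_pow K n \<one>\<^bsub>K\<^esub>) = add_pow L n \<one>\<^bsub>L\<^esub>" for n :: nat
    by (induction n) simp_all
  moreover have "inj_on h (carrier K)" by (rule non_trivial_field_hom_is_inj[OF h K L])
  then have "h (add_pow K n \<one>\<^bsub>K\<^esub>) \<noteq> h \<zero>\<^bsub>K\<^esub>"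
    using n by (subst inj_on_eq_iff[of h "carrier K"]) simp_all
  ultimately show ?thesis by simp
qed

theorem corollary3p1p5:
  fixes K :: "('k, 'r) ring_scheme"
    and G :: "('g, 'a) monoid_scheme"
    and M :: "('g \<Rightarrow> 'k, 'm, 'x) module_scheme"
  assumes "fin_gen_field K"
    and "comm_group G"
    and "total_rank G < \<infinity>"
    and "ring_char K \<notin> Sp G"
    and "simple_module (group_ring K G) M"
    and "rep_centralizer K G M = {\<one>\<^bsub>G\<^esub>}"
  shows "\<exists>H U. fin_gen_subgroup G H \<and> induced_from K G M H U"
proof -
  obtain S where K: "field K" and S: "finite S" "S \<subseteq> carrier K" "generate_field K S = carrier K"
    using assms(1) unfolding fin_gen_field_def by blast
  interpret G: comm_group G by (rule assms(2))
  obtain m and L :: "((('g \<Rightarrow> 'k) set list \<times> nat) multiset \<Rightarrow> ('g \<Rightarrow> 'k) set) ring" and \<psi>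
    where L: "algebraically_closed L" and \<psi>: "\<psi> \<in> ring_hom (group_ring K G) L" and m: "m \<in> carrier M"
      "carrier M = (\<lambda>r. r \<odot>\<^bsub>M\<^esub> m) ` carrier (group_ring K G)"
      "\<forall>r\<in>carrier (group_ring K G). \<psi> r = \<zero>\<^bsub>L\<^esub> \<longleftrightarrow> r \<odot>\<^bsub>M\<^esub> m = \<zero>\<^bsub>M\<^esub>"
    using simple_module_embeds_in_closed_field[OF assms(5)] by (elim exE conjE) (rule that)
  have Lf: "field L" using L by (rule algebraically_closed.axioms)
  have Mm: "module (group_ring K G) M" using assms(5) by (simp add: simple_module_def)
  interpret C: cyclic_representation G K M L \<psi> m
    using assms(2) K Mm Lf \<psi> m by (intro cyclic_representation.intro cyclic_representation_axioms.intro) blast+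
  interpret F: group_in_field L G C.\<gamma>
    using L assms(2) C.gamma_closed C.gamma_nonzero C.gamma_mult C.gamma_inj[OF assms(6)]
    by (intro group_in_field.intro group_in_field_axioms.intro)
  obtain S1 where S1: "finite S1" "S1 \<subseteq> carrier G"
    and tor: "\<And>g. g \<in> carrier G \<Longrightarrow> \<exists>n::nat. n > 0 \<and> (ring_char K = 0 \<or> \<not> ring_char K dvd n) \<and> g [^]\<^bsub>G\<^esub> n \<in> generate G S1"
    by (rule G.torsion_quotient_coprime_to_char[OF assms(3) ring_char_field(1)[OF K] assms(4)]) (rule that)
  have "\<exists>n>0. add_pow L n \<one>\<^bsub>L\<^esub> \<noteq> \<zero>\<^bsub>L\<^esub> \<and> g [^]\<^bsub>G\<^esub> (n::nat) \<in> generate G S1" if g: "g \<in> carrier G" for g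
  proof -
    obtain n :: nat where n: "n > 0" "ring_char K = 0 \<or> \<not> ring_char K dvd n" "g [^]\<^bsub>G\<^esub> n \<in> generate G S1"
      using tor[OF g] by blast
    have "add_pow L n \<one>\<^bsub>L\<^esub> \<noteq> \<zero>\<^bsub>L\<^esub>"
      by (rule field_hom_nat_multiple_one[OF K Lf C.iota_hom ring_char_field(2)[OF K n(1,2)]])
    then show ?thesis using n by blast
  qed
  moreover have "finite (C.\<iota> ` S)" "C.\<iota> ` S \<subseteq> carrier L" using S ring_hom_closed[OF C.iota_hom] by auto
  ultimately obtain E where E: "subfield E L" "C.\<iota> ` S \<subseteq> E" "fin_gen_subgroup G {g \<in> carrier G. C.\<gamma> g \<in> E}"
    and ind: "\<forall>I. finite I \<and> I \<subseteq> carrier G \<and> (\<forall>g\<in>I. \<forall>h\<in>I. C.\<gamma> g \<otimes>\<^bsub>L\<^esub> inv\<^bsub>L\<^esub> (C.\<gamma> h) \<in> E \<longrightarrow> g = h) \<longrightarrow>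
      ring.lin_independent L E I C.\<gamma>"
    using F.independence_field[OF _ _ S1 _ G.finite_torsion_primes[OF assms(3)], of "C.\<iota> ` S"] by blast
  have sub: "subgroup {g \<in> carrier G. C.\<gamma> g \<in> E} G" using E(3) by (simp add: fin_gen_subgroup_def)
  have "C.\<iota> k \<in> E" if "k \<in> carrier K" for k
    by (rule generated_field_image[OF K Lf C.iota_hom E(1) S(2) E(2)]) (use that S(3) in simp)
  then have "induced_from K G M {g \<in> carrier G. C.\<gamma> g \<in> E} (C.orbit {g \<in> carrier G. C.\<gamma> g \<in> E})"
    using ind by (intro C.induced_from_orbit[OF E(1) _ refl sub]) blast+
  then show ?thesis using E(3) by blast
qed

end
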